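(* Let $(\otimes,\mathrm{hom}_\ell,\mathrm{hom}_r)\colon\mathcal K\times\mathcal M\to\mathcal N$ be a two-variable adjunction ($\mathcal K,\mathcal M$ with pullbacks, $\mathcal N$ with pushouts) between categories equipped with awfs $(\mathbb C',\mathbb F')$, $(\mathbb C,\mathbb F)$, $(\mathbb L,\mathbb R)$ on $\mathcal K,\mathcal M,\mathcal N$ respectively. A single lifted functor $$\widehat\otimes\colon\mathbb C'\text{-}\mathbf{coalg}\times\mathbb C\text{-}\mathbf{coalg}\to\mathbb L\text{-}\mathbf{coalg},\quad \widehat{\mathrm{hom}}_\ell\colon\mathbb C'\text{-}\mathbf{coalg}^{\mathrm{op}}\times\mathbb R\text{-}\mathbf{alg}\to\mathbb F\text{-}\mathbf{alg},\quad\text{or}\quad \widehat{\mathrm{hom}}_r\colon\mathbb C\text{-}\mathbf{coalg}^{\mathrm{op}}\times\mathbb R\text{-}\mathbf{alg}\to\mathbb F'\text{-}\mathbf{alg}$$ specifies a two-variable adjunction of awfs $(\mathbb C',\mathbb F')\times(\mathbb C,\mathbb F)\to(\mathbb L,\mathbb R)$ if and only if it satisfies, in each variable separately (the other variable being fixed at an arbitrary coalgebra or algebra), the composition criterion appropriate to that variable, as listed in the context: criterion (T) in both variables for $\widehat\otimes$; criterion (H1) in the $\mathbb R$-algebra variable and criterion (H2) in the coalgebra variable for $\widehat{\mathrm{hom}}_\ell$ or $\widehat{\mathrm{hom}}_r$.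
   Context: $\mathcal M^{\mathbf 2}$ is the arrow category; a morphism $(u,v)\colon f\Rightarrow g$ is a commutative square $gu=vf$, also called a lifting problem of $f$ against $g$. A functorial factorization $\vec E=(L,R)$ factors each arrow functorially as $f=Rf\cdot Lf$ with $Lf\colon\mathrm{dom}f\to Ef$, $Rf\colon Ef\to\mathrm{cod}f$, with canonical $\vec\epsilon_f=(1,Rf)\colon Lf\Rightarrow f$, $\vec\eta_f=(Lf,1)\colon f\Rightarrow Rf$. An algebraic weak factorization system (awfs) $(\mathbb L,\mathbb R)$ is a comonad $\mathbb L=(L,\vec\epsilon,\vec\delta)$ and a monad $\mathbb R=(R,\vec\eta,\vec\mu)$ on the arrow category arising from a functorial factorization, with $\vec\delta_f=(1,\delta_f)$, $\delta_f\colon Ef\to ELf$, $\vec\mu_f=(\mu_f,1)$, $\mu_f\colon ERf\to Ef$, such that $(\delta,\mu)\colon LR\Rightarrow RL$ is a distributive law. An $\mathbb L$-coalgebra is $(j,s)$, $s\colon\mathrm{cod}j\to Ej$, with $sj=Lj$, $Rj\cdot s=1$, $\delta_js=E(1,s)s$; an $\mathbb R$-algebra is $(f,r)$, $r\colon Ef\to\mathrm{dom}f$, with $r\cdot Lf=1$, $fr=Rf$, $r\mu_f=r\,E(r,1)$. The canonical solution to a lifting problem $(u,v)\colon j\Rightarrow f$ is $r\cdot E(u,v)\cdot s$. Composable $\mathbb R$-algebras $(f,s),(g,t)$ compose to $gf$ with structure $t\bullet s=s\cdot E(1,t\cdot E(f,1))\cdot\delta_{gf}$; composable $\mathbb L$-coalgebras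 $(j,s),(k,t)$ compose to $kj$ with structure $t\bullet s=\mu_{kj}\cdot E(E(1,k)\cdot s,1)\cdot t$. A lifted functor is one commuting with forgetful functors to arrow categories. The awfs $(\mathbb C',\mathbb F')$, $(\mathbb C,\mathbb F)$, $(\mathbb L,\mathbb R)$ factor arrows through $Q'$, $Q$, $E$ respectively. A two-variable adjunction consists of bifunctors $\otimes\colon\mathcal K\times\mathcal M\to\mathcal N$, $\mathrm{hom}_\ell\colon\mathcal K^{\mathrm{op}}\times\mathcal N\to\mathcal M$, $\mathrm{hom}_r\colon\mathcal M^{\mathrm{op}}\times\mathcal N\to\mathcal K$ with natural isomorphisms $\mathcal N(k\otimes m,n)\cong\mathcal M(m,\mathrm{hom}_\ell(k,n))\cong\mathcal K(k,\mathrm{hom}_r(m,n))$. It induces a two-variable adjunction $(\widehat\otimes,\widehat{\mathrm{hom}}_\ell,\widehat{\mathrm{hom}}_r)\colon\mathcal K^{\mathbf 2}\times\mathcal M^{\mathbf 2}\to\mathcal N^{\mathbf 2}$: for $i\colon A\to B$, $j\colon J\to K$, $f\colon X\to Y$, the pushout-product is $i\widehat\otimes j\colon A\otimes K\sqcup_{A\otimes J}B\otimes J\to B\otimes K$, and $\widehat{\mathrm{hom}}_\ell(i,f)\colon\mathrm{hom}_\ell(B,X)\to\mathrm{hom}_\ell(B,Y)\times_{\mathrm{hom}_\ell(A,Y)}\mathrm{hom}_\ell(A,X)$; $\widehat{\mathrm{hom}}_r$ is analogous. Characterizing transformations: a lifted functor $\widehat\otimes$ corresponds to $\lambda_{i,j}\colon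 Q'i\otimes Qj\to E(i\widehat\otimes j)$: coalgebras $(i,s),(j,t)$ are sent to $i\widehat\otimes j$ with structure $\lambda_{i,j}\cdot(s\otimes t)$, and $\lambda_{i,j}$ is recovered as the coalgebra structure assigned to the cofree coalgebras $C'i,Cj$ followed by $E(\vec\epsilon_i\widehat\otimes\vec\epsilon_j)$. A lifted functor $\widehat{\mathrm{hom}}_\ell$ corresponds to $\rho^\ell_{i,f}\colon Q\widehat{\mathrm{hom}}_\ell(i,f)\to\mathrm{hom}_\ell(Q'i,Ef)$, sending $(i,s),(f,r)$ to $\widehat{\mathrm{hom}}_\ell(i,f)$ with structure $\mathrm{hom}_\ell(s,r)\cdot\rho^\ell_{i,f}$, and recovered from the structure assigned to $C'i,Rf$ by precomposing with $Q\widehat{\mathrm{hom}}_\ell(\vec\epsilon_i,\vec\eta_f)$. Similarly for $\rho^r_{j,f}\colon Q'\widehat{\mathrm{hom}}_r(j,f)\to\mathrm{hom}_r(Qj,Ef)$. A two-variable adjunction of awfs $(\mathbb C',\mathbb F')\times(\mathbb C,\mathbb F)\to(\mathbb L,\mathbb R)$ is a triple of lifted functors $\widehat\otimes,\widehat{\mathrm{hom}}_\ell,\widehat{\mathrm{hom}}_r$ whose characterizing transformations $\lambda,\rho^\ell,\rho^r$ are parameterized mates: for each $i$, $\lambda_{i,-}$ and $\rho^\ell_{i,-}$ are mates with respect to $i\widehat\otimes-\dashv\widehat{\mathrm{hom}}_\ell(i,-)$ and $Q'i\otimes-\dashv\mathrm{hom}_\ell(Q'i,-)$, and for each $j$, $\lambda_{-,j}$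 and $\rho^r_{j,-}$ are mates with respect to $-\widehat\otimes j\dashv\widehat{\mathrm{hom}}_r(j,-)$ and $-\otimes Qj\dashv\mathrm{hom}_r(Qj,-)$. (For $T\dashv S$ and $T'\dashv S'$, transformations $\lambda\colon T'H\Rightarrow GT$ and $\rho\colon HS\Rightarrow S'G$ are mates if $\rho=S'G\epsilon\cdot S'\lambda_S\cdot\iota_{HS}$, with $\epsilon$ the counit of $T\dashv S$ and $\iota$ the unit of $T'\dashv S'$.) A single lifted functor specifies a two-variable adjunction of awfs if the parameterized mates of its characterizing transformation characterize lifts of the other two functors. Composition criteria. In all of these, composite (co)algebras carry the structures above, values of the lifted functor carry the structures it assigns, and "solution" means canonical solution. (T) For $\widehat\otimes$ in the second variable, at a fixed $\mathbb C'$-coalgebra $i\colon A\to B$: for all composable $\mathbb C$-coalgebras $j\colon I\to J$, $k\colon J\to K$, all $\mathbb R$-algebras $f\colon X\to Y$ and all lifting problems $(a\sqcup c,b)\colon i\widehat\otimes(kj)\Rightarrow f$ (with $a\colon A\otimes K\to X$, $c\colon B\otimes I\to X$, $b\colon B\otimes K\to Y$), let $d\colon B\otimes J\to X$ be the solution to the lifting problem of $i\widehat\otimes j$ against $f$ obtained by precomposing with $((A\otimes k)\sqcup1,B\otimes k)\colon i\widehat\otimes j\Rightarrow i\widehat\otimes(kj)$; then the solution to $(a\sqcup d,b)\colon i\widehat\otimes k\Rightarrow f$ is the solution to the original problem. The criterion in the first variable is the same with the roles of the variables exchanged. (H1) For $\widehat{\mathrm{hom}}_\ell$ in the $\mathbb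 R$-algebra variable, at a fixed $\mathbb C'$-coalgebra $i\colon A\to B$ (writing $X^B=\mathrm{hom}_\ell(B,X)$): for all composable $\mathbb R$-algebras $f\colon X\to Y$, $g\colon Y\to Z$, all $\mathbb C$-coalgebras $j\colon J\to K$ and all $(a,b\times c)\colon j\Rightarrow\widehat{\mathrm{hom}}_\ell(i,gf)$ with $b\times c\colon K\to Z^B\times_{Z^A}X^A$, let $d\colon K\to Y^B$ be the solution to $(f^Ba,b\times f^Ac)\colon j\Rightarrow\widehat{\mathrm{hom}}_\ell(i,g)$; then the solution to $(a,d\times c)\colon j\Rightarrow\widehat{\mathrm{hom}}_\ell(i,f)$ is the solution to the original problem. (H2) For $\widehat{\mathrm{hom}}_\ell$ in the $\mathbb C'$-coalgebra variable, at a fixed $\mathbb R$-algebra $f\colon X\to Y$: for all composable $\mathbb C'$-coalgebras $i\colon A\to B$, $k\colon B\to D$, all $\mathbb C$-coalgebras $j\colon J\to K$ and all $(a,b\times c)\colon j\Rightarrow\widehat{\mathrm{hom}}_\ell(ki,f)$ with $a\colon J\to X^D$, $b\times c\colon K\to Y^D\times_{Y^A}X^A$, let $d\colon K\to X^B$ be the solution to the lifting problem of $j$ against $\widehat{\mathrm{hom}}_\ell(i,f)$ obtained by composing with $(X^k,Y^k\times1)\colon\widehat{\mathrm{hom}}_\ell(ki,f)\Rightarrow\widehat{\mathrm{hom}}_\ell(i,f)$; then the solution to $(a,b\times d)\colon j\Rightarrow\widehat{\mathrm{hom}}_\ell(k,f)$ is the solution to the original problem. For $\widehat{\mathrm{hom}}_r$,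 (H1) and (H2) are the same statements with the roles of $(\mathcal K,\mathbb C',\mathbb F')$ and $(\mathcal M,\mathbb C,\mathbb F)$ exchanged. *)

theory Defs
  imports Main
begin

section \<open>Categories, functors, natural transformations\<close>

record ('o, 'a) cat =
  Ob :: "'o set"
  Ar :: "'a set"
  Dom :: "'a \<Rightarrow> 'o"
  Cod :: "'a \<Rightarrow> 'o"
  Idt :: "'o \<Rightarrow> 'a"
  Cmp :: "'a \<Rightarrow> 'a \<Rightarrow> 'a" (infixr "\<cdot>\<index>" 70)

locale category =
  fixes C :: "('o, 'a, 'z) cat_scheme" (structure)
  assumes dom_ob: "f \<in> Ar C \<Longrightarrow> Dom C f \<in> Ob C"
    and cod_ob: "f \<in> Ar C \<Longrightarrow> Cod C f \<in> Ob C"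
    and idt_ar: "x \<in> Ob C \<Longrightarrow> Idt C x \<in> Ar C"
    and dom_idt: "x \<in> Ob C \<Longrightarrow> Dom C (Idt C x) = x"
    and cod_idt: "x \<in> Ob C \<Longrightarrow> Cod C (Idt C x) = x"
    and cmp_ar: "\<lbrakk>f \<in> Ar C; g \<in> Ar C; Dom C g = Cod C f\<rbrakk> \<Longrightarrow> g \<cdot> f \<in> Ar C"
    and dom_cmp: "\<lbrakk>f \<in> Ar C; g \<in> Ar C; Dom C g = Cod C f\<rbrakk> \<Longrightarrow> Dom C (g \<cdot> f) = Dom C f"
    and cod_cmp: "\<lbrakk>f \<in> Ar C; g \<in> Ar C; Dom C g = Cod C f\<rbrakk> \<Longrightarrow> Cod C (g \<cdot> f) = Cod C g"
    and cmp_idt: "f \<in> Ar C \<Longrightarrow> f \<cdot> Idt C (Dom C f) = f"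
    and idt_cmp: "f \<in> Ar C \<Longrightarrow> Idt C (Cod C f) \<cdot> f = f"
    and cmp_assoc: "\<lbrakk>f \<in> Ar C; g \<in> Ar C; h \<in> Ar C; Dom C g = Cod C f; Dom C h = Cod C g\<rbrakk>
      \<Longrightarrow> (h \<cdot> g) \<cdot> f = h \<cdot> (g \<cdot> f)"

definition hom :: "('o, 'a, 'z) cat_scheme \<Rightarrow> 'o \<Rightarrow> 'o \<Rightarrow> 'a set" where
  "hom C x y = {f \<in> Ar C. Dom C f = x \<and> Cod C f = y}"

definition op_cat :: "('o, 'a, 'z) cat_scheme \<Rightarrow> ('o, 'a) cat" where
  "op_cat C = \<lparr>Ob = Ob C, Ar = Ar C, Dom = Cod C, Cod = Dom C, Idt = Idt C,
     Cmp = (\<lambda>g f. f \<cdot>\<^bsub>C\<^esub> g)\<rparr>"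

definition prod_cat ::
  "('o1, 'a1, 'z1) cat_scheme \<Rightarrow> ('o2, 'a2, 'z2) cat_scheme \<Rightarrow> ('o1 \<times> 'o2, 'a1 \<times> 'a2) cat" where
  "prod_cat C D = \<lparr>Ob = Ob C \<times> Ob D, Ar = Ar C \<times> Ar D,
     Dom = map_prod (Dom C) (Dom D), Cod = map_prod (Cod C) (Cod D),
     Idt = map_prod (Idt C) (Idt D),
     Cmp = (\<lambda>(g, g') (f, f'). (g \<cdot>\<^bsub>C\<^esub> f, g' \<cdot>\<^bsub>D\<^esub> f'))\<rparr>"

text \<open>\<open>Sq f g u v\<close> is the morphism \<open>(u, v) : f \<Rightarrow> g\<close> of the arrow category,
  with \<open>u\<close> on domains and \<open>v\<close> on codomains.\<close>

datatype 'a square = Sq (sq_dom: 'a) (sq_cod: 'a) (sq_top: 'a) (sq_bot: 'a)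

definition arrow_cat :: "('o, 'a, 'z) cat_scheme \<Rightarrow> ('a, 'a square) cat" where
  "arrow_cat C = \<lparr>Ob = Ar C,
     Ar = {Sq f g u v | f g u v. f \<in> Ar C \<and> g \<in> Ar C \<and>
             u \<in> hom C (Dom C f) (Dom C g) \<and> v \<in> hom C (Cod C f) (Cod C g) \<and>
             g \<cdot>\<^bsub>C\<^esub> u = v \<cdot>\<^bsub>C\<^esub> f},
     Dom = sq_dom, Cod = sq_cod,
     Idt = (\<lambda>f. Sq f f (Idt C (Dom C f)) (Idt C (Cod C f))),
     Cmp = (\<lambda>T S. Sq (sq_dom S) (sq_cod T)
             (sq_top T \<cdot>\<^bsub>C\<^esub> sq_top S) (sq_bot T \<cdot>\<^bsub>C\<^esub> sq_bot S))\<rparr>"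

datatype ('o1, 'a1, 'o2, 'a2) cfun = CFun (fob: "'o1 \<Rightarrow> 'o2") (far: "'a1 \<Rightarrow> 'a2")

definition id_cfun :: "('o, 'a, 'o, 'a) cfun" where
  "id_cfun = CFun (\<lambda>x. x) (\<lambda>f. f)"

definition cfun_comp ::
  "('o2, 'a2, 'o3, 'a3) cfun \<Rightarrow> ('o1, 'a1, 'o2, 'a2) cfun \<Rightarrow> ('o1, 'a1, 'o3, 'a3) cfun" where
  "cfun_comp G F = CFun (fob G \<circ> fob F) (far G \<circ> far F)"

definition cfun_prod ::
  "('o1, 'a1, 'o2, 'a2) cfun \<Rightarrow> ('o3, 'a3, 'o4, 'a4) cfun
    \<Rightarrow> ('o1 \<times> 'o3, 'a1 \<times> 'a3, 'o2 \<times> 'o4, 'a2 \<times> 'a4) cfun" where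
  "cfun_prod F G = CFun (map_prod (fob F) (fob G)) (map_prod (far F) (far G))"

locale cfunctor = A: category A + B: category B
  for A :: "('o1, 'a1, 'z1) cat_scheme" and B :: "('o2, 'a2, 'z2) cat_scheme" +
  fixes F :: "('o1, 'a1, 'o2, 'a2) cfun"
  assumes fob_ob: "x \<in> Ob A \<Longrightarrow> fob F x \<in> Ob B"
    and far_hom: "f \<in> Ar A \<Longrightarrow> far F f \<in> hom B (fob F (Dom A f)) (fob F (Cod A f))"
    and far_idt: "x \<in> Ob A \<Longrightarrow> far F (Idt A x) = Idt B (fob F x)"
    and far_cmp: "\<lbrakk>f \<in> Ar A; g \<in> Ar A; Dom A g = Cod A f\<rbrakk>
      \<Longrightarrow> far F (g \<cdot>\<^bsub>A\<^esub> f) = far F g \<cdot>\<^bsub>B\<^esub> far F f"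

definition cfun_agree ::
  "('o1, 'a1, 'z1) cat_scheme \<Rightarrow> ('o1, 'a1, 'o2, 'a2) cfun \<Rightarrow> ('o1, 'a1, 'o2, 'a2) cfun \<Rightarrow> bool" where
  "cfun_agree A F G \<longleftrightarrow> (\<forall>x\<in>Ob A. fob F x = fob G x) \<and> (\<forall>f\<in>Ar A. far F f = far G f)"

definition fix_fst :: "('o1, 'a1, 'z1) cat_scheme \<Rightarrow> ('o1 \<times> 'o2, 'a1 \<times> 'a2, 'o3, 'a3) cfun
    \<Rightarrow> 'o1 \<Rightarrow> ('o2, 'a2, 'o3, 'a3) cfun" where
  "fix_fst C F x = CFun (\<lambda>y. fob F (x, y)) (\<lambda>g. far F (Idt C x, g))"

locale nat_trans = F: cfunctor A B F + G: cfunctor A B G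
  for A :: "('o1, 'a1, 'z1) cat_scheme" and B :: "('o2, 'a2, 'z2) cat_scheme"
    and F G :: "('o1, 'a1, 'o2, 'a2) cfun" +
  fixes \<tau> :: "'o1 \<Rightarrow> 'a2"
  assumes component: "x \<in> Ob A \<Longrightarrow> \<tau> x \<in> hom B (fob F x) (fob G x)"
    and naturality: "f \<in> Ar A \<Longrightarrow>
      \<tau> (Cod A f) \<cdot>\<^bsub>B\<^esub> far F f = far G f \<cdot>\<^bsub>B\<^esub> \<tau> (Dom A f)"

locale comonad =
  counit: nat_trans C C T id_cfun \<epsilon> + comult: nat_trans C C T "cfun_comp T T" \<delta>
  for C :: "('o, 'a, 'z) cat_scheme" (structure) and T and \<epsilon> and \<delta> +
  assumes counit_left: "x \<in> Ob C \<Longrightarrow> \<epsilon> (fob T x) \<cdot> \<delta> x = Idt C (fob T x)"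
    and counit_right: "x \<in> Ob C \<Longrightarrow> far T (\<epsilon> x) \<cdot> \<delta> x = Idt C (fob T x)"
    and coassoc: "x \<in> Ob C \<Longrightarrow> \<delta> (fob T x) \<cdot> \<delta> x = far T (\<delta> x) \<cdot> \<delta> x"

locale monad =
  unit: nat_trans C C id_cfun T \<eta> + mult: nat_trans C C "cfun_comp T T" T \<mu>
  for C :: "('o, 'a, 'z) cat_scheme" (structure) and T and \<eta> and \<mu> +
  assumes unit_left: "x \<in> Ob C \<Longrightarrow> \<mu> x \<cdot> \<eta> (fob T x) = Idt C (fob T x)"
    and unit_right: "x \<in> Ob C \<Longrightarrow> \<mu> x \<cdot> far T (\<eta> x) = Idt C (fob T x)"
    and assoc: "x \<in> Ob C \<Longrightarrow> \<mu> x \<cdot> \<mu> (fob T x) = \<mu> x \<cdot> far T (\<mu> x)"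

text \<open>A distributive law \<open>\<kappa> : L R \<Rightarrow> R L\<close> of a comonad \<open>L\<close> over a monad \<open>R\<close>.\<close>

locale distributive_law =
  comonad C L \<epsilon> \<delta> + monad C R \<eta> \<mu> +
  law: nat_trans C C "cfun_comp L R" "cfun_comp R L" \<kappa>
  for C :: "('o, 'a, 'z) cat_scheme" (structure) and L \<epsilon> \<delta> R \<eta> \<mu> \<kappa> +
  assumes law_counit: "x \<in> Ob C \<Longrightarrow> far R (\<epsilon> x) \<cdot> \<kappa> x = \<epsilon> (fob R x)"
    and law_comult: "x \<in> Ob C \<Longrightarrow>
      far R (\<delta> x) \<cdot> \<kappa> x = \<kappa> (fob L x) \<cdot> far L (\<kappa> x) \<cdot> \<delta> (fob R x)"
    and law_unit: "x \<in> Ob C \<Longrightarrow> \<kappa> x \<cdot> far L (\<eta> x) = \<eta> (fob L x)"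
    and law_mult: "x \<in> Ob C \<Longrightarrow>
      \<kappa> x \<cdot> far L (\<mu> x) = \<mu> (fob L x) \<cdot> far R (\<kappa> x) \<cdot> \<kappa> (fob R x)"

section \<open>Pullbacks and pushouts\<close>

definition is_pullback :: "('o, 'a, 'z) cat_scheme \<Rightarrow> 'a \<Rightarrow> 'a \<Rightarrow> 'a \<Rightarrow> 'a \<Rightarrow> bool" where
  "is_pullback C f g p q \<longleftrightarrow>
     f \<in> Ar C \<and> g \<in> Ar C \<and> Cod C f = Cod C g \<and>
     p \<in> Ar C \<and> q \<in> Ar C \<and> Dom C p = Dom C q \<and> Cod C p = Dom C f \<and> Cod C q = Dom C g \<and>
     f \<cdot>\<^bsub>C\<^esub> p = g \<cdot>\<^bsub>C\<^esub> q \<and>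
     (\<forall>x\<in>Ar C. \<forall>y\<in>Ar C. Dom C x = Dom C y \<longrightarrow> Cod C x = Dom C f \<longrightarrow> Cod C y = Dom C g \<longrightarrow>
        f \<cdot>\<^bsub>C\<^esub> x = g \<cdot>\<^bsub>C\<^esub> y \<longrightarrow>
        (\<exists>!h. h \<in> hom C (Dom C x) (Dom C p) \<and> p \<cdot>\<^bsub>C\<^esub> h = x \<and> q \<cdot>\<^bsub>C\<^esub> h = y))"

text \<open>The map \<open>x \<times> y\<close> into the pullback with projections \<open>(p, q)\<close>.\<close>

definition tuple :: "('o, 'a, 'z) cat_scheme \<Rightarrow> 'a \<times> 'a \<Rightarrow> 'a \<Rightarrow> 'a \<Rightarrow> 'a" where
  "tuple C pq x y = (THE h. h \<in> hom C (Dom C x) (Dom C (fst pq)) \<and>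
     fst pq \<cdot>\<^bsub>C\<^esub> h = x \<and> snd pq \<cdot>\<^bsub>C\<^esub> h = y)"

definition is_pushout :: "('o, 'a, 'z) cat_scheme \<Rightarrow> 'a \<Rightarrow> 'a \<Rightarrow> 'a \<Rightarrow> 'a \<Rightarrow> bool" where
  "is_pushout C f g p q \<longleftrightarrow> is_pullback (op_cat C) f g p q"

text \<open>The map \<open>x \<squnion> y\<close> out of the pushout with injections \<open>(p, q)\<close>.\<close>

definition cotuple :: "('o, 'a, 'z) cat_scheme \<Rightarrow> 'a \<times> 'a \<Rightarrow> 'a \<Rightarrow> 'a \<Rightarrow> 'a" where
  "cotuple C pq x y = tuple (op_cat C) pq x y"

text \<open>A category with pullbacks (pushouts) is treated as a category with an arbitrary choice of them,
  since the induced functors on arrow categories depend on such a choice.\<close>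

definition pullback_choice :: "('o, 'a, 'z) cat_scheme \<Rightarrow> ('a \<Rightarrow> 'a \<Rightarrow> 'a \<times> 'a) \<Rightarrow> bool" where
  "pullback_choice C pb \<longleftrightarrow> (\<forall>f\<in>Ar C. \<forall>g\<in>Ar C. Cod C f = Cod C g \<longrightarrow>
     is_pullback C f g (fst (pb f g)) (snd (pb f g)))"

definition pushout_choice :: "('o, 'a, 'z) cat_scheme \<Rightarrow> ('a \<Rightarrow> 'a \<Rightarrow> 'a \<times> 'a) \<Rightarrow> bool" where
  "pushout_choice C po \<longleftrightarrow> (\<forall>f\<in>Ar C. \<forall>g\<in>Ar C. Dom C f = Dom C g \<longrightarrow>
     is_pushout C f g (fst (po f g)) (snd (po f g)))"

section \<open>Algebraic weak factorization systems\<close>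

text \<open>The factorization of \<open>f\<close> is \<open>f = rgt f \<cdot> lft f\<close> through \<open>fob fac f\<close>;
  \<open>cmul f\<close> and \<open>mul f\<close> are the nontrivial components \<open>\<delta>\<^sub>f\<close> and \<open>\<mu>\<^sub>f\<close>
  of the comultiplication and the multiplication.\<close>

record ('o, 'a) awfs_cat = "('o, 'a) cat" +
  fac :: "('a, 'a square, 'o, 'a) cfun"
  lft :: "'a \<Rightarrow> 'a"
  rgt :: "'a \<Rightarrow> 'a"
  cmul :: "'a \<Rightarrow> 'a"
  mul :: "'a \<Rightarrow> 'a"

definition lft_cfun :: "('o, 'a, 'z) awfs_cat_scheme \<Rightarrow> ('a, 'a square, 'a, 'a square) cfun" where
  "lft_cfun C = CFun (lft C)
     (\<lambda>S. Sq (lft C (sq_dom S)) (lft C (sq_cod S)) (sq_top S) (far (fac C) S))"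

definition rgt_cfun :: "('o, 'a, 'z) awfs_cat_scheme \<Rightarrow> ('a, 'a square, 'a, 'a square) cfun" where
  "rgt_cfun C = CFun (rgt C)
     (\<lambda>S. Sq (rgt C (sq_dom S)) (rgt C (sq_cod S)) (far (fac C) S) (sq_bot S))"

definition counit_sq :: "('o, 'a, 'z) awfs_cat_scheme \<Rightarrow> 'a \<Rightarrow> 'a square" where
  "counit_sq C f = Sq (lft C f) f (Idt C (Dom C f)) (rgt C f)"

definition comult_sq :: "('o, 'a, 'z) awfs_cat_scheme \<Rightarrow> 'a \<Rightarrow> 'a square" where
  "comult_sq C f = Sq (lft C f) (lft C (lft C f)) (Idt C (Dom C f)) (cmul C f)"

definition unit_sq :: "('o, 'a, 'z) awfs_cat_scheme \<Rightarrow> 'a \<Rightarrow> 'a square" where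
  "unit_sq C f = Sq f (rgt C f) (lft C f) (Idt C (Cod C f))"

definition mult_sq :: "('o, 'a, 'z) awfs_cat_scheme \<Rightarrow> 'a \<Rightarrow> 'a square" where
  "mult_sq C f = Sq (rgt C (rgt C f)) (rgt C f) (mul C f) (Idt C (Cod C f))"

definition law_sq :: "('o, 'a, 'z) awfs_cat_scheme \<Rightarrow> 'a \<Rightarrow> 'a square" where
  "law_sq C f = Sq (lft C (rgt C f)) (rgt C (lft C f)) (cmul C f) (mul C f)"

locale functorial_factorization =
  factor: cfunctor "arrow_cat C" C "fac C" + category C
  for C :: "('o, 'a, 'z) awfs_cat_scheme" (structure) +
  assumes lft_hom: "f \<in> Ar C \<Longrightarrow> lft C f \<in> hom C (Dom C f) (fob (fac C) f)"
    and rgt_hom: "f \<in> Ar C \<Longrightarrow> rgt C f \<in> hom C (fob (fac C) f) (Cod C f)"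
    and factorization: "f \<in> Ar C \<Longrightarrow> rgt C f \<cdot> lft C f = f"
    and lft_natural: "Sq f g u v \<in> Ar (arrow_cat C) \<Longrightarrow>
      far (fac C) (Sq f g u v) \<cdot> lft C f = lft C g \<cdot> u"
    and rgt_natural: "Sq f g u v \<in> Ar (arrow_cat C) \<Longrightarrow>
      rgt C g \<cdot> far (fac C) (Sq f g u v) = v \<cdot> rgt C f"

locale awfs =
  functorial_factorization C +
  distributive_law "arrow_cat C" "lft_cfun C" "counit_sq C" "comult_sq C"
    "rgt_cfun C" "unit_sq C" "mult_sq C" "law_sq C"
  for C :: "('o, 'a, 'z) awfs_cat_scheme" (structure)

subsection \<open>Coalgebras and algebras\<close>

text \<open>A (co)algebra is an arrow paired with its structure map; a morphism of (co)algebras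
  records its source and target together with the underlying square.\<close>

type_synonym 'a structured = "'a \<times> 'a"
type_synonym 'a structured_map = "'a structured \<times> 'a structured \<times> 'a square"

definition is_coalg :: "('o, 'a, 'z) awfs_cat_scheme \<Rightarrow> 'a structured \<Rightarrow> bool" where
  "is_coalg C = (\<lambda>(j, s). j \<in> Ar C \<and> s \<in> hom C (Cod C j) (fob (fac C) j) \<and>
     s \<cdot>\<^bsub>C\<^esub> j = lft C j \<and>
     rgt C j \<cdot>\<^bsub>C\<^esub> s = Idt C (Cod C j) \<and>
     cmul C j \<cdot>\<^bsub>C\<^esub> s = far (fac C) (Sq j (lft C j) (Idt C (Dom C j)) s) \<cdot>\<^bsub>C\<^esub> s)"

definition is_alg :: "('o, 'a, 'z) awfs_cat_scheme \<Rightarrow> 'a structured \<Rightarrow> bool" where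
  "is_alg C = (\<lambda>(f, r). f \<in> Ar C \<and> r \<in> hom C (fob (fac C) f) (Dom C f) \<and>
     r \<cdot>\<^bsub>C\<^esub> lft C f = Idt C (Dom C f) \<and>
     f \<cdot>\<^bsub>C\<^esub> r = rgt C f \<and>
     r \<cdot>\<^bsub>C\<^esub> mul C f = r \<cdot>\<^bsub>C\<^esub> far (fac C) (Sq (rgt C f) f r (Idt C (Cod C f))))"

definition structured_cat :: "('o, 'a, 'z) cat_scheme \<Rightarrow> ('a structured \<Rightarrow> bool)
    \<Rightarrow> ('a structured \<Rightarrow> 'a structured \<Rightarrow> 'a square \<Rightarrow> bool)
    \<Rightarrow> ('a structured, 'a structured_map) cat" where
  "structured_cat C P Q = \<lparr>Ob = {X. P X},
     Ar = {(X, Y, S). P X \<and> P Y \<and> S \<in> hom (arrow_cat C) (fst X) (fst Y) \<and> Q X Y S},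
     Dom = (\<lambda>(X, Y, S). X), Cod = (\<lambda>(X, Y, S). Y),
     Idt = (\<lambda>X. (X, X, Idt (arrow_cat C) (fst X))),
     Cmp = (\<lambda>(Y', Z, T) (X, Y, S). (X, Z, T \<cdot>\<^bsub>arrow_cat C\<^esub> S))\<rparr>"

definition coalg :: "('o, 'a, 'z) awfs_cat_scheme \<Rightarrow> ('a structured, 'a structured_map) cat" where
  "coalg C = structured_cat C (is_coalg C)
     (\<lambda>X Y S. snd Y \<cdot>\<^bsub>C\<^esub> sq_bot S = far (fac C) S \<cdot>\<^bsub>C\<^esub> snd X)"

definition alg :: "('o, 'a, 'z) awfs_cat_scheme \<Rightarrow> ('a structured, 'a structured_map) cat" where
  "alg C = structured_cat C (is_alg C)
     (\<lambda>X Y S. sq_top S \<cdot>\<^bsub>C\<^esub> snd X = snd Y \<cdot>\<^bsub>C\<^esub> far (fac C) S)"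

definition forget :: "('a structured, 'a structured_map, 'a, 'a square) cfun" where
  "forget = CFun fst (\<lambda>(X, Y, S). S)"

definition cofree_coalg :: "('o, 'a, 'z) awfs_cat_scheme \<Rightarrow> 'a \<Rightarrow> 'a structured" where
  "cofree_coalg C j = (lft C j, cmul C j)"

definition free_alg :: "('o, 'a, 'z) awfs_cat_scheme \<Rightarrow> 'a \<Rightarrow> 'a structured" where
  "free_alg C f = (rgt C f, mul C f)"

definition coalg_comp ::
  "('o, 'a, 'z) awfs_cat_scheme \<Rightarrow> 'a structured \<Rightarrow> 'a structured \<Rightarrow> 'a structured" where
  "coalg_comp C = (\<lambda>(k, t) (j, s). let kj = k \<cdot>\<^bsub>C\<^esub> j in
     (kj, mul C kj \<cdot>\<^bsub>C\<^esub>
          far (fac C) (Sq k (rgt C kj)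
            (far (fac C) (Sq j kj (Idt C (Dom C j)) k) \<cdot>\<^bsub>C\<^esub> s) (Idt C (Cod C k))) \<cdot>\<^bsub>C\<^esub> t))"

definition alg_comp ::
  "('o, 'a, 'z) awfs_cat_scheme \<Rightarrow> 'a structured \<Rightarrow> 'a structured \<Rightarrow> 'a structured" where
  "alg_comp C = (\<lambda>(g, t) (f, s). let gf = g \<cdot>\<^bsub>C\<^esub> f in
     (gf, s \<cdot>\<^bsub>C\<^esub>
          far (fac C) (Sq (lft C gf) f (Idt C (Dom C f))
            (t \<cdot>\<^bsub>C\<^esub> far (fac C) (Sq gf g f (Idt C (Cod C g))))) \<cdot>\<^bsub>C\<^esub> cmul C gf))"

text \<open>The canonical solution to a lifting problem of a coalgebra against an algebra.\<close>

definition solution ::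
  "('o, 'a, 'z) awfs_cat_scheme \<Rightarrow> 'a structured \<Rightarrow> 'a structured \<Rightarrow> 'a square \<Rightarrow> 'a" where
  "solution C X Y S = snd Y \<cdot>\<^bsub>C\<^esub> far (fac C) S \<cdot>\<^bsub>C\<^esub> snd X"

section \<open>Two-variable adjunctions\<close>

text \<open>\<open>trl k m n\<close> and \<open>trr k m n\<close> transpose maps \<open>k \<otimes> m \<rightarrow> n\<close> to maps
  \<open>m \<rightarrow> hom\<^sub>l(k, n)\<close> and \<open>k \<rightarrow> hom\<^sub>r(m, n)\<close>, respectively.\<close>

record ('ok, 'ak, 'om, 'am, 'on, 'an) tva =
  ten :: "('ok \<times> 'om, 'ak \<times> 'am, 'on, 'an) cfun"
  homl :: "('ok \<times> 'on, 'ak \<times> 'an, 'om, 'am) cfun"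
  homr :: "('om \<times> 'on, 'am \<times> 'an, 'ok, 'ak) cfun"
  trl :: "'ok \<Rightarrow> 'om \<Rightarrow> 'on \<Rightarrow> 'an \<Rightarrow> 'am"
  trr :: "'ok \<Rightarrow> 'om \<Rightarrow> 'on \<Rightarrow> 'an \<Rightarrow> 'ak"

locale two_variable_adjunction =
  K: category K + M: category M + N: category N +
  tensor: cfunctor "prod_cat K M" N "ten A" +
  hom_left: cfunctor "prod_cat (op_cat K) N" M "homl A" +
  hom_right: cfunctor "prod_cat (op_cat M) N" K "homr A"
  for K :: "('ok, 'ak, 'zk) cat_scheme" and M :: "('om, 'am, 'zm) cat_scheme"
    and N :: "('on, 'an, 'zn) cat_scheme" and A :: "('ok, 'ak, 'om, 'am, 'on, 'an) tva" +
  assumes trl_bij: "\<lbrakk>k \<in> Ob K; m \<in> Ob M; n \<in> Ob N\<rbrakk> \<Longrightarrow>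
      bij_betw (trl A k m n) (hom N (fob (ten A) (k, m)) n) (hom M m (fob (homl A) (k, n)))"
    and trr_bij: "\<lbrakk>k \<in> Ob K; m \<in> Ob M; n \<in> Ob N\<rbrakk> \<Longrightarrow>
      bij_betw (trr A k m n) (hom N (fob (ten A) (k, m)) n) (hom K k (fob (homr A) (m, n)))"
    and trl_natural: "\<lbrakk>u \<in> hom K k' k; v \<in> hom M m' m; w \<in> hom N n n';
        h \<in> hom N (fob (ten A) (k, m)) n\<rbrakk> \<Longrightarrow>
      trl A k' m' n' (w \<cdot>\<^bsub>N\<^esub> h \<cdot>\<^bsub>N\<^esub> far (ten A) (u, v)) =
      far (homl A) (u, w) \<cdot>\<^bsub>M\<^esub> trl A k m n h \<cdot>\<^bsub>M\<^esub> v"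
    and trr_natural: "\<lbrakk>u \<in> hom K k' k; v \<in> hom M m' m; w \<in> hom N n n';
        h \<in> hom N (fob (ten A) (k, m)) n\<rbrakk> \<Longrightarrow>
      trr A k' m' n' (w \<cdot>\<^bsub>N\<^esub> h \<cdot>\<^bsub>N\<^esub> far (ten A) (u, v)) =
      far (homr A) (v, w) \<cdot>\<^bsub>K\<^esub> trr A k m n h \<cdot>\<^bsub>K\<^esub> u"

text \<open>Unit and counit of \<open>k \<otimes> - \<stileturn> hom\<^sub>l(k, -)\<close> and of
  \<open>- \<otimes> m \<stileturn> hom\<^sub>r(m, -)\<close>.\<close>

definition unit_l :: "('on, 'an, 'zn) cat_scheme \<Rightarrow> ('ok, 'ak, 'om, 'am, 'on, 'an) tva
    \<Rightarrow> 'ok \<Rightarrow> 'om \<Rightarrow> 'am" where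
  "unit_l N A k m = trl A k m (fob (ten A) (k, m)) (Idt N (fob (ten A) (k, m)))"

definition counit_l :: "('om, 'am, 'zm) cat_scheme \<Rightarrow> ('on, 'an, 'zn) cat_scheme
    \<Rightarrow> ('ok, 'ak, 'om, 'am, 'on, 'an) tva \<Rightarrow> 'ok \<Rightarrow> 'on \<Rightarrow> 'an" where
  "counit_l M N A k n = (let m = fob (homl A) (k, n) in
     the_inv_into (hom N (fob (ten A) (k, m)) n) (trl A k m n) (Idt M m))"

definition unit_r :: "('on, 'an, 'zn) cat_scheme \<Rightarrow> ('ok, 'ak, 'om, 'am, 'on, 'an) tva
    \<Rightarrow> 'om \<Rightarrow> 'ok \<Rightarrow> 'ak" where
  "unit_r N A m k = trr A k m (fob (ten A) (k, m)) (Idt N (fob (ten A) (k, m)))"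

definition counit_r :: "('ok, 'ak, 'zk) cat_scheme \<Rightarrow> ('on, 'an, 'zn) cat_scheme
    \<Rightarrow> ('ok, 'ak, 'om, 'am, 'on, 'an) tva \<Rightarrow> 'om \<Rightarrow> 'on \<Rightarrow> 'an" where
  "counit_r K N A m n = (let k = fob (homr A) (m, n) in
     the_inv_into (hom N (fob (ten A) (k, m)) n) (trr A k m n) (Idt K k))"

subsection \<open>The induced two-variable adjunction on arrow categories\<close>

text \<open>The injections of \<open>A \<otimes> K\<close> and \<open>B \<otimes> J\<close> into the domain of the pushout-product
  of \<open>i : A \<rightarrow> B\<close> and \<open>j : J \<rightarrow> K\<close>.\<close>

definition pp_inj :: "('ok, 'ak, 'zk) cat_scheme \<Rightarrow> ('om, 'am, 'zm) cat_scheme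
    \<Rightarrow> ('an \<Rightarrow> 'an \<Rightarrow> 'an \<times> 'an) \<Rightarrow> ('ok \<times> 'om, 'ak \<times> 'am, 'on, 'an) cfun
    \<Rightarrow> 'ak \<Rightarrow> 'am \<Rightarrow> 'an \<times> 'an" where
  "pp_inj K M po T i j = po (far T (Idt K (Dom K i), j)) (far T (i, Idt M (Dom M j)))"

definition pushout_product :: "('ok, 'ak, 'zk) cat_scheme \<Rightarrow> ('om, 'am, 'zm) cat_scheme
    \<Rightarrow> ('on, 'an, 'zn) cat_scheme \<Rightarrow> ('an \<Rightarrow> 'an \<Rightarrow> 'an \<times> 'an)
    \<Rightarrow> ('ok \<times> 'om, 'ak \<times> 'am, 'on, 'an) cfun
    \<Rightarrow> ('ak \<times> 'am, 'ak square \<times> 'am square, 'an, 'an square) cfun" where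
  "pushout_product K M N po T =
     (let pp = (\<lambda>(i, j). cotuple N (pp_inj K M po T i j)
                  (far T (i, Idt M (Cod M j))) (far T (Idt K (Cod K i), j)))
      in CFun pp
        (\<lambda>(S, S'). let q = pp_inj K M po T (sq_cod S) (sq_cod S') in
           Sq (pp (sq_dom S, sq_dom S')) (pp (sq_cod S, sq_cod S'))
              (cotuple N (pp_inj K M po T (sq_dom S) (sq_dom S'))
                 (fst q \<cdot>\<^bsub>N\<^esub> far T (sq_top S, sq_bot S'))
                 (snd q \<cdot>\<^bsub>N\<^esub> far T (sq_bot S, sq_top S')))
              (far T (sq_bot S, sq_bot S'))))"

text \<open>For \<open>H : A\<^sup>o\<^sup>p \<times> N \<rightarrow> B\<close>, the projections to \<open>H(cod i, cod f)\<close> and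
  \<open>H(dom i, dom f)\<close> from the codomain of the pullback-hom of \<open>i\<close> and \<open>f\<close>.
  Both \<open>homl\<close> and \<open>homr\<close> are instances of \<open>H\<close>.\<close>

definition ph_proj :: "('oa, 'aa, 'za) cat_scheme \<Rightarrow> ('on, 'an, 'zn) cat_scheme
    \<Rightarrow> ('ab \<Rightarrow> 'ab \<Rightarrow> 'ab \<times> 'ab) \<Rightarrow> ('oa \<times> 'on, 'aa \<times> 'an, 'ob, 'ab) cfun
    \<Rightarrow> 'aa \<Rightarrow> 'an \<Rightarrow> 'ab \<times> 'ab" where
  "ph_proj A N pb H i f = pb (far H (i, Idt N (Cod N f))) (far H (Idt A (Dom A i), f))"

definition pullback_hom :: "('oa, 'aa, 'za) cat_scheme \<Rightarrow> ('on, 'an, 'zn) cat_scheme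
    \<Rightarrow> ('ob, 'ab, 'zb) cat_scheme \<Rightarrow> ('ab \<Rightarrow> 'ab \<Rightarrow> 'ab \<times> 'ab)
    \<Rightarrow> ('oa \<times> 'on, 'aa \<times> 'an, 'ob, 'ab) cfun
    \<Rightarrow> ('aa \<times> 'an, 'aa square \<times> 'an square, 'ab, 'ab square) cfun" where
  "pullback_hom A N B pb H =
     (let ph = (\<lambda>(i, f). tuple B (ph_proj A N pb H i f)
                  (far H (Idt A (Cod A i), f)) (far H (i, Idt N (Dom N f))))
      in CFun ph
        (\<lambda>(S, S'). let p = ph_proj A N pb H (sq_cod S) (sq_dom S') in
           Sq (ph (sq_cod S, sq_dom S')) (ph (sq_dom S, sq_cod S'))
              (far H (sq_bot S, sq_top S'))
              (tuple B (ph_proj A N pb H (sq_dom S) (sq_cod S'))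
                 (far H (sq_bot S, sq_bot S') \<cdot>\<^bsub>B\<^esub> fst p)
                 (far H (sq_top S, sq_top S') \<cdot>\<^bsub>B\<^esub> snd p))))"

definition arrow_tva :: "('ok, 'ak, 'zk) cat_scheme \<Rightarrow> ('om, 'am, 'zm) cat_scheme
    \<Rightarrow> ('on, 'an, 'zn) cat_scheme \<Rightarrow> ('ak \<Rightarrow> 'ak \<Rightarrow> 'ak \<times> 'ak)
    \<Rightarrow> ('am \<Rightarrow> 'am \<Rightarrow> 'am \<times> 'am) \<Rightarrow> ('an \<Rightarrow> 'an \<Rightarrow> 'an \<times> 'an)
    \<Rightarrow> ('ok, 'ak, 'om, 'am, 'on, 'an) tva
    \<Rightarrow> ('ak, 'ak square, 'am, 'am square, 'an, 'an square) tva" where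
  "arrow_tva K M N pbK pbM poN A =
     (let inj = pp_inj K M poN (ten A);
          hl = pullback_hom K N M pbM (homl A);
          hr = pullback_hom M N K pbK (homr A)
      in \<lparr>ten = pushout_product K M N poN (ten A), homl = hl, homr = hr,
          trl = (\<lambda>i j f S. Sq j (fob hl (i, f))
             (trl A (Cod K i) (Dom M j) (Dom N f) (sq_top S \<cdot>\<^bsub>N\<^esub> snd (inj i j)))
             (tuple M (ph_proj K N pbM (homl A) i f)
                (trl A (Cod K i) (Cod M j) (Cod N f) (sq_bot S))
                (trl A (Dom K i) (Cod M j) (Dom N f) (sq_top S \<cdot>\<^bsub>N\<^esub> fst (inj i j))))),
          trr = (\<lambda>i j f S. Sq i (fob hr (j, f))
             (trr A (Dom K i) (Cod M j) (Dom N f) (sq_top S \<cdot>\<^bsub>N\<^esub> fst (inj i j)))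
             (tuple K (ph_proj M N pbK (homr A) j f)
                (trr A (Cod K i) (Cod M j) (Cod N f) (sq_bot S))
                (trr A (Cod K i) (Dom M j) (Dom N f) (sq_top S \<cdot>\<^bsub>N\<^esub> snd (inj i j)))))\<rparr>)"

section \<open>Lifted functors and their characterizing transformations\<close>

text \<open>\<open>F : A \<rightarrow> B\<close> lifts \<open>F\<^sub>0\<close> along \<open>U\<close> and \<open>V\<close>.\<close>

definition lifted :: "('o1, 'a1, 'z1) cat_scheme \<Rightarrow> ('o2, 'a2, 'z2) cat_scheme
    \<Rightarrow> ('o1, 'a1, 'o3, 'a3) cfun \<Rightarrow> ('o2, 'a2, 'o4, 'a4) cfun
    \<Rightarrow> ('o3, 'a3, 'o4, 'a4) cfun \<Rightarrow> ('o1, 'a1, 'o2, 'a2) cfun \<Rightarrow> bool" where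
  "lifted A B U V F\<^sub>0 F \<longleftrightarrow> cfunctor A B F \<and> cfun_agree A (cfun_comp V F) (cfun_comp F\<^sub>0 U)"

type_synonym ('a1, 'a2, 'a3) lift =
  "('a1 structured \<times> 'a2 structured, 'a1 structured_map \<times> 'a2 structured_map,
    'a3 structured, 'a3 structured_map) cfun"

definition lifted_tensor :: "('ok, 'ak, 'zk) awfs_cat_scheme \<Rightarrow> ('om, 'am, 'zm) awfs_cat_scheme
    \<Rightarrow> ('on, 'an, 'zn) awfs_cat_scheme
    \<Rightarrow> ('ak \<times> 'am, 'ak square \<times> 'am square, 'an, 'an square) cfun
    \<Rightarrow> ('ak, 'am, 'an) lift \<Rightarrow> bool" where
  "lifted_tensor K M N P T \<longleftrightarrow>
     lifted (prod_cat (coalg K) (coalg M)) (coalg N) (cfun_prod forget forget) forget P T"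

definition lifted_hom :: "('oa, 'aa, 'za) awfs_cat_scheme \<Rightarrow> ('on, 'an, 'zn) awfs_cat_scheme
    \<Rightarrow> ('ob, 'ab, 'zb) awfs_cat_scheme
    \<Rightarrow> ('aa \<times> 'an, 'aa square \<times> 'an square, 'ab, 'ab square) cfun
    \<Rightarrow> ('aa, 'an, 'ab) lift \<Rightarrow> bool" where
  "lifted_hom A N B P H \<longleftrightarrow>
     lifted (prod_cat (op_cat (coalg A)) (alg N)) (alg B) (cfun_prod forget forget) forget P H"

text \<open>A lift is determined by its characterizing transformation: by functoriality along the
  coalgebra map \<open>(1, s) : (j, s) \<Rightarrow> (lft j, cmul j)\<close> and its duals, the structure assigned to
  \<open>(i, s), (j, t)\<close> is \<open>\<lambda>\<^sub>i\<^sub>j \<cdot> (s \<otimes> t)\<close>, and similarly for the homs.\<close>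

definition tensor_char :: "('ok, 'ak, 'zk) awfs_cat_scheme \<Rightarrow> ('om, 'am, 'zm) awfs_cat_scheme
    \<Rightarrow> ('on, 'an, 'zn) awfs_cat_scheme
    \<Rightarrow> ('ak \<times> 'am, 'ak square \<times> 'am square, 'an, 'an square) cfun
    \<Rightarrow> ('ak, 'am, 'an) lift \<Rightarrow> 'ak \<Rightarrow> 'am \<Rightarrow> 'an" where
  "tensor_char K M N P T i j =
     far (fac N) (far P (counit_sq K i, counit_sq M j)) \<cdot>\<^bsub>N\<^esub>
     snd (fob T (cofree_coalg K i, cofree_coalg M j))"

definition hom_char :: "('oa, 'aa, 'za) awfs_cat_scheme \<Rightarrow> ('on, 'an, 'zn) awfs_cat_scheme
    \<Rightarrow> ('ob, 'ab, 'zb) awfs_cat_scheme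
    \<Rightarrow> ('aa \<times> 'an, 'aa square \<times> 'an square, 'ab, 'ab square) cfun
    \<Rightarrow> ('aa, 'an, 'ab) lift \<Rightarrow> 'aa \<Rightarrow> 'an \<Rightarrow> 'ab" where
  "hom_char A N B P H i f =
     snd (fob H (cofree_coalg A i, free_alg N f)) \<cdot>\<^bsub>B\<^esub>
     far (fac B) (far P (counit_sq A i, unit_sq N f))"

text \<open>For \<open>T \<stileturn> S\<close> with counit \<open>\<epsilon>\<close> and \<open>T' \<stileturn> S'\<close> with unit \<open>\<iota>\<close>, where
  \<open>S : D \<rightarrow> C\<close>, \<open>S' : D' \<rightarrow> C'\<close>, \<open>H : C \<rightarrow> C'\<close>, \<open>G : D \<rightarrow> D'\<close>: the transformations
  \<open>\<lambda> : T' H \<Rightarrow> G T\<close> and \<open>\<rho> : H S \<Rightarrow> S' G\<close> are mates.\<close>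

definition mates :: "('od, 'ad, 'zd) cat_scheme \<Rightarrow> ('oc', 'ac', 'zc') cat_scheme
    \<Rightarrow> ('od, 'ad, 'oc, 'ac) cfun \<Rightarrow> ('od \<Rightarrow> 'ad)
    \<Rightarrow> ('od', 'ad', 'oc', 'ac') cfun \<Rightarrow> ('oc' \<Rightarrow> 'ac')
    \<Rightarrow> ('oc, 'ac, 'oc', 'ac') cfun \<Rightarrow> ('od, 'ad, 'od', 'ad') cfun
    \<Rightarrow> ('oc \<Rightarrow> 'ad') \<Rightarrow> ('od \<Rightarrow> 'ac') \<Rightarrow> bool" where
  "mates D C' S \<epsilon> S' \<iota> H G lam rho \<longleftrightarrow> (\<forall>n\<in>Ob D.
     rho n = far S' (far G (\<epsilon> n)) \<cdot>\<^bsub>C'\<^esub> far S' (lam (fob S n)) \<cdot>\<^bsub>C'\<^esub> \<iota> (fob H (fob S n)))"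

definition awfs_two_variable_adjunction ::
  "('ok, 'ak, 'zk) awfs_cat_scheme \<Rightarrow> ('om, 'am, 'zm) awfs_cat_scheme
    \<Rightarrow> ('on, 'an, 'zn) awfs_cat_scheme
    \<Rightarrow> ('ak \<Rightarrow> 'ak \<Rightarrow> 'ak \<times> 'ak) \<Rightarrow> ('am \<Rightarrow> 'am \<Rightarrow> 'am \<times> 'am) \<Rightarrow> ('an \<Rightarrow> 'an \<Rightarrow> 'an \<times> 'an)
    \<Rightarrow> ('ok, 'ak, 'om, 'am, 'on, 'an) tva
    \<Rightarrow> ('ak, 'am, 'an) lift \<Rightarrow> ('ak, 'an, 'am) lift \<Rightarrow> ('am, 'an, 'ak) lift \<Rightarrow> bool" where
  "awfs_two_variable_adjunction K M N pbK pbM poN A T Hl Hr \<longleftrightarrow>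
     (let A' = arrow_tva K M N pbK pbM poN A;
          K' = arrow_cat K; M' = arrow_cat M; N' = arrow_cat N
      in lifted_tensor K M N (ten A') T \<and>
         lifted_hom K N M (homl A') Hl \<and>
         lifted_hom M N K (homr A') Hr \<and>
         (\<forall>i\<in>Ar K.
            mates N' M (fix_fst K' (homl A') i) (counit_l M' N' A' i)
              (fix_fst K (homl A) (fob (fac K) i)) (unit_l N A (fob (fac K) i))
              (fac M) (fac N)
              (\<lambda>j. tensor_char K M N (ten A') T i j)
              (\<lambda>f. hom_char K N M (homl A') Hl i f)) \<and>
         (\<forall>j\<in>Ar M.
            mates N' K (fix_fst M' (homr A') j) (counit_r K' N' A' j)
              (fix_fst M (homr A) (fob (fac M) j)) (unit_r N A (fob (fac M) j))
              (fac K) (fac N)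
              (\<lambda>i. tensor_char K M N (ten A') T i j)
              (\<lambda>f. hom_char M N K (homr A') Hr j f)))"

section \<open>Composition criteria\<close>

text \<open>Here \<open>w\<close> is the map \<open>a \<squnion> c\<close> out of the pushout, which is determined by
  its components \<open>a\<close> and \<open>c\<close>.\<close>

definition tensor_criterion_snd ::
  "('ok, 'ak, 'zk) awfs_cat_scheme \<Rightarrow> ('om, 'am, 'zm) awfs_cat_scheme
    \<Rightarrow> ('on, 'an, 'zn) awfs_cat_scheme \<Rightarrow> ('an \<Rightarrow> 'an \<Rightarrow> 'an \<times> 'an)
    \<Rightarrow> ('ok \<times> 'om, 'ak \<times> 'am, 'on, 'an) cfun \<Rightarrow> ('ak, 'am, 'an) lift \<Rightarrow> bool" where
  "tensor_criterion_snd K M N po T\<^sub>0 T \<longleftrightarrow>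
     (\<forall>i s j t k t' f r w b.
        is_coalg K (i, s) \<longrightarrow> is_coalg M (j, t) \<longrightarrow> is_coalg M (k, t') \<longrightarrow> Dom M k = Cod M j \<longrightarrow>
        is_alg N (f, r) \<longrightarrow>
        (let pp = (\<lambda>j. fob (pushout_product K M N po T\<^sub>0) (i, j));
             inj = pp_inj K M po T\<^sub>0 i;
             kj = k \<cdot>\<^bsub>M\<^esub> j;
             problem = Sq (pp kj) f w b
         in problem \<in> Ar (arrow_cat N) \<longrightarrow>
            (let a = w \<cdot>\<^bsub>N\<^esub> fst (inj kj);
                 d = solution N (fob T ((i, s), (j, t))) (f, r)
                       (problem \<cdot>\<^bsub>arrow_cat N\<^esub>
                        Sq (pp j) (pp kj)
                          (cotuple N (inj j)
                             (fst (inj kj) \<cdot>\<^bsub>N\<^esub> far T\<^sub>0 (Idt K (Dom K i), k)) (snd (inj kj)))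
                          (far T\<^sub>0 (Idt K (Cod K i), k)))
             in solution N (fob T ((i, s), (k, t'))) (f, r)
                  (Sq (pp k) f (cotuple N (inj k) a d) b)
                = solution N (fob T ((i, s), coalg_comp M (k, t') (j, t))) (f, r) problem)))"

definition tensor_criterion_fst ::
  "('ok, 'ak, 'zk) awfs_cat_scheme \<Rightarrow> ('om, 'am, 'zm) awfs_cat_scheme
    \<Rightarrow> ('on, 'an, 'zn) awfs_cat_scheme \<Rightarrow> ('an \<Rightarrow> 'an \<Rightarrow> 'an \<times> 'an)
    \<Rightarrow> ('ok \<times> 'om, 'ak \<times> 'am, 'on, 'an) cfun \<Rightarrow> ('ak, 'am, 'an) lift \<Rightarrow> bool" where
  "tensor_criterion_fst K M N po T\<^sub>0 T \<longleftrightarrow>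
     (\<forall>j t i s k s' f r w b.
        is_coalg M (j, t) \<longrightarrow> is_coalg K (i, s) \<longrightarrow> is_coalg K (k, s') \<longrightarrow> Dom K k = Cod K i \<longrightarrow>
        is_alg N (f, r) \<longrightarrow>
        (let pp = (\<lambda>i. fob (pushout_product K M N po T\<^sub>0) (i, j));
             inj = (\<lambda>i. pp_inj K M po T\<^sub>0 i j);
             ki = k \<cdot>\<^bsub>K\<^esub> i;
             problem = Sq (pp ki) f w b
         in problem \<in> Ar (arrow_cat N) \<longrightarrow>
            (let a = w \<cdot>\<^bsub>N\<^esub> snd (inj ki);
                 d = solution N (fob T ((i, s), (j, t))) (f, r)
                       (problem \<cdot>\<^bsub>arrow_cat N\<^esub>
                        Sq (pp i) (pp ki)
                          (cotuple N (inj i)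
                             (fst (inj ki)) (snd (inj ki) \<cdot>\<^bsub>N\<^esub> far T\<^sub>0 (k, Idt M (Dom M j))))
                          (far T\<^sub>0 (k, Idt M (Cod M j))))
             in solution N (fob T ((k, s'), (j, t))) (f, r)
                  (Sq (pp k) f (cotuple N (inj k) d a) b)
                = solution N (fob T (coalg_comp K (k, s') (i, s), (j, t))) (f, r) problem)))"

text \<open>In the two criteria for homs, \<open>w\<close> is the map \<open>b \<times> c\<close> into the pullback.\<close>

definition hom_criterion_alg ::
  "('oa, 'aa, 'za) awfs_cat_scheme \<Rightarrow> ('on, 'an, 'zn) awfs_cat_scheme
    \<Rightarrow> ('ob, 'ab, 'zb) awfs_cat_scheme \<Rightarrow> ('ab \<Rightarrow> 'ab \<Rightarrow> 'ab \<times> 'ab)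
    \<Rightarrow> ('oa \<times> 'on, 'aa \<times> 'an, 'ob, 'ab) cfun \<Rightarrow> ('aa, 'an, 'ab) lift \<Rightarrow> bool" where
  "hom_criterion_alg A N B pb H\<^sub>0 H \<longleftrightarrow>
     (\<forall>i s f r g r' j t a w.
        is_coalg A (i, s) \<longrightarrow> is_alg N (f, r) \<longrightarrow> is_alg N (g, r') \<longrightarrow> Dom N g = Cod N f \<longrightarrow>
        is_coalg B (j, t) \<longrightarrow>
        (let ph = (\<lambda>f. fob (pullback_hom A N B pb H\<^sub>0) (i, f));
             proj = ph_proj A N pb H\<^sub>0 i;
             gf = g \<cdot>\<^bsub>N\<^esub> f;
             problem = Sq j (ph gf) a w
         in problem \<in> Ar (arrow_cat B) \<longrightarrow>
            (let b = fst (proj gf) \<cdot>\<^bsub>B\<^esub> w;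
                 c = snd (proj gf) \<cdot>\<^bsub>B\<^esub> w;
                 d = solution B (j, t) (fob H ((i, s), (g, r')))
                       (Sq j (ph g)
                          (far H\<^sub>0 (Idt A (Cod A i), f) \<cdot>\<^bsub>B\<^esub> a)
                          (tuple B (proj g) b (far H\<^sub>0 (Idt A (Dom A i), f) \<cdot>\<^bsub>B\<^esub> c)))
             in solution B (j, t) (fob H ((i, s), (f, r)))
                  (Sq j (ph f) a (tuple B (proj f) d c))
                = solution B (j, t) (fob H ((i, s), alg_comp N (g, r') (f, r))) problem)))"

definition hom_criterion_coalg ::
  "('oa, 'aa, 'za) awfs_cat_scheme \<Rightarrow> ('on, 'an, 'zn) awfs_cat_scheme
    \<Rightarrow> ('ob, 'ab, 'zb) awfs_cat_scheme \<Rightarrow> ('ab \<Rightarrow> 'ab \<Rightarrow> 'ab \<times> 'ab)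
    \<Rightarrow> ('oa \<times> 'on, 'aa \<times> 'an, 'ob, 'ab) cfun \<Rightarrow> ('aa, 'an, 'ab) lift \<Rightarrow> bool" where
  "hom_criterion_coalg A N B pb H\<^sub>0 H \<longleftrightarrow>
     (\<forall>f r i s k s' j t a w.
        is_alg N (f, r) \<longrightarrow> is_coalg A (i, s) \<longrightarrow> is_coalg A (k, s') \<longrightarrow> Dom A k = Cod A i \<longrightarrow>
        is_coalg B (j, t) \<longrightarrow>
        (let ph = (\<lambda>i. fob (pullback_hom A N B pb H\<^sub>0) (i, f));
             proj = (\<lambda>i. ph_proj A N pb H\<^sub>0 i f);
             ki = k \<cdot>\<^bsub>A\<^esub> i;
             problem = Sq j (ph ki) a w
         in problem \<in> Ar (arrow_cat B) \<longrightarrow>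
            (let b = fst (proj ki) \<cdot>\<^bsub>B\<^esub> w;
                 d = solution B (j, t) (fob H ((i, s), (f, r)))
                       (Sq (ph ki) (ph i)
                          (far H\<^sub>0 (k, Idt N (Dom N f)))
                          (tuple B (proj i)
                             (far H\<^sub>0 (k, Idt N (Cod N f)) \<cdot>\<^bsub>B\<^esub> fst (proj ki)) (snd (proj ki)))
                        \<cdot>\<^bsub>arrow_cat B\<^esub> problem)
             in solution B (j, t) (fob H ((k, s'), (f, r)))
                  (Sq j (ph k) a (tuple B (proj k) b d))
                = solution B (j, t) (fob H (coalg_comp A (k, s') (i, s), (f, r))) problem)))"

end

theory Submission
  imports Defs
begin

text \<open>Fix coalgebras \<open>i\<close>, \<open>j\<close> and an algebra \<open>f\<close>. Transposition along the two-variable adjunction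
identifies squares from the pushout-product of \<open>i\<close> and \<open>j\<close> to \<open>f\<close> with squares from \<open>j\<close> to the
left pullback-hom of \<open>i\<close> and \<open>f\<close>, and with squares from \<open>i\<close> to the right pullback-hom of \<open>j\<close> and
\<open>f\<close>, and it identifies their diagonals as well. So a lift of any one of the three functors, through
its canonical solutions, provides an operation \<open>\<Phi>\<close> that solves one and the same three-variable
lifting problem for all \<open>i\<close>, \<open>j\<close>, \<open>f\<close>. The proof rests on two facts about such operations.

First, the characterizing transformations of a lifted tensor and a lifted hom are mates if and only
if both lifts provide the same operation (\<open>mates_iff_lifts_agree\<close>). A two-variable adjunction of
awfs is therefore a triple of lifts with a common \<open>\<Phi>\<close>
(\<open>awfs_two_variable_adjunction_iff\<close>).

Second, an algebra structure on an arrow \<open>p\<close> amounts to a solution of every lifting problem of a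
coalgebra against \<open>p\<close>, natural in coalgebra maps and compatible with composition of coalgebras
(\<open>alg_of_lifting\<close>), and dually for coalgebra structures (\<open>coalg_of_lifting\<close>). With an index
category this produces lifted functors (\<open>lift_to_alg\<close>, \<open>lift_to_coalg\<close>).

Every lifted functor makes \<open>\<Phi>\<close> natural in all three variables. A lifted tensor also makes \<open>\<Phi>\<close>
compatible with composition in \<open>f\<close>, because its values are coalgebras; a lifted left hom does so in
\<open>j\<close> and a lifted right hom in \<open>i\<close>, because their values are algebras. Conversely, by the second
fact, compatibility in one variable is all that is missing for \<open>\<Phi>\<close> to come from the corresponding
functor. Thus each single lift extends to a two-variable adjunction exactly when its \<open>\<Phi>\<close> is
compatible with composition in the other two variables, and these compatibilities are what the
criteria state: (T) in \<open>i\<close> or \<open>j\<close>, (H1) in \<open>f\<close>, (H2) in the coalgebra variable.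

Two symmetries shorten the work. Reversing arrows exchanges coalgebras and algebras (\<open>op_awfs\<close>).
Exchanging the arguments of the tensor turns its right hom into a left hom, so that transposition,
mates and criteria are treated for left homs only and then used for both sides.\<close>

section \<open>Categories and arrow categories\<close>

definition square :: "('o, 'a, 'z) cat_scheme \<Rightarrow> 'a \<Rightarrow> 'a \<Rightarrow> 'a \<Rightarrow> 'a \<Rightarrow> bool" where
  "square C f g u v \<longleftrightarrow> f \<in> Ar C \<and> g \<in> Ar C \<and> u \<in> Ar C \<and> v \<in> Ar C \<and>
     Dom C u = Dom C f \<and> Cod C u = Dom C g \<and> Dom C v = Cod C f \<and> Cod C v = Cod C g \<and>
     g \<cdot>\<^bsub>C\<^esub> u = v \<cdot>\<^bsub>C\<^esub> f"

lemma arrow_cat_ar: "Sq f g u v \<in> Ar (arrow_cat C) \<longleftrightarrow> square C f g u v"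
  unfolding arrow_cat_def square_def hom_def by auto

lemma arrow_cat_simps [simp]:
  "Ob (arrow_cat C) = Ar C" "Dom (arrow_cat C) = sq_dom" "Cod (arrow_cat C) = sq_cod"
  "Idt (arrow_cat C) f = Sq f f (Idt C (Dom C f)) (Idt C (Cod C f))"
  "Cmp (arrow_cat C) T S = Sq (sq_dom S) (sq_cod T)
             (sq_top T \<cdot>\<^bsub>C\<^esub> sq_top S) (sq_bot T \<cdot>\<^bsub>C\<^esub> sq_bot S)"
  by (auto simp: arrow_cat_def)

lemma op_cat_simps [simp]:
  "Ob (op_cat C) = Ob C" "Ar (op_cat C) = Ar C" "Dom (op_cat C) = Cod C" "Cod (op_cat C) = Dom C"
  "Idt (op_cat C) = Idt C" "Cmp (op_cat C) g f = f \<cdot>\<^bsub>C\<^esub> g"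
  by (auto simp: op_cat_def)

lemma prod_cat_simps [simp]:
  "Ob (prod_cat C D) = Ob C \<times> Ob D" "Ar (prod_cat C D) = Ar C \<times> Ar D"
  "Dom (prod_cat C D) (u, v) = (Dom C u, Dom D v)" "Cod (prod_cat C D) (u, v) = (Cod C u, Cod D v)"
  "Idt (prod_cat C D) (x, y) = (Idt C x, Idt D y)"
  "Cmp (prod_cat C D) (g, g') (f, f') = (g \<cdot>\<^bsub>C\<^esub> f, g' \<cdot>\<^bsub>D\<^esub> f')"
  by (auto simp: prod_cat_def)

lemma cfun_simps [simp]:
  "fob (cfun_comp G F) x = fob G (fob F x)" "far (cfun_comp G F) f = far G (far F f)"
  "fob id_cfun y = y" "far id_cfun g = g"
  "fob (cfun_prod P Q) (a, b) = (fob P a, fob Q b)" "far (cfun_prod P Q) (h, k) = (far P h, far Q k)"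
  by (auto simp: cfun_comp_def id_cfun_def cfun_prod_def)

context category begin

lemmas cat_simps [simp] = dom_ob cod_ob idt_ar dom_idt cod_idt cmp_ar dom_cmp cod_cmp cmp_assoc

lemma cmp_idt' [simp]: "\<lbrakk>f \<in> Ar C; Dom C f = x\<rbrakk> \<Longrightarrow> f \<cdot> Idt C x = f"
  using cmp_idt by blast

lemma idt_cmp' [simp]: "\<lbrakk>f \<in> Ar C; Cod C f = x\<rbrakk> \<Longrightarrow> Idt C x \<cdot> f = f"
  using idt_cmp by blast

lemma idt_cmp2 [simp]: "\<lbrakk>f \<in> Ar C; g \<in> Ar C; Dom C g = Cod C f; Cod C g = x\<rbrakk> \<Longrightarrow> Idt C x \<cdot> g \<cdot> f = g \<cdot> f"
  by simp

lemma hom_cmp: "\<lbrakk>g \<in> hom C y z; f \<in> hom C x y\<rbrakk> \<Longrightarrow> g \<cdot> f \<in> hom C x z"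
  by (simp add: hom_def)

text \<open>Composites are normalized to the right, so an equation \<open>a \<cdot> b = c\<close> does not match inside a longer
composite; it is applied there in this extended form.\<close>

lemma cmp_extend:
  assumes "a \<cdot> b = c" "a \<in> Ar C" "b \<in> Ar C" "x \<in> Ar C" "Dom C a = Cod C b" "Dom C b = Cod C x"
  shows "a \<cdot> b \<cdot> x = c \<cdot> x"
  using assms cmp_assoc by metis

lemma cmp_extend2:
  assumes "a \<cdot> b = c \<cdot> d" "a \<in> Ar C" "b \<in> Ar C" "c \<in> Ar C" "d \<in> Ar C" "x \<in> Ar C"
    "Dom C a = Cod C b" "Dom C b = Cod C x" "Dom C c = Cod C d"
  shows "a \<cdot> b \<cdot> x = c \<cdot> d \<cdot> x"
  using assms by (metis cmp_assoc dom_cmp)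

lemma square_cmp:
  "\<lbrakk>square C f g u v; square C g h u' v'\<rbrakk> \<Longrightarrow> square C f h (u' \<cdot> u) (v' \<cdot> v)"
  unfolding square_def by (auto) (metis cmp_assoc)

lemma square_idt: "f \<in> Ar C \<Longrightarrow> square C f f (Idt C (Dom C f)) (Idt C (Cod C f))"
  unfolding square_def by auto

lemma arrow_category: "category (arrow_cat C)"
proof
  fix f assume "f \<in> Ar (arrow_cat C)" then show "Dom (arrow_cat C) f \<in> Ob (arrow_cat C)"
    by (cases f) (simp add: arrow_cat_ar square_def)
next
  fix f assume "f \<in> Ar (arrow_cat C)" then show "Cod (arrow_cat C) f \<in> Ob (arrow_cat C)"
    by (cases f) (simp add: arrow_cat_ar square_def)
next
  fix f g assume "f \<in> Ar (arrow_cat C)" "g \<in> Ar (arrow_cat C)" "Dom (arrow_cat C) g = Cod (arrow_cat C) f"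
  then show "g \<cdot>\<^bsub>arrow_cat C\<^esub> f \<in> Ar (arrow_cat C)"
    by (cases f; cases g) (simp add: arrow_cat_ar square_cmp)
next
  fix f assume "f \<in> Ar (arrow_cat C)"
  then show "f \<cdot>\<^bsub>arrow_cat C\<^esub> Idt (arrow_cat C) (Dom (arrow_cat C) f) = f"
    by (cases f) (simp add: arrow_cat_ar square_def)
next
  fix f assume "f \<in> Ar (arrow_cat C)"
  then show "Idt (arrow_cat C) (Cod (arrow_cat C) f) \<cdot>\<^bsub>arrow_cat C\<^esub> f = f"
    by (cases f) (simp add: arrow_cat_ar square_def)
next
  fix f g h assume "f \<in> Ar (arrow_cat C)" "g \<in> Ar (arrow_cat C)" "h \<in> Ar (arrow_cat C)"
    "Dom (arrow_cat C) g = Cod (arrow_cat C) f" "Dom (arrow_cat C) h = Cod (arrow_cat C) g"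
  then show "(h \<cdot>\<^bsub>arrow_cat C\<^esub> g) \<cdot>\<^bsub>arrow_cat C\<^esub> f = h \<cdot>\<^bsub>arrow_cat C\<^esub> (g \<cdot>\<^bsub>arrow_cat C\<^esub> f)"
    by (cases f; cases g; cases h) (auto simp add: arrow_cat_ar square_def)
qed (auto simp: arrow_cat_ar square_idt)

lemma op_category: "category (op_cat C)"
  by unfold_locales auto

end

lemma prod_category: "category C \<Longrightarrow> category D \<Longrightarrow> category (prod_cat C D)"
  unfolding category_def by (auto simp: prod_cat_def)

section \<open>The equations of an algebraic weak factorization system\<close>

abbreviation E_map :: "('o, 'a) awfs_cat \<Rightarrow> 'a \<Rightarrow> 'a \<Rightarrow> 'a \<Rightarrow> 'a \<Rightarrow> 'a" where
  "E_map C f g u v \<equiv> far (fac C) (Sq f g u v)"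

text \<open>The components of the axioms of an awfs that are not identities. The list is closed under
exchanging the two factors while reversing all arrows, which gives every consequence a dual. The
last equation occurs in the distributive law twice: on domains in the law for the multiplication,
on codomains in the law for the comultiplication.\<close>

locale elementary_awfs = category C for C :: "('o, 'a) awfs_cat" (structure) +
  assumes E_ar: "square C f g u v \<Longrightarrow> E_map C f g u v \<in> Ar C"
    and E_dom: "square C f g u v \<Longrightarrow> Dom C (E_map C f g u v) = fob (fac C) f"
    and E_cod: "square C f g u v \<Longrightarrow> Cod C (E_map C f g u v) = fob (fac C) g"
    and E_idt: "f \<in> Ar C \<Longrightarrow>
      E_map C f f (Idt C (Dom C f)) (Idt C (Cod C f)) = Idt C (fob (fac C) f)"
    and E_cmp: "\<lbrakk>square C f g u v; square C g h u' v'\<rbrakk> \<Longrightarrow>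
      E_map C g h u' v' \<cdot> E_map C f g u v = E_map C f h (u' \<cdot> u) (v' \<cdot> v)"
    and L_ar: "f \<in> Ar C \<Longrightarrow> lft C f \<in> Ar C"
    and L_dom: "f \<in> Ar C \<Longrightarrow> Dom C (lft C f) = Dom C f"
    and L_cod: "f \<in> Ar C \<Longrightarrow> Cod C (lft C f) = fob (fac C) f"
    and R_ar: "f \<in> Ar C \<Longrightarrow> rgt C f \<in> Ar C"
    and R_dom: "f \<in> Ar C \<Longrightarrow> Dom C (rgt C f) = fob (fac C) f"
    and R_cod: "f \<in> Ar C \<Longrightarrow> Cod C (rgt C f) = Cod C f"
    and R_L: "f \<in> Ar C \<Longrightarrow> rgt C f \<cdot> lft C f = f"
    and E_L: "square C f g u v \<Longrightarrow> E_map C f g u v \<cdot> lft C f = lft C g \<cdot> u"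
    and R_E: "square C f g u v \<Longrightarrow> rgt C g \<cdot> E_map C f g u v = v \<cdot> rgt C f"
    and cmul_ar: "f \<in> Ar C \<Longrightarrow> cmul C f \<in> Ar C"
    and cmul_dom: "f \<in> Ar C \<Longrightarrow> Dom C (cmul C f) = fob (fac C) f"
    and cmul_cod: "f \<in> Ar C \<Longrightarrow> Cod C (cmul C f) = fob (fac C) (lft C f)"
    and cmul_L: "f \<in> Ar C \<Longrightarrow> cmul C f \<cdot> lft C f = lft C (lft C f)"
    and R_cmul: "f \<in> Ar C \<Longrightarrow> rgt C (lft C f) \<cdot> cmul C f = Idt C (fob (fac C) f)"
    and E_cmul: "f \<in> Ar C \<Longrightarrow> E_map C (lft C f) f (Idt C (Dom C f)) (rgt C f) \<cdot> cmul C f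
      = Idt C (fob (fac C) f)"
    and cmul_coassoc: "f \<in> Ar C \<Longrightarrow> cmul C (lft C f) \<cdot> cmul C f =
      E_map C (lft C f) (lft C (lft C f)) (Idt C (Dom C f)) (cmul C f) \<cdot> cmul C f"
    and cmul_E: "square C f g u v \<Longrightarrow> cmul C g \<cdot> E_map C f g u v =
      E_map C (lft C f) (lft C g) u (E_map C f g u v) \<cdot> cmul C f"
    and mul_ar: "f \<in> Ar C \<Longrightarrow> mul C f \<in> Ar C"
    and mul_dom: "f \<in> Ar C \<Longrightarrow> Dom C (mul C f) = fob (fac C) (rgt C f)"
    and mul_cod: "f \<in> Ar C \<Longrightarrow> Cod C (mul C f) = fob (fac C) f"
    and R_mul: "f \<in> Ar C \<Longrightarrow> rgt C f \<cdot> mul C f = rgt C (rgt C f)"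
    and mul_L: "f \<in> Ar C \<Longrightarrow> mul C f \<cdot> lft C (rgt C f) = Idt C (fob (fac C) f)"
    and mul_E: "f \<in> Ar C \<Longrightarrow> mul C f \<cdot> E_map C f (rgt C f) (lft C f) (Idt C (Cod C f))
      = Idt C (fob (fac C) f)"
    and mul_assoc: "f \<in> Ar C \<Longrightarrow> mul C f \<cdot> mul C (rgt C f) =
      mul C f \<cdot> E_map C (rgt C (rgt C f)) (rgt C f) (mul C f) (Idt C (Cod C f))"
    and E_mul: "square C f g u v \<Longrightarrow>
      mul C g \<cdot> E_map C (rgt C f) (rgt C g) (E_map C f g u v) v =
      E_map C f g u v \<cdot> mul C f"
    and cmul_mul: "f \<in> Ar C \<Longrightarrow> cmul C f \<cdot> mul C f = mul C (lft C f) \<cdot>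
      E_map C (lft C (rgt C f)) (rgt C (lft C f)) (cmul C f) (mul C f) \<cdot> cmul C (rgt C f)"
begin

lemmas E_simps [simp] = E_ar E_dom E_cod L_ar L_dom L_cod R_ar R_dom R_cod R_L cmul_ar cmul_dom
  cmul_cod mul_ar mul_dom mul_cod cmul_L R_cmul R_mul mul_L

lemma E_ob [simp]: "f \<in> Ar C \<Longrightarrow> fob (fac C) f \<in> Ob C"
  by (metis L_ar L_cod cod_ob)

end

lemma elementary_awfs:
  fixes C :: "('o, 'a) awfs_cat" (structure)
  assumes "awfs C" shows "elementary_awfs C"
proof -
  interpret awfs C by fact
  note [simp] = lft_cfun_def rgt_cfun_def counit_sq_def comult_sq_def unit_sq_def mult_sq_def law_sq_def
  have E: "E_map C f g u v \<in> hom C (fob (fac C) f) (fob (fac C) g)"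
    if "square C f g u v" for f g u v using factor.far_hom[of "Sq f g u v"] that
    by (simp add: arrow_cat_ar)
  have cm: "square C (lft C f) (lft C (lft C f)) (Idt C (Dom C f)) (cmul C f)" if "f \<in> Ar C" for f
    using comult.component[of f] that by (simp add: hom_def arrow_cat_ar)
  have m: "square C (rgt C (rgt C f)) (rgt C f) (mul C f) (Idt C (Cod C f))" if "f \<in> Ar C" for f
    using mult.component[of f] that by (simp add: hom_def arrow_cat_ar)
  show ?thesis
  proof
    fix f g u v assume sq: "square C f g u v"
    show "E_map C f g u v \<in> Ar C" "Dom C (E_map C f g u v) = fob (fac C) f"
      "Cod C (E_map C f g u v) = fob (fac C) g" using E[OF sq] by (simp_all add: hom_def)
    show "E_map C f g u v \<cdot> lft C f = lft C g \<cdot> u"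
      "rgt C g \<cdot> E_map C f g u v = v \<cdot> rgt C f"
      using sq lft_natural rgt_natural by (simp_all add: arrow_cat_ar)
    show "cmul C g \<cdot> E_map C f g u v =
      E_map C (lft C f) (lft C g) u (E_map C f g u v) \<cdot> cmul C f"
      using comult.naturality[of "Sq f g u v"] sq by (simp add: arrow_cat_ar)
    show "mul C g \<cdot> E_map C (rgt C f) (rgt C g) (E_map C f g u v) v =
      E_map C f g u v \<cdot> mul C f"
      using mult.naturality[of "Sq f g u v"] sq by (simp add: arrow_cat_ar)
  next
    fix f g u v h u' v' assume "square C f g u v" "square C g h u' v'"
    then show "E_map C g h u' v' \<cdot> E_map C f g u v = E_map C f h (u' \<cdot> u) (v' \<cdot> v)"
      using factor.far_cmp[of "Sq f g u v" "Sq g h u' v'"] by (simp add: arrow_cat_ar)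
  next
    fix f assume f: "f \<in> Ar C"
    show "E_map C f f (Idt C (Dom C f)) (Idt C (Cod C f)) = Idt C (fob (fac C) f)"
      using factor.far_idt[of f] f by simp
    show Lf: "lft C f \<in> Ar C" "Dom C (lft C f) = Dom C f" "Cod C (lft C f) = fob (fac C) f"
      using lft_hom f by (simp_all add: hom_def)
    show Rf: "rgt C f \<in> Ar C" "Dom C (rgt C f) = fob (fac C) f" "Cod C (rgt C f) = Cod C f"
      using rgt_hom f by (simp_all add: hom_def)
    show "rgt C f \<cdot> lft C f = f" using factorization f by simp
    show "cmul C f \<in> Ar C" "Dom C (cmul C f) = fob (fac C) f" "Cod C (cmul C f) = fob (fac C) (lft C f)"
      "cmul C f \<cdot> lft C f = lft C (lft C f)"
      using cm[OF f] lft_hom f by (auto simp add: square_def hom_def)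
    show "mul C f \<in> Ar C" "Dom C (mul C f) = fob (fac C) (rgt C f)" "Cod C (mul C f) = fob (fac C) f"
      "rgt C f \<cdot> mul C f = rgt C (rgt C f)"
      using m[OF f] rgt_hom f by (auto simp add: square_def hom_def)
    show "rgt C (lft C f) \<cdot> cmul C f = Idt C (fob (fac C) f)"
      using counit_left[of f] f Lf by simp
    show "E_map C (lft C f) f (Idt C (Dom C f)) (rgt C f) \<cdot> cmul C f = Idt C (fob (fac C) f)"
      using counit_right[of f] f Lf by simp
    show "cmul C (lft C f) \<cdot> cmul C f =
      E_map C (lft C f) (lft C (lft C f)) (Idt C (Dom C f)) (cmul C f) \<cdot> cmul C f"
      using coassoc[of f] f Lf by simp
    show "mul C f \<cdot> lft C (rgt C f) = Idt C (fob (fac C) f)"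
      using unit_left[of f] f Rf by simp
    show "mul C f \<cdot> E_map C f (rgt C f) (lft C f) (Idt C (Cod C f)) = Idt C (fob (fac C) f)"
      using unit_right[of f] f Rf by simp
    show "mul C f \<cdot> mul C (rgt C f) =
      mul C f \<cdot> E_map C (rgt C (rgt C f)) (rgt C f) (mul C f) (Idt C (Cod C f))"
      using assoc[of f] f Rf by simp
    show "cmul C f \<cdot> mul C f = mul C (lft C f) \<cdot>
      E_map C (lft C (rgt C f)) (rgt C (lft C f)) (cmul C f) (mul C f) \<cdot> cmul C (rgt C f)"
      using law_mult[of f] f by simp
  qed
qed

section \<open>Duality, composites and canonical solutions\<close>

definition op_awfs :: "('o, 'a) awfs_cat \<Rightarrow> ('o, 'a) awfs_cat" where
  "op_awfs C = \<lparr>Ob = Ob C, Ar = Ar C, Dom = Cod C, Cod = Dom C, Idt = Idt C,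
     Cmp = (\<lambda>g f. f \<cdot>\<^bsub>C\<^esub> g),
     fac = CFun (fob (fac C)) (\<lambda>S. E_map C (sq_cod S) (sq_dom S) (sq_bot S) (sq_top S)),
     lft = rgt C, rgt = lft C, cmul = mul C, mul = cmul C\<rparr>"

lemma op_awfs_simps [simp]:
  "Ob (op_awfs C) = Ob C" "Ar (op_awfs C) = Ar C" "Dom (op_awfs C) = Cod C" "Cod (op_awfs C) = Dom C"
  "Idt (op_awfs C) = Idt C" "Cmp (op_awfs C) g f = f \<cdot>\<^bsub>C\<^esub> g"
  "fob (fac (op_awfs C)) f = fob (fac C) f" "E_map (op_awfs C) f g u v = E_map C g f v u"
  "lft (op_awfs C) = rgt C" "rgt (op_awfs C) = lft C" "cmul (op_awfs C) = mul C" "mul (op_awfs C) = cmul C"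
  by (simp_all add: op_awfs_def)

lemma square_op: "square (op_awfs C) f g u v \<longleftrightarrow> square C g f v u"
  by (auto simp: square_def)

lemma is_alg_op [simp]: "is_alg (op_awfs C) X \<longleftrightarrow> is_coalg C X"
  and is_coalg_op [simp]: "is_coalg (op_awfs C) X \<longleftrightarrow> is_alg C X"
  by (auto simp: is_alg_def is_coalg_def hom_def split: prod.splits)

definition coalg_map :: "('o, 'a) awfs_cat \<Rightarrow> 'a structured \<Rightarrow> 'a structured \<Rightarrow> 'a \<Rightarrow> 'a \<Rightarrow> bool" where
  "coalg_map C X Y u v \<longleftrightarrow> square C (fst X) (fst Y) u v \<and>
     snd Y \<cdot>\<^bsub>C\<^esub> v = E_map C (fst X) (fst Y) u v \<cdot>\<^bsub>C\<^esub> snd X"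

definition alg_map :: "('o, 'a) awfs_cat \<Rightarrow> 'a structured \<Rightarrow> 'a structured \<Rightarrow> 'a \<Rightarrow> 'a \<Rightarrow> bool" where
  "alg_map C X Y u v \<longleftrightarrow> square C (fst X) (fst Y) u v \<and>
     u \<cdot>\<^bsub>C\<^esub> snd X = snd Y \<cdot>\<^bsub>C\<^esub> E_map C (fst X) (fst Y) u v"

lemma coalg_map_op: "coalg_map (op_awfs C) X Y u v \<longleftrightarrow> alg_map C Y X v u"
  by (auto simp: coalg_map_def alg_map_def square_op)

lemma cofree_op: "cofree_coalg (op_awfs C) f = free_alg C f"
  by (simp add: cofree_coalg_def free_alg_def)

context elementary_awfs begin

lemma law_square: "f \<in> Ar C \<Longrightarrow> square C (lft C (rgt C f)) (rgt C (lft C f)) (cmul C f) (mul C f)"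
  by (simp add: square_def)

lemma op_awfs: "elementary_awfs (op_awfs C)"
proof unfold_locales
  fix f assume f: "f \<in> Ar (op_awfs C)"
  then show "cmul (op_awfs C) f \<cdot>\<^bsub>op_awfs C\<^esub> mul (op_awfs C) f = mul (op_awfs C) (lft (op_awfs C) f) \<cdot>\<^bsub>op_awfs C\<^esub>
      E_map (op_awfs C) (lft (op_awfs C) (rgt (op_awfs C) f)) (rgt (op_awfs C) (lft (op_awfs C) f)) (cmul (op_awfs C) f) (mul (op_awfs C) f) \<cdot>\<^bsub>op_awfs C\<^esub> cmul (op_awfs C) (rgt (op_awfs C) f)"
    using cmul_mul[of f] law_square[of f] by simp
qed (simp_all add: square_op E_idt E_cmp E_L R_E E_cmul cmul_coassoc cmul_E mul_E mul_assoc E_mul)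

lemma E_cmp2:
  assumes "square C f g u v" "square C g h u' v'" "x \<in> Ar C" "Cod C x = fob (fac C) f"
  shows "E_map C g h u' v' \<cdot> E_map C f g u v \<cdot> x = E_map C f h (u' \<cdot> u) (v' \<cdot> v) \<cdot> x"
  using cmp_extend[OF E_cmp[OF assms(1,2)], of x] assms by simp

lemma squareD:
  assumes "square C f g u v"
  shows "f \<in> Ar C" "g \<in> Ar C" "u \<in> Ar C" "v \<in> Ar C" "Dom C u = Dom C f" "Cod C u = Dom C g"
    "Dom C v = Cod C f" "Cod C v = Cod C g"
  using assms by (auto simp: square_def)

lemma coalgD:
  assumes "is_coalg C (j, s)"
  shows "j \<in> Ar C" "s \<in> Ar C" "Dom C s = Cod C j" "Cod C s = fob (fac C) j"
    "s \<cdot> j = lft C j" "rgt C j \<cdot> s = Idt C (Cod C j)"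
    "cmul C j \<cdot> s = E_map C j (lft C j) (Idt C (Dom C j)) s \<cdot> s"
  using assms by (auto simp: is_coalg_def hom_def)

lemma coalgI:
  assumes "j \<in> Ar C" "s \<in> Ar C" "Dom C s = Cod C j" "Cod C s = fob (fac C) j"
    "s \<cdot> j = lft C j" "rgt C j \<cdot> s = Idt C (Cod C j)"
    "cmul C j \<cdot> s = E_map C j (lft C j) (Idt C (Dom C j)) s \<cdot> s"
  shows "is_coalg C (j, s)"
  using assms by (auto simp: is_coalg_def hom_def)

lemma algD:
  assumes "is_alg C (f, r)"
  shows "f \<in> Ar C" "r \<in> Ar C" "Dom C r = fob (fac C) f" "Cod C r = Dom C f"
    "r \<cdot> lft C f = Idt C (Dom C f)" "f \<cdot> r = rgt C f"
    "r \<cdot> mul C f = r \<cdot> E_map C (rgt C f) f r (Idt C (Cod C f))"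
  using assms by (auto simp: is_alg_def hom_def)

lemma counit_square: "f \<in> Ar C \<Longrightarrow> square C (lft C f) f (Idt C (Dom C f)) (rgt C f)"
  by (simp add: square_def)

lemma unit_square: "f \<in> Ar C \<Longrightarrow> square C f (rgt C f) (lft C f) (Idt C (Cod C f))"
  by (simp add: square_def)

lemma L_square: "square C f g u v \<Longrightarrow> square C (lft C f) (lft C g) u (E_map C f g u v)"
  by (frule squareD) (simp add: square_def E_L)

lemma R_square: "square C f g u v \<Longrightarrow> square C (rgt C f) (rgt C g) (E_map C f g u v) v"
  by (frule squareD) (simp add: square_def R_E)

lemma cofree_is_coalg: "f \<in> Ar C \<Longrightarrow> is_coalg C (cofree_coalg C f)"
  unfolding cofree_coalg_def by (intro coalgI) (simp_all add: cmul_coassoc)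

lemma coalg_square: "is_coalg C (j, s) \<Longrightarrow> square C j (lft C j) (Idt C (Dom C j)) s"
  using coalgD[of j s] by (simp add: square_def)

text \<open>Existence in the universal property of the cofree coalgebra: the transpose of a square into \<open>p\<close>.\<close>

lemma coalg_map_cofree:
  assumes js: "is_coalg C (j, s)" and sq: "square C j p u v"
  shows "coalg_map C (j, s) (cofree_coalg C p) u (E_map C j p u v \<cdot> s)"
proof -
  note [simp] = coalgD(1-6)[OF js] squareD[OF sq] sq
  have 1: "square C j (lft C p) (u \<cdot> Idt C (Dom C j)) (E_map C j p u v \<cdot> s)"
    by (rule square_cmp[OF coalg_square[OF js] L_square[OF sq]])
  have "cmul C p \<cdot> E_map C j p u v \<cdot> s = E_map C (lft C j) (lft C p) u (E_map C j p u v) \<cdot> cmul C j \<cdot> s"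
    using cmp_extend2[OF cmul_E[OF sq], of s] L_square[OF sq] by simp
  also have "\<dots> = E_map C j (lft C p) (u \<cdot> Idt C (Dom C j)) (E_map C j p u v \<cdot> s) \<cdot> s"
    unfolding coalgD(7)[OF js] by (rule E_cmp2[OF coalg_square[OF js] L_square[OF sq]]) simp_all
  finally show ?thesis using 1 by (simp add: coalg_map_def cofree_coalg_def)
qed

text \<open>The structure of a composite contains one \<open>\<mu>\<close>, and for coassociativity \<open>\<delta>\<close> has
to be moved past it; this is what the distributive law does. Below, \<open>u\<close> is the composite structure, and \<open>u \<cdot> k = e\<close>
says that along \<open>k\<close> it restricts to the structure coming from \<open>j\<close>.\<close>

lemma coalg_comp_is_coalg:
  assumes js: "is_coalg C (j, s)" and kt: "is_coalg C (k, t)" and kj: "Dom C k = Cod C j"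
  shows "is_coalg C (coalg_comp C (k, t) (j, s))"
proof -
  define h where "h = k \<cdot> j"
  define e where "e = E_map C j h (Idt C (Dom C j)) k \<cdot> s"
  define g where "g = E_map C k (rgt C h) e (Idt C (Cod C k)) \<cdot> t"
  define u where "u = mul C h \<cdot> g"
  note [simp] = coalgD(1-6)[OF js] coalgD(1-6)[OF kt] kj
  have h [simp]: "h \<in> Ar C" "Dom C h = Dom C j" "Cod C h = Cod C k" by (auto simp: h_def)
  have sq1: "square C j h (Idt C (Dom C j)) k" by (simp add: square_def h_def)
  note [simp] = E_ar[OF sq1] E_dom[OF sq1] E_cod[OF sq1]
  have e [simp]: "e \<in> Ar C" "Dom C e = Cod C j" "Cod C e = fob (fac C) h" by (auto simp: e_def)
  have ej: "e \<cdot> j = lft C h" using E_L[OF sq1] by (simp add: e_def)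
  have Re: "rgt C h \<cdot> e = k" unfolding e_def using cmp_extend2[OF R_E[OF sq1], of s] by simp
  have sq2: "square C k (rgt C h) e (Idt C (Cod C k))" by (simp add: square_def Re)
  note [simp] = E_ar[OF sq2] E_dom[OF sq2] E_cod[OF sq2]
  have g [simp]: "g \<in> Ar C" "Dom C g = Cod C k" "Cod C g = fob (fac C) (rgt C h)" by (auto simp: g_def)
  have u [simp]: "u \<in> Ar C" "Dom C u = Cod C k" "Cod C u = fob (fac C) h" by (auto simp: u_def)
  have gk: "g \<cdot> k = lft C (rgt C h) \<cdot> e" using E_L[OF sq2] by (simp add: g_def)
  have uk: "u \<cdot> k = e" using cmp_extend[OF mul_L, of h e] by (simp add: u_def gk)
  have Ru: "rgt C h \<cdot> u = Idt C (Cod C h)"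
    unfolding u_def g_def using cmp_extend[OF R_mul, of h "E_map C k (rgt C h) e (Idt C (Cod C k)) \<cdot> t"]
      cmp_extend2[OF R_E[OF sq2], of t] by simp
  have uh: "u \<cdot> h = lft C h" using cmp_extend[OF uk, of j] by (simp add: h_def[symmetric] ej)
  have sqA: "square C h (lft C h) (Idt C (Dom C j)) u" by (simp add: square_def uh)
  note [simp] = E_ar[OF sqA] E_dom[OF sqA] E_cod[OF sqA]
  have sqL1: "square C (lft C j) (lft C h) (Idt C (Dom C j)) (E_map C j h (Idt C (Dom C j)) k)"
    using L_square[OF sq1] .
  have sqL2: "square C (lft C k) (lft C (rgt C h)) e (E_map C k (rgt C h) e (Idt C (Cod C k)))"
    using L_square[OF sq2] .
  have sqRA: "square C (rgt C h) (rgt C (lft C h)) (E_map C h (lft C h) (Idt C (Dom C j)) u) u"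
    using R_square[OF sqA] .
  note [simp] = E_ar[OF sqL1] E_dom[OF sqL1] E_cod[OF sqL1] E_ar[OF sqL2] E_dom[OF sqL2] E_cod[OF sqL2]
    E_ar[OF sqRA] E_dom[OF sqRA] E_cod[OF sqRA]
  have A: "cmul C h \<cdot> e = E_map C j (lft C h) (Idt C (Dom C j)) e \<cdot> s"
  proof -
    have "cmul C h \<cdot> e = E_map C (lft C j) (lft C h) (Idt C (Dom C j)) (E_map C j h (Idt C (Dom C j)) k) \<cdot> cmul C j \<cdot> s"
      unfolding e_def using cmp_extend2[OF cmul_E[OF sq1], of s] by simp
    also have "\<dots> = E_map C j (lft C h) (Idt C (Dom C j) \<cdot> Idt C (Dom C j)) e \<cdot> s"
      unfolding coalgD(7)[OF js] e_def by (rule E_cmp2[OF coalg_square[OF js] sqL1]) simp_all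
    finally show ?thesis by simp
  qed
  have B: "E_map C h (lft C h) (Idt C (Dom C j)) u \<cdot> e = E_map C j (lft C h) (Idt C (Dom C j)) e \<cdot> s"
    unfolding e_def by (subst E_cmp2[OF sq1 sqA]) (simp_all add: uk[unfolded e_def])
  have sqk: "square C k (lft C k) (Idt C (Dom C k)) t" by (rule coalg_square[OF kt])
  have sqC: "square C k (lft C (rgt C h)) (e \<cdot> Idt C (Dom C k)) (E_map C k (rgt C h) e (Idt C (Cod C k)) \<cdot> t)"
    by (rule square_cmp[OF sqk sqL2])
  have sqC': "square C k (lft C (rgt C h)) e g" using sqC by (simp add: g_def)
  note law = law_square[OF h(1)]
  note [simp] = E_ar[OF law] E_dom[OF law] E_cod[OF law]
  have "cmul C (rgt C h) \<cdot> g = E_map C (lft C k) (lft C (rgt C h)) e (E_map C k (rgt C h) e (Idt C (Cod C k))) \<cdot> cmul C k \<cdot> t"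
    unfolding g_def using cmp_extend2[OF cmul_E[OF sq2], of t] by simp
  also have "\<dots> = E_map C k (lft C (rgt C h)) e g \<cdot> t"
    unfolding coalgD(7)[OF kt] using E_cmp2[OF sqk sqL2, of t] by (simp add: g_def)
  finally have D: "cmul C (rgt C h) \<cdot> g = E_map C k (lft C (rgt C h)) e g \<cdot> t" .
  have "cmul C h \<cdot> u = mul C (lft C h) \<cdot> E_map C (lft C (rgt C h)) (rgt C (lft C h)) (cmul C h) (mul C h) \<cdot> cmul C (rgt C h) \<cdot> g"
    unfolding u_def using cmp_extend[OF cmul_mul, of h g] by simp
  also have "\<dots> = mul C (lft C h) \<cdot> E_map C k (rgt C (lft C h)) (cmul C h \<cdot> e) u \<cdot> t"
    unfolding D using E_cmp2[OF sqC' law, of t] by (simp add: u_def)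
  also have "\<dots> = mul C (lft C h) \<cdot> E_map C (rgt C h) (rgt C (lft C h)) (E_map C h (lft C h) (Idt C (Dom C j)) u) u \<cdot> g"
    unfolding g_def using E_cmp2[OF sq2 sqRA, of t] A B by simp
  also have "\<dots> = E_map C h (lft C h) (Idt C (Dom C j)) u \<cdot> u"
    using cmp_extend2[OF E_mul[OF sqA], of g] by (simp add: u_def[symmetric])
  finally have "is_coalg C (h, u)" by (intro coalgI) (simp_all add: uh Ru)
  then show ?thesis by (simp add: coalg_comp_def Let_def h_def u_def g_def e_def)
qed

lemma solution_props:
  assumes js: "is_coalg C (j, s)" and fr: "is_alg C (f, r)" and sq: "square C j f u v"
  shows "solution C (j, s) (f, r) (Sq j f u v) \<in> Ar C"
    "Dom C (solution C (j, s) (f, r) (Sq j f u v)) = Cod C j"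
    "Cod C (solution C (j, s) (f, r) (Sq j f u v)) = Dom C f"
    "solution C (j, s) (f, r) (Sq j f u v) \<cdot> j = u"
    "f \<cdot> solution C (j, s) (f, r) (Sq j f u v) = v"
proof -
  note [simp] = coalgD(1-6)[OF js] algD(1-6)[OF fr] squareD[OF sq] sq
  show "solution C (j, s) (f, r) (Sq j f u v) \<in> Ar C"
    "Dom C (solution C (j, s) (f, r) (Sq j f u v)) = Cod C j"
    "Cod C (solution C (j, s) (f, r) (Sq j f u v)) = Dom C f"
    by (simp_all add: solution_def)
  show "solution C (j, s) (f, r) (Sq j f u v) \<cdot> j = u"
    using cmp_extend[OF algD(5)[OF fr], of u] by (simp add: solution_def E_L[OF sq])
  show "f \<cdot> solution C (j, s) (f, r) (Sq j f u v) = v"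
    using cmp_extend[OF algD(6)[OF fr], of "E_map C j f u v \<cdot> s"] cmp_extend2[OF R_E[OF sq], of s]
    by (simp add: solution_def)
qed

lemma solution_coalg_map:
  assumes js: "is_coalg C (j, s)" and js': "is_coalg C (j', s')" and fr: "is_alg C (f, r)"
    and sq: "square C j f u v" and m: "coalg_map C (j', s') (j, s) a b"
  shows "solution C (j', s') (f, r) (Sq j' f (u \<cdot> a) (v \<cdot> b)) = solution C (j, s) (f, r) (Sq j f u v) \<cdot> b"
proof -
  have sq': "square C j' j a b" and e: "s \<cdot> b = E_map C j' j a b \<cdot> s'"
    using m by (auto simp: coalg_map_def)
  note [simp] = coalgD(1-6)[OF js] coalgD(1-6)[OF js'] algD(1-6)[OF fr] squareD[OF sq] squareD[OF sq'] sq sq'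
  show ?thesis using E_cmp2[OF sq' sq, of s'] by (simp add: solution_def e)
qed

text \<open>The \<open>\<mu>\<close> in the structure of the composite coalgebra is absorbed by associativity of the algebra.
So canonical solutions against an algebra always respect composition of coalgebras.\<close>

lemma solution_coalg_comp:
  assumes js: "is_coalg C (j, s)" and kt: "is_coalg C (k, t)" and kj: "Dom C k = Cod C j"
    and fr: "is_alg C (f, r)" and sq: "square C (k \<cdot> j) f u v"
  shows "solution C (k, t) (f, r) (Sq k f (solution C (j, s) (f, r) (Sq j f u (v \<cdot> k))) v) =
    solution C (coalg_comp C (k, t) (j, s)) (f, r) (Sq (k \<cdot> j) f u v)"
proof -
  define h where "h = k \<cdot> j"
  define e where "e = E_map C j h (Idt C (Dom C j)) k \<cdot> s"
  note [simp] = coalgD(1-6)[OF js] coalgD(1-6)[OF kt] kj algD(1-6)[OF fr] squareD(2-8)[OF sq]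
  have h [simp]: "h \<in> Ar C" "Dom C h = Dom C j" "Cod C h = Cod C k" by (auto simp: h_def)
  have sqh: "square C h f u v" using sq by (simp add: h_def)
  have sq1: "square C j h (Idt C (Dom C j)) k" by (simp add: square_def h_def)
  have sqj: "square C j f u (v \<cdot> k)" using square_cmp[OF sq1 sqh] by simp
  note [simp] = E_ar[OF sq1] E_dom[OF sq1] E_cod[OF sq1] E_ar[OF sqh] E_dom[OF sqh] E_cod[OF sqh]
    E_ar[OF sqj] E_dom[OF sqj] E_cod[OF sqj]
  have e [simp]: "e \<in> Ar C" "Dom C e = Cod C j" "Cod C e = fob (fac C) h" by (auto simp: e_def)
  have Re: "rgt C h \<cdot> e = k" unfolding e_def using cmp_extend2[OF R_E[OF sq1], of s] by simp
  have sq2: "square C k (rgt C h) e (Idt C (Cod C k))" by (simp add: square_def Re)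
  note sqR = R_square[OF sqh]
  have sqr: "square C (rgt C f) f r (Idt C (Cod C f))" by (simp add: square_def)
  have sq3: "square C (rgt C h) f (r \<cdot> E_map C h f u v) v" using square_cmp[OF sqR sqr] by simp
  note [simp] = E_ar[OF sq2] E_dom[OF sq2] E_cod[OF sq2] E_ar[OF sqR] E_dom[OF sqR] E_cod[OF sqR]
    E_ar[OF sqr] E_dom[OF sqr] E_cod[OF sqr]
  have d: "solution C (j, s) (f, r) (Sq j f u (v \<cdot> k)) = r \<cdot> E_map C h f u v \<cdot> e"
    unfolding e_def using E_cmp2[OF sq1 sqh, of s] by (simp add: solution_def)
  let ?g = "E_map C k (rgt C h) e (Idt C (Cod C k)) \<cdot> t"
  have "r \<cdot> E_map C h f u v \<cdot> mul C h \<cdot> ?g =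
      r \<cdot> mul C f \<cdot> E_map C (rgt C h) (rgt C f) (E_map C h f u v) v \<cdot> ?g"
    using cmp_extend2[OF E_mul[OF sqh], of ?g] by simp
  also have "\<dots> = r \<cdot> E_map C (rgt C f) f r (Idt C (Cod C f)) \<cdot> E_map C (rgt C h) (rgt C f) (E_map C h f u v) v \<cdot> ?g"
    using cmp_extend2[OF algD(7)[OF fr]] by simp
  also have "\<dots> = r \<cdot> E_map C (rgt C h) f (r \<cdot> E_map C h f u v) v \<cdot> ?g"
    using E_cmp2[OF sqR sqr, of ?g] by simp
  also have "\<dots> = r \<cdot> E_map C k f (r \<cdot> E_map C h f u v \<cdot> e) v \<cdot> t"
    using E_cmp2[OF sq2 sq3, of t] by simp
  finally show ?thesis unfolding d
    by (simp add: solution_def coalg_comp_def Let_def h_def[symmetric] e_def[symmetric])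
qed

end

section \<open>Structures determined by their solutions\<close>

context elementary_awfs begin

text \<open>The counit \<open>L p \<Rightarrow> p\<close> is the universal lifting problem against \<open>p\<close>, so naturality makes \<open>\<psi>\<close>
determined by its solution \<open>r\<close>; the unit laws for \<open>r\<close> say that it is a solution. Associativity
comes from compatibility with composition, applied to the cofree coalgebras \<open>L p\<close> and \<open>L (R p)\<close>
and the problem with top \<open>1\<close> and bottom \<open>R (R p)\<close>: solved in two steps it gives
\<open>r \<cdot> E(r, 1)\<close>, solved at once it gives \<open>r \<cdot> \<mu>\<close>.\<close>

lemma
  fixes \<psi> :: "'a structured \<Rightarrow> 'a \<Rightarrow> 'a \<Rightarrow> 'a"
  assumes p: "p \<in> Ar C"
    and solves: "\<And>j t u v. \<lbrakk>is_coalg C (j, t); square C j p u v\<rbrakk> \<Longrightarrow>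
      \<psi> (j, t) u v \<in> hom C (Cod C j) (Dom C p) \<and> \<psi> (j, t) u v \<cdot> j = u \<and> p \<cdot> \<psi> (j, t) u v = v"
    and natural: "\<And>j t j' t' a b u v. \<lbrakk>is_coalg C (j, t); is_coalg C (j', t');
      coalg_map C (j', t') (j, t) a b; square C j p u v\<rbrakk> \<Longrightarrow>
      \<psi> (j', t') (u \<cdot> a) (v \<cdot> b) = \<psi> (j, t) u v \<cdot> b"
    and comp: "\<And>j t k t' u v. \<lbrakk>is_coalg C (j, t); is_coalg C (k, t'); Dom C k = Cod C j;
      square C (k \<cdot> j) p u v\<rbrakk> \<Longrightarrow>
      \<psi> (k, t') (\<psi> (j, t) u (v \<cdot> k)) v = \<psi> (coalg_comp C (k, t') (j, t)) u v"
  defines "r \<equiv> \<psi> (cofree_coalg C p) (Idt C (Dom C p)) (rgt C p)"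
  shows alg_of_lifting: "is_alg C (p, r)"
    and solution_alg_of_lifting: "\<lbrakk>is_coalg C (j, t); square C j p u v\<rbrakk> \<Longrightarrow>
      solution C (j, t) (p, r) (Sq j p u v) = \<psi> (j, t) u v"
proof -
  note [simp] = p
  have cof: "is_coalg C (lft C p, cmul C p)" using cofree_is_coalg[of p] by (simp add: cofree_coalg_def)
  have r: "r \<in> Ar C" "Dom C r = fob (fac C) p" "Cod C r = Dom C p"
    "r \<cdot> lft C p = Idt C (Dom C p)" "p \<cdot> r = rgt C p"
    using solves[OF cof counit_square] by (auto simp: r_def cofree_coalg_def hom_def)
  note [simp] = r(1-3)
  have sol: "solution C (j, t) (p, r) (Sq j p u v) = \<psi> (j, t) u v"
    if jt: "is_coalg C (j, t)" and sq: "square C j p u v" for j t u v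
  proof -
    note [simp] = coalgD(1-6)[OF jt] squareD[OF sq] sq
    have "\<psi> (j, t) (Idt C (Dom C p) \<cdot> u) (rgt C p \<cdot> E_map C j p u v \<cdot> t) = r \<cdot> E_map C j p u v \<cdot> t"
      unfolding r_def cofree_coalg_def
      by (rule natural[OF cof jt coalg_map_cofree[OF jt sq, unfolded cofree_coalg_def] counit_square[OF p]])
    moreover have "rgt C p \<cdot> E_map C j p u v \<cdot> t = v"
      using cmp_extend2[OF R_E[OF sq], of t] by simp
    ultimately show ?thesis by (simp add: solution_def)
  qed
  then show "\<lbrakk>is_coalg C (j, t); square C j p u v\<rbrakk> \<Longrightarrow>
      solution C (j, t) (p, r) (Sq j p u v) = \<psi> (j, t) u v" .
  define h where "h = lft C (rgt C p) \<cdot> lft C p"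
  have h [simp]: "h \<in> Ar C" "Dom C h = Dom C p" "Cod C h = fob (fac C) (rgt C p)" by (simp_all add: h_def)
  have cof2: "is_coalg C (lft C (rgt C p), cmul C (rgt C p))"
    using cofree_is_coalg[of "rgt C p"] by (simp add: cofree_coalg_def)
  \<comment> \<open>The lifting problem from which associativity is read off.\<close>
  have sqh: "square C h p (Idt C (Dom C p)) (rgt C (rgt C p))"
    using cmp_extend[OF R_L, of "rgt C p" "lft C p"] by (simp add: square_def h_def)
  have sq1: "square C (lft C p) h (Idt C (Dom C p)) (lft C (rgt C p))"
    by (simp add: square_def h_def)
  have sqr: "square C (rgt C p) p r (Idt C (Cod C p))" by (simp add: square_def r)
  have sqrr: "square C (lft C (rgt C p)) p r (rgt C (rgt C p))"
    by (simp add: square_def r)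
  define e where "e = E_map C (lft C p) h (Idt C (Dom C p)) (lft C (rgt C p)) \<cdot> cmul C p"
  have e [simp]: "e \<in> Ar C" "Dom C e = fob (fac C) p" "Cod C e = fob (fac C) h"
    using sq1 by (simp_all add: e_def)
  have Re: "rgt C h \<cdot> e = lft C (rgt C p)"
    unfolding e_def using cmp_extend2[OF R_E[OF sq1], of "cmul C p"] sq1 by simp
  have sq2: "square C (lft C (rgt C p)) (rgt C h) e (Idt C (fob (fac C) (rgt C p)))"
    by (simp add: square_def Re)
  define g where "g = E_map C (lft C (rgt C p)) (rgt C h) e (Idt C (fob (fac C) (rgt C p))) \<cdot> cmul C (rgt C p)"
  have g [simp]: "g \<in> Ar C" "Dom C g = fob (fac C) (rgt C p)" "Cod C g = fob (fac C) (rgt C h)"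
    using sq2 by (simp_all add: g_def)
  have cc: "coalg_comp C (lft C (rgt C p), cmul C (rgt C p)) (lft C p, cmul C p) = (h, mul C h \<cdot> g)"
    by (simp add: coalg_comp_def Let_def h_def e_def g_def)
  have ccc: "is_coalg C (h, mul C h \<cdot> g)"
    using coalg_comp_is_coalg[OF cof cof2] by (simp add: cc)
  note sqR = R_square[OF sqh]
  \<comment> \<open>The counit law of the comonad, applied inside the composite.\<close>
  have Ee: "E_map C h p (Idt C (Dom C p)) (rgt C (rgt C p)) \<cdot> e = Idt C (fob (fac C) p)"
    unfolding e_def using E_cmp2[OF sq1 sqh, of "cmul C p"] E_cmul[OF p] by simp
  have "r \<cdot> E_map C (rgt C p) p r (Idt C (Cod C p)) =
      solution C (lft C (rgt C p), cmul C (rgt C p)) (p, r) (Sq (lft C (rgt C p)) p r (rgt C (rgt C p)))"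
    using E_cmp2[OF counit_square[of "rgt C p"] sqr, of "cmul C (rgt C p)"] E_cmul[of "rgt C p"] sqr
    by (simp add: solution_def)
  also have "\<dots> = \<psi> (lft C (rgt C p), cmul C (rgt C p)) r (rgt C (rgt C p))"
    by (rule sol[OF cof2 sqrr])
  also have "\<dots> = \<psi> (h, mul C h \<cdot> g) (Idt C (Dom C p)) (rgt C (rgt C p))"
    using comp[OF cof cof2, of "Idt C (Dom C p)" "rgt C (rgt C p)"] sqh
    by (simp add: cc h_def[symmetric] r_def cofree_coalg_def)
  also have "\<dots> = r \<cdot> E_map C h p (Idt C (Dom C p)) (rgt C (rgt C p)) \<cdot> mul C h \<cdot> g"
    using sol[OF ccc sqh] by (simp add: solution_def)
  also have "\<dots> = r \<cdot> mul C p \<cdot> E_map C (rgt C h) (rgt C p)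
      (E_map C h p (Idt C (Dom C p)) (rgt C (rgt C p))) (rgt C (rgt C p)) \<cdot> g"
    using cmp_extend2[OF E_mul[OF sqh], of g] sqR sqh by simp
  also have "\<dots> = r \<cdot> mul C p"
    unfolding g_def using E_cmp2[OF sq2 sqR, of "cmul C (rgt C p)"] E_cmul[of "rgt C p"] by (simp add: Ee)
  finally show "is_alg C (p, r)" using r by (simp add: is_alg_def hom_def)
qed

lemma alg_comp_op:
  assumes fs: "is_alg C (f, s)" and gt: "is_alg C (g, t)" and "Dom C g = Cod C f"
  shows "alg_comp C (g, t) (f, s) = coalg_comp (op_awfs C) (f, s) (g, t)"
proof -
  note [simp] = algD(1-6)[OF fs] algD(1-6)[OF gt] assms(3)
  have 1: "square C (g \<cdot> f) g f (Idt C (Cod C g))" by (simp add: square_def)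
  have 2: "t \<cdot> E_map C (g \<cdot> f) g f (Idt C (Cod C g)) \<cdot> lft C (g \<cdot> f) = f"
    using E_L[OF 1] cmp_extend[OF algD(5)[OF gt], of f] by simp
  have 3: "square C (lft C (g \<cdot> f)) f (Idt C (Dom C f)) (t \<cdot> E_map C (g \<cdot> f) g f (Idt C (Cod C g)))"
    using 1 2 by (simp add: square_def)
  show ?thesis using 3 by (simp add: alg_comp_def coalg_comp_def Let_def)
qed

lemma solution_op:
  assumes "is_coalg C (j, s)" "is_alg C (f, r)" "square C j f u v"
  shows "solution (op_awfs C) (f, r) (j, s) (Sq f j v u) = solution C (j, s) (f, r) (Sq j f u v)"
  using coalgD(1-6)[OF assms(1)] algD(1-6)[OF assms(2)] assms(3) by (simp add: solution_def)

lemma free_is_alg: "f \<in> Ar C \<Longrightarrow> is_alg C (free_alg C f)"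
  using elementary_awfs.cofree_is_coalg[OF op_awfs, of f] by (simp add: cofree_op)

lemma alg_comp_is_alg:
  assumes "is_alg C (f, s)" "is_alg C (g, t)" "Dom C g = Cod C f"
  shows "is_alg C (alg_comp C (g, t) (f, s))"
  using elementary_awfs.coalg_comp_is_coalg[OF op_awfs, of g t f s] assms by (simp add: alg_comp_op)

lemma solution_alg_map:
  assumes "is_alg C (f, r)" "is_alg C (f', r')" "is_coalg C (j, s)" "square C j f u v"
    and m: "alg_map C (f, r) (f', r') a b"
  shows "solution C (j, s) (f', r') (Sq j f' (a \<cdot> u) (b \<cdot> v)) = a \<cdot> solution C (j, s) (f, r) (Sq j f u v)"
  using elementary_awfs.solution_coalg_map[OF op_awfs, of f r f' r' j s v u b a] assms
    square_cmp[of j f u v f' a b]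
  by (simp add: solution_op coalg_map_op square_op alg_map_def)

lemma solution_alg_comp:
  assumes fr: "is_alg C (f, r)" and gt: "is_alg C (g, t)" and gf: "Dom C g = Cod C f"
    and js: "is_coalg C (j, s)" and sq: "square C j (g \<cdot> f) u v"
  shows "solution C (j, s) (f, r) (Sq j f u (solution C (j, s) (g, t) (Sq j g (f \<cdot> u) v))) =
    solution C (j, s) (alg_comp C (g, t) (f, r)) (Sq j (g \<cdot> f) u v)"
proof -
  note [simp] = algD(1-6)[OF fr] algD(1-6)[OF gt] gf squareD[OF sq]
  have 1: "square C j g (f \<cdot> u) v" using sq by (simp add: square_def)
  note 2 = solution_props[OF js gt 1]
  have 3: "square C j f u (solution C (j, s) (g, t) (Sq j g (f \<cdot> u) v))"
    using 2 by (simp add: square_def)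
  obtain x where x: "alg_comp C (g, t) (f, r) = (g \<cdot> f, x)" by (simp add: alg_comp_def Let_def)
  then have "is_alg C (g \<cdot> f, x)" using alg_comp_is_alg[OF fr gt gf] by simp
  then show ?thesis
    using elementary_awfs.solution_coalg_comp[OF op_awfs, of g t f r j s v u] fr gt gf js sq 1 3 x
    by (simp add: solution_op square_op alg_comp_op)
qed

text \<open>The preceding result for the opposite system.\<close>

lemma
  fixes \<psi> :: "'a structured \<Rightarrow> 'a \<Rightarrow> 'a \<Rightarrow> 'a"
  assumes p: "p \<in> Ar C"
    and solves: "\<And>f r u v. \<lbrakk>is_alg C (f, r); square C p f u v\<rbrakk> \<Longrightarrow>
      \<psi> (f, r) u v \<in> hom C (Cod C p) (Dom C f) \<and> \<psi> (f, r) u v \<cdot> p = u \<and> f \<cdot> \<psi> (f, r) u v = v"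
    and natural: "\<And>f r f' r' a b u v. \<lbrakk>is_alg C (f, r); is_alg C (f', r');
      alg_map C (f, r) (f', r') a b; square C p f u v\<rbrakk> \<Longrightarrow>
      \<psi> (f', r') (a \<cdot> u) (b \<cdot> v) = a \<cdot> \<psi> (f, r) u v"
    and comp: "\<And>f r g t u v. \<lbrakk>is_alg C (f, r); is_alg C (g, t); Dom C g = Cod C f;
      square C p (g \<cdot> f) u v\<rbrakk> \<Longrightarrow>
      \<psi> (f, r) u (\<psi> (g, t) (f \<cdot> u) v) = \<psi> (alg_comp C (g, t) (f, r)) u v"
  defines "s \<equiv> \<psi> (free_alg C p) (lft C p) (Idt C (Cod C p))"
  shows coalg_of_lifting: "is_coalg C (p, s)"
    and solution_coalg_of_lifting: "\<lbrakk>is_alg C (f, r); square C p f u v\<rbrakk> \<Longrightarrow>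
      solution C (p, s) (f, r) (Sq p f u v) = \<psi> (f, r) u v"
proof -
  have sv: "\<psi> (f, r) v u \<in> hom (op_awfs C) (Cod (op_awfs C) f) (Dom (op_awfs C) p) \<and>
      \<psi> (f, r) v u \<cdot>\<^bsub>op_awfs C\<^esub> f = u \<and> p \<cdot>\<^bsub>op_awfs C\<^esub> \<psi> (f, r) v u = v"
    if "is_coalg (op_awfs C) (f, r)" "square (op_awfs C) f p u v" for f r u v
    using solves[of f r v u] that by (simp add: square_op hom_def)
  have nat: "\<psi> (f', r') (v \<cdot>\<^bsub>op_awfs C\<^esub> b) (u \<cdot>\<^bsub>op_awfs C\<^esub> a) = \<psi> (f, r) v u \<cdot>\<^bsub>op_awfs C\<^esub> b"
    if "is_coalg (op_awfs C) (f, r)" "is_coalg (op_awfs C) (f', r')"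
      "coalg_map (op_awfs C) (f', r') (f, r) a b" "square (op_awfs C) f p u v" for f r f' r' a b u v
    using natural[of f r f' r' b a v u] that by (simp add: square_op coalg_map_op)
  have cmp: "\<psi> (k, t') v (\<psi> (j, t) (v \<cdot>\<^bsub>op_awfs C\<^esub> k) u) = \<psi> (coalg_comp (op_awfs C) (k, t') (j, t)) v u"
    if "is_coalg (op_awfs C) (j, t)" "is_coalg (op_awfs C) (k, t')" "Dom (op_awfs C) k = Cod (op_awfs C) j"
      "square (op_awfs C) (k \<cdot>\<^bsub>op_awfs C\<^esub> j) p u v" for j t k t' u v
    using comp[of k t' j t v u] that by (simp add: square_op alg_comp_op)
  note rec = elementary_awfs.alg_of_lifting[OF op_awfs, of p "\<lambda>X u v. \<psi> X v u"]
    elementary_awfs.solution_alg_of_lifting[OF op_awfs, of p "\<lambda>X u v. \<psi> X v u"]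
  have "is_alg (op_awfs C) (p, \<psi> (cofree_coalg (op_awfs C) p) (rgt (op_awfs C) p) (Idt (op_awfs C) (Dom (op_awfs C) p)))"
    by (rule rec(1)) (use p sv nat cmp in auto)
  then show c: "is_coalg C (p, s)" by (simp add: cofree_op s_def)
  assume f: "is_alg C (f, r)" "square C p f u v"
  have "solution (op_awfs C) (f, r) (p, \<psi> (cofree_coalg (op_awfs C) p) (rgt (op_awfs C) p) (Idt (op_awfs C) (Dom (op_awfs C) p))) (Sq f p v u) = \<psi> (f, r) u v"
    by (rule rec(2)) (use p sv nat cmp f in \<open>auto simp: square_op\<close>)
  then show "solution C (p, s) (f, r) (Sq p f u v) = \<psi> (f, r) u v"
    using f c by (simp add: cofree_op s_def[symmetric] solution_op)
qed

text \<open>Structure maps are themselves solutions of universal problems, hence a square that preserves all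
solutions preserves the structure.\<close>

lemma alg_map_of_solutions:
  assumes fr: "is_alg C (f, r)" and gt: "is_alg C (g, t)" and sq: "square C f g a b"
    and eq: "\<And>j s u v. \<lbrakk>is_coalg C (j, s); square C j f u v\<rbrakk> \<Longrightarrow>
      solution C (j, s) (g, t) (Sq j g (a \<cdot> u) (b \<cdot> v)) = a \<cdot> solution C (j, s) (f, r) (Sq j f u v)"
  shows "alg_map C (f, r) (g, t) a b"
proof -
  note [simp] = algD(1-6)[OF fr] algD(1-6)[OF gt] squareD[OF sq] sq
  have cof: "is_coalg C (lft C f, cmul C f)" using cofree_is_coalg[of f] by (simp add: cofree_coalg_def)
  show ?thesis
    using eq[OF cof counit_square] E_cmp2[OF counit_square sq, of "cmul C f"] E_cmul[of f]
    by (simp add: solution_def alg_map_def)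
qed

lemma coalg_map_of_solutions:
  assumes js: "is_coalg C (j, s)" and kt: "is_coalg C (k, t)" and sq: "square C j k a b"
    and eq: "\<And>f r u v. \<lbrakk>is_alg C (f, r); square C k f u v\<rbrakk> \<Longrightarrow>
      solution C (j, s) (f, r) (Sq j f (u \<cdot> a) (v \<cdot> b)) = solution C (k, t) (f, r) (Sq k f u v) \<cdot> b"
  shows "coalg_map C (j, s) (k, t) a b"
proof -
  have "alg_map (op_awfs C) (k, t) (j, s) b a"
  proof (rule elementary_awfs.alg_map_of_solutions[OF op_awfs])
    fix f r u v assume "is_coalg (op_awfs C) (f, r)" "square (op_awfs C) f k u v"
    then show "solution (op_awfs C) (f, r) (j, s) (Sq f j (b \<cdot>\<^bsub>op_awfs C\<^esub> u) (a \<cdot>\<^bsub>op_awfs C\<^esub> v)) =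
      b \<cdot>\<^bsub>op_awfs C\<^esub> solution (op_awfs C) (f, r) (k, t) (Sq f k u v)"
      using eq[of f r v u] js kt square_cmp[OF sq, of f v u] by (simp add: square_op solution_op)
  qed (use assms in \<open>auto simp: square_op\<close>)
  then show ?thesis by (auto simp: alg_map_def coalg_map_def square_op)
qed

lemma coalg_map_unit: "is_coalg C (j, s) \<Longrightarrow> coalg_map C (j, s) (cofree_coalg C j) (Idt C (Dom C j)) s"
  using coalgD[of j s] coalg_square[of j s] by (simp add: coalg_map_def cofree_coalg_def)

lemma alg_square: "is_alg C (f, r) \<Longrightarrow> square C (rgt C f) f r (Idt C (Cod C f))"
  using algD[of f r] by (simp add: square_def)

lemma alg_map_counit: "is_alg C (f, r) \<Longrightarrow> alg_map C (free_alg C f) (f, r) r (Idt C (Cod C f))"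
  using algD[of f r] alg_square[of f r] by (simp add: alg_map_def free_alg_def)

lemma cofree_map: "square C f g u v \<Longrightarrow> coalg_map C (cofree_coalg C f) (cofree_coalg C g) u (E_map C f g u v)"
  using cmul_E[of f g u v] L_square[of f g u v] by (simp add: coalg_map_def cofree_coalg_def)

lemma coalg_map_idt: "is_coalg C (j, s) \<Longrightarrow> coalg_map C (j, s) (j, s) (Idt C (Dom C j)) (Idt C (Cod C j))"
  using coalgD[of j s] square_idt[of j] E_idt[of j] by (simp add: coalg_map_def)

lemma E_idt': "\<lbrakk>f \<in> Ar C; Dom C f = x; Cod C f = y\<rbrakk> \<Longrightarrow> E_map C f f (Idt C x) (Idt C y) = Idt C (fob (fac C) f)"
  using E_idt by blast

lemma alg_map_idt: "is_alg C (f, s) \<Longrightarrow> alg_map C (f, s) (f, s) (Idt C (Dom C f)) (Idt C (Cod C f))"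
  using algD[of f s] square_idt[of f] E_idt[of f] by (simp add: alg_map_def)

lemma coalg_compE:
  assumes "is_coalg C (j, s)" "is_coalg C (k, t)" "Dom C k = Cod C j"
  obtains x where "coalg_comp C (k, t) (j, s) = (k \<cdot> j, x)" "is_coalg C (k \<cdot> j, x)"
  using coalg_comp_is_coalg[OF assms] that by (auto simp: coalg_comp_def Let_def)

lemma alg_compE:
  assumes "is_alg C (f, s)" "is_alg C (g, t)" "Dom C g = Cod C f"
  obtains x where "alg_comp C (g, t) (f, s) = (g \<cdot> f, x)" "is_alg C (g \<cdot> f, x)"
  using alg_comp_is_alg[OF assms] that by (auto simp: alg_comp_def Let_def)

lemma square_first: "\<lbrakk>j \<in> Ar C; k \<in> Ar C; Dom C k = Cod C j\<rbrakk> \<Longrightarrow> square C j (k \<cdot> j) (Idt C (Dom C j)) k"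
  by (simp add: square_def)

lemma square_last: "\<lbrakk>f \<in> Ar C; g \<in> Ar C; Dom C g = Cod C f\<rbrakk> \<Longrightarrow> square C (g \<cdot> f) g f (Idt C (Cod C g))"
  by (simp add: square_def)

end

section \<open>Functors into categories of algebras and coalgebras\<close>

lemma alg_simps [simp]:
  "Ob (alg C) = {X. is_alg C X}" "Dom (alg C) (X, Y, S) = X" "Cod (alg C) (X, Y, S) = Y"
  "Idt (alg C) X = (X, X, Idt (arrow_cat C) (fst X))"
  "Cmp (alg C) (Y', Z, T) (X, Y, S) = (X, Z, T \<cdot>\<^bsub>arrow_cat C\<^esub> S)"
  by (simp_all add: alg_def structured_cat_def)

lemma coalg_simps [simp]:
  "Ob (coalg C) = {X. is_coalg C X}" "Dom (coalg C) (X, Y, S) = X" "Cod (coalg C) (X, Y, S) = Y"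
  "Idt (coalg C) X = (X, X, Idt (arrow_cat C) (fst X))"
  "Cmp (coalg C) (Y', Z, T) (X, Y, S) = (X, Z, T \<cdot>\<^bsub>arrow_cat C\<^esub> S)"
  by (simp_all add: coalg_def structured_cat_def)

lemma forget_simps [simp]: "fob forget X = fst X" "far forget (X, Y, S) = S"
  by (simp_all add: forget_def)

lemma alg_ar: "(X, Y, S) \<in> Ar (alg C) \<longleftrightarrow> is_alg C X \<and> is_alg C Y \<and>
   (\<exists>u v. S = Sq (fst X) (fst Y) u v \<and> alg_map C X Y u v)"
  by (cases S) (auto simp: alg_def structured_cat_def hom_def alg_map_def arrow_cat_ar)

lemma coalg_ar: "(X, Y, S) \<in> Ar (coalg C) \<longleftrightarrow> is_coalg C X \<and> is_coalg C Y \<and>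
   (\<exists>u v. S = Sq (fst X) (fst Y) u v \<and> coalg_map C X Y u v)"
  by (cases S) (auto simp: coalg_def structured_cat_def hom_def coalg_map_def arrow_cat_ar)

lemma category_structured:
  assumes C: "category C" and PP: "\<And>X. P X \<Longrightarrow> fst X \<in> Ar C"
    and idt: "\<And>X. P X \<Longrightarrow> Q X X (Idt (arrow_cat C) (fst X))"
    and cmp: "\<And>X Y Z S T. \<lbrakk>P X; P Y; P Z; S \<in> hom (arrow_cat C) (fst X) (fst Y);
      T \<in> hom (arrow_cat C) (fst Y) (fst Z); Q X Y S; Q Y Z T\<rbrakk> \<Longrightarrow> Q X Z (T \<cdot>\<^bsub>arrow_cat C\<^esub> S)"
  shows "category (structured_cat C P Q)"
proof -
  interpret A: category "arrow_cat C" using category.arrow_category[OF C] .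
  let ?S = "structured_cat C P Q" and ?A = "arrow_cat C"
  have [simp]: "Ob ?S = {X. P X}" "\<And>X Y S. Dom ?S (X, Y, S) = X" "\<And>X Y S. Cod ?S (X, Y, S) = Y"
    "\<And>X. Idt ?S X = (X, X, Idt ?A (fst X))"
    "\<And>X Y Y' Z S T. Cmp ?S (Y', Z, T) (X, Y, S) = (X, Z, T \<cdot>\<^bsub>?A\<^esub> S)"
    by (simp_all add: structured_cat_def del: arrow_cat_simps)
  have ar: "(X, Y, S) \<in> Ar ?S \<longleftrightarrow> P X \<and> P Y \<and> S \<in> hom ?A (fst X) (fst Y) \<and> Q X Y S" for X Y S
    by (simp add: structured_cat_def del: arrow_cat_simps)
  note [simp del] = arrow_cat_simps(4,5)
  show ?thesis
  proof
    fix f assume "f \<in> Ar ?S" then show "Dom ?S f \<in> Ob ?S" "Cod ?S f \<in> Ob ?S"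
      by (cases f; simp add: ar)+
  next
    fix X assume "X \<in> Ob ?S"
    moreover have "Idt ?A (fst X) \<in> hom ?A (fst X) (fst X)" if "P X"
      using A.idt_ar[of "fst X"] A.dom_idt[of "fst X"] A.cod_idt[of "fst X"] PP[OF that] by (simp add: hom_def)
    ultimately show "Idt ?S X \<in> Ar ?S" by (simp add: ar idt)
  next
    fix X show "Dom ?S (Idt ?S X) = X" "Cod ?S (Idt ?S X) = X" by simp_all
  next
    fix f g assume 0: "f \<in> Ar ?S" "g \<in> Ar ?S" "Dom ?S g = Cod ?S f"
    obtain X Y S Z T where fg: "f = (X, Y, S)" "g = (Y, Z, T)" using 0 by (cases f; cases g) simp
    have "T \<cdot>\<^bsub>?A\<^esub> S \<in> hom ?A (fst X) (fst Z)"
      using 0 fg by (intro A.hom_cmp[of T "fst Y" _ S]) (simp_all add: ar)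
    then show "g \<cdot>\<^bsub>?S\<^esub> f \<in> Ar ?S" using 0 fg cmp[of X Y Z S T] by (simp add: ar)
    show "Dom ?S (g \<cdot>\<^bsub>?S\<^esub> f) = Dom ?S f" "Cod ?S (g \<cdot>\<^bsub>?S\<^esub> f) = Cod ?S g" by (simp_all add: fg)
  next
    fix f assume "f \<in> Ar ?S"
    then show "f \<cdot>\<^bsub>?S\<^esub> Idt ?S (Dom ?S f) = f" "Idt ?S (Cod ?S f) \<cdot>\<^bsub>?S\<^esub> f = f"
      using A.cmp_idt A.idt_cmp by (cases f; auto simp add: ar hom_def)+
  next
    fix f g h assume "f \<in> Ar ?S" "g \<in> Ar ?S" "h \<in> Ar ?S" "Dom ?S g = Cod ?S f" "Dom ?S h = Cod ?S g"
    then show "(h \<cdot>\<^bsub>?S\<^esub> g) \<cdot>\<^bsub>?S\<^esub> f = h \<cdot>\<^bsub>?S\<^esub> (g \<cdot>\<^bsub>?S\<^esub> f)"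
      using A.cmp_assoc by (cases f; cases g; cases h) (simp add: ar hom_def)
  qed
qed

context elementary_awfs begin

lemma category_alg: "category (alg C)"
  unfolding alg_def
proof (rule category_structured)
  fix X assume "is_alg C X"
  then show "fst X \<in> Ar C" by (cases X) (simp add: algD)
  show "sq_top (Idt (arrow_cat C) (fst X)) \<cdot> snd X = snd X \<cdot> far (fac C) (Idt (arrow_cat C) (fst X))"
    using algD[of "fst X" "snd X"] \<open>is_alg C X\<close> by (simp add: E_idt)
next
  fix X Y Z S T
  assume 0: "is_alg C X" "is_alg C Y" "is_alg C Z" "S \<in> hom (arrow_cat C) (fst X) (fst Y)"
    "T \<in> hom (arrow_cat C) (fst Y) (fst Z)" "sq_top S \<cdot> snd X = snd Y \<cdot> far (fac C) S"
    "sq_top T \<cdot> snd Y = snd Z \<cdot> far (fac C) T"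
  obtain f r g s h t where X: "X = (f, r)" "Y = (g, s)" "Z = (h, t)" by (cases X; cases Y; cases Z)
  obtain u v u' v' where S: "S = Sq f g u v" "T = Sq g h u' v'" "square C f g u v" "square C g h u' v'"
    using 0(4,5) X by (cases S; cases T) (auto simp: hom_def arrow_cat_ar)
  note [simp] = X S squareD[OF S(3)] squareD[OF S(4)]
  note [simp] = algD(1-6)[of f r] algD(1-6)[of g s] algD(1-6)[of h t]
  show "sq_top (T \<cdot>\<^bsub>arrow_cat C\<^esub> S) \<cdot> snd X = snd Z \<cdot> far (fac C) (T \<cdot>\<^bsub>arrow_cat C\<^esub> S)"
    using 0 cmp_extend2[of u' s t "E_map C g h u' v'" "E_map C f g u v"] E_cmp[OF S(3,4)] by simp
qed (rule category_axioms)

lemma category_coalg: "category (coalg C)"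
  unfolding coalg_def
proof (rule category_structured)
  fix X assume "is_coalg C X"
  then show "fst X \<in> Ar C" by (cases X) (simp add: coalgD)
  show "snd X \<cdot> sq_bot (Idt (arrow_cat C) (fst X)) = far (fac C) (Idt (arrow_cat C) (fst X)) \<cdot> snd X"
    using coalgD[of "fst X" "snd X"] \<open>is_coalg C X\<close> by (simp add: E_idt)
next
  fix X Y Z S T
  assume 0: "is_coalg C X" "is_coalg C Y" "is_coalg C Z" "S \<in> hom (arrow_cat C) (fst X) (fst Y)"
    "T \<in> hom (arrow_cat C) (fst Y) (fst Z)" "snd Y \<cdot> sq_bot S = far (fac C) S \<cdot> snd X"
    "snd Z \<cdot> sq_bot T = far (fac C) T \<cdot> snd Y"
  obtain f r g s h t where X: "X = (f, r)" "Y = (g, s)" "Z = (h, t)" by (cases X; cases Y; cases Z)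
  obtain u v u' v' where S: "S = Sq f g u v" "T = Sq g h u' v'" "square C f g u v" "square C g h u' v'"
    using 0(4,5) X by (cases S; cases T) (auto simp: hom_def arrow_cat_ar)
  note [simp] = X S squareD[OF S(3)] squareD[OF S(4)]
  note [simp] = coalgD(1-6)[of f r] coalgD(1-6)[of g s] coalgD(1-6)[of h t]
  show "snd Z \<cdot> sq_bot (T \<cdot>\<^bsub>arrow_cat C\<^esub> S) = far (fac C) (T \<cdot>\<^bsub>arrow_cat C\<^esub> S) \<cdot> snd X"
    using 0 cmp_extend2[of t v' "E_map C g h u' v'" s v] E_cmp2[OF S(3,4), of r] by simp
qed (rule category_axioms)

text \<open>Naturality in the index is exactly what turns the squares \<open>far P a\<close> into maps for the algebra
structures that the operation defines pointwise.\<close>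

lemma lift_to_alg:
  fixes \<psi> :: "'x \<Rightarrow> 'a structured \<Rightarrow> 'a \<Rightarrow> 'a \<Rightarrow> 'a" and I :: "('x, 'y) cat"
  assumes P: "cfunctor I (arrow_cat C) P"
    and solves: "\<And>x j t u v. \<lbrakk>x \<in> Ob I; is_coalg C (j, t); square C j (fob P x) u v\<rbrakk> \<Longrightarrow>
      \<psi> x (j, t) u v \<in> hom C (Cod C j) (Dom C (fob P x)) \<and> \<psi> x (j, t) u v \<cdot> j = u \<and> fob P x \<cdot> \<psi> x (j, t) u v = v"
    and natural: "\<And>x j t j' t' a b u v. \<lbrakk>x \<in> Ob I; is_coalg C (j, t); is_coalg C (j', t');
      coalg_map C (j', t') (j, t) a b; square C j (fob P x) u v\<rbrakk> \<Longrightarrow>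
      \<psi> x (j', t') (u \<cdot> a) (v \<cdot> b) = \<psi> x (j, t) u v \<cdot> b"
    and comp: "\<And>x j t k t' u v. \<lbrakk>x \<in> Ob I; is_coalg C (j, t); is_coalg C (k, t'); Dom C k = Cod C j;
      square C (k \<cdot> j) (fob P x) u v\<rbrakk> \<Longrightarrow>
      \<psi> x (k, t') (\<psi> x (j, t) u (v \<cdot> k)) v = \<psi> x (coalg_comp C (k, t') (j, t)) u v"
    and index: "\<And>a j t u v. \<lbrakk>a \<in> Ar I; is_coalg C (j, t); square C j (fob P (Dom I a)) u v\<rbrakk> \<Longrightarrow>
      \<psi> (Cod I a) (j, t) (sq_top (far P a) \<cdot> u) (sq_bot (far P a) \<cdot> v) = sq_top (far P a) \<cdot> \<psi> (Dom I a) (j, t) u v"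
  shows "\<exists>H. cfunctor I (alg C) H \<and> cfun_agree I (cfun_comp forget H) P \<and>
    (\<forall>x\<in>Ob I. \<forall>j t u v. is_coalg C (j, t) \<longrightarrow> square C j (fob P x) u v \<longrightarrow>
       solution C (j, t) (fob H x) (Sq j (fob P x) u v) = \<psi> x (j, t) u v)"
proof -
  interpret P: cfunctor I "arrow_cat C" P by fact
  define A where "A x = (fob P x, \<psi> x (cofree_coalg C (fob P x)) (Idt C (Dom C (fob P x))) (rgt C (fob P x)))" for x
  have Px: "fob P x \<in> Ar C" if "x \<in> Ob I" for x using P.fob_ob[OF that] by simp
  have A: "is_alg C (A x)" if "x \<in> Ob I" for x
    unfolding A_def using alg_of_lifting[OF Px[OF that] solves[OF that] natural[OF that] comp[OF that]] .
  have sol: "solution C (j, t) (A x) (Sq j (fob P x) u v) = \<psi> x (j, t) u v"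
    if "x \<in> Ob I" "is_coalg C (j, t)" "square C j (fob P x) u v" for x j t u v
    unfolding A_def
    using solution_alg_of_lifting[OF Px[OF that(1)] solves[OF that(1)] natural[OF that(1)] comp[OF that(1)] that(2,3)] .
  have ar: "(A (Dom I a), A (Cod I a), far P a) \<in> Ar (alg C)" if a: "a \<in> Ar I" for a
  proof -
    obtain u v where S: "far P a = Sq (fob P (Dom I a)) (fob P (Cod I a)) u v"
      "square C (fob P (Dom I a)) (fob P (Cod I a)) u v"
      using P.far_hom[OF a] by (cases "far P a") (auto simp: hom_def arrow_cat_ar)
    have d: "Dom I a \<in> Ob I" "Cod I a \<in> Ob I" using a by auto
    have "alg_map C (A (Dom I a)) (A (Cod I a)) u v"
      unfolding A_def
    proof (rule alg_map_of_solutions)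
      fix j s u' v' assume j: "is_coalg C (j, s)" "square C j (fob P (Dom I a)) u' v'"
      show "solution C (j, s) (fob P (Cod I a), \<psi> (Cod I a) (cofree_coalg C (fob P (Cod I a)))
            (Idt C (Dom C (fob P (Cod I a)))) (rgt C (fob P (Cod I a))))
            (Sq j (fob P (Cod I a)) (u \<cdot> u') (v \<cdot> v')) =
        u \<cdot> solution C (j, s) (fob P (Dom I a), \<psi> (Dom I a) (cofree_coalg C (fob P (Dom I a)))
            (Idt C (Dom C (fob P (Dom I a)))) (rgt C (fob P (Dom I a)))) (Sq j (fob P (Dom I a)) u' v')"
        using sol[OF d(1) j] sol[OF d(2) j(1) square_cmp[OF j(2) S(2)]] index[OF a j] S(1)
        by (simp add: A_def)
    qed (use A d S in \<open>auto simp: A_def\<close>)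
    then show ?thesis using A d S by (auto simp: alg_ar A_def)
  qed
  interpret alg: category "alg C" by (rule category_alg)
  define H where "H = CFun A (\<lambda>a. (A (Dom I a), A (Cod I a), far P a))"
  have "cfunctor I (alg C) H"
  proof
    fix x assume x: "x \<in> Ob I"
    show "fob H x \<in> Ob (alg C)" using A x by (simp add: H_def)
    show "far H (Idt I x) = Idt (alg C) (fob H x)" using x P.far_idt[OF x] by (simp add: H_def A_def)
  next
    fix f assume "f \<in> Ar I" then show "far H f \<in> hom (alg C) (fob H (Dom I f)) (fob H (Cod I f))"
      using ar by (simp add: hom_def H_def)
  next
    fix f g assume "f \<in> Ar I" "g \<in> Ar I" "Dom I g = Cod I f"
    then show "far H (g \<cdot>\<^bsub>I\<^esub> f) = far H g \<cdot>\<^bsub>alg C\<^esub> far H f"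
      using P.far_cmp[of f g] by (simp add: H_def)
  qed
  moreover have "cfun_agree I (cfun_comp forget H) P" by (simp add: cfun_agree_def H_def A_def)
  ultimately show ?thesis using sol by (intro exI[of _ H]) (simp add: H_def)
qed

lemma lift_to_coalg:
  fixes \<psi> :: "'x \<Rightarrow> 'a structured \<Rightarrow> 'a \<Rightarrow> 'a \<Rightarrow> 'a" and I :: "('x, 'y) cat"
  assumes P: "cfunctor I (arrow_cat C) P"
    and solves: "\<And>x f r u v. \<lbrakk>x \<in> Ob I; is_alg C (f, r); square C (fob P x) f u v\<rbrakk> \<Longrightarrow>
      \<psi> x (f, r) u v \<in> hom C (Cod C (fob P x)) (Dom C f) \<and> \<psi> x (f, r) u v \<cdot> fob P x = u \<and> f \<cdot> \<psi> x (f, r) u v = v"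
    and natural: "\<And>x f r f' r' a b u v. \<lbrakk>x \<in> Ob I; is_alg C (f, r); is_alg C (f', r');
      alg_map C (f, r) (f', r') a b; square C (fob P x) f u v\<rbrakk> \<Longrightarrow>
      \<psi> x (f', r') (a \<cdot> u) (b \<cdot> v) = a \<cdot> \<psi> x (f, r) u v"
    and comp: "\<And>x f r g t u v. \<lbrakk>x \<in> Ob I; is_alg C (f, r); is_alg C (g, t); Dom C g = Cod C f;
      square C (fob P x) (g \<cdot> f) u v\<rbrakk> \<Longrightarrow>
      \<psi> x (f, r) u (\<psi> x (g, t) (f \<cdot> u) v) = \<psi> x (alg_comp C (g, t) (f, r)) u v"
    and index: "\<And>a f r u v. \<lbrakk>a \<in> Ar I; is_alg C (f, r); square C (fob P (Cod I a)) f u v\<rbrakk> \<Longrightarrow>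
      \<psi> (Dom I a) (f, r) (u \<cdot> sq_top (far P a)) (v \<cdot> sq_bot (far P a)) = \<psi> (Cod I a) (f, r) u v \<cdot> sq_bot (far P a)"
  shows "\<exists>T. cfunctor I (coalg C) T \<and> cfun_agree I (cfun_comp forget T) P \<and>
    (\<forall>x\<in>Ob I. \<forall>f r u v. is_alg C (f, r) \<longrightarrow> square C (fob P x) f u v \<longrightarrow>
       solution C (fob T x) (f, r) (Sq (fob P x) f u v) = \<psi> x (f, r) u v)"
proof -
  interpret P: cfunctor I "arrow_cat C" P by fact
  define A where "A x = (fob P x, \<psi> x (free_alg C (fob P x)) (lft C (fob P x)) (Idt C (Cod C (fob P x))))" for x
  have Px: "fob P x \<in> Ar C" if "x \<in> Ob I" for x using P.fob_ob[OF that] by simp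
  have A: "is_coalg C (A x)" if "x \<in> Ob I" for x
    unfolding A_def using coalg_of_lifting[OF Px[OF that] solves[OF that] natural[OF that] comp[OF that]] .
  have sol: "solution C (A x) (f, r) (Sq (fob P x) f u v) = \<psi> x (f, r) u v"
    if "x \<in> Ob I" "is_alg C (f, r)" "square C (fob P x) f u v" for x f r u v
    unfolding A_def
    using solution_coalg_of_lifting[OF Px[OF that(1)] solves[OF that(1)] natural[OF that(1)] comp[OF that(1)] that(2,3)] .
  have ar: "(A (Dom I a), A (Cod I a), far P a) \<in> Ar (coalg C)" if a: "a \<in> Ar I" for a
  proof -
    obtain u v where S: "far P a = Sq (fob P (Dom I a)) (fob P (Cod I a)) u v"
      "square C (fob P (Dom I a)) (fob P (Cod I a)) u v"
      using P.far_hom[OF a] by (cases "far P a") (auto simp: hom_def arrow_cat_ar)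
    have d: "Dom I a \<in> Ob I" "Cod I a \<in> Ob I" using a by auto
    have "coalg_map C (A (Dom I a)) (A (Cod I a)) u v"
      unfolding A_def
    proof (rule coalg_map_of_solutions)
      fix f r u' v' assume f: "is_alg C (f, r)" "square C (fob P (Cod I a)) f u' v'"
      show "solution C (fob P (Dom I a), \<psi> (Dom I a) (free_alg C (fob P (Dom I a)))
            (lft C (fob P (Dom I a))) (Idt C (Cod C (fob P (Dom I a))))) (f, r)
            (Sq (fob P (Dom I a)) f (u' \<cdot> u) (v' \<cdot> v)) =
        solution C (fob P (Cod I a), \<psi> (Cod I a) (free_alg C (fob P (Cod I a)))
            (lft C (fob P (Cod I a))) (Idt C (Cod C (fob P (Cod I a))))) (f, r) (Sq (fob P (Cod I a)) f u' v') \<cdot> v"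
        using sol[OF d(2) f] sol[OF d(1) f(1) square_cmp[OF S(2) f(2)]] index[OF a f] S(1)
        by (simp add: A_def)
    qed (use A d S in \<open>auto simp: A_def\<close>)
    then show ?thesis using A d S by (auto simp: coalg_ar A_def)
  qed
  interpret coalg: category "coalg C" by (rule category_coalg)
  define H where "H = CFun A (\<lambda>a. (A (Dom I a), A (Cod I a), far P a))"
  have "cfunctor I (coalg C) H"
  proof
    fix x assume x: "x \<in> Ob I"
    show "fob H x \<in> Ob (coalg C)" using A x by (simp add: H_def)
    show "far H (Idt I x) = Idt (coalg C) (fob H x)" using x P.far_idt[OF x] by (simp add: H_def A_def)
  next
    fix f assume "f \<in> Ar I" then show "far H f \<in> hom (coalg C) (fob H (Dom I f)) (fob H (Cod I f))"
      using ar by (simp add: hom_def H_def)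
  next
    fix f g assume "f \<in> Ar I" "g \<in> Ar I" "Dom I g = Cod I f"
    then show "far H (g \<cdot>\<^bsub>I\<^esub> f) = far H g \<cdot>\<^bsub>coalg C\<^esub> far H f"
      using P.far_cmp[of f g] by (simp add: H_def)
  qed
  moreover have "cfun_agree I (cfun_comp forget H) P" by (simp add: cfun_agree_def H_def A_def)
  ultimately show ?thesis using sol by (intro exI[of _ H]) (simp add: H_def)
qed

end

section \<open>Transposing squares\<close>

lemma cfunctor_comp: "\<lbrakk>cfunctor A B F; cfunctor B C G\<rbrakk> \<Longrightarrow> cfunctor A C (cfun_comp G F)"
  unfolding cfunctor_def cfunctor_axioms_def hom_def by auto

lemma cfunctor_prod:
  assumes "cfunctor A B F" "cfunctor C D G"
  shows "cfunctor (prod_cat A C) (prod_cat B D) (cfun_prod F G)"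
  using assms unfolding cfunctor_def cfunctor_axioms_def hom_def by (auto simp: prod_category)

lemma cfunctor_op: "cfunctor A B F \<Longrightarrow> cfunctor (op_cat A) (op_cat B) F"
  unfolding cfunctor_def cfunctor_axioms_def hom_def by (auto simp: category.op_category)

lemma (in elementary_awfs) forget_coalg: "cfunctor (coalg C) (arrow_cat C) forget"
  unfolding cfunctor_def cfunctor_axioms_def hom_def
  by (auto simp: category_coalg arrow_category coalg_ar coalg_map_def arrow_cat_ar dest: coalgD)

lemma (in elementary_awfs) forget_alg: "cfunctor (alg C) (arrow_cat C) forget"
  unfolding cfunctor_def cfunctor_axioms_def hom_def
  by (auto simp: category_alg arrow_category alg_ar alg_map_def arrow_cat_ar dest: algD)

locale bifunctor = K: category K + M: category M + N: category N + F: cfunctor "prod_cat K M" N ten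
  for K :: "('ok, 'ak, 'zk) cat_scheme" and M :: "('om, 'am, 'zm) cat_scheme" and N :: "('on, 'an, 'zn) cat_scheme"
    and ten :: "('ok \<times> 'om, 'ak \<times> 'am, 'on, 'an) cfun"
begin

lemma ten_ob [simp]: "\<lbrakk>k \<in> Ob K; m \<in> Ob M\<rbrakk> \<Longrightarrow> fob ten (k, m) \<in> Ob N"
  using F.fob_ob[of "(k, m)"] by simp

lemma ten_ar [simp]:
  assumes "u \<in> Ar K" "v \<in> Ar M"
  shows "far ten (u, v) \<in> Ar N" "Dom N (far ten (u, v)) = fob ten (Dom K u, Dom M v)"
    "Cod N (far ten (u, v)) = fob ten (Cod K u, Cod M v)"
  using F.far_hom[of "(u, v)"] assms by (simp_all add: hom_def)

lemma ten_idt [simp]: "\<lbrakk>k \<in> Ob K; m \<in> Ob M\<rbrakk> \<Longrightarrow> far ten (Idt K k, Idt M m) = Idt N (fob ten (k, m))"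
  using F.far_idt[of "(k, m)"] by simp

lemma ten_cmp [simp]:
  "\<lbrakk>u \<in> Ar K; u' \<in> Ar K; v \<in> Ar M; v' \<in> Ar M; Dom K u' = Cod K u; Dom M v' = Cod M v\<rbrakk> \<Longrightarrow>
    far ten (u', v') \<cdot>\<^bsub>N\<^esub> far ten (u, v) = far ten (u' \<cdot>\<^bsub>K\<^esub> u, v' \<cdot>\<^bsub>M\<^esub> v)"
  using F.far_cmp[of "(u, v)" "(u', v')"] by simp

lemma ten_cmp2 [simp]:
  "\<lbrakk>u \<in> Ar K; u' \<in> Ar K; v \<in> Ar M; v' \<in> Ar M; Dom K u' = Cod K u; Dom M v' = Cod M v;
    x \<in> Ar N; Cod N x = fob ten (Dom K u, Dom M v)\<rbrakk> \<Longrightarrow>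
    far ten (u', v') \<cdot>\<^bsub>N\<^esub> far ten (u, v) \<cdot>\<^bsub>N\<^esub> x = far ten (u' \<cdot>\<^bsub>K\<^esub> u, v' \<cdot>\<^bsub>M\<^esub> v) \<cdot>\<^bsub>N\<^esub> x"
  using N.cmp_extend[OF ten_cmp, of u u' v v' x] by simp

end

locale op_bifunctor = K: category K + N: category N + M: category M + F: cfunctor "prod_cat (op_cat K) N" M hm
  for K :: "('ok, 'ak, 'zk) cat_scheme" and N :: "('on, 'an, 'zn) cat_scheme" and M :: "('om, 'am, 'zm) cat_scheme"
    and hm :: "('ok \<times> 'on, 'ak \<times> 'an, 'om, 'am) cfun"
begin

lemma hm_ob [simp]: "\<lbrakk>k \<in> Ob K; n \<in> Ob N\<rbrakk> \<Longrightarrow> fob hm (k, n) \<in> Ob M"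
  using F.fob_ob[of "(k, n)"] by simp

lemma hm_ar [simp]:
  assumes "u \<in> Ar K" "w \<in> Ar N"
  shows "far hm (u, w) \<in> Ar M" "Dom M (far hm (u, w)) = fob hm (Cod K u, Dom N w)"
    "Cod M (far hm (u, w)) = fob hm (Dom K u, Cod N w)"
  using F.far_hom[of "(u, w)"] assms by (simp_all add: hom_def)

lemma hm_idt [simp]: "\<lbrakk>k \<in> Ob K; n \<in> Ob N\<rbrakk> \<Longrightarrow> far hm (Idt K k, Idt N n) = Idt M (fob hm (k, n))"
  using F.far_idt[of "(k, n)"] by simp

lemma hm_cmp [simp]:
  "\<lbrakk>u \<in> Ar K; u' \<in> Ar K; w \<in> Ar N; w' \<in> Ar N; Dom K u = Cod K u'; Dom N w' = Cod N w\<rbrakk> \<Longrightarrow>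
    far hm (u', w') \<cdot>\<^bsub>M\<^esub> far hm (u, w) = far hm (u \<cdot>\<^bsub>K\<^esub> u', w' \<cdot>\<^bsub>N\<^esub> w)"
  using F.far_cmp[of "(u, w)" "(u', w')"] by simp

lemma hm_cmp2 [simp]:
  "\<lbrakk>u \<in> Ar K; u' \<in> Ar K; w \<in> Ar N; w' \<in> Ar N; Dom K u = Cod K u'; Dom N w' = Cod N w;
    x \<in> Ar M; Cod M x = fob hm (Cod K u, Dom N w)\<rbrakk> \<Longrightarrow>
    far hm (u', w') \<cdot>\<^bsub>M\<^esub> far hm (u, w) \<cdot>\<^bsub>M\<^esub> x = far hm (u \<cdot>\<^bsub>K\<^esub> u', w' \<cdot>\<^bsub>N\<^esub> w) \<cdot>\<^bsub>M\<^esub> x"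
  using M.cmp_extend[OF hm_cmp, of u u' w w' x] by simp

end

text \<open>One half of a two-variable adjunction, with only one of the homs. The other half has the same form
after exchanging the arguments of the tensor.\<close>

locale parametric_adjunction = T?: bifunctor K M N ten + H?: op_bifunctor K N M hm
  for K :: "('ok, 'ak, 'zk) cat_scheme" and M :: "('om, 'am, 'zm) cat_scheme" and N :: "('on, 'an, 'zn) cat_scheme"
    and ten :: "('ok \<times> 'om, 'ak \<times> 'am, 'on, 'an) cfun" and hm :: "('ok \<times> 'on, 'ak \<times> 'an, 'om, 'am) cfun" +
  fixes tr :: "'ok \<Rightarrow> 'om \<Rightarrow> 'on \<Rightarrow> 'an \<Rightarrow> 'am"
  assumes tr_bij: "\<And>k m n. \<lbrakk>k \<in> Ob K; m \<in> Ob M; n \<in> Ob N\<rbrakk> \<Longrightarrow>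
      bij_betw (tr k m n) (hom N (fob ten (k, m)) n) (hom M m (fob hm (k, n)))"
    and tr_nat: "\<And>u k k' v m m' w n n' h. \<lbrakk>u \<in> hom K k' k; v \<in> hom M m' m; w \<in> hom N n n'; h \<in> hom N (fob ten (k, m)) n\<rbrakk> \<Longrightarrow>
      tr k' m' n' (w \<cdot>\<^bsub>N\<^esub> h \<cdot>\<^bsub>N\<^esub> far ten (u, v)) = far hm (u, w) \<cdot>\<^bsub>M\<^esub> tr k m n h \<cdot>\<^bsub>M\<^esub> v"
begin

lemma tr_hom:
  assumes "k \<in> Ob K" "m \<in> Ob M" "h \<in> Ar N" "Dom N h = fob ten (k, m)" "Cod N h = n"
  shows "tr k m n h \<in> Ar M" "Dom M (tr k m n h) = m" "Cod M (tr k m n h) = fob hm (k, n)"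
  using bij_betwE[OF tr_bij, of k m n] assms by (auto simp add: hom_def)

lemmas tr_hom_simps [simp] = tr_hom

lemma tr_inj:
  assumes "k \<in> Ob K" "m \<in> Ob M" "h \<in> Ar N" "Dom N h = fob ten (k, m)" "Cod N h = n"
    "h' \<in> Ar N" "Dom N h' = fob ten (k, m)" "Cod N h' = n"  "tr k m n h = tr k m n h'"
  shows "h = h'"
  using bij_betw_imp_inj_on[OF tr_bij, of k m n] assms by (auto simp add: hom_def inj_on_def)

lemma tr_surj:
  assumes "k \<in> Ob K" "m \<in> Ob M" "n \<in> Ob N" "g \<in> Ar M" "Dom M g = m" "Cod M g = fob hm (k, n)"
  obtains h where "h \<in> Ar N" "Dom N h = fob ten (k, m)" "Cod N h = n" "tr k m n h = g"
proof -
  have "g \<in> tr k m n ` hom N (fob ten (k, m)) n"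
    using bij_betw_imp_surj_on[OF tr_bij, of k m n] assms by (auto simp: hom_def)
  then show ?thesis using that by (auto simp: hom_def)
qed

lemma tr_right:
  assumes "k \<in> Ob K" "v \<in> Ar M" "h \<in> Ar N" "Dom N h = fob ten (k, Cod M v)" "Cod N h = n" "m' = Dom M v"
  shows "tr k m' n (h \<cdot>\<^bsub>N\<^esub> far ten (Idt K k, v)) = tr k (Cod M v) n h \<cdot>\<^bsub>M\<^esub> v"
  using tr_nat[of "Idt K k" k k v "Dom M v" "Cod M v" "Idt N (Cod N h)" "Cod N h" "Cod N h" h] assms N.cod_ob[of h]
  by (auto simp add: hom_def)

lemma tr_left:
  assumes "u \<in> Ar K" "m \<in> Ob M" "h \<in> Ar N" "Dom N h = fob ten (Cod K u, m)" "Cod N h = n" "k' = Dom K u"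
  shows "tr k' m n (h \<cdot>\<^bsub>N\<^esub> far ten (u, Idt M m)) = far hm (u, Idt N n) \<cdot>\<^bsub>M\<^esub> tr (Cod K u) m n h"
  using tr_nat[of u k' "Cod K u" "Idt M m" m m "Idt N n" n n h] assms N.cod_ob[of h]
  by (auto simp add: hom_def)

lemma tr_post:
  assumes "k \<in> Ob K" "m \<in> Ob M" "h \<in> Ar N" "Dom N h = fob ten (k, m)" "Cod N h = Dom N w" "w \<in> Ar N" "n' = Cod N w"
  shows "tr k m n' (w \<cdot>\<^bsub>N\<^esub> h) = far hm (Idt K k, w) \<cdot>\<^bsub>M\<^esub> tr k m (Dom N w) h"
  using tr_nat[of "Idt K k" k k "Idt M m" m m w "Dom N w" "Cod N w" h] assms by (simp add: hom_def)

lemma tr_natural: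
  assumes "u \<in> Ar K" "v \<in> Ar M" "w \<in> Ar N" "h \<in> Ar N" "Dom N h = fob ten (Cod K u, Cod M v)" "Cod N h = Dom N w"
    "k = Dom K u" "m = Dom M v" "n = Cod N w"
  shows "tr k m n (w \<cdot>\<^bsub>N\<^esub> h \<cdot>\<^bsub>N\<^esub> far ten (u, v)) =
    far hm (u, w) \<cdot>\<^bsub>M\<^esub> tr (Cod K u) (Cod M v) (Dom N w) h \<cdot>\<^bsub>M\<^esub> v"
  using tr_nat[of u "Dom K u" "Cod K u" v "Dom M v" "Cod M v" w "Dom N w" "Cod N w" h] assms
  by (simp add: hom_def)

end

text \<open>Pushout-products given by the universal property of their domains. In contrast to a choice of
pushouts of ordered pairs, this description is invariant under exchange of the two arguments up
to renaming the legs (\<open>pushout_data_swap\<close>).\<close>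

locale pushout_data = bifunctor K M N ten
  for K :: "('ok, 'ak, 'zk) cat_scheme" and M :: "('om, 'am, 'zm) cat_scheme" and N :: "('on, 'an, 'zn) cat_scheme"
    and ten :: "('ok \<times> 'om, 'ak \<times> 'am, 'on, 'an) cfun" +
  fixes PP :: "('ak \<times> 'am, 'ak square \<times> 'am square, 'an, 'an square) cfun"
    and inj1 inj2 :: "'ak \<Rightarrow> 'am \<Rightarrow> 'an"
  assumes inj: "\<And>i j. \<lbrakk>i \<in> Ar K; j \<in> Ar M\<rbrakk> \<Longrightarrow> inj1 i j \<in> Ar N \<and> inj2 i j \<in> Ar N \<and>
      Dom N (inj1 i j) = fob ten (Dom K i, Cod M j) \<and> Dom N (inj2 i j) = fob ten (Cod K i, Dom M j) \<and>
      Cod N (inj1 i j) = Dom N (fob PP (i, j)) \<and> Cod N (inj2 i j) = Dom N (fob PP (i, j)) \<and>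
      inj1 i j \<cdot>\<^bsub>N\<^esub> far ten (Idt K (Dom K i), j) = inj2 i j \<cdot>\<^bsub>N\<^esub> far ten (i, Idt M (Dom M j))"
    and po_ex: "\<And>i j x y n. \<lbrakk>i \<in> Ar K; j \<in> Ar M; x \<in> hom N (fob ten (Dom K i, Cod M j)) n;
      y \<in> hom N (fob ten (Cod K i, Dom M j)) n;
      x \<cdot>\<^bsub>N\<^esub> far ten (Idt K (Dom K i), j) = y \<cdot>\<^bsub>N\<^esub> far ten (i, Idt M (Dom M j))\<rbrakk> \<Longrightarrow>
      \<exists>h\<in>hom N (Dom N (fob PP (i, j))) n. h \<cdot>\<^bsub>N\<^esub> inj1 i j = x \<and> h \<cdot>\<^bsub>N\<^esub> inj2 i j = y"
    and po_eq: "\<And>i j h h' n. \<lbrakk>i \<in> Ar K; j \<in> Ar M; h \<in> hom N (Dom N (fob PP (i, j))) n; h' \<in> hom N (Dom N (fob PP (i, j))) n;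
      h \<cdot>\<^bsub>N\<^esub> inj1 i j = h' \<cdot>\<^bsub>N\<^esub> inj1 i j; h \<cdot>\<^bsub>N\<^esub> inj2 i j = h' \<cdot>\<^bsub>N\<^esub> inj2 i j\<rbrakk> \<Longrightarrow> h = h'"
    and PP: "\<And>i j. \<lbrakk>i \<in> Ar K; j \<in> Ar M\<rbrakk> \<Longrightarrow> fob PP (i, j) \<in> Ar N \<and>
      Cod N (fob PP (i, j)) = fob ten (Cod K i, Cod M j) \<and>
      fob PP (i, j) \<cdot>\<^bsub>N\<^esub> inj1 i j = far ten (i, Idt M (Cod M j)) \<and>
      fob PP (i, j) \<cdot>\<^bsub>N\<^esub> inj2 i j = far ten (Idt K (Cod K i), j)"
    and PP_far: "\<And>i i' u v j j' u' v'. \<lbrakk>square K i i' u v; square M j j' u' v'\<rbrakk> \<Longrightarrow>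
      \<exists>w\<in>hom N (Dom N (fob PP (i, j))) (Dom N (fob PP (i', j'))).
        far PP (Sq i i' u v, Sq j j' u' v') = Sq (fob PP (i, j)) (fob PP (i', j')) w (far ten (v, v')) \<and>
        w \<cdot>\<^bsub>N\<^esub> inj1 i j = inj1 i' j' \<cdot>\<^bsub>N\<^esub> far ten (u, v') \<and>
        w \<cdot>\<^bsub>N\<^esub> inj2 i j = inj2 i' j' \<cdot>\<^bsub>N\<^esub> far ten (v, u')"

locale pullback_data = op_bifunctor K N M hm
  for K :: "('ok, 'ak, 'zk) cat_scheme" and N :: "('on, 'an, 'zn) cat_scheme" and M :: "('om, 'am, 'zm) cat_scheme"
    and hm :: "('ok \<times> 'on, 'ak \<times> 'an, 'om, 'am) cfun" +
  fixes PH :: "('ak \<times> 'an, 'ak square \<times> 'an square, 'am, 'am square) cfun"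
    and p1 p2 :: "'ak \<Rightarrow> 'an \<Rightarrow> 'am"
  assumes proj: "\<And>i f. \<lbrakk>i \<in> Ar K; f \<in> Ar N\<rbrakk> \<Longrightarrow> p1 i f \<in> Ar M \<and> p2 i f \<in> Ar M \<and>
      Cod M (p1 i f) = fob hm (Cod K i, Cod N f) \<and> Cod M (p2 i f) = fob hm (Dom K i, Dom N f) \<and>
      Dom M (p1 i f) = Cod M (fob PH (i, f)) \<and> Dom M (p2 i f) = Cod M (fob PH (i, f)) \<and>
      far hm (i, Idt N (Cod N f)) \<cdot>\<^bsub>M\<^esub> p1 i f = far hm (Idt K (Dom K i), f) \<cdot>\<^bsub>M\<^esub> p2 i f"
    and pb_ex: "\<And>i f x y m. \<lbrakk>i \<in> Ar K; f \<in> Ar N; x \<in> hom M m (fob hm (Cod K i, Cod N f));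
      y \<in> hom M m (fob hm (Dom K i, Dom N f));
      far hm (i, Idt N (Cod N f)) \<cdot>\<^bsub>M\<^esub> x = far hm (Idt K (Dom K i), f) \<cdot>\<^bsub>M\<^esub> y\<rbrakk> \<Longrightarrow>
      \<exists>h\<in>hom M m (Cod M (fob PH (i, f))). p1 i f \<cdot>\<^bsub>M\<^esub> h = x \<and> p2 i f \<cdot>\<^bsub>M\<^esub> h = y"
    and pb_eq: "\<And>i f h h' m. \<lbrakk>i \<in> Ar K; f \<in> Ar N; h \<in> hom M m (Cod M (fob PH (i, f))); h' \<in> hom M m (Cod M (fob PH (i, f)));
      p1 i f \<cdot>\<^bsub>M\<^esub> h = p1 i f \<cdot>\<^bsub>M\<^esub> h'; p2 i f \<cdot>\<^bsub>M\<^esub> h = p2 i f \<cdot>\<^bsub>M\<^esub> h'\<rbrakk> \<Longrightarrow> h = h'"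
    and PH: "\<And>i f. \<lbrakk>i \<in> Ar K; f \<in> Ar N\<rbrakk> \<Longrightarrow> fob PH (i, f) \<in> Ar M \<and>
      Dom M (fob PH (i, f)) = fob hm (Cod K i, Dom N f) \<and>
      p1 i f \<cdot>\<^bsub>M\<^esub> fob PH (i, f) = far hm (Idt K (Cod K i), f) \<and>
      p2 i f \<cdot>\<^bsub>M\<^esub> fob PH (i, f) = far hm (i, Idt N (Dom N f))"
    and PH_far: "\<And>i i' u v f f' u' v'. \<lbrakk>square K i' i u v; square N f f' u' v'\<rbrakk> \<Longrightarrow>
      \<exists>w\<in>hom M (Cod M (fob PH (i, f))) (Cod M (fob PH (i', f'))).
        far PH (Sq i' i u v, Sq f f' u' v') = Sq (fob PH (i, f)) (fob PH (i', f')) (far hm (v, u')) w \<and>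
        p1 i' f' \<cdot>\<^bsub>M\<^esub> w = far hm (v, v') \<cdot>\<^bsub>M\<^esub> p1 i f \<and>
        p2 i' f' \<cdot>\<^bsub>M\<^esub> w = far hm (u, u') \<cdot>\<^bsub>M\<^esub> p2 i f"

text \<open>The transposition of squares is only given by its formula in components; that it is bijective and
natural is a consequence.\<close>

locale square_adjunction =
  K: elementary_awfs K + M: elementary_awfs M + N: elementary_awfs N +
  parametric_adjunction K M N ten hm tr + T?: pushout_data K M N ten PP inj1 inj2 +
  H?: pullback_data K N M hm PH p1 p2
  for K :: "('ok, 'ak) awfs_cat" and M :: "('om, 'am) awfs_cat" and N :: "('on, 'an) awfs_cat"
    and ten :: "('ok \<times> 'om, 'ak \<times> 'am, 'on, 'an) cfun" and hm :: "('ok \<times> 'on, 'ak \<times> 'an, 'om, 'am) cfun"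
    and tr :: "'ok \<Rightarrow> 'om \<Rightarrow> 'on \<Rightarrow> 'an \<Rightarrow> 'am"
    and PP :: "('ak \<times> 'am, 'ak square \<times> 'am square, 'an, 'an square) cfun"
    and inj1 inj2 :: "'ak \<Rightarrow> 'am \<Rightarrow> 'an"
    and PH :: "('ak \<times> 'an, 'ak square \<times> 'an square, 'am, 'am square) cfun"
    and p1 p2 :: "'ak \<Rightarrow> 'an \<Rightarrow> 'am" +
  fixes tr_sq :: "'ak \<Rightarrow> 'am \<Rightarrow> 'an \<Rightarrow> 'an square \<Rightarrow> 'am square"
  assumes tr_sq: "\<And>i j f w b. \<lbrakk>i \<in> Ar K; j \<in> Ar M; square N (fob PP (i, j)) f w b\<rbrakk> \<Longrightarrow>
      \<exists>z\<in>hom M (Cod M j) (Cod M (fob PH (i, f))).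
        tr_sq i j f (Sq (fob PP (i, j)) f w b) =
          Sq j (fob PH (i, f)) (tr (Cod K i) (Dom M j) (Dom N f) (w \<cdot>\<^bsub>N\<^esub> inj2 i j)) z \<and>
        p1 i f \<cdot>\<^bsub>M\<^esub> z = tr (Cod K i) (Cod M j) (Cod N f) b \<and>
        p2 i f \<cdot>\<^bsub>M\<^esub> z = tr (Dom K i) (Cod M j) (Dom N f) (w \<cdot>\<^bsub>N\<^esub> inj1 i j)"
begin

lemma inj_simps [simp]:
  assumes "i \<in> Ar K" "j \<in> Ar M"
  shows "inj1 i j \<in> Ar N" "inj2 i j \<in> Ar N"
    "Dom N (inj1 i j) = fob ten (Dom K i, Cod M j)" "Dom N (inj2 i j) = fob ten (Cod K i, Dom M j)"
    "Cod N (inj1 i j) = Dom N (fob PP (i, j))" "Cod N (inj2 i j) = Dom N (fob PP (i, j))"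
    "fob PP (i, j) \<in> Ar N" "Cod N (fob PP (i, j)) = fob ten (Cod K i, Cod M j)"
    "fob PP (i, j) \<cdot>\<^bsub>N\<^esub> inj1 i j = far ten (i, Idt M (Cod M j))"
    "fob PP (i, j) \<cdot>\<^bsub>N\<^esub> inj2 i j = far ten (Idt K (Cod K i), j)"
  using inj[OF assms] PP[OF assms] by auto

lemma proj_simps [simp]:
  assumes "i \<in> Ar K" "f \<in> Ar N"
  shows "p1 i f \<in> Ar M" "p2 i f \<in> Ar M"
    "Cod M (p1 i f) = fob hm (Cod K i, Cod N f)" "Cod M (p2 i f) = fob hm (Dom K i, Dom N f)"
    "Dom M (p1 i f) = Cod M (fob PH (i, f))" "Dom M (p2 i f) = Cod M (fob PH (i, f))"
    "fob PH (i, f) \<in> Ar M" "Dom M (fob PH (i, f)) = fob hm (Cod K i, Dom N f)"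
    "p1 i f \<cdot>\<^bsub>M\<^esub> fob PH (i, f) = far hm (Idt K (Cod K i), f)"
    "p2 i f \<cdot>\<^bsub>M\<^esub> fob PH (i, f) = far hm (i, Idt N (Dom N f))"
  using proj[OF assms] PH[OF assms] by auto

lemma inj_comm:
  assumes "i \<in> Ar K" "j \<in> Ar M"
  shows "inj1 i j \<cdot>\<^bsub>N\<^esub> far ten (Idt K (Dom K i), j) = inj2 i j \<cdot>\<^bsub>N\<^esub> far ten (i, Idt M (Dom M j))"
  using inj[OF assms] by auto

lemma proj_comm:
  assumes "i \<in> Ar K" "f \<in> Ar N"
  shows "far hm (i, Idt N (Cod N f)) \<cdot>\<^bsub>M\<^esub> p1 i f = far hm (Idt K (Dom K i), f) \<cdot>\<^bsub>M\<^esub> p2 i f"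
  using proj[OF assms] by auto

text \<open>A square \<open>(w, b)\<close> from the pushout-product of \<open>i\<close> and \<open>j\<close> to \<open>f\<close> consists of three maps
\<open>w \<cdot> inj2\<close>, \<open>b\<close> and \<open>w \<cdot> inj1\<close>. The transposed square \<open>(c, z)\<close> is the one whose three
components \<open>c\<close>, \<open>p1 \<cdot> z\<close> and \<open>p2 \<cdot> z\<close> are their transposes. As a relation, it can be read in
both directions.\<close>

definition transposed :: "'ak \<Rightarrow> 'am \<Rightarrow> 'an \<Rightarrow> 'an \<Rightarrow> 'an \<Rightarrow> 'am \<Rightarrow> 'am \<Rightarrow> bool" where
  "transposed i j f w b c z \<longleftrightarrow> i \<in> Ar K \<and> j \<in> Ar M \<and> f \<in> Ar N \<and>
     square N (fob PP (i, j)) f w b \<and> square M j (fob PH (i, f)) c z \<and>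
     c = tr (Cod K i) (Dom M j) (Dom N f) (w \<cdot>\<^bsub>N\<^esub> inj2 i j) \<and>
     p1 i f \<cdot>\<^bsub>M\<^esub> z = tr (Cod K i) (Cod M j) (Cod N f) b \<and>
     p2 i f \<cdot>\<^bsub>M\<^esub> z = tr (Dom K i) (Cod M j) (Dom N f) (w \<cdot>\<^bsub>N\<^esub> inj1 i j)"

lemma transposedD:
  assumes "transposed i j f w b c z"
  shows "i \<in> Ar K" "j \<in> Ar M" "f \<in> Ar N" "square N (fob PP (i, j)) f w b" "square M j (fob PH (i, f)) c z"
     "tr (Cod K i) (Dom M j) (Dom N f) (w \<cdot>\<^bsub>N\<^esub> inj2 i j) = c"
     "p1 i f \<cdot>\<^bsub>M\<^esub> z = tr (Cod K i) (Cod M j) (Cod N f) b"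
     "p2 i f \<cdot>\<^bsub>M\<^esub> z = tr (Dom K i) (Cod M j) (Dom N f) (w \<cdot>\<^bsub>N\<^esub> inj1 i j)"
  using assms by (auto simp: transposed_def)

lemma squareI_PP:
  assumes [simp]: "i \<in> Ar K" "j \<in> Ar M" "f \<in> Ar N" "w \<in> Ar N" "b \<in> Ar N"
    "Dom N w = Dom N (fob PP (i, j))" "Cod N w = Dom N f"
    "Dom N b = fob ten (Cod K i, Cod M j)" "Cod N b = Cod N f"
    and 1: "f \<cdot>\<^bsub>N\<^esub> w \<cdot>\<^bsub>N\<^esub> inj1 i j = b \<cdot>\<^bsub>N\<^esub> far ten (i, Idt M (Cod M j))"
    and 2: "f \<cdot>\<^bsub>N\<^esub> w \<cdot>\<^bsub>N\<^esub> inj2 i j = b \<cdot>\<^bsub>N\<^esub> far ten (Idt K (Cod K i), j)"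
  shows "square N (fob PP (i, j)) f w b"
proof -
  have "f \<cdot>\<^bsub>N\<^esub> w = b \<cdot>\<^bsub>N\<^esub> fob PP (i, j)"
    by (rule po_eq[of i j _ "Cod N f"]) (simp_all add: 1 2 hom_def)
  then show ?thesis by (simp add: square_def)
qed

lemma squareI_PH:
  assumes [simp]: "i \<in> Ar K" "j \<in> Ar M" "f \<in> Ar N" "c \<in> Ar M" "z \<in> Ar M"
    "Dom M c = Dom M j" "Cod M c = fob hm (Cod K i, Dom N f)"
    "Dom M z = Cod M j" "Cod M z = Cod M (fob PH (i, f))"
    and 1: "far hm (Idt K (Cod K i), f) \<cdot>\<^bsub>M\<^esub> c = p1 i f \<cdot>\<^bsub>M\<^esub> z \<cdot>\<^bsub>M\<^esub> j"
    and 2: "far hm (i, Idt N (Dom N f)) \<cdot>\<^bsub>M\<^esub> c = p2 i f \<cdot>\<^bsub>M\<^esub> z \<cdot>\<^bsub>M\<^esub> j"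
  shows "square M j (fob PH (i, f)) c z"
proof -
  have "fob PH (i, f) \<cdot>\<^bsub>M\<^esub> c = z \<cdot>\<^bsub>M\<^esub> j"
    by (rule pb_eq[of i f _ "Dom M j"])
      (use M.cmp_extend[OF proj_simps(9), of i f c] M.cmp_extend[OF proj_simps(10), of i f c] in
        \<open>simp_all add: 1 2 hom_def\<close>)
  then show ?thesis by (simp add: square_def)
qed

lemma transposed_ex:
  assumes [simp]: "i \<in> Ar K" "j \<in> Ar M" and sq: "square N (fob PP (i, j)) f w b"
  obtains c z where "transposed i j f w b c z" "tr_sq i j f (Sq (fob PP (i, j)) f w b) = Sq j (fob PH (i, f)) c z"
proof -
  note D [simp] = N.squareD[OF sq]
  obtain z where z: "z \<in> hom M (Cod M j) (Cod M (fob PH (i, f)))"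
    "tr_sq i j f (Sq (fob PP (i, j)) f w b) =
          Sq j (fob PH (i, f)) (tr (Cod K i) (Dom M j) (Dom N f) (w \<cdot>\<^bsub>N\<^esub> inj2 i j)) z"
    and pz: "p1 i f \<cdot>\<^bsub>M\<^esub> z = tr (Cod K i) (Cod M j) (Cod N f) b"
    "p2 i f \<cdot>\<^bsub>M\<^esub> z = tr (Dom K i) (Cod M j) (Dom N f) (w \<cdot>\<^bsub>N\<^esub> inj1 i j)"
    using tr_sq[OF assms(1,2) sq] by blast
  have [simp]: "z \<in> Ar M" "Dom M z = Cod M j" "Cod M z = Cod M (fob PH (i, f))"
    using z by (auto simp: hom_def)
  have fw: "f \<cdot>\<^bsub>N\<^esub> w = b \<cdot>\<^bsub>N\<^esub> fob PP (i, j)" using sq by (simp add: square_def)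
  have "far hm (Idt K (Cod K i), f) \<cdot>\<^bsub>M\<^esub> tr (Cod K i) (Dom M j) (Dom N f) (w \<cdot>\<^bsub>N\<^esub> inj2 i j) =
      tr (Cod K i) (Dom M j) (Cod N f) (f \<cdot>\<^bsub>N\<^esub> w \<cdot>\<^bsub>N\<^esub> inj2 i j)"
    using tr_post[of "Cod K i" "Dom M j" "w \<cdot>\<^bsub>N\<^esub> inj2 i j" f] by simp
  also have "\<dots> = tr (Cod K i) (Dom M j) (Cod N f) (b \<cdot>\<^bsub>N\<^esub> far ten (Idt K (Cod K i), j))"
    using N.cmp_extend2[OF fw, of "inj2 i j"] by simp
  also have "\<dots> = p1 i f \<cdot>\<^bsub>M\<^esub> z \<cdot>\<^bsub>M\<^esub> j"
    using tr_right[of "Cod K i" j b "Cod N f"] M.cmp_extend[OF pz(1), of j] by simp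
  finally have 1: "far hm (Idt K (Cod K i), f) \<cdot>\<^bsub>M\<^esub> tr (Cod K i) (Dom M j) (Dom N f) (w \<cdot>\<^bsub>N\<^esub> inj2 i j) = p1 i f \<cdot>\<^bsub>M\<^esub> z \<cdot>\<^bsub>M\<^esub> j" .
  have "far hm (i, Idt N (Dom N f)) \<cdot>\<^bsub>M\<^esub> tr (Cod K i) (Dom M j) (Dom N f) (w \<cdot>\<^bsub>N\<^esub> inj2 i j) =
      tr (Dom K i) (Dom M j) (Dom N f) (w \<cdot>\<^bsub>N\<^esub> inj2 i j \<cdot>\<^bsub>N\<^esub> far ten (i, Idt M (Dom M j)))"
    using tr_left[of i "Dom M j" "w \<cdot>\<^bsub>N\<^esub> inj2 i j" "Dom N f"] by simp
  also have "\<dots> = tr (Dom K i) (Dom M j) (Dom N f) ((w \<cdot>\<^bsub>N\<^esub> inj1 i j) \<cdot>\<^bsub>N\<^esub> far ten (Idt K (Dom K i), j))"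
    by (simp add: inj_comm)
  also have "\<dots> = p2 i f \<cdot>\<^bsub>M\<^esub> z \<cdot>\<^bsub>M\<^esub> j"
    using tr_right[of "Dom K i" j "w \<cdot>\<^bsub>N\<^esub> inj1 i j" "Dom N f"] M.cmp_extend[OF pz(2), of j] by simp
  finally have 2: "far hm (i, Idt N (Dom N f)) \<cdot>\<^bsub>M\<^esub> tr (Cod K i) (Dom M j) (Dom N f) (w \<cdot>\<^bsub>N\<^esub> inj2 i j) = p2 i f \<cdot>\<^bsub>M\<^esub> z \<cdot>\<^bsub>M\<^esub> j" .
  have "square M j (fob PH (i, f)) (tr (Cod K i) (Dom M j) (Dom N f) (w \<cdot>\<^bsub>N\<^esub> inj2 i j)) z"
    by (rule squareI_PH) (simp_all add: 1 2)
  then show ?thesis using that[OF _ z(2)] sq pz by (simp add: transposed_def)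
qed

lemma transposed_ex':
  assumes [simp]: "i \<in> Ar K" "j \<in> Ar M" "f \<in> Ar N" and sq: "square M j (fob PH (i, f)) c z"
  obtains w b where "transposed i j f w b c z"
proof -
  note D [simp] = M.squareD[OF sq]
  obtain c' where c': "c' \<in> Ar N" "Dom N c' = fob ten (Cod K i, Dom M j)" "Cod N c' = Dom N f"
    "tr (Cod K i) (Dom M j) (Dom N f) c' = c"
    by (rule tr_surj[of "Cod K i" "Dom M j" "Dom N f" c]) simp_all
  obtain b where b: "b \<in> Ar N" "Dom N b = fob ten (Cod K i, Cod M j)" "Cod N b = Cod N f"
    "tr (Cod K i) (Cod M j) (Cod N f) b = p1 i f \<cdot>\<^bsub>M\<^esub> z"
    by (rule tr_surj[of "Cod K i" "Cod M j" "Cod N f" "p1 i f \<cdot>\<^bsub>M\<^esub> z"]) simp_all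
  obtain a where a: "a \<in> Ar N" "Dom N a = fob ten (Dom K i, Cod M j)" "Cod N a = Dom N f"
    "tr (Dom K i) (Cod M j) (Dom N f) a = p2 i f \<cdot>\<^bsub>M\<^esub> z"
    by (rule tr_surj[of "Dom K i" "Cod M j" "Dom N f" "p2 i f \<cdot>\<^bsub>M\<^esub> z"]) simp_all
  note [simp] = c'(1-3) b(1-3) a(1-3)
  have PHc: "fob PH (i, f) \<cdot>\<^bsub>M\<^esub> c = z \<cdot>\<^bsub>M\<^esub> j" using sq by (simp add: square_def)
  have "a \<cdot>\<^bsub>N\<^esub> far ten (Idt K (Dom K i), j) = c' \<cdot>\<^bsub>N\<^esub> far ten (i, Idt M (Dom M j))"
  proof (rule tr_inj[of "Dom K i" "Dom M j" _ "Dom N f"])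
    show "tr (Dom K i) (Dom M j) (Dom N f) (a \<cdot>\<^bsub>N\<^esub> far ten (Idt K (Dom K i), j)) =
        tr (Dom K i) (Dom M j) (Dom N f) (c' \<cdot>\<^bsub>N\<^esub> far ten (i, Idt M (Dom M j)))"
      using M.cmp_extend[OF proj_simps(10), of i f c] PHc
      by (simp add: tr_left[of i] tr_right[of _ j] c'(4) a(4))
  qed simp_all
  then obtain w where w: "w \<in> hom N (Dom N (fob PP (i, j))) (Dom N f)" "w \<cdot>\<^bsub>N\<^esub> inj1 i j = a" "w \<cdot>\<^bsub>N\<^esub> inj2 i j = c'"
    using po_ex[of i j a "Dom N f" c'] by (auto simp: hom_def)
  have [simp]: "w \<in> Ar N" "Dom N w = Dom N (fob PP (i, j))" "Cod N w = Dom N f"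
    using w by (auto simp: hom_def)
  have 1: "f \<cdot>\<^bsub>N\<^esub> a = b \<cdot>\<^bsub>N\<^esub> far ten (i, Idt M (Cod M j))"
  proof (rule tr_inj[of "Dom K i" "Cod M j" _ "Cod N f"])
    show "tr (Dom K i) (Cod M j) (Cod N f) (f \<cdot>\<^bsub>N\<^esub> a) =
      tr (Dom K i) (Cod M j) (Cod N f) (b \<cdot>\<^bsub>N\<^esub> far ten (i, Idt M (Cod M j)))"
      using M.cmp_extend2[OF proj_comm, of i f z]
      by (simp add: tr_post[of _ _ a f] tr_left[of i] a(4) b(4))
  qed simp_all
  have 2: "f \<cdot>\<^bsub>N\<^esub> c' = b \<cdot>\<^bsub>N\<^esub> far ten (Idt K (Cod K i), j)"
  proof (rule tr_inj[of "Cod K i" "Dom M j" _ "Cod N f"])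
    show "tr (Cod K i) (Dom M j) (Cod N f) (f \<cdot>\<^bsub>N\<^esub> c') =
      tr (Cod K i) (Dom M j) (Cod N f) (b \<cdot>\<^bsub>N\<^esub> far ten (Idt K (Cod K i), j))"
      using M.cmp_extend[OF proj_simps(9), of i f c] PHc
      by (simp add: tr_post[of _ _ c' f] tr_right[of _ j] c'(4) b(4))
  qed simp_all
  have "square N (fob PP (i, j)) f w b" by (rule squareI_PP) (simp_all add: w 1 2)
  then have "transposed i j f w b c z" using sq w c'(4) a(4) b(4) by (simp add: transposed_def)
  then show ?thesis by (rule that)
qed

lemma transposed_unique:
  assumes 1: "transposed i j f w b c z" and 2: "transposed i j f w b c' z'"
  shows "c' = c" "z' = z"
proof -
  note D1 = transposedD[OF 1] and D2 = transposedD[OF 2]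
  show "c' = c" using D1 D2 by simp
  show "z' = z" by (rule pb_eq[of i f _ "Cod M j"])
      (use D1 D2 M.squareD[OF D1(5)] M.squareD[OF D2(5)] in \<open>simp_all add: hom_def\<close>)
qed

lemma transposed_unique':
  assumes 1: "transposed i j f w b c z" and 2: "transposed i j f w' b' c z"
  shows "w' = w" "b' = b"
proof -
  note D1 = transposedD[OF 1] and D2 = transposedD[OF 2]
  note [simp] = D1(1,2,3) N.squareD[OF D1(4)] N.squareD[OF D2(4)]
  show "b' = b"
    by (rule tr_inj[of "Cod K i" "Cod M j" _ "Cod N f"]) (use D1(7) D2(7) in simp_all)
  have 3: "w' \<cdot>\<^bsub>N\<^esub> inj1 i j = w \<cdot>\<^bsub>N\<^esub> inj1 i j"
    by (rule tr_inj[of "Dom K i" "Cod M j" _ "Dom N f"]) (use D1(8) D2(8) in simp_all)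
  have 4: "w' \<cdot>\<^bsub>N\<^esub> inj2 i j = w \<cdot>\<^bsub>N\<^esub> inj2 i j"
    by (rule tr_inj[of "Cod K i" "Dom M j" _ "Dom N f"]) (use D1(6) D2(6) in simp_all)
  show "w' = w" by (rule po_eq[of i j _ "Dom N f"]) (simp_all add: hom_def 3 4)
qed

lemma tr_sq_iff:
  assumes "i \<in> Ar K" "j \<in> Ar M" "square N (fob PP (i, j)) f w b"
  shows "tr_sq i j f (Sq (fob PP (i, j)) f w b) = Sq j (fob PH (i, f)) c z \<longleftrightarrow> transposed i j f w b c z"
  using transposed_ex[OF assms] transposed_unique by (metis square.inject)

lemma PP_farE:
  assumes "square K i i' u v" "square M j j' u' v'"
  obtains w where "far PP (Sq i i' u v, Sq j j' u' v') = Sq (fob PP (i, j)) (fob PP (i', j')) w (far ten (v, v'))"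
    "w \<in> Ar N" "Dom N w = Dom N (fob PP (i, j))" "Cod N w = Dom N (fob PP (i', j'))"
    "w \<cdot>\<^bsub>N\<^esub> inj1 i j = inj1 i' j' \<cdot>\<^bsub>N\<^esub> far ten (u, v')"
    "w \<cdot>\<^bsub>N\<^esub> inj2 i j = inj2 i' j' \<cdot>\<^bsub>N\<^esub> far ten (v, u')"
  using PP_far[OF assms] by (auto simp: hom_def)

lemma PH_farE:
  assumes "square K i' i u v" "square N f f' u' v'"
  obtains w where "far PH (Sq i' i u v, Sq f f' u' v') = Sq (fob PH (i, f)) (fob PH (i', f')) (far hm (v, u')) w"
    "w \<in> Ar M" "Dom M w = Cod M (fob PH (i, f))" "Cod M w = Cod M (fob PH (i', f'))"
    "p1 i' f' \<cdot>\<^bsub>M\<^esub> w = far hm (v, v') \<cdot>\<^bsub>M\<^esub> p1 i f"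
    "p2 i' f' \<cdot>\<^bsub>M\<^esub> w = far hm (u, u') \<cdot>\<^bsub>M\<^esub> p2 i f"
  using PH_far[OF assms] by (auto simp: hom_def)

lemma PP_square:
  assumes "square K i i' u v" "square M j j' u' v'"
    "far PP (Sq i i' u v, Sq j j' u' v') = Sq x y w b"
  shows "square N (fob PP (i, j)) (fob PP (i', j')) w (far ten (v, v'))"
    "x = fob PP (i, j)" "y = fob PP (i', j')" "b = far ten (v, v')"
proof -
  obtain w' where w': "far PP (Sq i i' u v, Sq j j' u' v') = Sq (fob PP (i, j)) (fob PP (i', j')) w' (far ten (v, v'))"
    "w' \<in> Ar N" "Dom N w' = Dom N (fob PP (i, j))" "Cod N w' = Dom N (fob PP (i', j'))"
    "w' \<cdot>\<^bsub>N\<^esub> inj1 i j = inj1 i' j' \<cdot>\<^bsub>N\<^esub> far ten (u, v')"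
    "w' \<cdot>\<^bsub>N\<^esub> inj2 i j = inj2 i' j' \<cdot>\<^bsub>N\<^esub> far ten (v, u')"
    by (rule PP_farE[OF assms(1,2)])
  show "x = fob PP (i, j)" "y = fob PP (i', j')" "b = far ten (v, v')" using w'(1) assms(3) by simp_all
  note [simp] = K.squareD[OF assms(1)] M.squareD[OF assms(2)] w'(2-6)
  have [simp]: "i' \<cdot>\<^bsub>K\<^esub> u = v \<cdot>\<^bsub>K\<^esub> i" "j' \<cdot>\<^bsub>M\<^esub> u' = v' \<cdot>\<^bsub>M\<^esub> j" using assms by (simp_all add: square_def)
  have "square N (fob PP (i, j)) (fob PP (i', j')) w' (far ten (v, v'))"
    by (rule squareI_PP)
      (use N.cmp_extend[OF inj_simps(9), of i' j' "far ten (u, v')"] N.cmp_extend[OF inj_simps(10), of i' j' "far ten (v, u')"] in simp_all)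
  then show "square N (fob PP (i, j)) (fob PP (i', j')) w (far ten (v, v'))" using w'(1) assms(3) by simp
qed

lemma PH_square:
  assumes "square K i' i u v" "square N f f' u' v'"
    "far PH (Sq i' i u v, Sq f f' u' v') = Sq x y c w"
  shows "square M (fob PH (i, f)) (fob PH (i', f')) (far hm (v, u')) w"
    "x = fob PH (i, f)" "y = fob PH (i', f')" "c = far hm (v, u')"
proof -
  obtain w' where w': "far PH (Sq i' i u v, Sq f f' u' v') = Sq (fob PH (i, f)) (fob PH (i', f')) (far hm (v, u')) w'"
    "w' \<in> Ar M" "Dom M w' = Cod M (fob PH (i, f))" "Cod M w' = Cod M (fob PH (i', f'))"
    "p1 i' f' \<cdot>\<^bsub>M\<^esub> w' = far hm (v, v') \<cdot>\<^bsub>M\<^esub> p1 i f"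
    "p2 i' f' \<cdot>\<^bsub>M\<^esub> w' = far hm (u, u') \<cdot>\<^bsub>M\<^esub> p2 i f"
    by (rule PH_farE[OF assms(1,2)])
  show "x = fob PH (i, f)" "y = fob PH (i', f')" "c = far hm (v, u')" using w'(1) assms(3) by simp_all
  note [simp] = K.squareD[OF assms(1)] N.squareD[OF assms(2)] w'(2-4)
  have [simp]: "i \<cdot>\<^bsub>K\<^esub> u = v \<cdot>\<^bsub>K\<^esub> i'" "f' \<cdot>\<^bsub>N\<^esub> u' = v' \<cdot>\<^bsub>N\<^esub> f" using assms by (simp_all add: square_def)
  have "square M (fob PH (i, f)) (fob PH (i', f')) (far hm (v, u')) w'"
    by (rule squareI_PH)
      (use M.cmp_extend2[OF w'(5), of "fob PH (i, f)"] M.cmp_extend2[OF w'(6), of "fob PH (i, f)"] in simp_all)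
  then show "square M (fob PH (i, f)) (fob PH (i', f')) (far hm (v, u')) w" using w'(1) assms(3) by simp
qed

lemma PP_functor: "cfunctor (prod_cat (arrow_cat K) (arrow_cat M)) (arrow_cat N) PP"
proof (intro cfunctor.intro cfunctor_axioms.intro prod_category K.arrow_category M.arrow_category N.arrow_category)
  fix x assume "x \<in> Ob (prod_cat (arrow_cat K) (arrow_cat M))"
  then obtain i j where x: "x = (i, j)" and [simp]: "i \<in> Ar K" "j \<in> Ar M" by auto
  show "fob PP x \<in> Ob (arrow_cat N)" by (simp add: x)
  note sq = K.square_idt[of i] M.square_idt[of j]
  obtain w where w: "far PP (Sq i i (Idt K (Dom K i)) (Idt K (Cod K i)), Sq j j (Idt M (Dom M j)) (Idt M (Cod M j)))
      = Sq (fob PP (i, j)) (fob PP (i, j)) w (far ten (Idt K (Cod K i), Idt M (Cod M j)))"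
    "w \<in> Ar N" "Dom N w = Dom N (fob PP (i, j))" "Cod N w = Dom N (fob PP (i, j))"
    "w \<cdot>\<^bsub>N\<^esub> inj1 i j = inj1 i j \<cdot>\<^bsub>N\<^esub> far ten (Idt K (Dom K i), Idt M (Cod M j))"
    "w \<cdot>\<^bsub>N\<^esub> inj2 i j = inj2 i j \<cdot>\<^bsub>N\<^esub> far ten (Idt K (Cod K i), Idt M (Dom M j))"
    by (rule PP_farE[OF sq]) simp_all
  have "w = Idt N (Dom N (fob PP (i, j)))"
    by (rule po_eq[of i j _ "Dom N (fob PP (i, j))"]) (simp_all add: w(2-6) hom_def)
  then show "far PP (Idt (prod_cat (arrow_cat K) (arrow_cat M)) x) = Idt (arrow_cat N) (fob PP x)"
    by (simp add: x w(1))
next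
  fix S assume "S \<in> Ar (prod_cat (arrow_cat K) (arrow_cat M))"
  then obtain i i' u v j j' u' v' where S: "S = (Sq i i' u v, Sq j j' u' v')"
    and sq: "square K i i' u v" "square M j j' u' v'"
    by (cases S, cases "fst S"; cases "snd S") (auto simp: arrow_cat_ar)
  show "far PP S \<in> hom (arrow_cat N) (fob PP (Dom (prod_cat (arrow_cat K) (arrow_cat M)) S))
      (fob PP (Cod (prod_cat (arrow_cat K) (arrow_cat M)) S))"
    using PP_square[OF sq] by (cases "far PP S") (simp add: hom_def S arrow_cat_ar)
next
  fix S S' assume 0: "S \<in> Ar (prod_cat (arrow_cat K) (arrow_cat M))" "S' \<in> Ar (prod_cat (arrow_cat K) (arrow_cat M))"
    "Dom (prod_cat (arrow_cat K) (arrow_cat M)) S' = Cod (prod_cat (arrow_cat K) (arrow_cat M)) S"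
  then obtain i i' u v j j' u' v' where S: "S = (Sq i i' u v, Sq j j' u' v')"
    and sq: "square K i i' u v" "square M j j' u' v'"
    by (cases S, cases "fst S"; cases "snd S") (auto simp: arrow_cat_ar)
  obtain i'' j'' a b a' b' where S': "S' = (Sq i' i'' a b, Sq j' j'' a' b')"
    and sq': "square K i' i'' a b" "square M j' j'' a' b'"
    using 0 S by (cases S', cases "fst S'"; cases "snd S'") (auto simp: arrow_cat_ar)
  note [simp] = K.squareD[OF sq(1)] M.squareD[OF sq(2)] K.squareD[OF sq'(1)] M.squareD[OF sq'(2)]
  obtain w where w: "far PP S = Sq (fob PP (i, j)) (fob PP (i', j')) w (far ten (v, v'))"
    "w \<in> Ar N" "Dom N w = Dom N (fob PP (i, j))" "Cod N w = Dom N (fob PP (i', j'))"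
    "w \<cdot>\<^bsub>N\<^esub> inj1 i j = inj1 i' j' \<cdot>\<^bsub>N\<^esub> far ten (u, v')"
    "w \<cdot>\<^bsub>N\<^esub> inj2 i j = inj2 i' j' \<cdot>\<^bsub>N\<^esub> far ten (v, u')"
    unfolding S by (rule PP_farE[OF sq])
  obtain w' where w': "far PP S' = Sq (fob PP (i', j')) (fob PP (i'', j'')) w' (far ten (b, b'))"
    "w' \<in> Ar N" "Dom N w' = Dom N (fob PP (i', j'))" "Cod N w' = Dom N (fob PP (i'', j''))"
    "w' \<cdot>\<^bsub>N\<^esub> inj1 i' j' = inj1 i'' j'' \<cdot>\<^bsub>N\<^esub> far ten (a, b')"
    "w' \<cdot>\<^bsub>N\<^esub> inj2 i' j' = inj2 i'' j'' \<cdot>\<^bsub>N\<^esub> far ten (b, a')"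
    unfolding S' by (rule PP_farE[OF sq'])
  obtain q where q: "far PP (Sq i i'' (a \<cdot>\<^bsub>K\<^esub> u) (b \<cdot>\<^bsub>K\<^esub> v), Sq j j'' (a' \<cdot>\<^bsub>M\<^esub> u') (b' \<cdot>\<^bsub>M\<^esub> v'))
      = Sq (fob PP (i, j)) (fob PP (i'', j'')) q (far ten (b \<cdot>\<^bsub>K\<^esub> v, b' \<cdot>\<^bsub>M\<^esub> v'))"
    "q \<in> Ar N" "Dom N q = Dom N (fob PP (i, j))" "Cod N q = Dom N (fob PP (i'', j''))"
    "q \<cdot>\<^bsub>N\<^esub> inj1 i j = inj1 i'' j'' \<cdot>\<^bsub>N\<^esub> far ten (a \<cdot>\<^bsub>K\<^esub> u, b' \<cdot>\<^bsub>M\<^esub> v')"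
    "q \<cdot>\<^bsub>N\<^esub> inj2 i j = inj2 i'' j'' \<cdot>\<^bsub>N\<^esub> far ten (b \<cdot>\<^bsub>K\<^esub> v, a' \<cdot>\<^bsub>M\<^esub> u')"
    by (rule PP_farE[OF K.square_cmp[OF sq(1) sq'(1)] M.square_cmp[OF sq(2) sq'(2)]])
  have "q = w' \<cdot>\<^bsub>N\<^esub> w"
    by (rule po_eq[of i j _ "Dom N (fob PP (i'', j''))"])
      (use N.cmp_extend2[OF w'(5), of "far ten (u, v')"] N.cmp_extend2[OF w'(6), of "far ten (v, u')"] in
        \<open>simp_all add: w(2-6) w'(2-4) q(2-6) hom_def\<close>)
  then show "far PP (S' \<cdot>\<^bsub>prod_cat (arrow_cat K) (arrow_cat M)\<^esub> S) = far PP S' \<cdot>\<^bsub>arrow_cat N\<^esub> far PP S"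
    using w(1) w'(1) q(1) by (simp add: S S')
qed

lemma PH_functor: "cfunctor (prod_cat (op_cat (arrow_cat K)) (arrow_cat N)) (arrow_cat M) PH"
proof (intro cfunctor.intro cfunctor_axioms.intro prod_category category.op_category K.arrow_category M.arrow_category N.arrow_category)
  let ?I = "prod_cat (op_cat (arrow_cat K)) (arrow_cat N)"
  fix x assume "x \<in> Ob ?I"
  then obtain i f where x: "x = (i, f)" and [simp]: "i \<in> Ar K" "f \<in> Ar N" by auto
  show "fob PH x \<in> Ob (arrow_cat M)" by (simp add: x)
  note sq = K.square_idt[of i] N.square_idt[of f]
  obtain w where w: "far PH (Sq i i (Idt K (Dom K i)) (Idt K (Cod K i)), Sq f f (Idt N (Dom N f)) (Idt N (Cod N f)))
      = Sq (fob PH (i, f)) (fob PH (i, f)) (far hm (Idt K (Cod K i), Idt N (Dom N f))) w"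
    "w \<in> Ar M" "Dom M w = Cod M (fob PH (i, f))" "Cod M w = Cod M (fob PH (i, f))"
    "p1 i f \<cdot>\<^bsub>M\<^esub> w = far hm (Idt K (Cod K i), Idt N (Cod N f)) \<cdot>\<^bsub>M\<^esub> p1 i f"
    "p2 i f \<cdot>\<^bsub>M\<^esub> w = far hm (Idt K (Dom K i), Idt N (Dom N f)) \<cdot>\<^bsub>M\<^esub> p2 i f"
    by (rule PH_farE[OF sq]) simp_all
  have "w = Idt M (Cod M (fob PH (i, f)))"
    by (rule pb_eq[of i f _ "Cod M (fob PH (i, f))"]) (simp_all add: w(2-6) hom_def)
  then show "far PH (Idt ?I x) = Idt (arrow_cat M) (fob PH x)"
    by (simp add: x w(1))
next
  let ?I = "prod_cat (op_cat (arrow_cat K)) (arrow_cat N)"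
  fix S assume "S \<in> Ar ?I"
  then obtain i i' u v f f' u' v' where S: "S = (Sq i' i u v, Sq f f' u' v')"
    and sq: "square K i' i u v" "square N f f' u' v'"
    by (cases S, cases "fst S"; cases "snd S") (auto simp: arrow_cat_ar)
  show "far PH S \<in> hom (arrow_cat M) (fob PH (Dom ?I S)) (fob PH (Cod ?I S))"
    using PH_square[OF sq] by (cases "far PH S") (simp add: hom_def S arrow_cat_ar)
next
  let ?I = "prod_cat (op_cat (arrow_cat K)) (arrow_cat N)"
  fix S S' assume 0: "S \<in> Ar ?I" "S' \<in> Ar ?I" "Dom ?I S' = Cod ?I S"
  then obtain i i' u v f f' u' v' where S: "S = (Sq i' i u v, Sq f f' u' v')"
    and sq: "square K i' i u v" "square N f f' u' v'"
    by (cases S, cases "fst S"; cases "snd S") (auto simp: arrow_cat_ar)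
  obtain i'' f'' a b a' b' where S': "S' = (Sq i'' i' a b, Sq f' f'' a' b')"
    and sq': "square K i'' i' a b" "square N f' f'' a' b'"
    using 0 S by (cases S', cases "fst S'"; cases "snd S'") (auto simp: arrow_cat_ar)
  note [simp] = K.squareD[OF sq(1)] N.squareD[OF sq(2)] K.squareD[OF sq'(1)] N.squareD[OF sq'(2)]
  obtain w where w: "far PH S = Sq (fob PH (i, f)) (fob PH (i', f')) (far hm (v, u')) w"
    "w \<in> Ar M" "Dom M w = Cod M (fob PH (i, f))" "Cod M w = Cod M (fob PH (i', f'))"
    "p1 i' f' \<cdot>\<^bsub>M\<^esub> w = far hm (v, v') \<cdot>\<^bsub>M\<^esub> p1 i f"
    "p2 i' f' \<cdot>\<^bsub>M\<^esub> w = far hm (u, u') \<cdot>\<^bsub>M\<^esub> p2 i f"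
    unfolding S by (rule PH_farE[OF sq])
  obtain w' where w': "far PH S' = Sq (fob PH (i', f')) (fob PH (i'', f'')) (far hm (b, a')) w'"
    "w' \<in> Ar M" "Dom M w' = Cod M (fob PH (i', f'))" "Cod M w' = Cod M (fob PH (i'', f''))"
    "p1 i'' f'' \<cdot>\<^bsub>M\<^esub> w' = far hm (b, b') \<cdot>\<^bsub>M\<^esub> p1 i' f'"
    "p2 i'' f'' \<cdot>\<^bsub>M\<^esub> w' = far hm (a, a') \<cdot>\<^bsub>M\<^esub> p2 i' f'"
    unfolding S' by (rule PH_farE[OF sq'])
  obtain q where q: "far PH (Sq i'' i (u \<cdot>\<^bsub>K\<^esub> a) (v \<cdot>\<^bsub>K\<^esub> b), Sq f f'' (a' \<cdot>\<^bsub>N\<^esub> u') (b' \<cdot>\<^bsub>N\<^esub> v'))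
      = Sq (fob PH (i, f)) (fob PH (i'', f'')) (far hm (v \<cdot>\<^bsub>K\<^esub> b, a' \<cdot>\<^bsub>N\<^esub> u')) q"
    "q \<in> Ar M" "Dom M q = Cod M (fob PH (i, f))" "Cod M q = Cod M (fob PH (i'', f''))"
    "p1 i'' f'' \<cdot>\<^bsub>M\<^esub> q = far hm (v \<cdot>\<^bsub>K\<^esub> b, b' \<cdot>\<^bsub>N\<^esub> v') \<cdot>\<^bsub>M\<^esub> p1 i f"
    "p2 i'' f'' \<cdot>\<^bsub>M\<^esub> q = far hm (u \<cdot>\<^bsub>K\<^esub> a, a' \<cdot>\<^bsub>N\<^esub> u') \<cdot>\<^bsub>M\<^esub> p2 i f"
    by (rule PH_farE[OF K.square_cmp[OF sq'(1) sq(1)] N.square_cmp[OF sq(2) sq'(2)]])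
  have "q = w' \<cdot>\<^bsub>M\<^esub> w"
    by (rule pb_eq[of i'' f'' _ "Cod M (fob PH (i, f))"])
      (use M.cmp_extend2[OF w'(5), of w] M.cmp_extend2[OF w'(6), of w] in
        \<open>simp_all add: w(2-6) w'(2-4) q(2-6) hom_def\<close>)
  then show "far PH (S' \<cdot>\<^bsub>?I\<^esub> S) = far PH S' \<cdot>\<^bsub>arrow_cat M\<^esub> far PH S"
    using w(1) w'(1) q(1) by (simp add: S S')
qed

lemma transposed_natural:
  assumes t: "transposed i j f w b c z" and sqi: "square K i' i u v" and sqj: "square M j' j u' v'"
    and sqf: "square N f f' a e"
  shows "transposed i' j' f' (a \<cdot>\<^bsub>N\<^esub> w \<cdot>\<^bsub>N\<^esub> sq_top (far PP (Sq i' i u v, Sq j' j u' v')))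
     (e \<cdot>\<^bsub>N\<^esub> b \<cdot>\<^bsub>N\<^esub> far ten (v, v')) (far hm (v, a) \<cdot>\<^bsub>M\<^esub> c \<cdot>\<^bsub>M\<^esub> u')
     (sq_bot (far PH (Sq i' i u v, Sq f f' a e)) \<cdot>\<^bsub>M\<^esub> z \<cdot>\<^bsub>M\<^esub> v')"
proof -
  obtain q where q: "far PP (Sq i' i u v, Sq j' j u' v') = Sq (fob PP (i', j')) (fob PP (i, j)) q (far ten (v, v'))"
    "q \<in> Ar N" "Dom N q = Dom N (fob PP (i', j'))" "Cod N q = Dom N (fob PP (i, j))"
    "q \<cdot>\<^bsub>N\<^esub> inj1 i' j' = inj1 i j \<cdot>\<^bsub>N\<^esub> far ten (u, v')"
    "q \<cdot>\<^bsub>N\<^esub> inj2 i' j' = inj2 i j \<cdot>\<^bsub>N\<^esub> far ten (v, u')"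
    by (rule PP_farE[OF sqi sqj])
  obtain y where y: "far PH (Sq i' i u v, Sq f f' a e) = Sq (fob PH (i, f)) (fob PH (i', f')) (far hm (v, a)) y"
    "y \<in> Ar M" "Dom M y = Cod M (fob PH (i, f))" "Cod M y = Cod M (fob PH (i', f'))"
    "p1 i' f' \<cdot>\<^bsub>M\<^esub> y = far hm (v, e) \<cdot>\<^bsub>M\<^esub> p1 i f"
    "p2 i' f' \<cdot>\<^bsub>M\<^esub> y = far hm (u, a) \<cdot>\<^bsub>M\<^esub> p2 i f"
    by (rule PH_farE[OF sqi sqf])
  note D = transposedD[OF t]
  note [simp] = D(1-3) K.squareD[OF sqi] M.squareD[OF sqj] N.squareD[OF sqf] N.squareD[OF D(4)] M.squareD[OF D(5)]
    q(2-6) y(2-4)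
  have 1: "square N (fob PP (i', j')) f' (a \<cdot>\<^bsub>N\<^esub> w \<cdot>\<^bsub>N\<^esub> q) (e \<cdot>\<^bsub>N\<^esub> b \<cdot>\<^bsub>N\<^esub> far ten (v, v'))"
    using N.square_cmp[OF N.square_cmp[OF PP_square(1)[OF sqi sqj q(1)] D(4)] sqf] by simp
  have 2: "square M j' (fob PH (i', f')) (far hm (v, a) \<cdot>\<^bsub>M\<^esub> c \<cdot>\<^bsub>M\<^esub> u') (y \<cdot>\<^bsub>M\<^esub> z \<cdot>\<^bsub>M\<^esub> v')"
    using M.square_cmp[OF M.square_cmp[OF sqj D(5)] PH_square(1)[OF sqi sqf y(1)]] by simp
  have 3: "p1 i' f' \<cdot>\<^bsub>M\<^esub> y \<cdot>\<^bsub>M\<^esub> z \<cdot>\<^bsub>M\<^esub> v' = far hm (v, e) \<cdot>\<^bsub>M\<^esub> tr (Cod K i) (Cod M j) (Cod N f) b \<cdot>\<^bsub>M\<^esub> v'"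
    using M.cmp_extend2[OF y(5), of "z \<cdot>\<^bsub>M\<^esub> v'"] M.cmp_extend[OF D(7), of v'] by simp
  have 4: "p2 i' f' \<cdot>\<^bsub>M\<^esub> y \<cdot>\<^bsub>M\<^esub> z \<cdot>\<^bsub>M\<^esub> v' = far hm (u, a) \<cdot>\<^bsub>M\<^esub> tr (Dom K i) (Cod M j) (Dom N f) (w \<cdot>\<^bsub>N\<^esub> inj1 i j) \<cdot>\<^bsub>M\<^esub> v'"
    using M.cmp_extend2[OF y(6), of "z \<cdot>\<^bsub>M\<^esub> v'"] M.cmp_extend[OF D(8), of v'] by simp
  show ?thesis
    using 1 2 3 4 D(6) tr_natural[of v v' e b "Cod K i'" "Cod M j'" "Cod N f'"]
      tr_natural[of u v' a "w \<cdot>\<^bsub>N\<^esub> inj1 i j" "Dom K i'" "Cod M j'" "Dom N f'"]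
      tr_natural[of v u' a "w \<cdot>\<^bsub>N\<^esub> inj2 i j" "Cod K i'" "Dom M j'" "Dom N f'"]
    by (simp add: transposed_def q(1) y(1))
qed

text \<open>Transposition restricts to diagonals: solving the problem before or after transposing is the same
condition, since both amount to the same three equations.\<close>

lemma transposed_solves:
  assumes t: "transposed i j f w b c z" and d [simp]: "d \<in> Ar N" "Dom N d = fob ten (Cod K i, Cod M j)" "Cod N d = Dom N f"
  shows "d \<cdot>\<^bsub>N\<^esub> fob PP (i, j) = w \<and> f \<cdot>\<^bsub>N\<^esub> d = b \<longleftrightarrow>
    tr (Cod K i) (Cod M j) (Dom N f) d \<cdot>\<^bsub>M\<^esub> j = c \<and>
    fob PH (i, f) \<cdot>\<^bsub>M\<^esub> tr (Cod K i) (Cod M j) (Dom N f) d = z"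
proof -
  note D = transposedD[OF t]
  note [simp] = D(1-3) N.squareD[OF D(4)] M.squareD[OF D(5)]
  let ?D = "tr (Cod K i) (Cod M j) (Dom N f) d"
  have 1: "tr (Cod K i) (Dom M j) (Dom N f) (d \<cdot>\<^bsub>N\<^esub> far ten (Idt K (Cod K i), j)) = ?D \<cdot>\<^bsub>M\<^esub> j"
    by (rule tr_right) simp_all
  have 2: "tr (Dom K i) (Cod M j) (Dom N f) (d \<cdot>\<^bsub>N\<^esub> far ten (i, Idt M (Cod M j))) = p2 i f \<cdot>\<^bsub>M\<^esub> fob PH (i, f) \<cdot>\<^bsub>M\<^esub> ?D"
    using tr_left[of i "Cod M j" d "Dom N f"] M.cmp_extend[OF proj_simps(10), of i f ?D] by simp
  have 3: "tr (Cod K i) (Cod M j) (Cod N f) (f \<cdot>\<^bsub>N\<^esub> d) = p1 i f \<cdot>\<^bsub>M\<^esub> fob PH (i, f) \<cdot>\<^bsub>M\<^esub> ?D"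
    using tr_post[of "Cod K i" "Cod M j" d f] M.cmp_extend[OF proj_simps(9), of i f ?D] by simp
  show ?thesis
  proof
    assume a: "d \<cdot>\<^bsub>N\<^esub> fob PP (i, j) = w \<and> f \<cdot>\<^bsub>N\<^esub> d = b"
    have w1: "w \<cdot>\<^bsub>N\<^esub> inj1 i j = d \<cdot>\<^bsub>N\<^esub> far ten (i, Idt M (Cod M j))"
      "w \<cdot>\<^bsub>N\<^esub> inj2 i j = d \<cdot>\<^bsub>N\<^esub> far ten (Idt K (Cod K i), j)"
      using a by (auto simp flip: inj_simps(9,10))
    have "?D \<cdot>\<^bsub>M\<^esub> j = c" using D(6) 1 w1 by simp
    moreover have "fob PH (i, f) \<cdot>\<^bsub>M\<^esub> ?D = z"
      by (rule pb_eq[of i f _ "Cod M j"]) (use a D(7,8) 2 3 w1 in \<open>simp_all add: hom_def\<close>)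
    ultimately show "?D \<cdot>\<^bsub>M\<^esub> j = c \<and> fob PH (i, f) \<cdot>\<^bsub>M\<^esub> ?D = z" by simp
  next
    assume a: "?D \<cdot>\<^bsub>M\<^esub> j = c \<and> fob PH (i, f) \<cdot>\<^bsub>M\<^esub> ?D = z"
    have "f \<cdot>\<^bsub>N\<^esub> d = b"
      by (rule tr_inj[of "Cod K i" "Cod M j" _ "Cod N f"]) (use a D(7) 3 in simp_all)
    moreover have 4: "d \<cdot>\<^bsub>N\<^esub> far ten (i, Idt M (Cod M j)) = w \<cdot>\<^bsub>N\<^esub> inj1 i j"
      by (rule tr_inj[of "Dom K i" "Cod M j" _ "Dom N f"]) (use a D(8) 2 in simp_all)
    moreover have 5: "d \<cdot>\<^bsub>N\<^esub> far ten (Idt K (Cod K i), j) = w \<cdot>\<^bsub>N\<^esub> inj2 i j"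
      by (rule tr_inj[of "Cod K i" "Dom M j" _ "Dom N f"]) (use a D(6) 1 in simp_all)
    moreover have "d \<cdot>\<^bsub>N\<^esub> fob PP (i, j) = w"
      by (rule po_eq[of i j _ "Dom N f"]) (simp_all add: hom_def 4 5)
    ultimately show "d \<cdot>\<^bsub>N\<^esub> fob PP (i, j) = w \<and> f \<cdot>\<^bsub>N\<^esub> d = b" by simp
  qed
qed

end

section \<open>Lifted functors and mates\<close>

context square_adjunction begin

abbreviation "idK i \<equiv> Sq i i (Idt K (Dom K i)) (Idt K (Cod K i))"
abbreviation "idM i \<equiv> Sq i i (Idt M (Dom M i)) (Idt M (Cod M i))"
abbreviation "idN i \<equiv> Sq i i (Idt N (Dom N i)) (Idt N (Cod N i))"

lemma PP_far_eq:
  assumes "square K i i' u v" "square M j j' u' v'"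
  shows "far PP (Sq i i' u v, Sq j j' u' v') = Sq (fob PP (i, j)) (fob PP (i', j'))
      (sq_top (far PP (Sq i i' u v, Sq j j' u' v'))) (far ten (v, v'))"
    "square N (fob PP (i, j)) (fob PP (i', j')) (sq_top (far PP (Sq i i' u v, Sq j j' u' v'))) (far ten (v, v'))"
  using PP_square[OF assms] by (cases "far PP (Sq i i' u v, Sq j j' u' v')"; simp)+

lemma PH_far_eq:
  assumes "square K i' i u v" "square N f f' u' v'"
  shows "far PH (Sq i' i u v, Sq f f' u' v') = Sq (fob PH (i, f)) (fob PH (i', f'))
      (far hm (v, u')) (sq_bot (far PH (Sq i' i u v, Sq f f' u' v')))"
    "square M (fob PH (i, f)) (fob PH (i', f')) (far hm (v, u')) (sq_bot (far PH (Sq i' i u v, Sq f f' u' v')))"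
  using PH_square[OF assms] by (cases "far PH (Sq i' i u v, Sq f f' u' v')"; simp)+

lemma EPP_cmp:
  assumes "square K i i' u v" "square M j j' u' v'" "square K i' i'' a b" "square M j' j'' a' b'"
  shows "far (fac N) (far PP (Sq i' i'' a b, Sq j' j'' a' b')) \<cdot>\<^bsub>N\<^esub> far (fac N) (far PP (Sq i i' u v, Sq j j' u' v'))
    = far (fac N) (far PP (Sq i i'' (a \<cdot>\<^bsub>K\<^esub> u) (b \<cdot>\<^bsub>K\<^esub> v), Sq j j'' (a' \<cdot>\<^bsub>M\<^esub> u') (b' \<cdot>\<^bsub>M\<^esub> v')))"
proof -
  have "far PP (Sq i' i'' a b, Sq j' j'' a' b') \<cdot>\<^bsub>arrow_cat N\<^esub> far PP (Sq i i' u v, Sq j j' u' v') =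
    far PP (Sq i i'' (a \<cdot>\<^bsub>K\<^esub> u) (b \<cdot>\<^bsub>K\<^esub> v), Sq j j'' (a' \<cdot>\<^bsub>M\<^esub> u') (b' \<cdot>\<^bsub>M\<^esub> v'))"
    using cfunctor.far_cmp[OF PP_functor, of "(Sq i i' u v, Sq j j' u' v')" "(Sq i' i'' a b, Sq j' j'' a' b')"] assms
    by (simp add: arrow_cat_ar)
  moreover obtain q where q: "far PP (Sq i i' u v, Sq j j' u' v') = Sq (fob PP (i, j)) (fob PP (i', j')) q (far ten (v, v'))"
    "square N (fob PP (i, j)) (fob PP (i', j')) q (far ten (v, v'))" using PP_far_eq[OF assms(1,2)] by blast
  moreover obtain q' where q': "far PP (Sq i' i'' a b, Sq j' j'' a' b') = Sq (fob PP (i', j')) (fob PP (i'', j'')) q' (far ten (b, b'))"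
    "square N (fob PP (i', j')) (fob PP (i'', j'')) q' (far ten (b, b'))" using PP_far_eq[OF assms(3,4)] by blast
  ultimately show ?thesis using N.E_cmp[OF q(2) q'(2)] by simp
qed

lemma EPH_cmp:
  assumes "square K i' i u v" "square N f f' u' v'" "square K i'' i' a b" "square N f' f'' a' b'"
  shows "far (fac M) (far PH (Sq i'' i' a b, Sq f' f'' a' b')) \<cdot>\<^bsub>M\<^esub> far (fac M) (far PH (Sq i' i u v, Sq f f' u' v'))
    = far (fac M) (far PH (Sq i'' i (u \<cdot>\<^bsub>K\<^esub> a) (v \<cdot>\<^bsub>K\<^esub> b), Sq f f'' (a' \<cdot>\<^bsub>N\<^esub> u') (b' \<cdot>\<^bsub>N\<^esub> v')))"
proof -
  have "far PH (Sq i'' i' a b, Sq f' f'' a' b') \<cdot>\<^bsub>arrow_cat M\<^esub> far PH (Sq i' i u v, Sq f f' u' v') =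
    far PH (Sq i'' i (u \<cdot>\<^bsub>K\<^esub> a) (v \<cdot>\<^bsub>K\<^esub> b), Sq f f'' (a' \<cdot>\<^bsub>N\<^esub> u') (b' \<cdot>\<^bsub>N\<^esub> v'))"
    using cfunctor.far_cmp[OF PH_functor, of "(Sq i' i u v, Sq f f' u' v')" "(Sq i'' i' a b, Sq f' f'' a' b')"] assms
    by (simp add: arrow_cat_ar)
  moreover obtain q where q: "far PH (Sq i' i u v, Sq f f' u' v') = Sq (fob PH (i, f)) (fob PH (i', f')) (far hm (v, u')) q"
    "square M (fob PH (i, f)) (fob PH (i', f')) (far hm (v, u')) q" using PH_far_eq[OF assms(1,2)] by blast
  moreover obtain q' where q': "far PH (Sq i'' i' a b, Sq f' f'' a' b') = Sq (fob PH (i', f')) (fob PH (i'', f'')) (far hm (b, a')) q'"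
    "square M (fob PH (i', f')) (fob PH (i'', f'')) (far hm (b, a')) q'" using PH_far_eq[OF assms(3,4)] by blast
  ultimately show ?thesis using M.E_cmp[OF q(2) q'(2)] by simp
qed

lemma EPP_ar:
  assumes "square K i i' u v" "square M j j' u' v'"
  shows "far (fac N) (far PP (Sq i i' u v, Sq j j' u' v')) \<in> Ar N"
    "Dom N (far (fac N) (far PP (Sq i i' u v, Sq j j' u' v'))) = fob (fac N) (fob PP (i, j))"
    "Cod N (far (fac N) (far PP (Sq i i' u v, Sq j j' u' v'))) = fob (fac N) (fob PP (i', j'))"
proof -
  obtain q where "far PP (Sq i i' u v, Sq j j' u' v') = Sq (fob PP (i, j)) (fob PP (i', j')) q (far ten (v, v'))"
    "square N (fob PP (i, j)) (fob PP (i', j')) q (far ten (v, v'))" using PP_far_eq[OF assms] by blast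
  then show "far (fac N) (far PP (Sq i i' u v, Sq j j' u' v')) \<in> Ar N"
    "Dom N (far (fac N) (far PP (Sq i i' u v, Sq j j' u' v'))) = fob (fac N) (fob PP (i, j))"
    "Cod N (far (fac N) (far PP (Sq i i' u v, Sq j j' u' v'))) = fob (fac N) (fob PP (i', j'))"
    by simp_all
qed

lemma EPH_ar:
  assumes "square K i' i u v" "square N f f' u' v'"
  shows "far (fac M) (far PH (Sq i' i u v, Sq f f' u' v')) \<in> Ar M"
    "Dom M (far (fac M) (far PH (Sq i' i u v, Sq f f' u' v'))) = fob (fac M) (fob PH (i, f))"
    "Cod M (far (fac M) (far PH (Sq i' i u v, Sq f f' u' v'))) = fob (fac M) (fob PH (i', f'))"
proof -
  obtain q where "far PH (Sq i' i u v, Sq f f' u' v') = Sq (fob PH (i, f)) (fob PH (i', f')) (far hm (v, u')) q"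
    "square M (fob PH (i, f)) (fob PH (i', f')) (far hm (v, u')) q" using PH_far_eq[OF assms] by blast
  then show "far (fac M) (far PH (Sq i' i u v, Sq f f' u' v')) \<in> Ar M"
    "Dom M (far (fac M) (far PH (Sq i' i u v, Sq f f' u' v'))) = fob (fac M) (fob PH (i, f))"
    "Cod M (far (fac M) (far PH (Sq i' i u v, Sq f f' u' v'))) = fob (fac M) (fob PH (i', f'))"
    by simp_all
qed

lemma PP_idt:
  assumes "i \<in> Ar K" "j \<in> Ar M"
  shows "far PP (idK i, idM j) = idN (fob PP (i, j))"
  using cfunctor.far_idt[OF PP_functor, of "(i, j)"] assms by simp

lemma PH_idt:
  assumes "i \<in> Ar K" "f \<in> Ar N"
  shows "far PH (idK i, idN f) = idM (fob PH (i, f))"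
  using cfunctor.far_idt[OF PH_functor, of "(i, f)"] assms by simp

lemma tensor_ob:
  assumes "lifted_tensor K M N PP T" "is_coalg K X" "is_coalg M Y"
  shows "fst (fob T (X, Y)) = fob PP (fst X, fst Y)" "is_coalg N (fob PP (fst X, fst Y), snd (fob T (X, Y)))"
proof -
  have 1: "cfunctor (prod_cat (coalg K) (coalg M)) (coalg N) T"
    and 2: "cfun_agree (prod_cat (coalg K) (coalg M)) (cfun_comp forget T) (cfun_comp PP (cfun_prod forget forget))"
    using assms by (auto simp: lifted_tensor_def lifted_def)
  show 3: "fst (fob T (X, Y)) = fob PP (fst X, fst Y)" using 2 assms by (cases X; cases Y) (simp add: cfun_agree_def)
  have "is_coalg N (fob T (X, Y))" using cfunctor.fob_ob[OF 1, of "(X, Y)"] assms by simp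
  then show "is_coalg N (fob PP (fst X, fst Y), snd (fob T (X, Y)))" by (simp flip: 3)
qed

lemma tensor_map:
  assumes T: "lifted_tensor K M N PP T" and X: "is_coalg K X" "is_coalg K X'" and Y: "is_coalg M Y" "is_coalg M Y'"
    and a: "coalg_map K X X' u v" and b: "coalg_map M Y Y' u' v'"
  shows "coalg_map N (fob T (X, Y)) (fob T (X', Y'))
    (sq_top (far PP (Sq (fst X) (fst X') u v, Sq (fst Y) (fst Y') u' v'))) (far ten (v, v'))"
proof -
  have 1: "cfunctor (prod_cat (coalg K) (coalg M)) (coalg N) T"
    and 2: "cfun_agree (prod_cat (coalg K) (coalg M)) (cfun_comp forget T) (cfun_comp PP (cfun_prod forget forget))"
    using assms by (auto simp: lifted_tensor_def lifted_def)
  let ?a = "((X, X', Sq (fst X) (fst X') u v), (Y, Y', Sq (fst Y) (fst Y') u' v'))"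
  have a: "?a \<in> Ar (prod_cat (coalg K) (coalg M))" using assms by (auto simp: coalg_ar)
  have "far forget (far T ?a) = far PP (Sq (fst X) (fst X') u v, Sq (fst Y) (fst Y') u' v')"
    using 2 a by (auto simp: cfun_agree_def)
  moreover have "far T ?a \<in> hom (coalg N) (fob T (X, Y)) (fob T (X', Y'))"
    using cfunctor.far_hom[OF 1 a] by simp
  ultimately have 3: "(fob T (X, Y), fob T (X', Y'), far PP (Sq (fst X) (fst X') u v, Sq (fst Y) (fst Y') u' v')) \<in> Ar (coalg N)"
    by (cases "far T ?a") (simp add: hom_def)
  have sq: "square K (fst X) (fst X') u v" "square M (fst Y) (fst Y') u' v'"
    using assms(6,7) by (auto simp: coalg_map_def)
  show ?thesis using 3 PP_far_eq(1)[OF sq] by (auto simp: coalg_ar)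
qed

lemma hom_ob:
  assumes "lifted_hom K N M PH H" "is_coalg K X" "is_alg N Y"
  shows "fst (fob H (X, Y)) = fob PH (fst X, fst Y)" "is_alg M (fob PH (fst X, fst Y), snd (fob H (X, Y)))"
proof -
  have 1: "cfunctor (prod_cat (op_cat (coalg K)) (alg N)) (alg M) H"
    and 2: "cfun_agree (prod_cat (op_cat (coalg K)) (alg N)) (cfun_comp forget H) (cfun_comp PH (cfun_prod forget forget))"
    using assms by (auto simp: lifted_hom_def lifted_def)
  show 3: "fst (fob H (X, Y)) = fob PH (fst X, fst Y)" using 2 assms by (cases X; cases Y) (simp add: cfun_agree_def)
  have "is_alg M (fob H (X, Y))" using cfunctor.fob_ob[OF 1, of "(X, Y)"] assms by simp
  then show "is_alg M (fob PH (fst X, fst Y), snd (fob H (X, Y)))" by (simp flip: 3)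
qed

lemma hom_map:
  assumes H: "lifted_hom K N M PH H" and X: "is_coalg K X" "is_coalg K X'" and Y: "is_alg N Y" "is_alg N Y'"
    and a: "coalg_map K X' X u v" and b: "alg_map N Y Y' u' v'"
  shows "alg_map M (fob H (X, Y)) (fob H (X', Y')) (far hm (v, u'))
    (sq_bot (far PH (Sq (fst X') (fst X) u v, Sq (fst Y) (fst Y') u' v')))"
proof -
  have 1: "cfunctor (prod_cat (op_cat (coalg K)) (alg N)) (alg M) H"
    and 2: "cfun_agree (prod_cat (op_cat (coalg K)) (alg N)) (cfun_comp forget H) (cfun_comp PH (cfun_prod forget forget))"
    using assms by (auto simp: lifted_hom_def lifted_def)
  let ?a = "((X', X, Sq (fst X') (fst X) u v), (Y, Y', Sq (fst Y) (fst Y') u' v'))"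
  have a: "?a \<in> Ar (prod_cat (op_cat (coalg K)) (alg N))" using assms by (auto simp: coalg_ar alg_ar)
  have "far forget (far H ?a) = far PH (Sq (fst X') (fst X) u v, Sq (fst Y) (fst Y') u' v')"
    using 2 a by (auto simp: cfun_agree_def)
  moreover have "far H ?a \<in> hom (alg M) (fob H (X, Y)) (fob H (X', Y'))"
    using cfunctor.far_hom[OF 1 a] by simp
  ultimately have 3: "(fob H (X, Y), fob H (X', Y'), far PH (Sq (fst X') (fst X) u v, Sq (fst Y) (fst Y') u' v')) \<in> Ar (alg M)"
    by (cases "far H ?a") (simp add: hom_def)
  have sq: "square K (fst X') (fst X) u v" "square N (fst Y) (fst Y') u' v'"
    using assms(6,7) by (auto simp: coalg_map_def alg_map_def)
  show ?thesis using 3 PH_far_eq(1)[OF sq] by (auto simp: alg_ar)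
qed

definition tensor_solution where
  "tensor_solution T i s j t f r w b = solution N (fob T ((i, s), (j, t))) (f, r) (Sq (fob PP (i, j)) f w b)"

definition hom_solution where
  "hom_solution H i s j t f r c z = solution M (j, t) (fob H ((i, s), (f, r))) (Sq j (fob PH (i, f)) c z)"

text \<open>The two lifts induce the same three-variable lifting operation.\<close>

definition lifts_agree where
  "lifts_agree T H \<longleftrightarrow> (\<forall>i s j t f r w b c z. is_coalg K (i, s) \<longrightarrow> is_coalg M (j, t) \<longrightarrow> is_alg N (f, r) \<longrightarrow>
     transposed i j f w b c z \<longrightarrow>
     tr (Cod K i) (Cod M j) (Dom N f) (tensor_solution T i s j t f r w b) = hom_solution H i s j t f r c z)"

lemma lifts_agreeD:
  "\<lbrakk>lifts_agree T H; is_coalg K (i, s); is_coalg M (j, t); is_alg N (f, r); transposed i j f w b c z\<rbrakk> \<Longrightarrow>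
    tr (Cod K i) (Cod M j) (Dom N f) (tensor_solution T i s j t f r w b) = hom_solution H i s j t f r c z"
  unfolding lifts_agree_def by blast

lemma tensor_solution_props:
  assumes T: "lifted_tensor K M N PP T" and "is_coalg K (i, s)" "is_coalg M (j, t)" "is_alg N (f, r)"
    "square N (fob PP (i, j)) f w b"
  shows "tensor_solution T i s j t f r w b \<in> Ar N" "Dom N (tensor_solution T i s j t f r w b) = fob ten (Cod K i, Cod M j)"
    "Cod N (tensor_solution T i s j t f r w b) = Dom N f" "tensor_solution T i s j t f r w b \<cdot>\<^bsub>N\<^esub> fob PP (i, j) = w"
    "f \<cdot>\<^bsub>N\<^esub> tensor_solution T i s j t f r w b = b"
  using N.solution_props[OF tensor_ob(2)[OF T assms(2,3), simplified] assms(4,5)]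
    tensor_ob(1)[OF T assms(2,3)] K.coalgD(1)[OF assms(2)] M.coalgD(1)[OF assms(3)]
  by (simp_all add: tensor_solution_def) (metis prod.collapse)+

lemma hom_solution_props:
  assumes H: "lifted_hom K N M PH H" and "is_coalg K (i, s)" "is_coalg M (j, t)" "is_alg N (f, r)"
    "square M j (fob PH (i, f)) c z"
  shows "hom_solution H i s j t f r c z \<in> Ar M" "Dom M (hom_solution H i s j t f r c z) = Cod M j"
    "Cod M (hom_solution H i s j t f r c z) = fob hm (Cod K i, Dom N f)" "hom_solution H i s j t f r c z \<cdot>\<^bsub>M\<^esub> j = c"
    "fob PH (i, f) \<cdot>\<^bsub>M\<^esub> hom_solution H i s j t f r c z = z"
  using M.solution_props[OF assms(3) hom_ob(2)[OF H assms(2,4), simplified] assms(5)]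
    hom_ob(1)[OF H assms(2,4)] K.coalgD(1)[OF assms(2)] N.algD(1)[OF assms(4)]
  by (simp_all add: hom_solution_def) (metis prod.collapse)+

lemma tensor_solution_natural:
  assumes T: "lifted_tensor K M N PP T" and i: "is_coalg K (i, s)" "is_coalg K (i', s')" "coalg_map K (i', s') (i, s) u v"
    and j: "is_coalg M (j, t)" "is_coalg M (j', t')" "coalg_map M (j', t') (j, t) u' v'"
    and f: "is_alg N (f, r)" "is_alg N (f', r')" "alg_map N (f, r) (f', r') a e"
    and sq: "square N (fob PP (i, j)) f w b"
  shows "tensor_solution T i' s' j' t' f' r' (a \<cdot>\<^bsub>N\<^esub> w \<cdot>\<^bsub>N\<^esub> sq_top (far PP (Sq i' i u v, Sq j' j u' v')))
     (e \<cdot>\<^bsub>N\<^esub> b \<cdot>\<^bsub>N\<^esub> far ten (v, v')) = a \<cdot>\<^bsub>N\<^esub> tensor_solution T i s j t f r w b \<cdot>\<^bsub>N\<^esub> far ten (v, v')"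
proof -
  note 1 = tensor_ob[OF T i(1) j(1), simplified] tensor_ob[OF T i(2) j(2), simplified]
  note m = tensor_map[OF T i(2,1) j(2,1) i(3) j(3), simplified]
  have 2: "fob T ((i, s), (j, t)) = (fob PP (i, j), snd (fob T ((i, s), (j, t))))"
    "fob T ((i', s'), (j', t')) = (fob PP (i', j'), snd (fob T ((i', s'), (j', t'))))"
    using 1(1,3) by (metis prod.collapse)+
  have sqi: "square K i' i u v" "square M j' j u' v'" "square N f f' a e"
    using i j f by (auto simp: coalg_map_def alg_map_def)
  note P = PP_far_eq(2)[OF sqi(1,2)]
  let ?q = "sq_top (far PP (Sq i' i u v, Sq j' j u' v'))"
  note D = N.squareD[OF P] N.squareD[OF sq] N.squareD[OF sqi(3)] K.squareD[OF sqi(1)] M.squareD[OF sqi(2)]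
  have s1: "square N (fob PP (i', j')) f (w \<cdot>\<^bsub>N\<^esub> ?q) (b \<cdot>\<^bsub>N\<^esub> far ten (v, v'))"
    by (rule N.square_cmp[OF P sq])
  have "tensor_solution T i' s' j' t' f' r' (a \<cdot>\<^bsub>N\<^esub> w \<cdot>\<^bsub>N\<^esub> ?q) (e \<cdot>\<^bsub>N\<^esub> b \<cdot>\<^bsub>N\<^esub> far ten (v, v'))
     = a \<cdot>\<^bsub>N\<^esub> tensor_solution T i' s' j' t' f r (w \<cdot>\<^bsub>N\<^esub> ?q) (b \<cdot>\<^bsub>N\<^esub> far ten (v, v'))"
    unfolding tensor_solution_def by (subst (1 2) 2(2)) (rule N.solution_alg_map[OF f(1,2) 1(4) s1 f(3)])
  also have "tensor_solution T i' s' j' t' f r (w \<cdot>\<^bsub>N\<^esub> ?q) (b \<cdot>\<^bsub>N\<^esub> far ten (v, v')) = tensor_solution T i s j t f r w b \<cdot>\<^bsub>N\<^esub> far ten (v, v')"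
    unfolding tensor_solution_def by (subst 2(1), subst 2(2), rule N.solution_coalg_map[OF 1(2,4) f(1) sq]) (use m 2 in simp)
  finally show ?thesis .
qed

lemma hom_solution_natural:
  assumes H: "lifted_hom K N M PH H" and i: "is_coalg K (i, s)" "is_coalg K (i', s')" "coalg_map K (i', s') (i, s) u v"
    and j: "is_coalg M (j, t)" "is_coalg M (j', t')" "coalg_map M (j', t') (j, t) u' v'"
    and f: "is_alg N (f, r)" "is_alg N (f', r')" "alg_map N (f, r) (f', r') a e"
    and sq: "square M j (fob PH (i, f)) c z"
  shows "hom_solution H i' s' j' t' f' r' (far hm (v, a) \<cdot>\<^bsub>M\<^esub> c \<cdot>\<^bsub>M\<^esub> u')
     (sq_bot (far PH (Sq i' i u v, Sq f f' a e)) \<cdot>\<^bsub>M\<^esub> z \<cdot>\<^bsub>M\<^esub> v') =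
     far hm (v, a) \<cdot>\<^bsub>M\<^esub> hom_solution H i s j t f r c z \<cdot>\<^bsub>M\<^esub> v'"
proof -
  note 1 = hom_ob[OF H i(1) f(1), simplified] hom_ob[OF H i(2) f(2), simplified]
  note m = hom_map[OF H i(1,2) f(1,2) i(3) f(3), simplified]
  have 2: "fob H ((i, s), (f, r)) = (fob PH (i, f), snd (fob H ((i, s), (f, r))))"
    "fob H ((i', s'), (f', r')) = (fob PH (i', f'), snd (fob H ((i', s'), (f', r'))))"
    using 1(1,3) by (metis prod.collapse)+
  have sqi: "square K i' i u v" "square M j' j u' v'" "square N f f' a e"
    using i j f by (auto simp: coalg_map_def alg_map_def)
  note P = PH_far_eq(2)[OF sqi(1,3)]
  let ?y = "sq_bot (far PH (Sq i' i u v, Sq f f' a e))"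
  have s1: "square M j' (fob PH (i, f)) (c \<cdot>\<^bsub>M\<^esub> u') (z \<cdot>\<^bsub>M\<^esub> v')"
    by (rule M.square_cmp[OF sqi(2) sq])
  have "hom_solution H i' s' j' t' f' r' (far hm (v, a) \<cdot>\<^bsub>M\<^esub> c \<cdot>\<^bsub>M\<^esub> u') (?y \<cdot>\<^bsub>M\<^esub> z \<cdot>\<^bsub>M\<^esub> v')
     = far hm (v, a) \<cdot>\<^bsub>M\<^esub> hom_solution H i s j' t' f r (c \<cdot>\<^bsub>M\<^esub> u') (z \<cdot>\<^bsub>M\<^esub> v')"
    unfolding hom_solution_def by (subst 2(1), subst 2(2), rule M.solution_alg_map[OF 1(2,4) j(2) s1]) (use m 2 in simp)
  also have "hom_solution H i s j' t' f r (c \<cdot>\<^bsub>M\<^esub> u') (z \<cdot>\<^bsub>M\<^esub> v') = hom_solution H i s j t f r c z \<cdot>\<^bsub>M\<^esub> v'"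
    unfolding hom_solution_def by (subst (1 2) 2(1)) (rule M.solution_coalg_map[OF j(1,2) 1(2) sq j(3)])
  finally show ?thesis .
qed

lemma tensor_structure_map:
  assumes T: "lifted_tensor K M N PP T" and X: "is_coalg K X" "is_coalg K X'" and Y: "is_coalg M Y" "is_coalg M Y'"
    and a: "coalg_map K X X' u v" and b: "coalg_map M Y Y' u' v'"
  shows "snd (fob T (X', Y')) \<cdot>\<^bsub>N\<^esub> far ten (v, v') =
    far (fac N) (far PP (Sq (fst X) (fst X') u v, Sq (fst Y) (fst Y') u' v')) \<cdot>\<^bsub>N\<^esub> snd (fob T (X, Y))"
proof -
  have sq: "square K (fst X) (fst X') u v" "square M (fst Y) (fst Y') u' v'"
    using a b by (auto simp: coalg_map_def)
  show ?thesis using tensor_map[OF assms] tensor_ob(1)[OF T X(1) Y(1)] tensor_ob(1)[OF T X(2) Y(2)]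
    by (subst PP_far_eq(1)[OF sq]) (simp add: coalg_map_def)
qed

lemma hom_structure_map:
  assumes H: "lifted_hom K N M PH H" and X: "is_coalg K X" "is_coalg K X'" and Y: "is_alg N Y" "is_alg N Y'"
    and a: "coalg_map K X' X u v" and b: "alg_map N Y Y' u' v'"
  shows "far hm (v, u') \<cdot>\<^bsub>M\<^esub> snd (fob H (X, Y)) =
    snd (fob H (X', Y')) \<cdot>\<^bsub>M\<^esub> far (fac M) (far PH (Sq (fst X') (fst X) u v, Sq (fst Y) (fst Y') u' v'))"
proof -
  have sq: "square K (fst X') (fst X) u v" "square N (fst Y) (fst Y') u' v'"
    using a b by (auto simp: coalg_map_def alg_map_def)
  show ?thesis using hom_map[OF assms] hom_ob(1)[OF H X(1) Y(1)] hom_ob(1)[OF H X(2) Y(2)]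
    by (subst PH_far_eq(1)[OF sq]) (simp add: alg_map_def)
qed

lemma tensor_structure_ar:
  assumes T: "lifted_tensor K M N PP T" "is_coalg K X" "is_coalg M Y"
  shows "snd (fob T (X, Y)) \<in> Ar N" "Dom N (snd (fob T (X, Y))) = fob ten (Cod K (fst X), Cod M (fst Y))"
    "Cod N (snd (fob T (X, Y))) = fob (fac N) (fob PP (fst X, fst Y))"
  using N.coalgD[OF tensor_ob(2)[OF assms]] K.coalgD(1)[of "fst X" "snd X"] M.coalgD(1)[of "fst Y" "snd Y"] assms by simp_all

lemma hom_structure_ar:
  assumes H: "lifted_hom K N M PH H" "is_coalg K X" "is_alg N Y"
  shows "snd (fob H (X, Y)) \<in> Ar M" "Dom M (snd (fob H (X, Y))) = fob (fac M) (fob PH (fst X, fst Y))"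
    "Cod M (snd (fob H (X, Y))) = fob hm (Cod K (fst X), Dom N (fst Y))"
  using M.algD[OF hom_ob(2)[OF assms]] K.coalgD(1)[of "fst X" "snd X"] N.algD(1)[of "fst Y" "snd Y"] assms by simp_all

lemma tensor_char_ar:
  assumes T: "lifted_tensor K M N PP T" and [simp]: "i \<in> Ar K" "j \<in> Ar M"
  shows "tensor_char K M N PP T i j \<in> Ar N"
    "Dom N (tensor_char K M N PP T i j) = fob ten (fob (fac K) i, fob (fac M) j)"
    "Cod N (tensor_char K M N PP T i j) = fob (fac N) (fob PP (i, j))"
  using tensor_structure_ar[OF T K.cofree_is_coalg M.cofree_is_coalg, of i j]
    EPP_ar[OF K.counit_square M.counit_square, of i j]
  by (simp_all add: tensor_char_def counit_sq_def cofree_coalg_def)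

lemma hom_char_ar:
  assumes H: "lifted_hom K N M PH H" and [simp]: "i \<in> Ar K" "f \<in> Ar N"
  shows "hom_char K N M PH H i f \<in> Ar M"
    "Dom M (hom_char K N M PH H i f) = fob (fac M) (fob PH (i, f))"
    "Cod M (hom_char K N M PH H i f) = fob hm (fob (fac K) i, fob (fac N) f)"
  using hom_structure_ar[OF H K.cofree_is_coalg N.free_is_alg, of i f]
    EPH_ar[OF K.counit_square N.unit_square, of i f]
  by (simp_all add: hom_char_def counit_sq_def unit_sq_def cofree_coalg_def free_alg_def)

text \<open>Functoriality along the maps \<open>(1, s)\<close> and \<open>(1, t)\<close> into cofree coalgebras.\<close>

lemma tensor_structure_char:
  assumes T: "lifted_tensor K M N PP T" and i: "is_coalg K (i, s)" and j: "is_coalg M (j, t)"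
  shows "snd (fob T ((i, s), (j, t))) = tensor_char K M N PP T i j \<cdot>\<^bsub>N\<^esub> far ten (s, t)"
proof -
  note Di [simp] = K.coalgD(1-4)[OF i] and Dj [simp] = M.coalgD(1-4)[OF j]
  note cof = K.cofree_is_coalg[OF Di(1)] M.cofree_is_coalg[OF Dj(1)]
  note sq = K.coalg_square[OF i] M.coalg_square[OF j] K.counit_square[OF Di(1)] M.counit_square[OF Dj(1)]
  note a = tensor_structure_ar[OF T i j, simplified] tensor_structure_ar[OF T cof]
  note [simp] = a[unfolded cofree_coalg_def, simplified] EPP_ar[OF sq(3,4)] EPP_ar[OF sq(1,2)]
  have "tensor_char K M N PP T i j \<cdot>\<^bsub>N\<^esub> far ten (s, t) =
      far (fac N) (far PP (Sq (lft K i) i (Idt K (Dom K i)) (rgt K i), Sq (lft M j) j (Idt M (Dom M j)) (rgt M j)))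
      \<cdot>\<^bsub>N\<^esub> far (fac N) (far PP (Sq i (lft K i) (Idt K (Dom K i)) s, Sq j (lft M j) (Idt M (Dom M j)) t))
      \<cdot>\<^bsub>N\<^esub> snd (fob T ((i, s), (j, t)))"
    using tensor_structure_map[OF T i cof(1) j cof(2) K.coalg_map_unit[OF i] M.coalg_map_unit[OF j]]
    by (simp add: tensor_char_def counit_sq_def cofree_coalg_def)
  also have "\<dots> = far (fac N) (far PP (idK i, idM j)) \<cdot>\<^bsub>N\<^esub> snd (fob T ((i, s), (j, t)))"
    using N.cmp_extend[OF EPP_cmp[OF sq], of "snd (fob T ((i, s), (j, t)))"] K.coalgD(6)[OF i] M.coalgD(6)[OF j] by simp
  finally show ?thesis by (simp add: PP_idt N.E_idt')
qed

text \<open>Functoriality along \<open>(1, s)\<close> into the cofree coalgebra and \<open>(r, 1)\<close> out of the free algebra.\<close>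

lemma hom_structure_char:
  assumes H: "lifted_hom K N M PH H" and i: "is_coalg K (i, s)" and f: "is_alg N (f, r)"
  shows "snd (fob H ((i, s), (f, r))) = far hm (s, r) \<cdot>\<^bsub>M\<^esub> hom_char K N M PH H i f"
proof -
  note Di [simp] = K.coalgD(1-4)[OF i] and Df [simp] = N.algD(1-4)[OF f]
  note cof = K.cofree_is_coalg[OF Di(1)] N.free_is_alg[OF Df(1)]
  note sq = K.counit_square[OF Di(1)] N.unit_square[OF Df(1)] K.coalg_square[OF i] N.alg_square[OF f]
  note a = hom_structure_ar[OF H i f, simplified] hom_structure_ar[OF H cof]
  note [simp] = a[unfolded cofree_coalg_def free_alg_def, simplified] EPH_ar[OF sq(3,4)] EPH_ar[OF sq(1,2)]
  have "far hm (s, r) \<cdot>\<^bsub>M\<^esub> hom_char K N M PH H i f = snd (fob H ((i, s), (f, r))) \<cdot>\<^bsub>M\<^esub>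
      far (fac M) (far PH (Sq i (lft K i) (Idt K (Dom K i)) s, Sq (rgt N f) f r (Idt N (Cod N f)))) \<cdot>\<^bsub>M\<^esub>
      far (fac M) (far PH (Sq (lft K i) i (Idt K (Dom K i)) (rgt K i), Sq f (rgt N f) (lft N f) (Idt N (Cod N f))))"
    using M.cmp_extend2[OF hom_structure_map[OF H cof(1) i cof(2) f K.coalg_map_unit[OF i] N.alg_map_counit[OF f]], of
      "far (fac M) (far PH (Sq (lft K i) i (Idt K (Dom K i)) (rgt K i), Sq f (rgt N f) (lft N f) (Idt N (Cod N f))))"]
    by (simp add: hom_char_def counit_sq_def unit_sq_def cofree_coalg_def free_alg_def)
  also have "\<dots> = snd (fob H ((i, s), (f, r))) \<cdot>\<^bsub>M\<^esub> far (fac M) (far PH (idK i, idN f))"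
    using EPH_cmp[OF sq] K.coalgD(6)[OF i] N.algD(5)[OF f] by simp
  finally show ?thesis by (simp add: PH_idt M.E_idt')
qed

lemma tensor_char_natural:
  assumes T: "lifted_tensor K M N PP T" and [simp]: "i \<in> Ar K" and sq: "square M j j' u v"
  shows "tensor_char K M N PP T i j' \<cdot>\<^bsub>N\<^esub> far ten (Idt K (fob (fac K) i), E_map M j j' u v) =
    far (fac N) (far PP (idK i, Sq j j' u v)) \<cdot>\<^bsub>N\<^esub> tensor_char K M N PP T i j"
proof -
  note [simp] = M.squareD[OF sq] sq
  note cof = K.cofree_is_coalg[OF assms(2)] M.cofree_is_coalg[OF M.squareD(1)[OF sq]] M.cofree_is_coalg[OF M.squareD(2)[OF sq]]
  note s = K.square_idt[OF K.L_ar[OF assms(2)]] M.L_square[OF sq] K.counit_square[OF assms(2)] M.counit_square[OF M.squareD(2)[OF sq]]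
    K.square_idt[OF assms(2)] M.counit_square[OF M.squareD(1)[OF sq]]
  note a = tensor_structure_ar[OF T cof(1,2)] tensor_structure_ar[OF T cof(1,3)]
  note [simp] = a[unfolded cofree_coalg_def, simplified] EPP_ar[OF s(3,4)] EPP_ar[OF s(3,6)] EPP_ar[OF s(1,2), simplified] EPP_ar[OF s(5) sq]
  have "tensor_char K M N PP T i j' \<cdot>\<^bsub>N\<^esub> far ten (Idt K (fob (fac K) i), E_map M j j' u v) =
      far (fac N) (far PP (Sq (lft K i) i (Idt K (Dom K i)) (rgt K i), Sq (lft M j') j' (Idt M (Dom M j')) (rgt M j')))
      \<cdot>\<^bsub>N\<^esub> far (fac N) (far PP (idK (lft K i), Sq (lft M j) (lft M j') u (E_map M j j' u v)))
      \<cdot>\<^bsub>N\<^esub> snd (fob T (cofree_coalg K i, cofree_coalg M j))"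
    using tensor_structure_map[OF T cof(1,1,2,3) K.coalg_map_idt[OF cof(1)[unfolded cofree_coalg_def], folded cofree_coalg_def] M.cofree_map[OF sq]]
    by (simp add: tensor_char_def counit_sq_def cofree_coalg_def)
  also have "\<dots> = far (fac N) (far PP (Sq (lft K i) i (Idt K (Dom K i)) (rgt K i), Sq (lft M j) j' u (v \<cdot>\<^bsub>M\<^esub> rgt M j)))
      \<cdot>\<^bsub>N\<^esub> snd (fob T (cofree_coalg K i, cofree_coalg M j))"
    using N.cmp_extend[OF EPP_cmp[OF s(1-4)], of "snd (fob T (cofree_coalg K i, cofree_coalg M j))"] M.R_E[OF sq]
    by (simp add: cofree_coalg_def)
  also have "\<dots> = far (fac N) (far PP (idK i, Sq j j' u v)) \<cdot>\<^bsub>N\<^esub> tensor_char K M N PP T i j"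
    using N.cmp_extend[OF EPP_cmp[OF s(3,6) s(5) sq], of "snd (fob T (cofree_coalg K i, cofree_coalg M j))"]
    by (simp add: tensor_char_def counit_sq_def cofree_coalg_def)
  finally show ?thesis .
qed

text \<open>The counit of the adjunction on arrow categories at \<open>f\<close>, described through the transposition of
its components and, in \<open>sq_counit\<close>, as the inverse image of an identity.\<close>

abbreviation "is_counit i f w b \<equiv>
  transposed i (fob PH (i, f)) f w b (Idt M (Dom M (fob PH (i, f)))) (Idt M (Cod M (fob PH (i, f))))"

abbreviation "sq_counit i f \<equiv> the_inv_into (hom (arrow_cat N) (fob PP (i, fob PH (i, f))) f)
  (tr_sq i (fob PH (i, f)) f) (Idt (arrow_cat M) (fob PH (i, f)))"

abbreviation "unit_at i m \<equiv>
  tr (fob (fac K) i) m (fob ten (fob (fac K) i, m)) (Idt N (fob ten (fob (fac K) i, m)))"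

text \<open>The formula for the mate composes three maps after the unit; transposing backwards merges it into
the transpose of a single map.\<close>

abbreviation "mate T i f w b \<equiv> tr (fob (fac K) i) (fob (fac M) (fob PH (i, f))) (fob (fac N) f)
  (E_map N (fob PP (i, fob PH (i, f))) f w b \<cdot>\<^bsub>N\<^esub> tensor_char K M N PP T i (fob PH (i, f)))"

abbreviation "mates_at T i \<rho> \<equiv> mates (arrow_cat N) M (fix_fst (arrow_cat K) PH i) (sq_counit i)
  (fix_fst K hm (fob (fac K) i)) (unit_at i) (fac M) (fac N) (tensor_char K M N PP T i) \<rho>"

lemma counit_transposed:
  assumes [simp]: "i \<in> Ar K" "f \<in> Ar N"
  obtains w b where "is_counit i f w b"
    "sq_counit i f = Sq (fob PP (i, fob PH (i, f))) f w b"
proof -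
  let ?p = "fob PH (i, f)"
  obtain w b where t: "transposed i ?p f w b (Idt M (Dom M ?p)) (Idt M (Cod M ?p))"
    using transposed_ex'[OF assms(1) _ assms(2) M.square_idt[of ?p]] by auto
  have inj: "inj_on (tr_sq i ?p f) (hom (arrow_cat N) (fob PP (i, ?p)) f)"
  proof (rule inj_onI)
    fix S S' assume S: "S \<in> hom (arrow_cat N) (fob PP (i, ?p)) f" "S' \<in> hom (arrow_cat N) (fob PP (i, ?p)) f"
      "tr_sq i ?p f S = tr_sq i ?p f S'"
    obtain w b w' b' where SS: "S = Sq (fob PP (i, ?p)) f w b" "S' = Sq (fob PP (i, ?p)) f w' b'"
      "square N (fob PP (i, ?p)) f w b" "square N (fob PP (i, ?p)) f w' b'"
      using S(1,2) by (cases S; cases S') (auto simp: hom_def arrow_cat_ar)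
    obtain c z where cz: "transposed i ?p f w b c z" "tr_sq i ?p f (Sq (fob PP (i, ?p)) f w b) = Sq ?p ?p c z"
      by (rule transposed_ex[OF assms(1) _ SS(3)]) simp
    have "tr_sq i ?p f (Sq (fob PP (i, ?p)) f w' b') = Sq ?p ?p c z" using S(3) cz(2) unfolding SS by metis
    then have "transposed i ?p f w' b' c z" using tr_sq_iff[OF assms(1) _ SS(4)] by simp
    then show "S = S'" using transposed_unique'[OF cz(1)] SS by simp
  qed
  have "tr_sq i ?p f (Sq (fob PP (i, ?p)) f w b) = Sq ?p ?p (Idt M (Dom M ?p)) (Idt M (Cod M ?p))"
    using t tr_sq_iff[OF assms(1) _ transposedD(4)[OF t]] by simp
  then have "the_inv_into (hom (arrow_cat N) (fob PP (i, ?p)) f) (tr_sq i ?p f) (Idt (arrow_cat M) ?p) = Sq (fob PP (i, ?p)) f w b"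
    using transposedD(4)[OF t] by (intro the_inv_into_f_eq[OF inj]) (simp_all add: hom_def arrow_cat_ar)
  then show ?thesis using that t by blast
qed

lemma mates_iff:
  assumes T: "lifted_tensor K M N PP T" and [simp]: "i \<in> Ar K"
  shows "mates_at T i \<rho> \<longleftrightarrow>
    (\<forall>f w b. f \<in> Ar N \<longrightarrow> is_counit i f w b \<longrightarrow> \<rho> f = mate T i f w b)"
proof -
  have "far hm (Idt K (fob (fac K) i), E_map N (fob PP (i, fob PH (i, f))) f w b) \<cdot>\<^bsub>M\<^esub>
      far hm (Idt K (fob (fac K) i), tensor_char K M N PP T i (fob PH (i, f))) \<cdot>\<^bsub>M\<^esub>
      unit_at i (fob (fac M) (fob PH (i, f))) = mate T i f w b"
    if f [simp]: "f \<in> Ar N" and t: "is_counit i f w b" for f w b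
  proof -
    note [simp] = tensor_char_ar[OF T assms(2), of "fob PH (i, f)"] transposedD(4)[OF t]
    let ?Q = "fob (fac K) i" and ?m = "fob (fac M) (fob PH (i, f))"
    show ?thesis
      using tr_post[of ?Q ?m "Idt N (fob ten (?Q, ?m))" "E_map N (fob PP (i, fob PH (i, f))) f w b \<cdot>\<^bsub>N\<^esub> tensor_char K M N PP T i (fob PH (i, f))"]
      by simp
  qed
  note eq = this
  show ?thesis (is "?L \<longleftrightarrow> ?R")
  proof
    assume L: ?L
    show ?R
    proof (intro allI impI)
      fix f w b assume f: "f \<in> Ar N" and t: "is_counit i f w b"
      obtain w' b' where t': "is_counit i f w' b'"
        "sq_counit i f = Sq (fob PP (i, fob PH (i, f))) f w' b'" by (rule counit_transposed[OF assms(2) f])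
      have [simp]: "w' = w" "b' = b" using transposed_unique'[OF t t'(1)] .
      show "\<rho> f = mate T i f w b"
        using L f t'(2) eq[OF f t] by (simp add: mates_def fix_fst_def del: arrow_cat_simps(4))
    qed
  next
    assume R: ?R
    show ?L unfolding mates_def
    proof
      fix f assume "f \<in> Ob (arrow_cat N)"
      then have f: "f \<in> Ar N" by simp
      obtain w' b' where t': "is_counit i f w' b'"
        "sq_counit i f = Sq (fob PP (i, fob PH (i, f))) f w' b'" by (rule counit_transposed[OF assms(2) f])
      show "\<rho> f = far (fix_fst K hm (fob (fac K) i)) (far (fac N) (sq_counit i f)) \<cdot>\<^bsub>M\<^esub>
        far (fix_fst K hm (fob (fac K) i)) (tensor_char K M N PP T i (fob (fix_fst (arrow_cat K) PH i) f)) \<cdot>\<^bsub>M\<^esub>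
        unit_at i (fob (fac M) (fob (fix_fst (arrow_cat K) PH i) f))"
        using R f t' eq[OF f t'(1)] by (simp add: fix_fst_def del: arrow_cat_simps(4))
    qed
  qed
qed

text \<open>Every square transposed to \<open>(c, z)\<close> is the counit precomposed with the pushout-product of \<open>i\<close> with
\<open>(c, z)\<close>, so by naturality of \<open>\<lambda>\<close> in its second argument the canonical solution is computed from
the value of the mate at \<open>(i, f)\<close> alone.\<close>

lemma tensor_solution_mate:
  assumes T: "lifted_tensor K M N PP T" and i: "is_coalg K (i, s)" and j: "is_coalg M (j, t)" and f: "is_alg N (f, r)"
    and t: "transposed i j f w b c z"
    and t0: "is_counit i f w0 b0"
  shows "tr (Cod K i) (Cod M j) (Dom N f) (tensor_solution T i s j t f r w b) = far hm (s, r) \<cdot>\<^bsub>M\<^esub>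
    mate T i f w0 b0 \<cdot>\<^bsub>M\<^esub>
    E_map M j (fob PH (i, f)) c z \<cdot>\<^bsub>M\<^esub> t"
proof -
  let ?p = "fob PH (i, f)"
  note Di [simp] = K.coalgD(1-4)[OF i] and Dj [simp] = M.coalgD(1-4)[OF j] and Df [simp] = N.algD(1-4)[OF f]
  have [simp]: "?p \<in> Ar M" by simp
  note sq [simp] = transposedD(4)[OF t] transposedD(5)[OF t] transposedD(4)[OF t0]
  note [simp] = N.squareD[OF sq(1)] M.squareD[OF sq(2)] N.squareD[OF sq(3)]
  note [simp] = tensor_char_ar[OF T Di(1), of ?p] tensor_char_ar[OF T Di(1) Dj(1)]
  let ?P = "far PP (idK i, Sq j ?p c z)"
  note ids = K.square_idt[OF Di(1)] N.square_idt[OF Df(1)]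
  note P = PP_far_eq[OF ids(1) sq(2)]
  have "transposed i j f (w0 \<cdot>\<^bsub>N\<^esub> sq_top ?P) (b0 \<cdot>\<^bsub>N\<^esub> far ten (Idt K (Cod K i), z)) c z"
    using transposed_natural[OF t0 ids(1) sq(2) ids(2)] N.squareD[OF P(2)] by (simp add: PH_idt)
  from transposed_unique'[OF this t] have wb: "w = w0 \<cdot>\<^bsub>N\<^esub> sq_top ?P" "b = b0 \<cdot>\<^bsub>N\<^esub> far ten (Idt K (Cod K i), z)" .
  have "E_map N (fob PP (i, j)) f w b = E_map N (fob PP (i, ?p)) f w0 b0 \<cdot>\<^bsub>N\<^esub> far (fac N) ?P"
    using N.E_cmp[OF P(2) sq(3)] P(1) wb by simp
  then have "tensor_solution T i s j t f r w b = r \<cdot>\<^bsub>N\<^esub> E_map N (fob PP (i, ?p)) f w0 b0 \<cdot>\<^bsub>N\<^esub> far (fac N) ?P \<cdot>\<^bsub>N\<^esub>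
      tensor_char K M N PP T i j \<cdot>\<^bsub>N\<^esub> far ten (s, t)"
    using EPP_ar[OF ids(1) sq(2)] by (simp add: tensor_solution_def solution_def tensor_structure_char[OF T i j])
  also have "\<dots> = r \<cdot>\<^bsub>N\<^esub> E_map N (fob PP (i, ?p)) f w0 b0 \<cdot>\<^bsub>N\<^esub> tensor_char K M N PP T i ?p \<cdot>\<^bsub>N\<^esub>
      far ten (Idt K (fob (fac K) i), E_map M j ?p c z) \<cdot>\<^bsub>N\<^esub> far ten (s, t)"
    using N.cmp_extend2[OF tensor_char_natural[OF T Di(1) sq(2)], of "far ten (s, t)"] EPP_ar[OF ids(1) sq(2)] by simp
  also have "\<dots> = r \<cdot>\<^bsub>N\<^esub> (E_map N (fob PP (i, ?p)) f w0 b0 \<cdot>\<^bsub>N\<^esub> tensor_char K M N PP T i ?p) \<cdot>\<^bsub>N\<^esub>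
      far ten (s, E_map M j ?p c z \<cdot>\<^bsub>M\<^esub> t)"
    by simp
  finally show ?thesis
    using tr_natural[of s "E_map M j ?p c z \<cdot>\<^bsub>M\<^esub> t" r "E_map N (fob PP (i, ?p)) f w0 b0 \<cdot>\<^bsub>N\<^esub> tensor_char K M N PP T i ?p" "Cod K i" "Cod M j" "Dom N f"]
    by simp
qed

text \<open>If the transformations are mates, then \<open>tensor_solution_mate\<close> and \<open>hom_structure_char\<close> give the
same expression. For the converse, \<open>\<rho>\<close> at \<open>(i, f)\<close> is itself a canonical solution: that of the
cofree coalgebra on the pullback-hom of \<open>i\<close> and \<open>f\<close>, against the pullback-hom of \<open>L i\<close> and
\<open>R f\<close>, of the square given by counits and unit. The corresponding solution for the tensor
transposes to the mate of \<open>\<lambda>\<close>.\<close>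

lemma mates_iff_lifts_agree:
  assumes T: "lifted_tensor K M N PP T" and H: "lifted_hom K N M PH H"
  shows "(\<forall>i\<in>Ar K. mates_at T i (hom_char K N M PH H i)) \<longleftrightarrow> lifts_agree T H"
proof
  assume L: "\<forall>i\<in>Ar K. mates_at T i (hom_char K N M PH H i)"
  show "lifts_agree T H" unfolding lifts_agree_def
  proof (intro allI impI)
    fix i s j t f r w b c z
    assume i: "is_coalg K (i, s)" and j: "is_coalg M (j, t)" and f: "is_alg N (f, r)" and t: "transposed i j f w b c z"
    note D [simp] = transposedD(1-3)[OF t]
    obtain w0 b0 where t0: "is_counit i f w0 b0"
      by (rule counit_transposed[OF D(1,3)])
    have "hom_char K N M PH H i f = mate T i f w0 b0"
      using L mates_iff[OF T D(1)] D t0 by blast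
    then show "tr (Cod K i) (Cod M j) (Dom N f) (tensor_solution T i s j t f r w b) = hom_solution H i s j t f r c z"
      using tensor_solution_mate[OF T i j f t t0] hom_structure_char[OF H i f] hom_char_ar[OF H D(1,3)]
        K.coalgD(1-4)[OF i] N.algD(1-4)[OF f] M.coalgD(1-4)[OF j] transposedD(5)[OF t]
      by (simp add: hom_solution_def solution_def)
  qed
next
  assume c: "lifts_agree T H"
  show "\<forall>i\<in>Ar K. mates_at T i (hom_char K N M PH H i)"
  proof
    fix i assume Di [simp]: "i \<in> Ar K"
    show "mates_at T i (hom_char K N M PH H i)" unfolding mates_iff[OF T Di]
    proof (intro allI impI)
      fix f w0 b0 assume Df [simp]: "f \<in> Ar N"
        and t0: "is_counit i f w0 b0"
      let ?p = "fob PH (i, f)"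
      have p: "?p \<in> Ar M" by simp
      note cu = K.counit_square[OF Di] M.counit_square[OF p] N.unit_square[OF Df]
      note cof = K.cofree_is_coalg[OF Di, unfolded cofree_coalg_def] M.cofree_is_coalg[OF p, unfolded cofree_coalg_def]
        N.free_is_alg[OF Df, unfolded free_alg_def]
      note sq0 = transposedD(4)[OF t0]
      note P = PP_far_eq[OF cu(1,2)] and H' = PH_far_eq[OF cu(1,3)]
      let ?P = "far PP (Sq (lft K i) i (Idt K (Dom K i)) (rgt K i), Sq (lft M ?p) ?p (Idt M (Dom M ?p)) (rgt M ?p))"
      let ?H = "far PH (Sq (lft K i) i (Idt K (Dom K i)) (rgt K i), Sq f (rgt N f) (lft N f) (Idt N (Cod N f)))"
      let ?w = "lft N f \<cdot>\<^bsub>N\<^esub> w0 \<cdot>\<^bsub>N\<^esub> sq_top ?P" and ?b = "b0 \<cdot>\<^bsub>N\<^esub> far ten (rgt K i, rgt M ?p)"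
      note [simp] = N.squareD[OF sq0] N.squareD[OF P(2)] M.squareD[OF H'(2)] sq0 EPP_ar[OF cu(1,2), simplified] EPH_ar[OF cu(1,3), simplified]
        tensor_structure_ar[OF T cof(1,2), simplified] hom_structure_ar[OF H cof(1,3), simplified]
        tensor_char_ar[OF T Di p]
      have t: "transposed (lft K i) (lft M ?p) (rgt N f) ?w ?b (far hm (rgt K i, lft N f)) (sq_bot ?H \<cdot>\<^bsub>M\<^esub> rgt M ?p)"
        using transposed_natural[OF t0 cu] by simp
      have "hom_solution H (lft K i) (cmul K i) (lft M ?p) (cmul M ?p) (rgt N f) (mul N f) (far hm (rgt K i, lft N f)) (sq_bot ?H \<cdot>\<^bsub>M\<^esub> rgt M ?p)
        = snd (fob H ((lft K i, cmul K i), (rgt N f, mul N f))) \<cdot>\<^bsub>M\<^esub> (far (fac M) ?H \<cdot>\<^bsub>M\<^esub> E_map M (lft M ?p) ?p (Idt M (Dom M ?p)) (rgt M ?p)) \<cdot>\<^bsub>M\<^esub> cmul M ?p"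
        using M.E_cmp[OF cu(2) H'(2)] H'(1) by (simp add: hom_solution_def solution_def)
      also have "\<dots> = hom_char K N M PH H i f"
        using M.E_cmul[OF p] cu(2) by (simp add: hom_char_def counit_sq_def unit_sq_def cofree_coalg_def free_alg_def)
      finally have h: "hom_solution H (lft K i) (cmul K i) (lft M ?p) (cmul M ?p) (rgt N f) (mul N f) (far hm (rgt K i, lft N f)) (sq_bot ?H \<cdot>\<^bsub>M\<^esub> rgt M ?p) = hom_char K N M PH H i f" .
      have e: "E_map N (fob PP (lft K i, lft M ?p)) (rgt N f) ?w ?b =
          E_map N f (rgt N f) (lft N f) (Idt N (Cod N f)) \<cdot>\<^bsub>N\<^esub> E_map N (fob PP (i, ?p)) f w0 b0 \<cdot>\<^bsub>N\<^esub> far (fac N) ?P"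
        using N.E_cmp[OF N.square_cmp[OF P(2) sq0] cu(3)] N.E_cmp[OF P(2) sq0] P(1) by simp
      have "tensor_solution T (lft K i) (cmul K i) (lft M ?p) (cmul M ?p) (rgt N f) (mul N f) ?w ?b =
          mul N f \<cdot>\<^bsub>N\<^esub> E_map N f (rgt N f) (lft N f) (Idt N (Cod N f)) \<cdot>\<^bsub>N\<^esub> E_map N (fob PP (i, ?p)) f w0 b0 \<cdot>\<^bsub>N\<^esub>
            tensor_char K M N PP T i ?p"
        unfolding tensor_solution_def solution_def snd_conv e using cu(3)
        by (simp add: tensor_char_def counit_sq_def cofree_coalg_def)
      also have "\<dots> = E_map N (fob PP (i, ?p)) f w0 b0 \<cdot>\<^bsub>N\<^esub> tensor_char K M N PP T i ?p"
        using N.cmp_extend[OF N.mul_E[OF Df], of "E_map N (fob PP (i, ?p)) f w0 b0 \<cdot>\<^bsub>N\<^esub> tensor_char K M N PP T i ?p"] cu(3) by simp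
      finally show "hom_char K N M PH H i f = tr (fob (fac K) i) (fob (fac M) ?p) (fob (fac N) f)
        (E_map N (fob PP (i, ?p)) f w0 b0 \<cdot>\<^bsub>N\<^esub> tensor_char K M N PP T i ?p)"
        using lifts_agreeD[OF c cof t] h by simp
    qed
  qed
qed

end

section \<open>Composition criteria\<close>

definition swap_cfun :: "('a \<times> 'b, 'c \<times> 'd, 'b \<times> 'a, 'd \<times> 'c) cfun" where
  "swap_cfun = CFun prod.swap prod.swap"

lemma swap_cfun_simps [simp]: "fob swap_cfun (x, y) = (y, x)" "far swap_cfun (u, v) = (v, u)"
  by (simp_all add: swap_cfun_def)

text \<open>Criterion (T) in the second variable, where the map \<open>a \<squnion> d\<close> appears as any \<open>w'\<close> with the required
restrictions along the legs. Not naming it by a chosen pushout makes the condition for the first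
variable literally an instance with exchanged arguments.\<close>

definition tensor_composes ::
  "('ok, 'ak) awfs_cat \<Rightarrow> ('om, 'am) awfs_cat \<Rightarrow> ('on, 'an) awfs_cat
    \<Rightarrow> ('ak \<times> 'am, 'ak square \<times> 'am square, 'an, 'an square) cfun
    \<Rightarrow> ('ak \<Rightarrow> 'am \<Rightarrow> 'an) \<Rightarrow> ('ak \<Rightarrow> 'am \<Rightarrow> 'an) \<Rightarrow> ('ak, 'am, 'an) lift \<Rightarrow> bool" where
  "tensor_composes K M N PP inj1 inj2 T \<longleftrightarrow> (\<forall>i s j t k t' f r w b w'.
     is_coalg K (i, s) \<longrightarrow> is_coalg M (j, t) \<longrightarrow> is_coalg M (k, t') \<longrightarrow> Dom M k = Cod M j \<longrightarrow> is_alg N (f, r) \<longrightarrow>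
     square N (fob PP (i, k \<cdot>\<^bsub>M\<^esub> j)) f w b \<longrightarrow> square N (fob PP (i, k)) f w' b \<longrightarrow>
     w' \<cdot>\<^bsub>N\<^esub> inj1 i k = w \<cdot>\<^bsub>N\<^esub> inj1 i (k \<cdot>\<^bsub>M\<^esub> j) \<longrightarrow>
     w' \<cdot>\<^bsub>N\<^esub> inj2 i k = solution N (fob T ((i, s), (j, t))) (f, r) (Sq (fob PP (i, j)) f
       (w \<cdot>\<^bsub>N\<^esub> sq_top (far PP (Idt (arrow_cat K) i, Sq j (k \<cdot>\<^bsub>M\<^esub> j) (Idt M (Dom M j)) k)))
       (b \<cdot>\<^bsub>N\<^esub> sq_bot (far PP (Idt (arrow_cat K) i, Sq j (k \<cdot>\<^bsub>M\<^esub> j) (Idt M (Dom M j)) k)))) \<longrightarrow>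
     solution N (fob T ((i, s), (k, t'))) (f, r) (Sq (fob PP (i, k)) f w' b) =
       solution N (fob T ((i, s), coalg_comp M (k, t') (j, t))) (f, r) (Sq (fob PP (i, k \<cdot>\<^bsub>M\<^esub> j)) f w b))"

text \<open>Criterion (H1), with \<open>d \<times> c\<close> given as any \<open>z'\<close> that has these projections.\<close>

definition hom_composes_alg ::
  "('ok, 'ak) awfs_cat \<Rightarrow> ('on, 'an) awfs_cat \<Rightarrow> ('om, 'am) awfs_cat
    \<Rightarrow> ('ak \<times> 'an, 'ak square \<times> 'an square, 'am, 'am square) cfun
    \<Rightarrow> ('ak \<Rightarrow> 'an \<Rightarrow> 'am) \<Rightarrow> ('ak \<Rightarrow> 'an \<Rightarrow> 'am) \<Rightarrow> ('ak, 'an, 'am) lift \<Rightarrow> bool" where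
  "hom_composes_alg K N M PH p1 p2 H \<longleftrightarrow> (\<forall>i s f r g r' j t c z z'.
     is_coalg K (i, s) \<longrightarrow> is_alg N (f, r) \<longrightarrow> is_alg N (g, r') \<longrightarrow> Dom N g = Cod N f \<longrightarrow> is_coalg M (j, t) \<longrightarrow>
     square M j (fob PH (i, g \<cdot>\<^bsub>N\<^esub> f)) c z \<longrightarrow> square M j (fob PH (i, f)) c z' \<longrightarrow>
     p1 i f \<cdot>\<^bsub>M\<^esub> z' = solution M (j, t) (fob H ((i, s), (g, r'))) (Sq j (fob PH (i, g))
       (sq_top (far PH (Idt (arrow_cat K) i, Sq (g \<cdot>\<^bsub>N\<^esub> f) g f (Idt N (Cod N g)))) \<cdot>\<^bsub>M\<^esub> c)
       (sq_bot (far PH (Idt (arrow_cat K) i, Sq (g \<cdot>\<^bsub>N\<^esub> f) g f (Idt N (Cod N g)))) \<cdot>\<^bsub>M\<^esub> z)) \<longrightarrow>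
     p2 i f \<cdot>\<^bsub>M\<^esub> z' = p2 i (g \<cdot>\<^bsub>N\<^esub> f) \<cdot>\<^bsub>M\<^esub> z \<longrightarrow>
     solution M (j, t) (fob H ((i, s), (f, r))) (Sq j (fob PH (i, f)) c z') =
       solution M (j, t) (fob H ((i, s), alg_comp N (g, r') (f, r))) (Sq j (fob PH (i, g \<cdot>\<^bsub>N\<^esub> f)) c z))"

text \<open>Criterion (H2), with \<open>b \<times> d\<close> given as any \<open>z'\<close> that has these projections.\<close>

definition hom_composes_coalg ::
  "('ok, 'ak) awfs_cat \<Rightarrow> ('on, 'an) awfs_cat \<Rightarrow> ('om, 'am) awfs_cat
    \<Rightarrow> ('ak \<times> 'an, 'ak square \<times> 'an square, 'am, 'am square) cfun
    \<Rightarrow> ('ak \<Rightarrow> 'an \<Rightarrow> 'am) \<Rightarrow> ('ak \<Rightarrow> 'an \<Rightarrow> 'am) \<Rightarrow> ('ak, 'an, 'am) lift \<Rightarrow> bool" where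
  "hom_composes_coalg K N M PH p1 p2 H \<longleftrightarrow> (\<forall>f r i s k s' j t c z z'.
     is_alg N (f, r) \<longrightarrow> is_coalg K (i, s) \<longrightarrow> is_coalg K (k, s') \<longrightarrow> Dom K k = Cod K i \<longrightarrow> is_coalg M (j, t) \<longrightarrow>
     square M j (fob PH (k \<cdot>\<^bsub>K\<^esub> i, f)) c z \<longrightarrow> square M j (fob PH (k, f)) c z' \<longrightarrow>
     p1 k f \<cdot>\<^bsub>M\<^esub> z' = p1 (k \<cdot>\<^bsub>K\<^esub> i) f \<cdot>\<^bsub>M\<^esub> z \<longrightarrow>
     p2 k f \<cdot>\<^bsub>M\<^esub> z' = solution M (j, t) (fob H ((i, s), (f, r))) (Sq j (fob PH (i, f))
       (sq_top (far PH (Sq i (k \<cdot>\<^bsub>K\<^esub> i) (Idt K (Dom K i)) k, Idt (arrow_cat N) f)) \<cdot>\<^bsub>M\<^esub> c)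
       (sq_bot (far PH (Sq i (k \<cdot>\<^bsub>K\<^esub> i) (Idt K (Dom K i)) k, Idt (arrow_cat N) f)) \<cdot>\<^bsub>M\<^esub> z)) \<longrightarrow>
     solution M (j, t) (fob H ((k, s'), (f, r))) (Sq j (fob PH (k, f)) c z') =
       solution M (j, t) (fob H (coalg_comp K (k, s') (i, s), (f, r))) (Sq j (fob PH (k \<cdot>\<^bsub>K\<^esub> i, f)) c z))"

context square_adjunction begin

lemma transposed_pre_M:
  assumes t: "transposed i j f w b c z" and sq: "square M j' j u v"
  shows "transposed i j' f (w \<cdot>\<^bsub>N\<^esub> sq_top (far PP (idK i, Sq j' j u v))) (b \<cdot>\<^bsub>N\<^esub> far ten (Idt K (Cod K i), v))
    (c \<cdot>\<^bsub>M\<^esub> u) (z \<cdot>\<^bsub>M\<^esub> v)"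
proof -
  note D [simp] = transposedD(1-5)[OF t]
  note ids = K.square_idt[OF D(1)] N.square_idt[OF D(3)]
  note [simp] = N.squareD[OF D(4)] M.squareD[OF D(5)] M.squareD[OF sq] N.squareD[OF PP_far_eq(2)[OF ids(1) sq]]
  show ?thesis using transposed_natural[OF t ids(1) sq ids(2)] by (simp add: PH_idt)
qed

lemma transposed_post_N:
  assumes t: "transposed i j f w b c z" and sq: "square N f f' a e"
  shows "transposed i j f' (a \<cdot>\<^bsub>N\<^esub> w) (e \<cdot>\<^bsub>N\<^esub> b) (far hm (Idt K (Cod K i), a) \<cdot>\<^bsub>M\<^esub> c)
    (sq_bot (far PH (idK i, Sq f f' a e)) \<cdot>\<^bsub>M\<^esub> z)"
proof -
  note D [simp] = transposedD(1-5)[OF t]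
  note ids = K.square_idt[OF D(1)] M.square_idt[OF D(2)]
  note [simp] = N.squareD[OF D(4)] M.squareD[OF D(5)] N.squareD[OF sq] M.squareD[OF PH_far_eq(2)[OF ids(1) sq]]
  show ?thesis using transposed_natural[OF t ids sq] by (simp add: PP_idt)
qed

lemma transposed_pre_K:
  assumes t: "transposed i j f w b c z" and sq: "square K i' i u v"
  shows "transposed i' j f (w \<cdot>\<^bsub>N\<^esub> sq_top (far PP (Sq i' i u v, idM j))) (b \<cdot>\<^bsub>N\<^esub> far ten (v, Idt M (Cod M j)))
    (far hm (v, Idt N (Dom N f)) \<cdot>\<^bsub>M\<^esub> c) (sq_bot (far PH (Sq i' i u v, idN f)) \<cdot>\<^bsub>M\<^esub> z)"
proof -
  note D [simp] = transposedD(1-5)[OF t]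
  note ids = M.square_idt[OF D(2)] N.square_idt[OF D(3)]
  note [simp] = N.squareD[OF D(4)] M.squareD[OF D(5)] K.squareD[OF sq] N.squareD[OF PP_far_eq(2)[OF sq ids(1)]]
    M.squareD[OF PH_far_eq(2)[OF sq ids(2)]]
  show ?thesis using transposed_natural[OF t sq ids] by simp
qed

text \<open>Values of the hom are algebras, and canonical solutions against an algebra respect composition of
coalgebras (\<open>solution_coalg_comp\<close>). The statement is the transpose of this.\<close>

lemma lifts_agree_imp_tensor_composes:
  assumes T: "lifted_tensor K M N PP T" and H: "lifted_hom K N M PH H" and c: "lifts_agree T H"
  shows "tensor_composes K M N PP inj1 inj2 T"
  unfolding tensor_composes_def
proof (intro allI impI, goal_cases)
  case (1 i s j t k t' f r w b w')
  let ?kj = "k \<cdot>\<^bsub>M\<^esub> j" and ?Q = "far PP (Idt (arrow_cat K) i, Sq j (k \<cdot>\<^bsub>M\<^esub> j) (Idt M (Dom M j)) k)"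
  note i = 1(1) and j = 1(2) and k = 1(3) and kj [simp] = 1(4) and f = 1(5) and sq = 1(6) and sq' = 1(7)
    and w1 = 1(8) and w2 = 1(9)
  note [simp] = K.coalgD(1-4)[OF i] M.coalgD(1-4)[OF j] M.coalgD(1-4)[OF k] N.algD(1-4)[OF f]
  obtain x where x: "coalg_comp M (k, t') (j, t) = (?kj, x)" "is_coalg M (?kj, x)"
    by (rule M.coalg_compE[OF j k kj])
  obtain c1 z where t1: "transposed i ?kj f w b c1 z" by (rule transposed_ex[OF _ _ sq]) simp_all
  obtain c2 z2 where t2: "transposed i k f w' b c2 z2" by (rule transposed_ex[OF _ _ sq']) simp_all
  have sqj: "square M j ?kj (Idt M (Dom M j)) k" by (rule M.square_first) simp_all
  note D1 = transposedD[OF t1] and D2 = transposedD[OF t2]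
  note [simp] = M.squareD[OF D1(5)] M.squareD[OF D2(5)]
  have z2: "z2 = z" by (rule pb_eq[of i f _ "Cod M k"]) (use D1(7,8) D2(7,8) w1 in \<open>simp_all add: hom_def\<close>)
  have t3: "transposed i j f (w \<cdot>\<^bsub>N\<^esub> sq_top ?Q) (b \<cdot>\<^bsub>N\<^esub> sq_bot ?Q) c1 (z \<cdot>\<^bsub>M\<^esub> k)"
    using transposed_pre_M[OF t1 sqj] PP_far_eq(1)[OF K.square_idt[of i] sqj] by (cases ?Q) simp
  have c2: "c2 = hom_solution H i s j t f r c1 (z \<cdot>\<^bsub>M\<^esub> k)"
    using lifts_agreeD[OF c i j f t3] D2(6) w2 by (simp add: tensor_solution_def)
  have hx: "fob H ((i, s), (f, r)) = (fob PH (i, f), snd (fob H ((i, s), (f, r))))"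
    using hom_ob(1)[OF H i f] by (metis fst_conv prod.collapse)
  have "tr (Cod K i) (Cod M k) (Dom N f) (tensor_solution T i s k t' f r w' b) = hom_solution H i s k t' f r c2 z"
    using lifts_agreeD[OF c i k f t2] z2 by simp
  also have "\<dots> = hom_solution H i s ?kj x f r c1 z"
    using M.solution_coalg_comp[OF j k kj hom_ob(2)[OF H i f, simplified] D1(5)] hx x(1) by (simp add: hom_solution_def c2)
  also have "\<dots> = tr (Cod K i) (Cod M ?kj) (Dom N f) (tensor_solution T i s ?kj x f r w b)"
    using lifts_agreeD[OF c i x(2) f t1] by simp
  finally have "tensor_solution T i s k t' f r w' b = tensor_solution T i s ?kj x f r w b"
    by (intro tr_inj[of "Cod K i" "Cod M k" _ "Dom N f"])
      (use tensor_solution_props[OF T i k f sq'] tensor_solution_props[OF T i x(2) f sq] in simp_all)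
  then show ?case
    by (simp add: tensor_solution_def x)
qed

text \<open>Values of the tensor are coalgebras, and canonical solutions of a coalgebra respect composition of
algebras (\<open>solution_alg_comp\<close>).\<close>

lemma lifts_agree_imp_hom_composes_alg:
  assumes T: "lifted_tensor K M N PP T" and H: "lifted_hom K N M PH H" and c: "lifts_agree T H"
  shows "hom_composes_alg K N M PH p1 p2 H"
  unfolding hom_composes_alg_def
proof (intro allI impI, goal_cases)
  case (1 i s f r g r' j t c1 z z')
  let ?gf = "g \<cdot>\<^bsub>N\<^esub> f" and ?Q = "far PH (Idt (arrow_cat K) i, Sq (g \<cdot>\<^bsub>N\<^esub> f) g f (Idt N (Cod N g)))"
  note i = 1(1) and f = 1(2) and g = 1(3) and gf [simp] = 1(4) and j = 1(5) and sq = 1(6) and sq' = 1(7)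
    and z1 = 1(8) and z2 = 1(9)
  note [simp] = K.coalgD(1-4)[OF i] M.coalgD(1-4)[OF j] N.algD(1-4)[OF f] N.algD(1-4)[OF g]
  obtain x where x: "alg_comp N (g, r') (f, r) = (?gf, x)" "is_alg N (?gf, x)"
    by (rule N.alg_compE[OF f g gf])
  obtain w b where t1: "transposed i j ?gf w b c1 z" by (rule transposed_ex'[OF _ _ _ sq]) simp_all
  obtain w' b' where t2: "transposed i j f w' b' c1 z'" by (rule transposed_ex'[OF _ _ _ sq']) simp_all
  have sqg: "square N ?gf g f (Idt N (Cod N g))" by (rule N.square_last) simp_all
  note D1 = transposedD[OF t1] and D2 = transposedD[OF t2]
  note [simp] = N.squareD[OF D1(4)] N.squareD[OF D2(4)]
  have e1: "w' \<cdot>\<^bsub>N\<^esub> inj1 i j = w \<cdot>\<^bsub>N\<^esub> inj1 i j"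
    by (rule tr_inj[of "Dom K i" "Cod M j" _ "Dom N f"]) (use D1(8) D2(8) z2 in simp_all)
  have e2: "w' \<cdot>\<^bsub>N\<^esub> inj2 i j = w \<cdot>\<^bsub>N\<^esub> inj2 i j"
    by (rule tr_inj[of "Cod K i" "Dom M j" _ "Dom N f"]) (use D1(6) D2(6) in simp_all)
  have w': "w' = w" by (rule po_eq[of i j _ "Dom N f"]) (simp_all add: hom_def e1 e2)
  \<comment> \<open>The auxiliary problem of (H1) against \<open>g\<close> and its transpose.\<close>
  have t3: "transposed i j g (f \<cdot>\<^bsub>N\<^esub> w) b (sq_top ?Q \<cdot>\<^bsub>M\<^esub> c1) (sq_bot ?Q \<cdot>\<^bsub>M\<^esub> z)"
    using transposed_post_N[OF t1 sqg] PH_far_eq(1)[OF K.square_idt[of i] sqg] by (cases ?Q) simp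
  note p = tensor_solution_props[OF T i j g transposedD(4)[OF t3]]
  have b': "b' = tensor_solution T i s j t g r' (f \<cdot>\<^bsub>N\<^esub> w) b"
    by (rule tr_inj[of "Cod K i" "Cod M j" _ "Cod N f"])
      (use lifts_agreeD[OF c i j g t3] D2(7) z1 p in \<open>simp_all add: hom_solution_def\<close>)
  have tx: "fob T ((i, s), (j, t)) = (fob PP (i, j), snd (fob T ((i, s), (j, t))))"
    using tensor_ob(1)[OF T i j] by (metis fst_conv prod.collapse)
  have "hom_solution H i s j t f r c1 z' = tr (Cod K i) (Cod M j) (Dom N f) (tensor_solution T i s j t f r w b')"
    using lifts_agreeD[OF c i j f t2] w' by simp
  also have "tensor_solution T i s j t f r w b' = tensor_solution T i s j t ?gf x w b"
    using N.solution_alg_comp[OF f g gf tensor_ob(2)[OF T i j, simplified] D1(4)] tx x(1) by (simp add: tensor_solution_def b')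
  also have "tr (Cod K i) (Cod M j) (Dom N f) \<dots> = hom_solution H i s j t ?gf x c1 z"
    using lifts_agreeD[OF c i j x(2) t1] by simp
  finally show ?case
    by (simp add: hom_solution_def x)
qed

text \<open>The transposed solutions of the tensor are a lifting operation against each pullback-hom: natural
because the tensor is a functor on coalgebras, compatible with composition by the criterion.\<close>

lemma tensor_composes_imp_lifts_agree:
  assumes T: "lifted_tensor K M N PP T" and crit: "tensor_composes K M N PP inj1 inj2 T"
  shows "\<exists>H. lifted_hom K N M PH H \<and> lifts_agree T H"
proof -
  \<comment> \<open>The choice picks the unique square that transposes to \<open>(c, z)\<close>.\<close>
  define \<psi> where "\<psi> x jt c z = (case (x, jt) of (((i, s), (f, r)), (j, t)) \<Rightarrow>
    (let wb = SOME wb. transposed i j f (fst wb) (snd wb) c z in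
      tr (Cod K i) (Cod M j) (Dom N f) (tensor_solution T i s j t f r (fst wb) (snd wb))))"
    for x :: "'ak structured \<times> 'an structured" and jt :: "'am structured" and c z :: 'am
  have \<psi>: "\<psi> ((i, s), (f, r)) (j, t) c z = tr (Cod K i) (Cod M j) (Dom N f) (tensor_solution T i s j t f r w b)"
    if t: "transposed i j f w b c z" for i s f r j t c z w b
  proof -
    have "(SOME wb. transposed i j f (fst wb) (snd wb) c z) = (w, b)"
    proof (rule some_equality)
      fix wb assume "transposed i j f (fst wb) (snd wb) c z"
      then show "wb = (w, b)" using transposed_unique'[OF t, of "fst wb" "snd wb"] by (metis prod.collapse)
    qed (simp add: t)
    then show ?thesis by (simp add: \<psi>_def)
  qed
  let ?I = "prod_cat (op_cat (coalg K)) (alg N)"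
  let ?P = "cfun_comp PH (cfun_prod forget forget)"
  have P: "cfunctor ?I (arrow_cat M) ?P"
    by (rule cfunctor_comp[OF cfunctor_prod[OF cfunctor_op[OF K.forget_coalg] N.forget_alg] PH_functor])
  have "\<exists>H. cfunctor ?I (alg M) H \<and> cfun_agree ?I (cfun_comp forget H) ?P \<and>
    (\<forall>x\<in>Ob ?I. \<forall>j t u v. is_coalg M (j, t) \<longrightarrow> square M j (fob ?P x) u v \<longrightarrow>
       solution M (j, t) (fob H x) (Sq j (fob ?P x) u v) = \<psi> x (j, t) u v)"
  proof (rule M.lift_to_alg[OF P])
    fix x j t c z assume "x \<in> Ob ?I" and j: "is_coalg M (j, t)" and sq: "square M j (fob ?P x) c z"
    then obtain i s f r where x: "x = ((i, s), (f, r))" and i: "is_coalg K (i, s)" and f: "is_alg N (f, r)" by auto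
    note [simp] = K.coalgD(1-4)[OF i] M.coalgD(1-4)[OF j] N.algD(1-4)[OF f]
    obtain w b where t: "transposed i j f w b c z" by (rule transposed_ex'[of i j f c z]) (use sq x in simp_all)
    show "\<psi> x (j, t) c z \<in> hom M (Cod M j) (Dom M (fob ?P x)) \<and> \<psi> x (j, t) c z \<cdot>\<^bsub>M\<^esub> j = c \<and>
        fob ?P x \<cdot>\<^bsub>M\<^esub> \<psi> x (j, t) c z = z"
      using tensor_solution_props[OF T i j f transposedD(4)[OF t]] transposed_solves[OF t, of "tensor_solution T i s j t f r w b"]
      by (simp add: x \<psi>[OF t] hom_def)
  next
    fix x j t j' t' u v c z
    assume "x \<in> Ob ?I" and j: "is_coalg M (j, t)" and j': "is_coalg M (j', t')"
      and m: "coalg_map M (j', t') (j, t) u v" and sq: "square M j (fob ?P x) c z"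
    then obtain i s f r where x: "x = ((i, s), (f, r))" and i: "is_coalg K (i, s)" and f: "is_alg N (f, r)" by auto
    note [simp] = K.coalgD(1-4)[OF i] M.coalgD(1-4)[OF j] N.algD(1-4)[OF f]
    obtain w b where t: "transposed i j f w b c z" by (rule transposed_ex'[of i j f c z]) (use sq x in simp_all)
    have sqm: "square M j' j u v" using m by (simp add: coalg_map_def)
    note [simp] = M.squareD[OF sqm] N.squareD[OF transposedD(4)[OF t]]
    note p = tensor_solution_props[OF T i j f transposedD(4)[OF t]]
    have "tensor_solution T i s j' t' f r (w \<cdot>\<^bsub>N\<^esub> sq_top (far PP (idK i, Sq j' j u v))) (b \<cdot>\<^bsub>N\<^esub> far ten (Idt K (Cod K i), v)) =
        tensor_solution T i s j t f r w b \<cdot>\<^bsub>N\<^esub> far ten (Idt K (Cod K i), v)"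
      using tensor_solution_natural[OF T i i K.coalg_map_idt[OF i] j j' m f f N.alg_map_idt[OF f] transposedD(4)[OF t]] p
        N.squareD[OF PP_far_eq(2)[OF K.square_idt[of i] sqm]] by simp
    then show "\<psi> x (j', t') (c \<cdot>\<^bsub>M\<^esub> u) (z \<cdot>\<^bsub>M\<^esub> v) = \<psi> x (j, t) c z \<cdot>\<^bsub>M\<^esub> v"
      using p tr_right[of "Cod K i" v "tensor_solution T i s j t f r w b" "Dom N f"]
      by (simp add: x \<psi>[OF t] \<psi>[OF transposed_pre_M[OF t sqm]])
  next
    fix x j t k t' c z
    assume "x \<in> Ob ?I" and j: "is_coalg M (j, t)" and k: "is_coalg M (k, t')" and kj: "Dom M k = Cod M j"
      and sq: "square M (k \<cdot>\<^bsub>M\<^esub> j) (fob ?P x) c z"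
    then obtain i s f r where x: "x = ((i, s), (f, r))" and i: "is_coalg K (i, s)" and f: "is_alg N (f, r)" by auto
    note [simp] = K.coalgD(1-4)[OF i] M.coalgD(1-4)[OF j] M.coalgD(1-4)[OF k] N.algD(1-4)[OF f] kj
    let ?kj = "k \<cdot>\<^bsub>M\<^esub> j" and ?Q = "far PP (Idt (arrow_cat K) i, Sq j (k \<cdot>\<^bsub>M\<^esub> j) (Idt M (Dom M j)) k)"
    obtain x' where x': "coalg_comp M (k, t') (j, t) = (?kj, x')" "is_coalg M (?kj, x')"
      by (rule M.coalg_compE[OF j k kj])
    obtain w b where t: "transposed i ?kj f w b c z" by (rule transposed_ex'[of i ?kj f c z]) (use sq x in simp_all)
    note D = transposedD[OF t]
    note [simp] = M.squareD[OF D(5)] N.squareD[OF D(4)]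
    have sqj: "square M j ?kj (Idt M (Dom M j)) k" by (rule M.square_first) simp_all
    have t3: "transposed i j f (w \<cdot>\<^bsub>N\<^esub> sq_top ?Q) (b \<cdot>\<^bsub>N\<^esub> sq_bot ?Q) c (z \<cdot>\<^bsub>M\<^esub> k)"
      using transposed_pre_M[OF t sqj] PP_far_eq(1)[OF K.square_idt[of i] sqj] by (cases ?Q) simp
    note D3 = transposedD[OF t3]
    define d where "d = tensor_solution T i s j t f r (w \<cdot>\<^bsub>N\<^esub> sq_top ?Q) (b \<cdot>\<^bsub>N\<^esub> sq_bot ?Q)"
    note p = tensor_solution_props[OF T i j f D3(4), folded d_def]
    have \<psi>j: "\<psi> x (j, t) c (z \<cdot>\<^bsub>M\<^esub> k) = tr (Cod K i) (Cod M j) (Dom N f) d"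
      by (simp add: x \<psi>[OF t3] d_def)
    have s: "tr (Cod K i) (Cod M j) (Dom N f) d \<cdot>\<^bsub>M\<^esub> j = c"
      "fob PH (i, f) \<cdot>\<^bsub>M\<^esub> tr (Cod K i) (Cod M j) (Dom N f) d = z \<cdot>\<^bsub>M\<^esub> k"
      using transposed_solves[OF t3, of d] p by simp_all
    have sqk: "square M k (fob PH (i, f)) (tr (Cod K i) (Cod M j) (Dom N f) d) z"
      using s p by (simp add: square_def)
    \<comment> \<open>The second problem of (T), recovered from its transpose.\<close>
    obtain w' b' where t': "transposed i k f w' b' (tr (Cod K i) (Cod M j) (Dom N f) d) z"
      by (rule transposed_ex'[OF _ _ _ sqk]) simp_all
    note D' = transposedD[OF t']
    note [simp] = N.squareD[OF D'(4)]
    have b': "b' = b"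
      by (rule tr_inj[of "Cod K i" "Cod M k" _ "Cod N f"]) (use D(7) D'(7) in simp_all)
    have w1: "w' \<cdot>\<^bsub>N\<^esub> inj1 i k = w \<cdot>\<^bsub>N\<^esub> inj1 i ?kj"
      by (rule tr_inj[of "Dom K i" "Cod M k" _ "Dom N f"]) (use D(8) D'(8) in simp_all)
    have w2: "w' \<cdot>\<^bsub>N\<^esub> inj2 i k = d"
      by (rule tr_inj[of "Cod K i" "Cod M j" _ "Dom N f"]) (use D'(6) p in simp_all)
    have "tensor_solution T i s k t' f r w' b = tensor_solution T i s ?kj x' f r w b"
      using crit[unfolded tensor_composes_def, rule_format, OF i j k kj f D(4) D'(4)[unfolded b'] w1
        w2[unfolded d_def tensor_solution_def]] x'(1) by (simp add: tensor_solution_def)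
    then show "\<psi> x (k, t') (\<psi> x (j, t) c (z \<cdot>\<^bsub>M\<^esub> k)) z = \<psi> x (coalg_comp M (k, t') (j, t)) c z"
      using \<psi>[OF t'] \<psi>[OF t] unfolding \<psi>j by (simp add: x x'(1) b')
  next
    fix a j t c z
    assume a: "a \<in> Ar ?I" and j: "is_coalg M (j, t)" and sq: "square M j (fob ?P (Dom ?I a)) c z"
    obtain X X' Y Y' u v g e where a': "a = ((X', X, Sq (fst X') (fst X) u v), (Y, Y', Sq (fst Y) (fst Y') g e))"
      "is_coalg K X" "is_coalg K X'" "is_alg N Y" "is_alg N Y'" "coalg_map K X' X u v" "alg_map N Y Y' g e"
      using a by (cases a) (auto simp: coalg_ar alg_ar)
    obtain i s i' s' f r f' r' where X: "X = (i, s)" "X' = (i', s')" "Y = (f, r)" "Y' = (f', r')"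
      by (cases X; cases X'; cases Y; cases Y')
    note i = a'(2,3,6)[unfolded X] and f = a'(4,5,7)[unfolded X]
    note [simp] = K.coalgD(1-4)[OF i(1)] K.coalgD(1-4)[OF i(2)] M.coalgD(1-4)[OF j] N.algD(1-4)[OF f(1)] N.algD(1-4)[OF f(2)]
    obtain w b where t: "transposed i j f w b c z" by (rule transposed_ex'[of i j f c z]) (use sq a' X in simp_all)
    note D = transposedD[OF t]
    have sqi: "square K i' i u v" "square N f f' g e" using i f by (simp_all add: coalg_map_def alg_map_def)
    note [simp] = M.squareD[OF D(5)] N.squareD[OF D(4)] K.squareD[OF sqi(1)] N.squareD[OF sqi(2)]
      M.squareD[OF PH_far_eq(2)[OF sqi]]
    note p = tensor_solution_props[OF T i(1) j f(1) D(4)]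
    have "\<psi> ((i', s'), (f', r')) (j, t) (far hm (v, g) \<cdot>\<^bsub>M\<^esub> c) (sq_bot (far PH (Sq i' i u v, Sq f f' g e)) \<cdot>\<^bsub>M\<^esub> z) =
      far hm (v, g) \<cdot>\<^bsub>M\<^esub> \<psi> ((i, s), (f, r)) (j, t) c z"
      using \<psi>[OF transposed_natural[OF t sqi(1) M.square_idt[of j] sqi(2)], of s' r' t] \<psi>[OF t, of s r t] p
        tensor_solution_natural[OF T i j j M.coalg_map_idt[OF j] f D(4)]
        tr_natural[of v "Idt M (Cod M j)" g "tensor_solution T i s j t f r w b" "Cod K i'" "Cod M j" "Dom N f'"]
      by simp
    then show "\<psi> (Cod ?I a) (j, t) (sq_top (far ?P a) \<cdot>\<^bsub>M\<^esub> c) (sq_bot (far ?P a) \<cdot>\<^bsub>M\<^esub> z) =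
        sq_top (far ?P a) \<cdot>\<^bsub>M\<^esub> \<psi> (Dom ?I a) (j, t) c z"
      using PH_far_eq(1)[OF sqi] by (cases "far PH (Sq i' i u v, Sq f f' g e)") (simp add: a'(1) X)
  qed
  then obtain H where H: "cfunctor ?I (alg M) H" "cfun_agree ?I (cfun_comp forget H) ?P"
    "\<And>x j t u v. \<lbrakk>x \<in> Ob ?I; is_coalg M (j, t); square M j (fob ?P x) u v\<rbrakk> \<Longrightarrow>
       solution M (j, t) (fob H x) (Sq j (fob ?P x) u v) = \<psi> x (j, t) u v" by blast
  have "lifted_hom K N M PH H" using H by (simp add: lifted_hom_def lifted_def)
  moreover have "lifts_agree T H" unfolding lifts_agree_def
  proof (intro allI impI)
    fix i s j t f r w b c z
    assume i: "is_coalg K (i, s)" and j: "is_coalg M (j, t)" and f: "is_alg N (f, r)" and t: "transposed i j f w b c z"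
    show "tr (Cod K i) (Cod M j) (Dom N f) (tensor_solution T i s j t f r w b) = hom_solution H i s j t f r c z"
      using H(3)[of "((i, s), (f, r))" j t c z] i j f transposedD(5)[OF t] \<psi>[OF t] by (simp add: hom_solution_def)
  qed
  ultimately show ?thesis by blast
qed

text \<open>Solutions of the hom, transposed backwards, are a lifting operation of each pushout-product against
all algebras, and (H1) is its compatibility with composition of algebras.\<close>

lemma hom_composes_alg_imp_lifts_agree:
  assumes H: "lifted_hom K N M PH H" and crit: "hom_composes_alg K N M PH p1 p2 H"
  shows "\<exists>T. lifted_tensor K M N PP T \<and> lifts_agree T H"
proof -
  \<comment> \<open>The choice picks the unique \<open>d\<close> that transposes to the solution for the hom.\<close>
  define \<psi> where "\<psi> x fr w b = (case (x, fr) of (((i, s), (j, t)), (f, r)) \<Rightarrow>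
    SOME d. d \<in> hom N (fob ten (Cod K i, Cod M j)) (Dom N f) \<and> (\<exists>c z. transposed i j f w b c z \<and>
      tr (Cod K i) (Cod M j) (Dom N f) d = hom_solution H i s j t f r c z))"
    for x :: "'ak structured \<times> 'am structured" and fr :: "'an structured" and w b :: 'an
  have \<psi>: "\<psi> ((i, s), (j, t)) (f, r) w b \<in> Ar N"
    "Dom N (\<psi> ((i, s), (j, t)) (f, r) w b) = fob ten (Cod K i, Cod M j)"
    "Cod N (\<psi> ((i, s), (j, t)) (f, r) w b) = Dom N f"
    "tr (Cod K i) (Cod M j) (Dom N f) (\<psi> ((i, s), (j, t)) (f, r) w b) = hom_solution H i s j t f r c z"
    if t: "transposed i j f w b c z" and i: "is_coalg K (i, s)" and j: "is_coalg M (j, t)" and f: "is_alg N (f, r)"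
    for i s f r j t c z w b
  proof -
    note [simp] = K.coalgD(1-4)[OF i] M.coalgD(1-4)[OF j] N.algD(1-4)[OF f]
    note p = hom_solution_props[OF H i j f transposedD(5)[OF t]]
    obtain d where "d \<in> hom N (fob ten (Cod K i, Cod M j)) (Dom N f)"
      "tr (Cod K i) (Cod M j) (Dom N f) d = hom_solution H i s j t f r c z"
      by (rule tr_surj[of "Cod K i" "Cod M j" "Dom N f" "hom_solution H i s j t f r c z"]) (use p in \<open>auto simp: hom_def\<close>)
    then have "\<exists>d. d \<in> hom N (fob ten (Cod K i, Cod M j)) (Dom N f) \<and> (\<exists>c z. transposed i j f w b c z \<and>
      tr (Cod K i) (Cod M j) (Dom N f) d = hom_solution H i s j t f r c z)" using t by blast
    from someI_ex[OF this] obtain c' z' where 1: "\<psi> ((i, s), (j, t)) (f, r) w b \<in> hom N (fob ten (Cod K i, Cod M j)) (Dom N f)"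
      "transposed i j f w b c' z'" "tr (Cod K i) (Cod M j) (Dom N f) (\<psi> ((i, s), (j, t)) (f, r) w b) = hom_solution H i s j t f r c' z'"
      by (auto simp: \<psi>_def)
    then show "\<psi> ((i, s), (j, t)) (f, r) w b \<in> Ar N"
      "Dom N (\<psi> ((i, s), (j, t)) (f, r) w b) = fob ten (Cod K i, Cod M j)"
      "Cod N (\<psi> ((i, s), (j, t)) (f, r) w b) = Dom N f"
      "tr (Cod K i) (Cod M j) (Dom N f) (\<psi> ((i, s), (j, t)) (f, r) w b) = hom_solution H i s j t f r c z"
      using transposed_unique[OF t 1(2)] by (auto simp: hom_def)
  qed
  let ?I = "prod_cat (coalg K) (coalg M)"
  let ?P = "cfun_comp PP (cfun_prod forget forget)"
  have P: "cfunctor ?I (arrow_cat N) ?P"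
    by (rule cfunctor_comp[OF cfunctor_prod[OF K.forget_coalg M.forget_coalg] PP_functor])
  have "\<exists>T. cfunctor ?I (coalg N) T \<and> cfun_agree ?I (cfun_comp forget T) ?P \<and>
    (\<forall>x\<in>Ob ?I. \<forall>f r u v. is_alg N (f, r) \<longrightarrow> square N (fob ?P x) f u v \<longrightarrow>
       solution N (fob T x) (f, r) (Sq (fob ?P x) f u v) = \<psi> x (f, r) u v)"
  proof (rule N.lift_to_coalg[OF P])
    fix x f r w b assume "x \<in> Ob ?I" and f: "is_alg N (f, r)" and sq: "square N (fob ?P x) f w b"
    then obtain i s j t where x: "x = ((i, s), (j, t))" and i: "is_coalg K (i, s)" and j: "is_coalg M (j, t)" by auto
    note [simp] = K.coalgD(1-4)[OF i] M.coalgD(1-4)[OF j] N.algD(1-4)[OF f]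
    obtain c z where t: "transposed i j f w b c z" by (rule transposed_ex[of i j f w b]) (use sq x in simp_all)
    show "\<psi> x (f, r) w b \<in> hom N (Cod N (fob ?P x)) (Dom N f) \<and> \<psi> x (f, r) w b \<cdot>\<^bsub>N\<^esub> fob ?P x = w \<and>
        f \<cdot>\<^bsub>N\<^esub> \<psi> x (f, r) w b = b"
      using hom_solution_props[OF H i j f transposedD(5)[OF t]] transposed_solves[OF t, of "\<psi> x (f, r) w b"] \<psi>[OF t i j f]
      by (simp add: x hom_def)
  next
    fix x f r f' r' g e w b
    assume "x \<in> Ob ?I" and f: "is_alg N (f, r)" and f': "is_alg N (f', r')"
      and m: "alg_map N (f, r) (f', r') g e" and sq: "square N (fob ?P x) f w b"
    then obtain i s j t where x: "x = ((i, s), (j, t))" and i: "is_coalg K (i, s)" and j: "is_coalg M (j, t)" by auto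
    note [simp] = K.coalgD(1-4)[OF i] M.coalgD(1-4)[OF j] N.algD(1-4)[OF f] N.algD(1-4)[OF f']
    obtain c z where t: "transposed i j f w b c z" by (rule transposed_ex[of i j f w b]) (use sq x in simp_all)
    have sqm: "square N f f' g e" using m by (simp add: alg_map_def)
    note t' = transposed_post_N[OF t sqm]
    note [simp] = N.squareD[OF sqm] N.squareD[OF transposedD(4)[OF t]] M.squareD[OF transposedD(5)[OF t]]
    note p = hom_solution_props[OF H i j f transposedD(5)[OF t]] and q = \<psi>[OF t i j f] and q' = \<psi>[OF t' i j f']
    have "hom_solution H i s j t f' r' (far hm (Idt K (Cod K i), g) \<cdot>\<^bsub>M\<^esub> c) (sq_bot (far PH (idK i, Sq f f' g e)) \<cdot>\<^bsub>M\<^esub> z) =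
        far hm (Idt K (Cod K i), g) \<cdot>\<^bsub>M\<^esub> hom_solution H i s j t f r c z"
      using hom_solution_natural[OF H i i K.coalg_map_idt[OF i] j j M.coalg_map_idt[OF j] f f' m transposedD(5)[OF t]] p
        M.squareD[OF PH_far_eq(2)[OF K.square_idt[of i] sqm]] by simp
    then have "\<psi> x (f', r') (g \<cdot>\<^bsub>N\<^esub> w) (e \<cdot>\<^bsub>N\<^esub> b) = g \<cdot>\<^bsub>N\<^esub> \<psi> x (f, r) w b"
      unfolding x using tr_post[of "Cod K i" "Cod M j" "\<psi> ((i, s), (j, t)) (f, r) w b" g]
      by (intro tr_inj[of "Cod K i" "Cod M j" _ "Dom N f'"]) (simp_all add: q q')
    then show "\<psi> x (f', r') (g \<cdot>\<^bsub>N\<^esub> w) (e \<cdot>\<^bsub>N\<^esub> b) = g \<cdot>\<^bsub>N\<^esub> \<psi> x (f, r) w b" .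
  next
    fix x f r g r' w b
    assume "x \<in> Ob ?I" and f: "is_alg N (f, r)" and g: "is_alg N (g, r')" and gf: "Dom N g = Cod N f"
      and sq: "square N (fob ?P x) (g \<cdot>\<^bsub>N\<^esub> f) w b"
    then obtain i s j t where x: "x = ((i, s), (j, t))" and i: "is_coalg K (i, s)" and j: "is_coalg M (j, t)" by auto
    note [simp] = K.coalgD(1-4)[OF i] M.coalgD(1-4)[OF j] N.algD(1-4)[OF f] N.algD(1-4)[OF g] gf
    let ?gf = "g \<cdot>\<^bsub>N\<^esub> f" and ?Q = "far PH (Idt (arrow_cat K) i, Sq (g \<cdot>\<^bsub>N\<^esub> f) g f (Idt N (Cod N g)))"
    obtain x' where x': "alg_comp N (g, r') (f, r) = (?gf, x')" "is_alg N (?gf, x')"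
      by (rule N.alg_compE[OF f g gf])
    obtain c z where t: "transposed i j ?gf w b c z" by (rule transposed_ex[of i j ?gf w b]) (use sq x in simp_all)
    note D = transposedD[OF t]
    note [simp] = M.squareD[OF D(5)] N.squareD[OF D(4)]
    have sqg: "square N ?gf g f (Idt N (Cod N g))" by (rule N.square_last) simp_all
    have t3: "transposed i j g (f \<cdot>\<^bsub>N\<^esub> w) b (sq_top ?Q \<cdot>\<^bsub>M\<^esub> c) (sq_bot ?Q \<cdot>\<^bsub>M\<^esub> z)"
      using transposed_post_N[OF t sqg] PH_far_eq(1)[OF K.square_idt[of i] sqg] by (cases ?Q) simp
    define d where "d = \<psi> x (g, r') (f \<cdot>\<^bsub>N\<^esub> w) b"
    note q = \<psi>[OF t3 i j g, folded x, folded d_def]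
    note p = hom_solution_props[OF H i j g transposedD(5)[OF t3]]
    have s: "d \<cdot>\<^bsub>N\<^esub> fob PP (i, j) = f \<cdot>\<^bsub>N\<^esub> w" "g \<cdot>\<^bsub>N\<^esub> d = b"
      using transposed_solves[OF t3, of d] p q by simp_all
    have sqf: "square N (fob PP (i, j)) f w d" using s q by (simp add: square_def)
    obtain c' z' where t': "transposed i j f w d c' z'" by (rule transposed_ex[OF _ _ sqf]) simp_all
    note D' = transposedD[OF t']
    have c': "c' = c" using D(6) D'(6) by simp
    have z1: "p1 i f \<cdot>\<^bsub>M\<^esub> z' = hom_solution H i s j t g r' (sq_top ?Q \<cdot>\<^bsub>M\<^esub> c) (sq_bot ?Q \<cdot>\<^bsub>M\<^esub> z)"
      using D'(7) q by simp
    have z2: "p2 i f \<cdot>\<^bsub>M\<^esub> z' = p2 i ?gf \<cdot>\<^bsub>M\<^esub> z" using D'(8) D(8) by simp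
    have h: "hom_solution H i s j t f r c z' = hom_solution H i s j t ?gf x' c z"
      using crit[unfolded hom_composes_alg_def, rule_format, OF i f g gf j D(5) D'(5)[unfolded c'] z1[unfolded hom_solution_def] z2] x'(1)
      by (simp add: hom_solution_def)
    show "\<psi> x (f, r) w (\<psi> x (g, r') (f \<cdot>\<^bsub>N\<^esub> w) b) = \<psi> x (alg_comp N (g, r') (f, r)) w b"
      unfolding d_def[symmetric] unfolding x x'(1)
      by (rule tr_inj[of "Cod K i" "Cod M j" _ "Dom N f"])
        (use \<psi>[OF t' i j f] \<psi>[OF t i j x'(2)] h c' in simp_all)
  next
    fix a f r w b
    assume a: "a \<in> Ar ?I" and f: "is_alg N (f, r)" and sq: "square N (fob ?P (Cod ?I a)) f w b"
    obtain X X' Y Y' u v u' v' where a': "a = ((X', X, Sq (fst X') (fst X) u v), (Y', Y, Sq (fst Y') (fst Y) u' v'))"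
      "is_coalg K X" "is_coalg K X'" "is_coalg M Y" "is_coalg M Y'" "coalg_map K X' X u v" "coalg_map M Y' Y u' v'"
      using a by (cases a) (auto simp: coalg_ar)
    obtain i s i' s' j t j' t' where X: "X = (i, s)" "X' = (i', s')" "Y = (j, t)" "Y' = (j', t')"
      by (cases X; cases X'; cases Y; cases Y')
    note i = a'(2,3,6)[unfolded X] and j = a'(4,5,7)[unfolded X]
    note [simp] = K.coalgD(1-4)[OF i(1)] K.coalgD(1-4)[OF i(2)] M.coalgD(1-4)[OF j(1)] M.coalgD(1-4)[OF j(2)] N.algD(1-4)[OF f]
    obtain c z where t: "transposed i j f w b c z" by (rule transposed_ex[of i j f w b]) (use sq a' X in simp_all)
    note D = transposedD[OF t]
    have sqi: "square K i' i u v" "square M j' j u' v'" using i j by (simp_all add: coalg_map_def)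
    note [simp] = M.squareD[OF D(5)] N.squareD[OF D(4)] K.squareD[OF sqi(1)] M.squareD[OF sqi(2)]
      N.squareD[OF PP_far_eq(2)[OF sqi]]
    note t' = transposed_natural[OF t sqi N.square_idt[of f], simplified]
    note p = hom_solution_props[OF H i(1) j(1) f D(5)]
    note q = \<psi>[OF t i(1) j(1) f] and q' = \<psi>[OF t' i(2) j(2) f]
    have "\<psi> ((i', s'), (j', t')) (f, r) (w \<cdot>\<^bsub>N\<^esub> sq_top (far PP (Sq i' i u v, Sq j' j u' v'))) (b \<cdot>\<^bsub>N\<^esub> far ten (v, v')) =
      \<psi> ((i, s), (j, t)) (f, r) w b \<cdot>\<^bsub>N\<^esub> far ten (v, v')"
      by (rule tr_inj[of "Cod K i'" "Cod M j'" _ "Dom N f"])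
        (use q q' p hom_solution_natural[OF H i j f f N.alg_map_idt[OF f] D(5)]
        tr_natural[of v v' "Idt N (Dom N f)" "\<psi> ((i, s), (j, t)) (f, r) w b" "Cod K i'" "Cod M j'" "Dom N f"] in simp_all)
    then show "\<psi> (Dom ?I a) (f, r) (w \<cdot>\<^bsub>N\<^esub> sq_top (far ?P a)) (b \<cdot>\<^bsub>N\<^esub> sq_bot (far ?P a)) =
        \<psi> (Cod ?I a) (f, r) w b \<cdot>\<^bsub>N\<^esub> sq_bot (far ?P a)"
      using PP_far_eq(1)[OF sqi] by (cases "far PP (Sq i' i u v, Sq j' j u' v')") (simp add: a'(1) X)
  qed
  then obtain T where T: "cfunctor ?I (coalg N) T" "cfun_agree ?I (cfun_comp forget T) ?P"
    "\<And>x f r u v. \<lbrakk>x \<in> Ob ?I; is_alg N (f, r); square N (fob ?P x) f u v\<rbrakk> \<Longrightarrow>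
       solution N (fob T x) (f, r) (Sq (fob ?P x) f u v) = \<psi> x (f, r) u v" by blast
  have "lifted_tensor K M N PP T" using T by (simp add: lifted_tensor_def lifted_def)
  moreover have "lifts_agree T H" unfolding lifts_agree_def
  proof (intro allI impI)
    fix i s j t f r w b c z
    assume i: "is_coalg K (i, s)" and j: "is_coalg M (j, t)" and f: "is_alg N (f, r)" and t: "transposed i j f w b c z"
    show "tr (Cod K i) (Cod M j) (Dom N f) (tensor_solution T i s j t f r w b) = hom_solution H i s j t f r c z"
      using T(3)[of "((i, s), (j, t))" f r w b] i j f transposedD(4)[OF t] \<psi>(4)[OF t i j f] by (simp add: tensor_solution_def)
  qed
  ultimately show ?thesis by blast
qed

text \<open>Criterion (T) in the first variable.\<close>

abbreviation "tensor_composes_fst T \<equiv> tensor_composes M K N (cfun_comp PP swap_cfun) (\<lambda>j i. inj2 i j) (\<lambda>j i. inj1 i j) (cfun_comp T swap_cfun)"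

text \<open>For the variable shared by both functors, the criteria are transposes of each other piece by piece:
equal tops correspond to equal restrictions along \<open>inj2\<close>, equal bottoms to equal projections
along \<open>p1\<close>, and the intermediate solutions \<open>d\<close> on both sides to each other.\<close>

lemma tensor_composes_fst_iff:
  assumes T: "lifted_tensor K M N PP T" and H: "lifted_hom K N M PH H" and c: "lifts_agree T H"
  shows "tensor_composes_fst T \<longleftrightarrow> hom_composes_coalg K N M PH p1 p2 H"
proof -
  let ?Q = "\<lambda>i k j. far PP (Sq i (k \<cdot>\<^bsub>K\<^esub> i) (Idt K (Dom K i)) k, Idt (arrow_cat M) j)"
  let ?Q' = "\<lambda>i k f. far PH (Sq i (k \<cdot>\<^bsub>K\<^esub> i) (Idt K (Dom K i)) k, Idt (arrow_cat N) f)"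
  have main: "(w' \<cdot>\<^bsub>N\<^esub> inj2 k j = w \<cdot>\<^bsub>N\<^esub> inj2 (k \<cdot>\<^bsub>K\<^esub> i) j \<longleftrightarrow> c2 = c1)"
    "(b' = b \<longleftrightarrow> p1 k f \<cdot>\<^bsub>M\<^esub> z' = p1 (k \<cdot>\<^bsub>K\<^esub> i) f \<cdot>\<^bsub>M\<^esub> z)"
    "(w' \<cdot>\<^bsub>N\<^esub> inj1 k j = tensor_solution T i s j t f r (w \<cdot>\<^bsub>N\<^esub> sq_top (?Q i k j)) (b \<cdot>\<^bsub>N\<^esub> sq_bot (?Q i k j)) \<longleftrightarrow>
       p2 k f \<cdot>\<^bsub>M\<^esub> z' = hom_solution H i s j t f r (sq_top (?Q' i k f) \<cdot>\<^bsub>M\<^esub> c1) (sq_bot (?Q' i k f) \<cdot>\<^bsub>M\<^esub> z))"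
    "(solution N (fob T ((k, s'), (j, t))) (f, r) (Sq (fob PP (k, j)) f w' b') =
       solution N (fob T (coalg_comp K (k, s') (i, s), (j, t))) (f, r) (Sq (fob PP (k \<cdot>\<^bsub>K\<^esub> i, j)) f w b)) \<longleftrightarrow>
     (solution M (j, t) (fob H ((k, s'), (f, r))) (Sq j (fob PH (k, f)) c2 z') =
       solution M (j, t) (fob H (coalg_comp K (k, s') (i, s), (f, r))) (Sq j (fob PH (k \<cdot>\<^bsub>K\<^esub> i, f)) c1 z))"
    if j: "is_coalg M (j, t)" and i: "is_coalg K (i, s)" and k: "is_coalg K (k, s')" and ki [simp]: "Dom K k = Cod K i"
      and f: "is_alg N (f, r)" and t1: "transposed (k \<cdot>\<^bsub>K\<^esub> i) j f w b c1 z" and t2: "transposed k j f w' b' c2 z'"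
    for j t i s k s' f r w b c1 z w' b' c2 z'
  proof -
    let ?ki = "k \<cdot>\<^bsub>K\<^esub> i"
    note [simp] = K.coalgD(1-4)[OF i] K.coalgD(1-4)[OF k] M.coalgD(1-4)[OF j] N.algD(1-4)[OF f]
    obtain x where x: "coalg_comp K (k, s') (i, s) = (?ki, x)" "is_coalg K (?ki, x)"
      by (rule K.coalg_compE[OF i k ki])
    note D1 = transposedD[OF t1] and D2 = transposedD[OF t2]
    note [simp] = N.squareD[OF D1(4)] N.squareD[OF D2(4)] M.squareD[OF D1(5)] M.squareD[OF D2(5)]
    have sqi: "square K i ?ki (Idt K (Dom K i)) k" by (rule K.square_first) simp_all
    have t3: "transposed i j f (w \<cdot>\<^bsub>N\<^esub> sq_top (?Q i k j)) (b \<cdot>\<^bsub>N\<^esub> sq_bot (?Q i k j))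
        (sq_top (?Q' i k f) \<cdot>\<^bsub>M\<^esub> c1) (sq_bot (?Q' i k f) \<cdot>\<^bsub>M\<^esub> z)"
      using transposed_pre_K[OF t1 sqi] PP_far_eq(1)[OF sqi M.square_idt[of j]] PH_far_eq(1)[OF sqi N.square_idt[of f]]
      by (cases "?Q i k j"; cases "?Q' i k f") simp
    note p = tensor_solution_props[OF T i j f transposedD(4)[OF t3]]
    show "w' \<cdot>\<^bsub>N\<^esub> inj2 k j = w \<cdot>\<^bsub>N\<^esub> inj2 ?ki j \<longleftrightarrow> c2 = c1"
      using tr_inj[of "Cod K k" "Dom M j" "w' \<cdot>\<^bsub>N\<^esub> inj2 k j" "Dom N f" "w \<cdot>\<^bsub>N\<^esub> inj2 ?ki j"] D1(6) D2(6) by auto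
    show "b' = b \<longleftrightarrow> p1 k f \<cdot>\<^bsub>M\<^esub> z' = p1 ?ki f \<cdot>\<^bsub>M\<^esub> z"
      using tr_inj[of "Cod K k" "Cod M j" b' "Cod N f" b] D1(7) D2(7) by auto
    show "w' \<cdot>\<^bsub>N\<^esub> inj1 k j = tensor_solution T i s j t f r (w \<cdot>\<^bsub>N\<^esub> sq_top (?Q i k j)) (b \<cdot>\<^bsub>N\<^esub> sq_bot (?Q i k j)) \<longleftrightarrow>
       p2 k f \<cdot>\<^bsub>M\<^esub> z' = hom_solution H i s j t f r (sq_top (?Q' i k f) \<cdot>\<^bsub>M\<^esub> c1) (sq_bot (?Q' i k f) \<cdot>\<^bsub>M\<^esub> z)"
      using tr_inj[of "Cod K i" "Cod M j" "w' \<cdot>\<^bsub>N\<^esub> inj1 k j" "Dom N f" "tensor_solution T i s j t f r (w \<cdot>\<^bsub>N\<^esub> sq_top (?Q i k j)) (b \<cdot>\<^bsub>N\<^esub> sq_bot (?Q i k j))"]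
        D2(8) lifts_agreeD[OF c i j f t3] p(1-3) by auto
    have "tensor_solution T k s' j t f r w' b' = tensor_solution T ?ki x j t f r w b \<longleftrightarrow> hom_solution H k s' j t f r c2 z' = hom_solution H ?ki x j t f r c1 z"
      using tr_inj[of "Cod K k" "Cod M j" "tensor_solution T k s' j t f r w' b'" "Dom N f" "tensor_solution T ?ki x j t f r w b"]
        lifts_agreeD[OF c k j f t2] lifts_agreeD[OF c x(2) j f t1] tensor_solution_props(1-3)[OF T k j f D2(4)] tensor_solution_props(1-3)[OF T x(2) j f D1(4)]
      by auto
    then show "(solution N (fob T ((k, s'), (j, t))) (f, r) (Sq (fob PP (k, j)) f w' b') =
       solution N (fob T (coalg_comp K (k, s') (i, s), (j, t))) (f, r) (Sq (fob PP (k \<cdot>\<^bsub>K\<^esub> i, j)) f w b)) \<longleftrightarrow>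
     (solution M (j, t) (fob H ((k, s'), (f, r))) (Sq j (fob PH (k, f)) c2 z') =
       solution M (j, t) (fob H (coalg_comp K (k, s') (i, s), (f, r))) (Sq j (fob PH (k \<cdot>\<^bsub>K\<^esub> i, f)) c1 z))"
      by (simp add: tensor_solution_def hom_solution_def x(1))
  qed
  show ?thesis
  proof
    assume L: "tensor_composes_fst T"
    show "hom_composes_coalg K N M PH p1 p2 H" unfolding hom_composes_coalg_def
    proof (intro allI impI, goal_cases)
      case (1 f r i s k s' j t c1 z z')
      note f = 1(1) and i = 1(2) and k = 1(3) and ki = 1(4) and j = 1(5) and sq = 1(6,7) and z1 = 1(8) and z2 = 1(9)
      note [simp] = K.coalgD(1-4)[OF i] K.coalgD(1-4)[OF k] M.coalgD(1-4)[OF j] N.algD(1-4)[OF f] ki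
      obtain w b where t1: "transposed (k \<cdot>\<^bsub>K\<^esub> i) j f w b c1 z" by (rule transposed_ex'[OF _ _ _ sq(1)]) simp_all
      obtain w' b' where t2: "transposed k j f w' b' c1 z'" by (rule transposed_ex'[OF _ _ _ sq(2)]) simp_all
      note m = main[OF j i k ki f t1 t2]
      have b': "b' = b" using m(2) z1 by blast
      have "solution N (fob T ((k, s'), (j, t))) (f, r) (Sq (fob PP (k, j)) f w' b) =
       solution N (fob T (coalg_comp K (k, s') (i, s), (j, t))) (f, r) (Sq (fob PP (k \<cdot>\<^bsub>K\<^esub> i, j)) f w b)"
        using L[unfolded tensor_composes_def, rule_format, OF j i k ki f, of w b w'] transposedD(4)[OF t1] transposedD(4)[OF t2] b'
          m(1) m(3)[unfolded hom_solution_def tensor_solution_def] z2 by simp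
      then show ?case
        using m(4)[unfolded b'] by blast
    qed
  next
    assume R: "hom_composes_coalg K N M PH p1 p2 H"
    show "tensor_composes_fst T" unfolding tensor_composes_def cfun_simps swap_cfun_simps
    proof (intro allI impI, goal_cases)
      case (1 j t i s k s' f r w b w')
      note j = 1(1) and i = 1(2) and k = 1(3) and ki = 1(4) and f = 1(5) and sq = 1(6,7) and w2 = 1(8) and w1 = 1(9)
      note [simp] = K.coalgD(1-4)[OF i] K.coalgD(1-4)[OF k] M.coalgD(1-4)[OF j] N.algD(1-4)[OF f] ki
      obtain c1 z where t1: "transposed (k \<cdot>\<^bsub>K\<^esub> i) j f w b c1 z" by (rule transposed_ex[OF _ _ sq(1)]) simp_all
      obtain c2 z' where t2: "transposed k j f w' b c2 z'" by (rule transposed_ex[OF _ _ sq(2)]) simp_all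
      note m = main[OF j i k ki f t1 t2]
      have c2: "c2 = c1" using m(1) w2 by blast
      have "solution M (j, t) (fob H ((k, s'), (f, r))) (Sq j (fob PH (k, f)) c1 z') =
         solution M (j, t) (fob H (coalg_comp K (k, s') (i, s), (f, r))) (Sq j (fob PH (k \<cdot>\<^bsub>K\<^esub> i, f)) c1 z)"
        using R[unfolded hom_composes_coalg_def, rule_format, OF f i k ki j, of c1 z z'] transposedD(5)[OF t1] transposedD(5)[OF t2] c2
          m(2) m(3)[unfolded hom_solution_def tensor_solution_def] w1 by blast
      then show ?case
        using m(4)[unfolded c2] by blast
    qed
  qed
qed

end

section \<open>Pushout-products and pullback-homs\<close>

lemma
  assumes pb: "is_pullback C f g (fst pq) (snd pq)"
    and xy: "x \<in> Ar C" "y \<in> Ar C" "Dom C x = Dom C y" "Cod C x = Dom C f" "Cod C y = Dom C g"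
      "f \<cdot>\<^bsub>C\<^esub> x = g \<cdot>\<^bsub>C\<^esub> y"
  shows tuple_ar: "tuple C pq x y \<in> Ar C" "Dom C (tuple C pq x y) = Dom C x"
      "Cod C (tuple C pq x y) = Dom C (fst pq)"
    and tuple_proj: "fst pq \<cdot>\<^bsub>C\<^esub> tuple C pq x y = x" "snd pq \<cdot>\<^bsub>C\<^esub> tuple C pq x y = y"
proof -
  have "\<exists>!h. h \<in> hom C (Dom C x) (Dom C (fst pq)) \<and> fst pq \<cdot>\<^bsub>C\<^esub> h = x \<and> snd pq \<cdot>\<^bsub>C\<^esub> h = y"
    using pb xy unfolding is_pullback_def by blast
  from theI'[OF this] show "tuple C pq x y \<in> Ar C" "Dom C (tuple C pq x y) = Dom C x"
      "Cod C (tuple C pq x y) = Dom C (fst pq)"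
    "fst pq \<cdot>\<^bsub>C\<^esub> tuple C pq x y = x" "snd pq \<cdot>\<^bsub>C\<^esub> tuple C pq x y = y"
    by (auto simp: tuple_def hom_def)
qed

lemma (in category) pullback_ext:
  assumes pb: "is_pullback C f g p q" and h: "h \<in> hom C m (Dom C p)" "h' \<in> hom C m (Dom C p)"
    and eq: "p \<cdot> h = p \<cdot> h'" "q \<cdot> h = q \<cdot> h'"
  shows "h = h'"
proof -
  have d: "f \<in> Ar C" "g \<in> Ar C" "p \<in> Ar C" "q \<in> Ar C" "Dom C p = Dom C q" "Cod C p = Dom C f" "Cod C q = Dom C g"
    "f \<cdot> p = g \<cdot> q" "Cod C f = Cod C g" using pb by (auto simp: is_pullback_def)
  have "f \<cdot> p \<cdot> h = g \<cdot> q \<cdot> h" using cmp_extend2[OF d(8), of h] d h by (simp add: hom_def)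
  moreover have "\<lbrakk>x \<in> Ar C; y \<in> Ar C; Dom C x = Dom C y; Cod C x = Dom C f; Cod C y = Dom C g; f \<cdot> x = g \<cdot> y\<rbrakk>
      \<Longrightarrow> \<exists>!k. k \<in> hom C (Dom C x) (Dom C p) \<and> p \<cdot> k = x \<and> q \<cdot> k = y" for x y
    using pb unfolding is_pullback_def by blast
  from this[of "p \<cdot> h" "q \<cdot> h"]
  have "f \<cdot> p \<cdot> h = g \<cdot> q \<cdot> h \<Longrightarrow>
    \<exists>!k. k \<in> hom C (Dom C (p \<cdot> h)) (Dom C p) \<and> p \<cdot> k = p \<cdot> h \<and> q \<cdot> k = q \<cdot> h"
    using h d by (simp add: hom_def)
  moreover have "Dom C (p \<cdot> h) = m" using h d by (simp add: hom_def)
  ultimately show ?thesis using h eq by auto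
qed

lemma
  assumes po: "is_pushout C f g (fst pq) (snd pq)"
    and xy: "x \<in> Ar C" "y \<in> Ar C" "Cod C x = Cod C y" "Dom C x = Cod C f" "Dom C y = Cod C g"
      "x \<cdot>\<^bsub>C\<^esub> f = y \<cdot>\<^bsub>C\<^esub> g"
  shows cotuple_ar: "cotuple C pq x y \<in> Ar C" "Cod C (cotuple C pq x y) = Cod C x"
      "Dom C (cotuple C pq x y) = Cod C (fst pq)"
    and cotuple_inj: "cotuple C pq x y \<cdot>\<^bsub>C\<^esub> fst pq = x" "cotuple C pq x y \<cdot>\<^bsub>C\<^esub> snd pq = y"
  using tuple_ar[of "op_cat C" f g pq x y] tuple_proj[of "op_cat C" f g pq x y] assms
  by (simp_all add: cotuple_def is_pushout_def)

lemma (in category) pushout_ext: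
  assumes po: "is_pushout C f g p q" and h: "h \<in> hom C (Cod C p) m" "h' \<in> hom C (Cod C p) m"
    and eq: "h \<cdot> p = h' \<cdot> p" "h \<cdot> q = h' \<cdot> q"
  shows "h = h'"
  using category.pullback_ext[OF op_category, of f g p q h m h'] assms
  by (simp add: is_pushout_def hom_def)

locale pushout_bifunctor = bifunctor K M N ten
  for K :: "('ok, 'ak, 'zk) cat_scheme" and M :: "('om, 'am, 'zm) cat_scheme" and N :: "('on, 'an, 'zn) cat_scheme"
    and ten :: "('ok \<times> 'om, 'ak \<times> 'am, 'on, 'an) cfun" +
  fixes po :: "'an \<Rightarrow> 'an \<Rightarrow> 'an \<times> 'an"
  assumes po: "pushout_choice N po"
begin

abbreviation "q \<equiv> pp_inj K M po ten"
abbreviation "PP \<equiv> pushout_product K M N po ten"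

lemma po_q: "\<lbrakk>i \<in> Ar K; j \<in> Ar M\<rbrakk> \<Longrightarrow>
    is_pushout N (far ten (Idt K (Dom K i), j)) (far ten (i, Idt M (Dom M j))) (fst (q i j)) (snd (q i j))"
  using po unfolding pushout_choice_def pp_inj_def by simp

lemma q_simps [simp]:
  assumes "i \<in> Ar K" "j \<in> Ar M"
  shows "fst (q i j) \<in> Ar N" "snd (q i j) \<in> Ar N" "Dom N (fst (q i j)) = fob ten (Dom K i, Cod M j)"
    "Dom N (snd (q i j)) = fob ten (Cod K i, Dom M j)" "Cod N (snd (q i j)) = Cod N (fst (q i j))"
  using po_q[OF assms] assms by (simp_all add: is_pushout_def is_pullback_def)

lemma q_comm:
  assumes "i \<in> Ar K" "j \<in> Ar M"
  shows "fst (q i j) \<cdot>\<^bsub>N\<^esub> far ten (Idt K (Dom K i), j) = snd (q i j) \<cdot>\<^bsub>N\<^esub> far ten (i, Idt M (Dom M j))"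
  using po_q[OF assms] assms by (simp add: is_pushout_def is_pullback_def)

lemma PP_ob: "fob PP (i, j) = cotuple N (q i j) (far ten (i, Idt M (Cod M j))) (far ten (Idt K (Cod K i), j))"
  by (simp add: pushout_product_def Let_def)

lemma PP_far_def: "far PP (Sq i i' u v, Sq j j' u' v') = Sq (fob PP (i, j)) (fob PP (i', j'))
    (cotuple N (q i j) (fst (q i' j') \<cdot>\<^bsub>N\<^esub> far ten (u, v')) (snd (q i' j') \<cdot>\<^bsub>N\<^esub> far ten (v, u'))) (far ten (v, v'))"
  by (simp add: pushout_product_def Let_def)

lemma PP_ob_simps:
  assumes [simp]: "i \<in> Ar K" "j \<in> Ar M"
  shows "fob PP (i, j) \<in> Ar N" "Dom N (fob PP (i, j)) = Cod N (fst (q i j))"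
    "Cod N (fob PP (i, j)) = fob ten (Cod K i, Cod M j)"
    "fob PP (i, j) \<cdot>\<^bsub>N\<^esub> fst (q i j) = far ten (i, Idt M (Cod M j))"
    "fob PP (i, j) \<cdot>\<^bsub>N\<^esub> snd (q i j) = far ten (Idt K (Cod K i), j)"
  unfolding PP_ob
  using cotuple_ar[OF po_q[OF assms], of "far ten (i, Idt M (Cod M j))" "far ten (Idt K (Cod K i), j)"]
    cotuple_inj[OF po_q[OF assms], of "far ten (i, Idt M (Cod M j))" "far ten (Idt K (Cod K i), j)"]
  by simp_all

lemma pushout_data: "pushout_data K M N ten PP (\<lambda>i j. fst (q i j)) (\<lambda>i j. snd (q i j))"
proof
  fix i j assume [simp]: "i \<in> Ar K" "j \<in> Ar M"
  note [simp] = PP_ob_simps[of i j]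
  show "fst (q i j) \<in> Ar N \<and> snd (q i j) \<in> Ar N \<and>
      Dom N (fst (q i j)) = fob ten (Dom K i, Cod M j) \<and> Dom N (snd (q i j)) = fob ten (Cod K i, Dom M j) \<and>
      Cod N (fst (q i j)) = Dom N (fob PP (i, j)) \<and> Cod N (snd (q i j)) = Dom N (fob PP (i, j)) \<and>
      fst (q i j) \<cdot>\<^bsub>N\<^esub> far ten (Idt K (Dom K i), j) = snd (q i j) \<cdot>\<^bsub>N\<^esub> far ten (i, Idt M (Dom M j))"
    by (simp add: q_comm)
  show "fob PP (i, j) \<in> Ar N \<and> Cod N (fob PP (i, j)) = fob ten (Cod K i, Cod M j) \<and>
      fob PP (i, j) \<cdot>\<^bsub>N\<^esub> fst (q i j) = far ten (i, Idt M (Cod M j)) \<and>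
      fob PP (i, j) \<cdot>\<^bsub>N\<^esub> snd (q i j) = far ten (Idt K (Cod K i), j)" by simp
  fix n
  show "\<exists>h\<in>hom N (Dom N (fob PP (i, j))) n. h \<cdot>\<^bsub>N\<^esub> fst (q i j) = x \<and> h \<cdot>\<^bsub>N\<^esub> snd (q i j) = y"
    if "x \<in> hom N (fob ten (Dom K i, Cod M j)) n" "y \<in> hom N (fob ten (Cod K i, Dom M j)) n"
      "x \<cdot>\<^bsub>N\<^esub> far ten (Idt K (Dom K i), j) = y \<cdot>\<^bsub>N\<^esub> far ten (i, Idt M (Dom M j))" for x y
    using cotuple_ar[OF po_q, of i j x y] cotuple_inj[OF po_q, of i j x y] that
    by (intro bexI[of _ "cotuple N (q i j) x y"]) (simp_all add: hom_def)
  show "h = h'" if "h \<in> hom N (Dom N (fob PP (i, j))) n" "h' \<in> hom N (Dom N (fob PP (i, j))) n"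
      "h \<cdot>\<^bsub>N\<^esub> fst (q i j) = h' \<cdot>\<^bsub>N\<^esub> fst (q i j)" "h \<cdot>\<^bsub>N\<^esub> snd (q i j) = h' \<cdot>\<^bsub>N\<^esub> snd (q i j)" for h h'
    using N.pushout_ext[OF po_q, of i j h n h'] that by simp
next
  fix i i' u v j j' u' v' assume sq: "square K i i' u v" "square M j j' u' v'"
  have [simp]: "i \<in> Ar K" "i' \<in> Ar K" "u \<in> Ar K" "v \<in> Ar K" "Dom K u = Dom K i" "Cod K u = Dom K i'"
    "Dom K v = Cod K i" "Cod K v = Cod K i'" "i' \<cdot>\<^bsub>K\<^esub> u = v \<cdot>\<^bsub>K\<^esub> i" using sq(1) by (auto simp: square_def)
  have [simp]: "j \<in> Ar M" "j' \<in> Ar M" "u' \<in> Ar M" "v' \<in> Ar M" "Dom M u' = Dom M j" "Cod M u' = Dom M j'"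
    "Dom M v' = Cod M j" "Cod M v' = Cod M j'" "j' \<cdot>\<^bsub>M\<^esub> u' = v' \<cdot>\<^bsub>M\<^esub> j" using sq(2) by (auto simp: square_def)
  note [simp] = PP_ob_simps[of i j] PP_ob_simps[of i' j']
  let ?x = "fst (q i' j') \<cdot>\<^bsub>N\<^esub> far ten (u, v')" and ?y = "snd (q i' j') \<cdot>\<^bsub>N\<^esub> far ten (v, u')"
  have c: "?x \<cdot>\<^bsub>N\<^esub> far ten (Idt K (Dom K i), j) = ?y \<cdot>\<^bsub>N\<^esub> far ten (i, Idt M (Dom M j))"
    using N.cmp_extend2[OF q_comm, of i' j' "far ten (u, u')"] by simp
  show "\<exists>w\<in>hom N (Dom N (fob PP (i, j))) (Dom N (fob PP (i', j'))).
        far PP (Sq i i' u v, Sq j j' u' v') = Sq (fob PP (i, j)) (fob PP (i', j')) w (far ten (v, v')) \<and>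
        w \<cdot>\<^bsub>N\<^esub> fst (q i j) = ?x \<and> w \<cdot>\<^bsub>N\<^esub> snd (q i j) = ?y"
    using cotuple_ar[OF po_q _ _ _ _ _ c] cotuple_inj[OF po_q _ _ _ _ _ c]
    by (intro bexI[of _ "cotuple N (q i j) ?x ?y"]) (simp_all add: hom_def PP_far_def)
qed

end

lemma bifunctor_swap: "bifunctor K M N T\<^sub>0 \<Longrightarrow> bifunctor M K N (cfun_comp T\<^sub>0 swap_cfun)"
  unfolding bifunctor_def cfunctor_def cfunctor_axioms_def hom_def by (auto simp: prod_category)

lemma pushout_data_swap:
  assumes "pushout_data K M N T\<^sub>0 PP inj1 inj2"
  shows "pushout_data M K N (cfun_comp T\<^sub>0 swap_cfun) (cfun_comp PP swap_cfun) (\<lambda>j i. inj2 i j) (\<lambda>j i. inj1 i j)"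
proof -
  interpret pushout_data K M N T\<^sub>0 PP inj1 inj2 by fact
  interpret S: bifunctor M K N "cfun_comp T\<^sub>0 swap_cfun" by (rule bifunctor_swap) (rule bifunctor_axioms)
  show ?thesis
  proof (unfold_locales, goal_cases)
    case (1 j i) then show ?case using inj[of i j] by simp
  next
    case (2 j i x y n) then show ?case using po_ex[of i j y n x] by auto
  next
    case (3 j i h h' n) then show ?case using po_eq[of i j h n h'] by simp
  next
    case (4 j i) then show ?case using PP[of i j] by simp
  next
    case (5 j j' u' v' i i' u v) then show ?case using PP_far[of i i' u v j j' u' v'] by auto
  qed
qed

locale pullback_bifunctor = op_bifunctor A N B H
  for A :: "('oa, 'aa, 'za) cat_scheme" and N :: "('on, 'an, 'zn) cat_scheme" and B :: "('ob, 'ab, 'zb) cat_scheme"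
    and H :: "('oa \<times> 'on, 'aa \<times> 'an, 'ob, 'ab) cfun" +
  fixes pb :: "'ab \<Rightarrow> 'ab \<Rightarrow> 'ab \<times> 'ab"
  assumes pb: "pullback_choice B pb"
begin

abbreviation "p \<equiv> ph_proj A N pb H"
abbreviation "PH \<equiv> pullback_hom A N B pb H"

lemma pb_p: "\<lbrakk>i \<in> Ar A; f \<in> Ar N\<rbrakk> \<Longrightarrow>
    is_pullback B (far H (i, Idt N (Cod N f))) (far H (Idt A (Dom A i), f)) (fst (p i f)) (snd (p i f))"
  using pb unfolding pullback_choice_def ph_proj_def by simp

lemma p_simps [simp]:
  assumes "i \<in> Ar A" "f \<in> Ar N"
  shows "fst (p i f) \<in> Ar B" "snd (p i f) \<in> Ar B" "Cod B (fst (p i f)) = fob H (Cod A i, Cod N f)"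
    "Cod B (snd (p i f)) = fob H (Dom A i, Dom N f)" "Dom B (snd (p i f)) = Dom B (fst (p i f))"
  using pb_p[OF assms] assms by (simp_all add: is_pullback_def)

lemma p_comm:
  assumes "i \<in> Ar A" "f \<in> Ar N"
  shows "far H (i, Idt N (Cod N f)) \<cdot>\<^bsub>B\<^esub> fst (p i f) = far H (Idt A (Dom A i), f) \<cdot>\<^bsub>B\<^esub> snd (p i f)"
  using pb_p[OF assms] assms by (simp add: is_pullback_def)

lemma PH_ob: "fob PH (i, f) = tuple B (p i f) (far H (Idt A (Cod A i), f)) (far H (i, Idt N (Dom N f)))"
  by (simp add: pullback_hom_def Let_def)

lemma PH_far_def: "far PH (Sq i' i u v, Sq f f' u' v') = Sq (fob PH (i, f)) (fob PH (i', f')) (far H (v, u'))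
    (tuple B (p i' f') (far H (v, v') \<cdot>\<^bsub>B\<^esub> fst (p i f)) (far H (u, u') \<cdot>\<^bsub>B\<^esub> snd (p i f)))"
  by (simp add: pullback_hom_def Let_def)

lemma PH_ob_simps:
  assumes [simp]: "i \<in> Ar A" "f \<in> Ar N"
  shows "fob PH (i, f) \<in> Ar B" "Cod B (fob PH (i, f)) = Dom B (fst (p i f))"
    "Dom B (fob PH (i, f)) = fob H (Cod A i, Dom N f)"
    "fst (p i f) \<cdot>\<^bsub>B\<^esub> fob PH (i, f) = far H (Idt A (Cod A i), f)"
    "snd (p i f) \<cdot>\<^bsub>B\<^esub> fob PH (i, f) = far H (i, Idt N (Dom N f))"
  unfolding PH_ob
  using tuple_ar[OF pb_p[OF assms], of "far H (Idt A (Cod A i), f)" "far H (i, Idt N (Dom N f))"]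
    tuple_proj[OF pb_p[OF assms], of "far H (Idt A (Cod A i), f)" "far H (i, Idt N (Dom N f))"]
  by simp_all

lemma pullback_data: "pullback_data A N B H PH (\<lambda>i f. fst (p i f)) (\<lambda>i f. snd (p i f))"
proof
  fix i f assume [simp]: "i \<in> Ar A" "f \<in> Ar N"
  note [simp] = PH_ob_simps[of i f]
  show "fst (p i f) \<in> Ar B \<and> snd (p i f) \<in> Ar B \<and>
      Cod B (fst (p i f)) = fob H (Cod A i, Cod N f) \<and> Cod B (snd (p i f)) = fob H (Dom A i, Dom N f) \<and>
      Dom B (fst (p i f)) = Cod B (fob PH (i, f)) \<and> Dom B (snd (p i f)) = Cod B (fob PH (i, f)) \<and>
      far H (i, Idt N (Cod N f)) \<cdot>\<^bsub>B\<^esub> fst (p i f) = far H (Idt A (Dom A i), f) \<cdot>\<^bsub>B\<^esub> snd (p i f)"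
    by (simp add: p_comm)
  show "fob PH (i, f) \<in> Ar B \<and> Dom B (fob PH (i, f)) = fob H (Cod A i, Dom N f) \<and>
      fst (p i f) \<cdot>\<^bsub>B\<^esub> fob PH (i, f) = far H (Idt A (Cod A i), f) \<and>
      snd (p i f) \<cdot>\<^bsub>B\<^esub> fob PH (i, f) = far H (i, Idt N (Dom N f))" by simp
  fix m
  show "\<exists>h\<in>hom B m (Cod B (fob PH (i, f))). fst (p i f) \<cdot>\<^bsub>B\<^esub> h = x \<and> snd (p i f) \<cdot>\<^bsub>B\<^esub> h = y"
    if "x \<in> hom B m (fob H (Cod A i, Cod N f))" "y \<in> hom B m (fob H (Dom A i, Dom N f))"
      "far H (i, Idt N (Cod N f)) \<cdot>\<^bsub>B\<^esub> x = far H (Idt A (Dom A i), f) \<cdot>\<^bsub>B\<^esub> y" for x y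
    using tuple_ar[OF pb_p, of i f x y] tuple_proj[OF pb_p, of i f x y] that
    by (intro bexI[of _ "tuple B (p i f) x y"]) (simp_all add: hom_def)
  show "h = h'" if "h \<in> hom B m (Cod B (fob PH (i, f)))" "h' \<in> hom B m (Cod B (fob PH (i, f)))"
      "fst (p i f) \<cdot>\<^bsub>B\<^esub> h = fst (p i f) \<cdot>\<^bsub>B\<^esub> h'" "snd (p i f) \<cdot>\<^bsub>B\<^esub> h = snd (p i f) \<cdot>\<^bsub>B\<^esub> h'" for h h'
    using M.pullback_ext[OF pb_p, of i f h m h'] that by simp
next
  fix i i' u v f f' u' v' assume sq: "square A i' i u v" "square N f f' u' v'"
  have [simp]: "i \<in> Ar A" "i' \<in> Ar A" "u \<in> Ar A" "v \<in> Ar A" "Dom A u = Dom A i'" "Cod A u = Dom A i"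
    "Dom A v = Cod A i'" "Cod A v = Cod A i" "i \<cdot>\<^bsub>A\<^esub> u = v \<cdot>\<^bsub>A\<^esub> i'" using sq(1) by (auto simp: square_def)
  have [simp]: "f \<in> Ar N" "f' \<in> Ar N" "u' \<in> Ar N" "v' \<in> Ar N" "Dom N u' = Dom N f" "Cod N u' = Dom N f'"
    "Dom N v' = Cod N f" "Cod N v' = Cod N f'" "f' \<cdot>\<^bsub>N\<^esub> u' = v' \<cdot>\<^bsub>N\<^esub> f" using sq(2) by (auto simp: square_def)
  note [simp] = PH_ob_simps[of i f] PH_ob_simps[of i' f']
  let ?x = "far H (v, v') \<cdot>\<^bsub>B\<^esub> fst (p i f)" and ?y = "far H (u, u') \<cdot>\<^bsub>B\<^esub> snd (p i f)"
  have "far H (u, v') \<cdot>\<^bsub>B\<^esub> far H (i, Idt N (Cod N f)) \<cdot>\<^bsub>B\<^esub> fst (p i f) =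
    far H (u, v') \<cdot>\<^bsub>B\<^esub> far H (Idt A (Dom A i), f) \<cdot>\<^bsub>B\<^esub> snd (p i f)" by (simp only: p_comm \<open>i \<in> Ar A\<close> \<open>f \<in> Ar N\<close>)
  then have c: "far H (i', Idt N (Cod N f')) \<cdot>\<^bsub>B\<^esub> ?x = far H (Idt A (Dom A i'), f') \<cdot>\<^bsub>B\<^esub> ?y" by simp
  show "\<exists>w\<in>hom B (Cod B (fob PH (i, f))) (Cod B (fob PH (i', f'))).
        far PH (Sq i' i u v, Sq f f' u' v') = Sq (fob PH (i, f)) (fob PH (i', f')) (far H (v, u')) w \<and>
        fst (p i' f') \<cdot>\<^bsub>B\<^esub> w = ?x \<and> snd (p i' f') \<cdot>\<^bsub>B\<^esub> w = ?y"
    using tuple_ar[OF pb_p _ _ _ _ _ c] tuple_proj[OF pb_p _ _ _ _ _ c]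
    by (intro bexI[of _ "tuple B (p i' f') ?x ?y"]) (simp_all add: hom_def PH_far_def)
qed

end

text \<open>\<open>W i k x y\<close> stands for the map induced by \<open>x\<close> and \<open>y\<close> out of a chosen pushout. Left abstract, it
may take its arguments in either order, as the two variables require.\<close>

definition tensor_composes_via ::
  "('ok, 'ak) awfs_cat \<Rightarrow> ('om, 'am) awfs_cat \<Rightarrow> ('on, 'an) awfs_cat
    \<Rightarrow> ('ak \<times> 'am, 'ak square \<times> 'am square, 'an, 'an square) cfun
    \<Rightarrow> ('ak \<Rightarrow> 'am \<Rightarrow> 'an) \<Rightarrow> ('ak \<Rightarrow> 'am \<Rightarrow> 'an \<Rightarrow> 'an \<Rightarrow> 'an) \<Rightarrow> ('ak, 'am, 'an) lift \<Rightarrow> bool" where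
  "tensor_composes_via K M N PP inj1 W T \<longleftrightarrow> (\<forall>i s j t k t' f r w b.
     is_coalg K (i, s) \<longrightarrow> is_coalg M (j, t) \<longrightarrow> is_coalg M (k, t') \<longrightarrow> Dom M k = Cod M j \<longrightarrow> is_alg N (f, r) \<longrightarrow>
     square N (fob PP (i, k \<cdot>\<^bsub>M\<^esub> j)) f w b \<longrightarrow>
     solution N (fob T ((i, s), (k, t'))) (f, r) (Sq (fob PP (i, k)) f (W i k (w \<cdot>\<^bsub>N\<^esub> inj1 i (k \<cdot>\<^bsub>M\<^esub> j))
       (solution N (fob T ((i, s), (j, t))) (f, r) (Sq (fob PP (i, j)) f
         (w \<cdot>\<^bsub>N\<^esub> sq_top (far PP (Idt (arrow_cat K) i, Sq j (k \<cdot>\<^bsub>M\<^esub> j) (Idt M (Dom M j)) k)))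
         (b \<cdot>\<^bsub>N\<^esub> sq_bot (far PP (Idt (arrow_cat K) i, Sq j (k \<cdot>\<^bsub>M\<^esub> j) (Idt M (Dom M j)) k)))))) b) =
       solution N (fob T ((i, s), coalg_comp M (k, t') (j, t))) (f, r) (Sq (fob PP (i, k \<cdot>\<^bsub>M\<^esub> j)) f w b))"

context square_adjunction begin

lemma tensor_composes_iff:
  assumes T: "lifted_tensor K M N PP T"
    and W: "\<And>i k n x y. \<lbrakk>i \<in> Ar K; k \<in> Ar M; x \<in> Ar N; y \<in> Ar N;
        Dom N x = fob ten (Dom K i, Cod M k); Dom N y = fob ten (Cod K i, Dom M k); Cod N x = Cod N y;
        x \<cdot>\<^bsub>N\<^esub> far ten (Idt K (Dom K i), k) = y \<cdot>\<^bsub>N\<^esub> far ten (i, Idt M (Dom M k))\<rbrakk> \<Longrightarrow>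
      W i k x y \<in> Ar N \<and> Dom N (W i k x y) = Dom N (fob PP (i, k)) \<and> Cod N (W i k x y) = Cod N y \<and>
      W i k x y \<cdot>\<^bsub>N\<^esub> inj1 i k = x \<and> W i k x y \<cdot>\<^bsub>N\<^esub> inj2 i k = y"
  shows "tensor_composes K M N PP inj1 inj2 T \<longleftrightarrow> tensor_composes_via K M N PP inj1 W T"
proof -
  let ?Q = "\<lambda>i j k. far PP (Idt (arrow_cat K) i, Sq j (k \<cdot>\<^bsub>M\<^esub> j) (Idt M (Dom M j)) k)"
  let ?d = "\<lambda>i s j t k f r w b. solution N (fob T ((i, s), (j, t))) (f, r) (Sq (fob PP (i, j)) f
         (w \<cdot>\<^bsub>N\<^esub> sq_top (?Q i j k)) (b \<cdot>\<^bsub>N\<^esub> sq_bot (?Q i j k)))"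
  have main: "square N (fob PP (i, k)) f (W i k (w \<cdot>\<^bsub>N\<^esub> inj1 i (k \<cdot>\<^bsub>M\<^esub> j)) (?d i s j t k f r w b)) b \<and>
      W i k (w \<cdot>\<^bsub>N\<^esub> inj1 i (k \<cdot>\<^bsub>M\<^esub> j)) (?d i s j t k f r w b) \<cdot>\<^bsub>N\<^esub> inj1 i k = w \<cdot>\<^bsub>N\<^esub> inj1 i (k \<cdot>\<^bsub>M\<^esub> j) \<and>
      W i k (w \<cdot>\<^bsub>N\<^esub> inj1 i (k \<cdot>\<^bsub>M\<^esub> j)) (?d i s j t k f r w b) \<cdot>\<^bsub>N\<^esub> inj2 i k = ?d i s j t k f r w b"
    if i: "is_coalg K (i, s)" and j: "is_coalg M (j, t)" and k: "is_coalg M (k, t')" and kj [simp]: "Dom M k = Cod M j"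
      and f: "is_alg N (f, r)" and sq: "square N (fob PP (i, k \<cdot>\<^bsub>M\<^esub> j)) f w b" for i s j t k t' f r w b
  proof -
    let ?kj = "k \<cdot>\<^bsub>M\<^esub> j"
    note [simp] = K.coalgD(1-4)[OF i] M.coalgD(1-4)[OF j] M.coalgD(1-4)[OF k] N.algD(1-4)[OF f] N.squareD[OF sq]
    have sqj: "square M j ?kj (Idt M (Dom M j)) k" by (rule M.square_first) simp_all
    obtain q where q: "?Q i j k = Sq (fob PP (i, j)) (fob PP (i, ?kj)) q (far ten (Idt K (Cod K i), k))"
      "q \<in> Ar N" "Dom N q = Dom N (fob PP (i, j))" "Cod N q = Dom N (fob PP (i, ?kj))"
      "q \<cdot>\<^bsub>N\<^esub> inj1 i j = inj1 i ?kj \<cdot>\<^bsub>N\<^esub> far ten (Idt K (Dom K i), k)"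
      using PP_farE[OF K.square_idt[of i] sqj] by auto
    note [simp] = q(2-4)
    have sq': "square N (fob PP (i, j)) f (w \<cdot>\<^bsub>N\<^esub> q) (b \<cdot>\<^bsub>N\<^esub> far ten (Idt K (Cod K i), k))"
      using N.square_cmp[OF PP_square(1)[OF K.square_idt[of i] sqj] sq] q(1) by simp
    define d where "d = ?d i s j t k f r w b"
    have d: "d = tensor_solution T i s j t f r (w \<cdot>\<^bsub>N\<^esub> q) (b \<cdot>\<^bsub>N\<^esub> far ten (Idt K (Cod K i), k))"
      by (simp only: d_def tensor_solution_def q(1) square.sel)
    note p [simp] = tensor_solution_props[OF T i j f sq', folded d]
    have "d \<cdot>\<^bsub>N\<^esub> far ten (i, Idt M (Cod M j)) = w \<cdot>\<^bsub>N\<^esub> inj1 i ?kj \<cdot>\<^bsub>N\<^esub> far ten (Idt K (Dom K i), k)"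
      using N.cmp_extend[OF p(4), of "inj1 i j"] q(5) by simp
    then have WW: "W i k (w \<cdot>\<^bsub>N\<^esub> inj1 i ?kj) d \<in> Ar N \<and> Dom N (W i k (w \<cdot>\<^bsub>N\<^esub> inj1 i ?kj) d) = Dom N (fob PP (i, k)) \<and>
       Cod N (W i k (w \<cdot>\<^bsub>N\<^esub> inj1 i ?kj) d) = Cod N d \<and>
      W i k (w \<cdot>\<^bsub>N\<^esub> inj1 i ?kj) d \<cdot>\<^bsub>N\<^esub> inj1 i k = w \<cdot>\<^bsub>N\<^esub> inj1 i ?kj \<and> W i k (w \<cdot>\<^bsub>N\<^esub> inj1 i ?kj) d \<cdot>\<^bsub>N\<^esub> inj2 i k = d"
      by (intro W) simp_all
    have fw: "f \<cdot>\<^bsub>N\<^esub> w = b \<cdot>\<^bsub>N\<^esub> fob PP (i, ?kj)" using sq by (simp add: square_def)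
    have "square N (fob PP (i, k)) f (W i k (w \<cdot>\<^bsub>N\<^esub> inj1 i ?kj) d) b"
      by (rule squareI_PP) (use WW N.cmp_extend2[OF fw, of "inj1 i ?kj"] in simp_all)
    then show ?thesis using WW unfolding d_def by blast
  qed
  show ?thesis
  proof
    assume L: "tensor_composes K M N PP inj1 inj2 T"
    show "tensor_composes_via K M N PP inj1 W T" unfolding tensor_composes_via_def
    proof (intro allI impI, goal_cases)
      case (1 i s j t k t' f r w b)
      note m = main[OF 1]
      show ?case by (rule L[unfolded tensor_composes_def, rule_format, OF 1]) (use m in blast)+
    qed
  next
    assume R: "tensor_composes_via K M N PP inj1 W T"
    show "tensor_composes K M N PP inj1 inj2 T" unfolding tensor_composes_def
    proof (intro allI impI, goal_cases)
      case (1 i s j t k t' f r w b w')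
      note a = 1(1-6) and w' = 1(7-9)
      note m = main[OF a]
      have "w' = W i k (w \<cdot>\<^bsub>N\<^esub> inj1 i (k \<cdot>\<^bsub>M\<^esub> j)) (?d i s j t k f r w b)"
      proof (rule po_eq[of i k _ "Dom N f"])
        show "i \<in> Ar K" "k \<in> Ar M" using a K.coalgD(1) M.coalgD(1) by blast+
        show "w' \<in> hom N (Dom N (fob PP (i, k))) (Dom N f)" using N.squareD[OF w'(1)] by (simp add: hom_def)
        show "W i k (w \<cdot>\<^bsub>N\<^esub> inj1 i (k \<cdot>\<^bsub>M\<^esub> j)) (?d i s j t k f r w b) \<in> hom N (Dom N (fob PP (i, k))) (Dom N f)"
          using N.squareD[OF conjunct1[OF m]] unfolding hom_def by blast
      qed (use w' m in metis)+
      then show ?case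
        using R[unfolded tensor_composes_via_def] a by blast
    qed
  qed
qed

end

locale arrow_adjunction =
  square_adjunction K M N ten hm tr PP inj1 inj2 "pullback_hom K N M pb hm"
    "\<lambda>i f. fst (ph_proj K N pb hm i f)" "\<lambda>i f. snd (ph_proj K N pb hm i f)" tr_sq +
  C?: pullback_bifunctor K N M hm pb
  for K :: "('ok, 'ak) awfs_cat" and M :: "('om, 'am) awfs_cat" and N :: "('on, 'an) awfs_cat"
    and ten hm tr PP inj1 inj2 tr_sq pb
begin

lemma tuple_p:
  assumes [simp]: "i \<in> Ar K" "f \<in> Ar N" and xy: "x \<in> Ar M" "y \<in> Ar M" "Dom M x = Dom M y"
    "Cod M x = fob hm (Cod K i, Cod N f)" "Cod M y = fob hm (Dom K i, Dom N f)"
    and c: "far hm (i, Idt N (Cod N f)) \<cdot>\<^bsub>M\<^esub> x = far hm (Idt K (Dom K i), f) \<cdot>\<^bsub>M\<^esub> y"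
  shows "tuple M (p i f) x y \<in> Ar M" "Dom M (tuple M (p i f) x y) = Dom M y"
    "Cod M (tuple M (p i f) x y) = Cod M (fob PH (i, f))"
    "fst (p i f) \<cdot>\<^bsub>M\<^esub> tuple M (p i f) x y = x" "snd (p i f) \<cdot>\<^bsub>M\<^esub> tuple M (p i f) x y = y"
proof -
  have "Cod M x = Dom M (far hm (i, Idt N (Cod N f)))" "Cod M y = Dom M (far hm (Idt K (Dom K i), f))"
    by (simp_all add: xy)
  note 1 = xy(1-3) this c and 2 = pb_p[OF assms(1,2)]
  show "tuple M (p i f) x y \<in> Ar M" "Dom M (tuple M (p i f) x y) = Dom M y"
    "fst (p i f) \<cdot>\<^bsub>M\<^esub> tuple M (p i f) x y = x" "snd (p i f) \<cdot>\<^bsub>M\<^esub> tuple M (p i f) x y = y"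
    using tuple_ar[OF 2 1] tuple_proj[OF 2 1] xy(3) by simp_all
  show "Cod M (tuple M (p i f) x y) = Cod M (fob PH (i, f))"
    using tuple_ar(3)[OF 2 1] PH_ob_simps(2)[OF assms(1,2)] by metis
qed

text \<open>Maps into a chosen pullback agree with the tuple of their projections.\<close>

lemma tuple_eta:
  assumes [simp]: "i \<in> Ar K" "f \<in> Ar N" "h \<in> Ar M" "Cod M h = Cod M (fob PH (i, f))"
  shows "tuple M (p i f) (fst (p i f) \<cdot>\<^bsub>M\<^esub> h) (snd (p i f) \<cdot>\<^bsub>M\<^esub> h) = h"
proof -
  have "far hm (i, Idt N (Cod N f)) \<cdot>\<^bsub>M\<^esub> fst (p i f) \<cdot>\<^bsub>M\<^esub> h = far hm (Idt K (Dom K i), f) \<cdot>\<^bsub>M\<^esub> snd (p i f) \<cdot>\<^bsub>M\<^esub> h"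
    by (rule M.cmp_extend2[OF proj_comm]) simp_all
  note t = tuple_p[OF assms(1,2) _ _ _ _ _ this]
  show ?thesis by (rule pb_eq[of i f _ "Dom M h"]) (use t in \<open>simp_all add: hom_def\<close>)
qed

lemma hom_criterion_alg_iff:
  assumes H: "lifted_hom K N M PH H"
  shows "hom_criterion_alg K N M pb hm H \<longleftrightarrow> hom_composes_alg K N M PH (\<lambda>i f. fst (p i f)) (\<lambda>i f. snd (p i f)) H"
proof -
  let ?Q = "\<lambda>i f g. far PH (Idt (arrow_cat K) i, Sq (g \<cdot>\<^bsub>N\<^esub> f) g f (Idt N (Cod N g)))"
  let ?d = "\<lambda>i s f g r' j t c z. solution M (j, t) (fob H ((i, s), (g, r'))) (Sq j (fob PH (i, g))
       (sq_top (?Q i f g) \<cdot>\<^bsub>M\<^esub> c) (sq_bot (?Q i f g) \<cdot>\<^bsub>M\<^esub> z))"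
  have main: "square M j (fob PH (i, f)) c (tuple M (p i f) (?d i s f g r' j t c z) (snd (p i (g \<cdot>\<^bsub>N\<^esub> f)) \<cdot>\<^bsub>M\<^esub> z))"
    "fst (p i f) \<cdot>\<^bsub>M\<^esub> tuple M (p i f) (?d i s f g r' j t c z) (snd (p i (g \<cdot>\<^bsub>N\<^esub> f)) \<cdot>\<^bsub>M\<^esub> z) = ?d i s f g r' j t c z"
    "snd (p i f) \<cdot>\<^bsub>M\<^esub> tuple M (p i f) (?d i s f g r' j t c z) (snd (p i (g \<cdot>\<^bsub>N\<^esub> f)) \<cdot>\<^bsub>M\<^esub> z) = snd (p i (g \<cdot>\<^bsub>N\<^esub> f)) \<cdot>\<^bsub>M\<^esub> z"
    "far hm (Idt K (Cod K i), f) = sq_top (?Q i f g)"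
    "tuple M (p i g) (fst (p i (g \<cdot>\<^bsub>N\<^esub> f)) \<cdot>\<^bsub>M\<^esub> z) (far hm (Idt K (Dom K i), f) \<cdot>\<^bsub>M\<^esub> snd (p i (g \<cdot>\<^bsub>N\<^esub> f)) \<cdot>\<^bsub>M\<^esub> z) = sq_bot (?Q i f g) \<cdot>\<^bsub>M\<^esub> z"
    if i: "is_coalg K (i, s)" and f: "is_alg N (f, r)" and g: "is_alg N (g, r')" and gf [simp]: "Dom N g = Cod N f"
      and j: "is_coalg M (j, t)" and sq: "square M j (fob PH (i, g \<cdot>\<^bsub>N\<^esub> f)) c z" for i s f r g r' j t c z
  proof -
    let ?gf = "g \<cdot>\<^bsub>N\<^esub> f"
    note [simp] = K.coalgD(1-4)[OF i] M.coalgD(1-4)[OF j] N.algD(1-4)[OF f] N.algD(1-4)[OF g] M.squareD[OF sq]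
    have sqg: "square N ?gf g f (Idt N (Cod N g))" by (rule N.square_last) simp_all
    obtain q where q: "?Q i f g = Sq (fob PH (i, ?gf)) (fob PH (i, g)) (far hm (Idt K (Cod K i), f)) q"
      "q \<in> Ar M" "Dom M q = Cod M (fob PH (i, ?gf))" "Cod M q = Cod M (fob PH (i, g))"
      "fst (p i g) \<cdot>\<^bsub>M\<^esub> q = fst (p i ?gf)" "snd (p i g) \<cdot>\<^bsub>M\<^esub> q = far hm (Idt K (Dom K i), f) \<cdot>\<^bsub>M\<^esub> snd (p i ?gf)"
      using PH_farE[OF K.square_idt[of i] sqg] by auto
    note [simp] = q(2-4)
    show "far hm (Idt K (Cod K i), f) = sq_top (?Q i f g)" using q(1) by simp
    have z1: "fst (p i g) \<cdot>\<^bsub>M\<^esub> q \<cdot>\<^bsub>M\<^esub> z = fst (p i ?gf) \<cdot>\<^bsub>M\<^esub> z"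
      and z2: "snd (p i g) \<cdot>\<^bsub>M\<^esub> q \<cdot>\<^bsub>M\<^esub> z = far hm (Idt K (Dom K i), f) \<cdot>\<^bsub>M\<^esub> snd (p i ?gf) \<cdot>\<^bsub>M\<^esub> z"
      using M.cmp_extend[OF q(5), of z] M.cmp_extend2[OF q(6), of z] by simp_all
    show "tuple M (p i g) (fst (p i ?gf) \<cdot>\<^bsub>M\<^esub> z) (far hm (Idt K (Dom K i), f) \<cdot>\<^bsub>M\<^esub> snd (p i ?gf) \<cdot>\<^bsub>M\<^esub> z) = sq_bot (?Q i f g) \<cdot>\<^bsub>M\<^esub> z"
      using tuple_eta[of i g "q \<cdot>\<^bsub>M\<^esub> z"] q(1) by (simp add: z1 z2)
    have sq': "square M j (fob PH (i, g)) (far hm (Idt K (Cod K i), f) \<cdot>\<^bsub>M\<^esub> c) (q \<cdot>\<^bsub>M\<^esub> z)"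
      using M.square_cmp[OF sq PH_square(1)[OF K.square_idt[of i] sqg]] q(1) by simp
    define d where "d = ?d i s f g r' j t c z"
    have d: "d = hom_solution H i s j t g r' (far hm (Idt K (Cod K i), f) \<cdot>\<^bsub>M\<^esub> c) (q \<cdot>\<^bsub>M\<^esub> z)"
      by (simp only: d_def hom_solution_def q(1) square.sel)
    note s [simp] = hom_solution_props[OF H i j g sq', folded d]
    have zj: "fob PH (i, ?gf) \<cdot>\<^bsub>M\<^esub> c = z \<cdot>\<^bsub>M\<^esub> j" using sq by (simp add: square_def)
    have "far hm (i, Idt N (Cod N f)) \<cdot>\<^bsub>M\<^esub> d = snd (p i g) \<cdot>\<^bsub>M\<^esub> fob PH (i, g) \<cdot>\<^bsub>M\<^esub> d"
      using M.cmp_extend[OF proj_simps(10), of i g d] by simp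
    also have "\<dots> = far hm (Idt K (Dom K i), f) \<cdot>\<^bsub>M\<^esub> snd (p i ?gf) \<cdot>\<^bsub>M\<^esub> z" by (simp add: z2)
    finally have c: "far hm (i, Idt N (Cod N f)) \<cdot>\<^bsub>M\<^esub> d = far hm (Idt K (Dom K i), f) \<cdot>\<^bsub>M\<^esub> snd (p i ?gf) \<cdot>\<^bsub>M\<^esub> z" .
    define y where "y = tuple M (p i f) d (snd (p i ?gf) \<cdot>\<^bsub>M\<^esub> z)"
    have y: "y \<in> Ar M" "Dom M y = Cod M j" "Cod M y = Cod M (fob PH (i, f))"
      "fst (p i f) \<cdot>\<^bsub>M\<^esub> y = d" "snd (p i f) \<cdot>\<^bsub>M\<^esub> y = snd (p i ?gf) \<cdot>\<^bsub>M\<^esub> z"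
      unfolding y_def using tuple_p[OF _ _ _ _ _ _ _ c] by simp_all
    then show "fst (p i f) \<cdot>\<^bsub>M\<^esub> tuple M (p i f) (?d i s f g r' j t c z) (snd (p i ?gf) \<cdot>\<^bsub>M\<^esub> z) = ?d i s f g r' j t c z"
      "snd (p i f) \<cdot>\<^bsub>M\<^esub> tuple M (p i f) (?d i s f g r' j t c z) (snd (p i ?gf) \<cdot>\<^bsub>M\<^esub> z) = snd (p i ?gf) \<cdot>\<^bsub>M\<^esub> z"
      unfolding y_def d_def by blast+
    have "square M j (fob PH (i, f)) c y"
      by (rule squareI_PH) (use y M.cmp_extend[OF y(4), of j] M.cmp_extend2[OF y(5), of j] M.cmp_extend[OF proj_simps(10), of i ?gf c] zj in simp_all)
    then show "square M j (fob PH (i, f)) c (tuple M (p i f) (?d i s f g r' j t c z) (snd (p i ?gf) \<cdot>\<^bsub>M\<^esub> z))"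
      unfolding y_def d_def .
  qed
  show ?thesis unfolding hom_criterion_alg_def hom_composes_alg_def Let_def arrow_cat_ar
  proof (intro iffI allI impI, goal_cases)
    case (1 i s f r g r' j t c z z')
    note m = main[OF 1(2-7)]
    have "tuple M (p i f) (?d i s f g r' j t c z) (snd (p i (g \<cdot>\<^bsub>N\<^esub> f)) \<cdot>\<^bsub>M\<^esub> z) = z'"
      unfolding 1(9,10)[symmetric]
      using tuple_eta[of i f z'] M.squareD[OF 1(8)] K.coalgD(1)[OF 1(2)] N.algD(1)[OF 1(3)] by blast
    then show ?case using 1(1)[rule_format, OF 1(2-7)] unfolding m(4,5) by metis
  next
    case (2 i s f r g r' j t c z)
    note m = main[OF 2(2-7)]
    show ?case unfolding m(4,5) by (rule 2(1)[rule_format, OF 2(2-7) m(1,2,3)])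
  qed
qed

lemma hom_criterion_coalg_iff:
  assumes H: "lifted_hom K N M PH H"
  shows "hom_criterion_coalg K N M pb hm H \<longleftrightarrow> hom_composes_coalg K N M PH (\<lambda>i f. fst (p i f)) (\<lambda>i f. snd (p i f)) H"
proof -
  let ?Q = "\<lambda>i k f. far PH (Sq i (k \<cdot>\<^bsub>K\<^esub> i) (Idt K (Dom K i)) k, Idt (arrow_cat N) f)"
  let ?d = "\<lambda>i s k f r j t c z. solution M (j, t) (fob H ((i, s), (f, r))) (Sq j (fob PH (i, f))
       (sq_top (?Q i k f) \<cdot>\<^bsub>M\<^esub> c) (sq_bot (?Q i k f) \<cdot>\<^bsub>M\<^esub> z))"
  have main: "square M j (fob PH (k, f)) c (tuple M (p k f) (fst (p (k \<cdot>\<^bsub>K\<^esub> i) f) \<cdot>\<^bsub>M\<^esub> z) (?d i s k f r j t c z))"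
    "fst (p k f) \<cdot>\<^bsub>M\<^esub> tuple M (p k f) (fst (p (k \<cdot>\<^bsub>K\<^esub> i) f) \<cdot>\<^bsub>M\<^esub> z) (?d i s k f r j t c z) = fst (p (k \<cdot>\<^bsub>K\<^esub> i) f) \<cdot>\<^bsub>M\<^esub> z"
    "snd (p k f) \<cdot>\<^bsub>M\<^esub> tuple M (p k f) (fst (p (k \<cdot>\<^bsub>K\<^esub> i) f) \<cdot>\<^bsub>M\<^esub> z) (?d i s k f r j t c z) = ?d i s k f r j t c z"
    "far hm (k, Idt N (Dom N f)) = sq_top (?Q i k f)"
    "tuple M (p i f) (far hm (k, Idt N (Cod N f)) \<cdot>\<^bsub>M\<^esub> fst (p (k \<cdot>\<^bsub>K\<^esub> i) f)) (snd (p (k \<cdot>\<^bsub>K\<^esub> i) f)) = sq_bot (?Q i k f)"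
    if f: "is_alg N (f, r)" and i: "is_coalg K (i, s)" and k: "is_coalg K (k, s')" and ki [simp]: "Dom K k = Cod K i"
      and j: "is_coalg M (j, t)" and sq: "square M j (fob PH (k \<cdot>\<^bsub>K\<^esub> i, f)) c z" for f r i s k s' j t c z
  proof -
    let ?ki = "k \<cdot>\<^bsub>K\<^esub> i"
    note [simp] = K.coalgD(1-4)[OF i] K.coalgD(1-4)[OF k] M.coalgD(1-4)[OF j] N.algD(1-4)[OF f] M.squareD[OF sq]
    have sqi: "square K i ?ki (Idt K (Dom K i)) k" by (rule K.square_first) simp_all
    obtain q where q: "?Q i k f = Sq (fob PH (?ki, f)) (fob PH (i, f)) (far hm (k, Idt N (Dom N f))) q"
      "q \<in> Ar M" "Dom M q = Cod M (fob PH (?ki, f))" "Cod M q = Cod M (fob PH (i, f))"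
      "fst (p i f) \<cdot>\<^bsub>M\<^esub> q = far hm (k, Idt N (Cod N f)) \<cdot>\<^bsub>M\<^esub> fst (p ?ki f)" "snd (p i f) \<cdot>\<^bsub>M\<^esub> q = snd (p ?ki f)"
      using PH_farE[OF sqi N.square_idt[of f]] by auto
    note [simp] = q(2-4)
    show "far hm (k, Idt N (Dom N f)) = sq_top (?Q i k f)" using q(1) by simp
    show "tuple M (p i f) (far hm (k, Idt N (Cod N f)) \<cdot>\<^bsub>M\<^esub> fst (p ?ki f)) (snd (p ?ki f)) = sq_bot (?Q i k f)"
      using tuple_eta[of i f q] q(1) by (simp add: q(5,6))
    have z1: "fst (p i f) \<cdot>\<^bsub>M\<^esub> q \<cdot>\<^bsub>M\<^esub> z = far hm (k, Idt N (Cod N f)) \<cdot>\<^bsub>M\<^esub> fst (p ?ki f) \<cdot>\<^bsub>M\<^esub> z"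
      using M.cmp_extend2[OF q(5), of z] by simp
    have sq': "square M j (fob PH (i, f)) (far hm (k, Idt N (Dom N f)) \<cdot>\<^bsub>M\<^esub> c) (q \<cdot>\<^bsub>M\<^esub> z)"
      using M.square_cmp[OF sq PH_square(1)[OF sqi N.square_idt[of f]]] q(1) by simp
    define d where "d = ?d i s k f r j t c z"
    have d: "d = hom_solution H i s j t f r (far hm (k, Idt N (Dom N f)) \<cdot>\<^bsub>M\<^esub> c) (q \<cdot>\<^bsub>M\<^esub> z)"
      by (simp only: d_def hom_solution_def q(1) square.sel)
    note s [simp] = hom_solution_props[OF H i j f sq', folded d]
    have zj: "fob PH (?ki, f) \<cdot>\<^bsub>M\<^esub> c = z \<cdot>\<^bsub>M\<^esub> j" using sq by (simp add: square_def)
    have "far hm (Idt K (Dom K k), f) \<cdot>\<^bsub>M\<^esub> d = fst (p i f) \<cdot>\<^bsub>M\<^esub> fob PH (i, f) \<cdot>\<^bsub>M\<^esub> d"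
      using M.cmp_extend[OF proj_simps(9), of i f d] by simp
    then have c: "far hm (k, Idt N (Cod N f)) \<cdot>\<^bsub>M\<^esub> fst (p ?ki f) \<cdot>\<^bsub>M\<^esub> z = far hm (Idt K (Dom K k), f) \<cdot>\<^bsub>M\<^esub> d"
      by (simp add: z1)
    define y where "y = tuple M (p k f) (fst (p ?ki f) \<cdot>\<^bsub>M\<^esub> z) d"
    have y: "y \<in> Ar M" "Dom M y = Cod M j" "Cod M y = Cod M (fob PH (k, f))"
      "fst (p k f) \<cdot>\<^bsub>M\<^esub> y = fst (p ?ki f) \<cdot>\<^bsub>M\<^esub> z" "snd (p k f) \<cdot>\<^bsub>M\<^esub> y = d"
      unfolding y_def using tuple_p[OF _ _ _ _ _ _ _ c] by simp_all
    then show "fst (p k f) \<cdot>\<^bsub>M\<^esub> tuple M (p k f) (fst (p ?ki f) \<cdot>\<^bsub>M\<^esub> z) (?d i s k f r j t c z) = fst (p ?ki f) \<cdot>\<^bsub>M\<^esub> z"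
      "snd (p k f) \<cdot>\<^bsub>M\<^esub> tuple M (p k f) (fst (p ?ki f) \<cdot>\<^bsub>M\<^esub> z) (?d i s k f r j t c z) = ?d i s k f r j t c z"
      unfolding y_def d_def by blast+
    have "square M j (fob PH (k, f)) c y"
      by (rule squareI_PH) (use y M.cmp_extend2[OF y(4), of j] M.cmp_extend[OF y(5), of j] M.cmp_extend[OF proj_simps(9), of ?ki f c] zj in simp_all)
    then show "square M j (fob PH (k, f)) c (tuple M (p k f) (fst (p ?ki f) \<cdot>\<^bsub>M\<^esub> z) (?d i s k f r j t c z))"
      unfolding y_def d_def .
  qed
  show ?thesis unfolding hom_criterion_coalg_def hom_composes_coalg_def Let_def arrow_cat_ar arrow_cat_simps(5) square.sel
  proof (intro iffI allI impI, goal_cases)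
    case (1 f r i s k s' j t c z z')
    note m = main[OF 1(2-7)]
    have "tuple M (p k f) (fst (p (k \<cdot>\<^bsub>K\<^esub> i) f) \<cdot>\<^bsub>M\<^esub> z) (?d i s k f r j t c z) = z'"
      unfolding 1(9,10)[symmetric]
      using tuple_eta[of k f z'] M.squareD[OF 1(8)] K.coalgD(1)[OF 1(4)] N.algD(1)[OF 1(2)] by blast
    then show ?case using 1(1)[rule_format, OF 1(2-7)] unfolding m(4,5) by metis
  next
    case (2 f r i s k s' j t c z)
    note m = main[OF 2(2-7)]
    show ?case unfolding m(4,5) by (rule 2(1)[rule_format, OF 2(2-7) m(1,2,3)])
  qed
qed

end

section \<open>Both sides of a two-variable adjunction\<close>

lemma parametric_adjunction_left:
  assumes "two_variable_adjunction K M N A"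
  shows "parametric_adjunction K M N (ten A) (homl A) (trl A)"
proof -
  interpret two_variable_adjunction K M N A by fact
  show ?thesis by unfold_locales (use trl_bij trl_natural in blast)+
qed

lemma parametric_adjunction_right:
  assumes "two_variable_adjunction K M N A"
  shows "parametric_adjunction M K N (cfun_comp (ten A) swap_cfun) (homr A) (\<lambda>m k. trr A k m)"
proof -
  interpret two_variable_adjunction K M N A by fact
  interpret S: bifunctor M K N "cfun_comp (ten A) swap_cfun"
    by (rule bifunctor_swap) (unfold_locales)
  show ?thesis
    by unfold_locales (use trr_bij trr_natural in auto)
qed

lemma arrow_adjunctionI:
  assumes K: "elementary_awfs K" and M: "elementary_awfs M" and N: "elementary_awfs N"
    and adj: "parametric_adjunction K M N T\<^sub>0 hm tr" and PP: "pushout_data K M N T\<^sub>0 PP inj1 inj2"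
    and pb: "pullback_choice M pb"
    and tr_sq: "\<And>i j f w b. tr_sq i j f (Sq (fob PP (i, j)) f w b) = Sq j (fob (pullback_hom K N M pb hm) (i, f))
      (tr (Cod K i) (Dom M j) (Dom N f) (w \<cdot>\<^bsub>N\<^esub> inj2 i j))
      (tuple M (ph_proj K N pb hm i f) (tr (Cod K i) (Cod M j) (Cod N f) b)
        (tr (Dom K i) (Cod M j) (Dom N f) (w \<cdot>\<^bsub>N\<^esub> inj1 i j)))"
  shows "arrow_adjunction K M N T\<^sub>0 hm tr PP inj1 inj2 tr_sq pb"
proof -
  interpret K: elementary_awfs K by fact
  interpret M: elementary_awfs M by fact
  interpret N: elementary_awfs N by fact
  interpret parametric_adjunction K M N T\<^sub>0 hm tr by fact
  interpret P: pushout_data K M N T\<^sub>0 PP inj1 inj2 by fact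
  interpret H': pullback_bifunctor K N M hm pb by unfold_locales (rule pb)
  interpret H'': pullback_data K N M hm "pullback_hom K N M pb hm" "\<lambda>i f. fst (ph_proj K N pb hm i f)" "\<lambda>i f. snd (ph_proj K N pb hm i f)"
    by (rule H'.pullback_data)
  show ?thesis
  proof unfold_locales
    fix i j f w b assume [simp]: "i \<in> Ar K" "j \<in> Ar M" and sq: "square N (fob PP (i, j)) f w b"
    note [simp] = N.squareD[OF sq]
    have [simp]: "inj1 i j \<in> Ar N" "Dom N (inj1 i j) = fob T\<^sub>0 (Dom K i, Cod M j)" "Cod N (inj1 i j) = Dom N (fob PP (i, j))"
      "fob PP (i, j) \<in> Ar N" "Cod N (fob PP (i, j)) = fob T\<^sub>0 (Cod K i, Cod M j)"
      "fob PP (i, j) \<cdot>\<^bsub>N\<^esub> inj1 i j = far T\<^sub>0 (i, Idt M (Cod M j))"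
      using P.inj[of i j] P.PP[of i j] by simp_all
    have fw: "f \<cdot>\<^bsub>N\<^esub> w = b \<cdot>\<^bsub>N\<^esub> fob PP (i, j)" using sq by (simp add: square_def)
    let ?x = "tr (Cod K i) (Cod M j) (Cod N f) b" and ?y = "tr (Dom K i) (Cod M j) (Dom N f) (w \<cdot>\<^bsub>N\<^esub> inj1 i j)"
    have "far hm (i, Idt N (Cod N f)) \<cdot>\<^bsub>M\<^esub> ?x = far hm (Idt K (Dom K i), f) \<cdot>\<^bsub>M\<^esub> ?y"
      using tr_left[of i "Cod M j" b "Cod N f" "Dom K i"] tr_post[of "Dom K i" "Cod M j" "w \<cdot>\<^bsub>N\<^esub> inj1 i j" f "Cod N f"]
        N.cmp_extend2[OF fw, of "inj1 i j"] by simp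
    then show "\<exists>z\<in>hom M (Cod M j) (Cod M (fob (pullback_hom K N M pb hm) (i, f))).
        tr_sq i j f (Sq (fob PP (i, j)) f w b) =
          Sq j (fob (pullback_hom K N M pb hm) (i, f)) (tr (Cod K i) (Dom M j) (Dom N f) (w \<cdot>\<^bsub>N\<^esub> inj2 i j)) z \<and>
        fst (ph_proj K N pb hm i f) \<cdot>\<^bsub>M\<^esub> z = ?x \<and> snd (ph_proj K N pb hm i f) \<cdot>\<^bsub>M\<^esub> z = ?y"
      using tuple_ar[OF H'.pb_p, of i f ?x ?y] tuple_proj[OF H'.pb_p, of i f ?x ?y] H'.PH_ob_simps(2)[of i f]
      by (intro bexI[of _ "tuple M (ph_proj K N pb hm i f) ?x ?y"]) (simp_all add: tr_sq hom_def)
  qed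
qed

lemma cfunctor_swap:
  assumes "category A" "category B" "cfunctor (prod_cat A B) C F"
  shows "cfunctor (prod_cat B A) C (cfun_comp F swap_cfun)"
  using assms unfolding cfunctor_def cfunctor_axioms_def hom_def by (auto simp: prod_category)

lemma lifted_tensor_swap:
  assumes "elementary_awfs K" "elementary_awfs M" "lifted_tensor K M N P T"
  shows "lifted_tensor M K N (cfun_comp P swap_cfun) (cfun_comp T swap_cfun)"
  using assms cfunctor_swap[of "coalg K" "coalg M" "coalg N" T]
    elementary_awfs.category_coalg[of K] elementary_awfs.category_coalg[of M]
  unfolding lifted_tensor_def lifted_def cfun_agree_def by auto

lemma cfun_swap_swap: "cfun_comp (cfun_comp T swap_cfun) swap_cfun = T"
  by (cases T) (auto simp: cfun_comp_def swap_cfun_def o_def)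

locale awfs_adjunction = two_variable_adjunction K M N A
  for K :: "('ok, 'ak) awfs_cat" and M :: "('om, 'am) awfs_cat" and N :: "('on, 'an) awfs_cat"
    and A :: "('ok, 'ak, 'om, 'am, 'on, 'an) tva" +
  fixes pbK :: "'ak \<Rightarrow> 'ak \<Rightarrow> 'ak \<times> 'ak" and pbM :: "'am \<Rightarrow> 'am \<Rightarrow> 'am \<times> 'am"
    and poN :: "'an \<Rightarrow> 'an \<Rightarrow> 'an \<times> 'an"
  assumes pbK: "pullback_choice K pbK" and pbM: "pullback_choice M pbM" and poN: "pushout_choice N poN"
    and aK: "elementary_awfs K" and aM: "elementary_awfs M" and aN: "elementary_awfs N"
begin

abbreviation "PP \<equiv> pushout_product K M N poN (ten A)"
abbreviation "q \<equiv> pp_inj K M poN (ten A)"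
abbreviation "tva \<equiv> arrow_tva K M N pbK pbM poN A"

sublocale P: pushout_bifunctor K M N "ten A" poN
  by unfold_locales (rule poN)

sublocale left: arrow_adjunction K M N "ten A" "homl A" "trl A" PP "\<lambda>i j. fst (q i j)" "\<lambda>i j. snd (q i j)" "trl tva" pbM
  by (rule arrow_adjunctionI[OF aK aM aN parametric_adjunction_left[OF two_variable_adjunction_axioms] P.pushout_data pbM])
    (simp add: arrow_tva_def Let_def)

text \<open>The tensor with exchanged arguments has \<open>homr\<close> as its left hom, and the legs of the chosen
pushouts change places.\<close>

sublocale right: arrow_adjunction M K N "cfun_comp (ten A) swap_cfun" "homr A" "\<lambda>m k. trr A k m" "cfun_comp PP swap_cfun"
  "\<lambda>j i. snd (q i j)" "\<lambda>j i. fst (q i j)" "\<lambda>j i. trr tva i j" pbK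
  by (rule arrow_adjunctionI[OF aM aK aN parametric_adjunction_right[OF two_variable_adjunction_axioms]
        pushout_data_swap[OF P.pushout_data] pbK])
    (simp add: arrow_tva_def Let_def)

abbreviation "PHl \<equiv> pullback_hom K N M pbM (homl A)"
abbreviation "PHr \<equiv> pullback_hom M N K pbK (homr A)"

text \<open>Both families of mate conditions are instances of \<open>mates_iff_lifts_agree\<close>.\<close>

lemma awfs_two_variable_adjunction_iff:
  "awfs_two_variable_adjunction K M N pbK pbM poN A T Hl Hr \<longleftrightarrow>
    lifted_tensor K M N PP T \<and> lifted_hom K N M PHl Hl \<and>
    lifted_hom M N K PHr Hr \<and> left.lifts_agree T Hl \<and> right.lifts_agree (cfun_comp T swap_cfun) Hr"
proof -
  have sel: "ten tva = PP" "homl tva = PHl" "homr tva = PHr"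
    by (simp_all add: arrow_tva_def Let_def)
  have cl: "counit_l (arrow_cat M) (arrow_cat N) tva i = left.sq_counit i" for i
    unfolding counit_l_def sel Let_def ..
  have cr: "counit_r (arrow_cat K) (arrow_cat N) tva j = right.sq_counit j" for j
    unfolding counit_r_def sel Let_def cfun_simps swap_cfun_simps ..
  have ul: "unit_l N A (fob (fac K) i) = left.unit_at i" for i
    unfolding unit_l_def ..
  have ur: "unit_r N A (fob (fac M) j) = right.unit_at j" for j
    unfolding unit_r_def cfun_simps swap_cfun_simps ..
  have tc: "(\<lambda>i. tensor_char K M N PP T i j) = tensor_char M K N (cfun_comp PP swap_cfun) (cfun_comp T swap_cfun) j" for j
    by (simp add: tensor_char_def fun_eq_iff)
  show ?thesis
    unfolding awfs_two_variable_adjunction_def Let_def sel cl cr ul ur tc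
    using left.mates_iff_lifts_agree[of T Hl] right.mates_iff_lifts_agree[of "cfun_comp T swap_cfun" Hr] lifted_tensor_swap[OF aK aM, of N PP T]
    by auto
qed

lemma tensor_criterion_snd_iff:
  assumes T: "lifted_tensor K M N PP T"
  shows "tensor_criterion_snd K M N poN (ten A) T \<longleftrightarrow>
    tensor_composes K M N PP (\<lambda>i j. fst (q i j)) (\<lambda>i j. snd (q i j)) T"
proof -
  have far: "far PP (Idt (arrow_cat K) i, Sq j (k \<cdot>\<^bsub>M\<^esub> j) (Idt M (Dom M j)) k) =
      Sq (fob PP (i, j)) (fob PP (i, k \<cdot>\<^bsub>M\<^esub> j))
        (cotuple N (q i j) (fst (q i (k \<cdot>\<^bsub>M\<^esub> j)) \<cdot>\<^bsub>N\<^esub> far (ten A) (Idt K (Dom K i), k)) (snd (q i (k \<cdot>\<^bsub>M\<^esub> j))))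
        (far (ten A) (Idt K (Cod K i), k))"
    if "is_coalg K (i, s)" "is_coalg M (j, t)" "is_coalg M (k, t')" "Dom M k = Cod M j" for i s j t k t'
    using left.K.coalgD[OF that(1)] left.M.coalgD[OF that(2)] left.M.coalgD[OF that(3)] that(4) by (simp add: P.PP_far_def)
  have eq: "tensor_composes K M N PP (\<lambda>i j. fst (q i j)) (\<lambda>i j. snd (q i j)) T \<longleftrightarrow>
      tensor_composes_via K M N PP (\<lambda>i j. fst (q i j)) (\<lambda>i j. cotuple N (q i j)) T"
    by (rule left.tensor_composes_iff[OF T, of "\<lambda>i j. cotuple N (q i j)"])
      (simp_all add: cotuple_ar[OF P.po_q] cotuple_inj[OF P.po_q] P.PP_ob_simps del: left.inj_simps right.inj_simps)
  show ?thesis unfolding eq tensor_composes_via_def tensor_criterion_snd_def Let_def arrow_cat_ar arrow_cat_simps(5) square.sel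
  proof (intro iffI allI impI, goal_cases)
    case (1 i s j t k t' f r w b)
    then show ?case by (subst (1 2) far[OF 1(2-5)]) (simp only: square.sel)
  next
    case (2 i s j t k t' f r w b)
    from 2(1)[rule_format, OF 2(2-7)] show ?case by (subst (asm) (1 2) far[OF 2(2-5)]) (simp only: square.sel)
  qed
qed

lemma tensor_criterion_fst_iff:
  assumes T: "lifted_tensor K M N PP T"
  shows "tensor_criterion_fst K M N poN (ten A) T \<longleftrightarrow>
    tensor_composes M K N (cfun_comp PP swap_cfun) (\<lambda>j i. snd (q i j)) (\<lambda>j i. fst (q i j)) (cfun_comp T swap_cfun)"
proof -
  have far: "far PP (Sq i (k \<cdot>\<^bsub>K\<^esub> i) (Idt K (Dom K i)) k, Idt (arrow_cat M) j) =
      Sq (fob PP (i, j)) (fob PP (k \<cdot>\<^bsub>K\<^esub> i, j))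
        (cotuple N (q i j) (fst (q (k \<cdot>\<^bsub>K\<^esub> i) j)) (snd (q (k \<cdot>\<^bsub>K\<^esub> i) j) \<cdot>\<^bsub>N\<^esub> far (ten A) (k, Idt M (Dom M j))))
        (far (ten A) (k, Idt M (Cod M j)))"
    if "is_coalg M (j, t)" "is_coalg K (i, s)" "is_coalg K (k, s')" "Dom K k = Cod K i" for i s j t k s'
    using left.M.coalgD[OF that(1)] left.K.coalgD[OF that(2)] left.K.coalgD[OF that(3)] that(4) by (simp add: P.PP_far_def)
  have eq: "tensor_composes M K N (cfun_comp PP swap_cfun) (\<lambda>j i. snd (q i j)) (\<lambda>j i. fst (q i j)) (cfun_comp T swap_cfun) \<longleftrightarrow>
      tensor_composes_via M K N (cfun_comp PP swap_cfun) (\<lambda>j i. snd (q i j)) (\<lambda>j i x y. cotuple N (q i j) y x) (cfun_comp T swap_cfun)"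
    by (rule right.tensor_composes_iff[OF lifted_tensor_swap[OF aK aM T], of "\<lambda>j i x y. cotuple N (q i j) y x"])
      (simp_all add: cotuple_ar[OF P.po_q] cotuple_inj[OF P.po_q] P.PP_ob_simps del: left.inj_simps right.inj_simps)
  show ?thesis unfolding eq tensor_composes_via_def tensor_criterion_fst_def Let_def arrow_cat_ar arrow_cat_simps(5) square.sel cfun_simps swap_cfun_simps
  proof (intro iffI allI impI, goal_cases)
    case (1 j t i s k s' f r w b)
    then show ?case by (subst (1 2) far[OF 1(2-5)]) (simp only: square.sel)
  next
    case (2 j t i s k s' f r w b)
    from 2(1)[rule_format, OF 2(2-7)] show ?case by (subst (asm) (1 2) far[OF 2(2-5)]) (simp only: square.sel)
  qed
qed

text \<open>Each variable of the tensor accounts for one of the homs.\<close>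

lemma tensor_specifies_iff:
  assumes T: "lifted_tensor K M N PP T"
  shows "(\<exists>Hl Hr. awfs_two_variable_adjunction K M N pbK pbM poN A T Hl Hr) \<longleftrightarrow>
    tensor_criterion_fst K M N poN (ten A) T \<and> tensor_criterion_snd K M N poN (ten A) T"
  unfolding awfs_two_variable_adjunction_iff tensor_criterion_snd_iff[OF T] tensor_criterion_fst_iff[OF T]
  using left.lifts_agree_imp_tensor_composes[of T] left.tensor_composes_imp_lifts_agree[of T] T
    right.lifts_agree_imp_tensor_composes[of "cfun_comp T swap_cfun"] right.tensor_composes_imp_lifts_agree[of "cfun_comp T swap_cfun"]
    lifted_tensor_swap[OF aK aM T] by blast

text \<open>(H1) yields the tensor. Once it agrees with the given hom, (H2) is the criterion for the tensor in
the first variable, which yields the right hom.\<close>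

lemma homl_specifies_iff:
  assumes Hl: "lifted_hom K N M PHl Hl"
  shows "(\<exists>T Hr. awfs_two_variable_adjunction K M N pbK pbM poN A T Hl Hr) \<longleftrightarrow>
    hom_criterion_alg K N M pbM (homl A) Hl \<and> hom_criterion_coalg K N M pbM (homl A) Hl"
  unfolding awfs_two_variable_adjunction_iff left.hom_criterion_alg_iff[OF Hl] left.hom_criterion_coalg_iff[OF Hl]
  using left.hom_composes_alg_imp_lifts_agree[OF Hl] left.lifts_agree_imp_hom_composes_alg[OF _ Hl] left.tensor_composes_fst_iff[OF _ Hl]
    right.lifts_agree_imp_tensor_composes[OF lifted_tensor_swap[OF aK aM]] right.tensor_composes_imp_lifts_agree[OF lifted_tensor_swap[OF aK aM]] Hl
  by blast

text \<open>The same argument on the other side, where the tensor is found with its arguments exchanged.\<close>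

lemma homr_specifies_iff:
  assumes Hr: "lifted_hom M N K PHr Hr"
  shows "(\<exists>T Hl. awfs_two_variable_adjunction K M N pbK pbM poN A T Hl Hr) \<longleftrightarrow>
    hom_criterion_alg M N K pbK (homr A) Hr \<and> hom_criterion_coalg M N K pbK (homr A) Hr"
proof -
  have "\<exists>T. lifted_tensor K M N PP T \<and> right.lifts_agree (cfun_comp T swap_cfun) Hr"
    if crit: "hom_composes_alg M N K PHr (\<lambda>j f. fst (right.p j f)) (\<lambda>j f. snd (right.p j f)) Hr"
  proof -
    obtain T where "lifted_tensor M K N (cfun_comp PP swap_cfun) T" "right.lifts_agree T Hr"
      using right.hom_composes_alg_imp_lifts_agree[OF Hr crit] by blast
    then show ?thesis using lifted_tensor_swap[OF aM aK, of N "cfun_comp PP swap_cfun" T]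
      by (intro exI[of _ "cfun_comp T swap_cfun"]) (simp add: cfun_swap_swap)
  qed
  moreover have "tensor_composes K M N PP (\<lambda>i j. fst (q i j)) (\<lambda>i j. snd (q i j)) T \<longleftrightarrow>
      hom_composes_coalg M N K PHr (\<lambda>j f. fst (right.p j f)) (\<lambda>j f. snd (right.p j f)) Hr"
    if "lifted_tensor K M N PP T" "right.lifts_agree (cfun_comp T swap_cfun) Hr" for T
    using right.tensor_composes_fst_iff[OF lifted_tensor_swap[OF aK aM that(1)] Hr that(2)] by (simp add: cfun_swap_swap)
  ultimately show ?thesis
    unfolding awfs_two_variable_adjunction_iff right.hom_criterion_alg_iff[OF Hr] right.hom_criterion_coalg_iff[OF Hr]
    using right.lifts_agree_imp_hom_composes_alg[OF lifted_tensor_swap[OF aK aM] Hr] left.lifts_agree_imp_tensor_composes left.tensor_composes_imp_lifts_agree Hr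
    by blast
qed

end

theorem theorem5p19:
  fixes K :: "('ok, 'ak) awfs_cat" and M :: "('om, 'am) awfs_cat" and N :: "('on, 'an) awfs_cat"
    and A :: "('ok, 'ak, 'om, 'am, 'on, 'an) tva"
    and pbK :: "'ak \<Rightarrow> 'ak \<Rightarrow> 'ak \<times> 'ak" and pbM :: "'am \<Rightarrow> 'am \<Rightarrow> 'am \<times> 'am"
    and poN :: "'an \<Rightarrow> 'an \<Rightarrow> 'an \<times> 'an"
  assumes "two_variable_adjunction K M N A"
    and "pullback_choice K pbK" and "pullback_choice M pbM" and "pushout_choice N poN"
    and "awfs K" and "awfs M" and "awfs N"
  shows
    "(\<forall>T. lifted_tensor K M N (pushout_product K M N poN (ten A)) T \<longrightarrow>
       ((\<exists>Hl Hr. awfs_two_variable_adjunction K M N pbK pbM poN A T Hl Hr) \<longleftrightarrow>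
        tensor_criterion_fst K M N poN (ten A) T \<and> tensor_criterion_snd K M N poN (ten A) T)) \<and>
     (\<forall>Hl. lifted_hom K N M (pullback_hom K N M pbM (homl A)) Hl \<longrightarrow>
       ((\<exists>T Hr. awfs_two_variable_adjunction K M N pbK pbM poN A T Hl Hr) \<longleftrightarrow>
        hom_criterion_alg K N M pbM (homl A) Hl \<and> hom_criterion_coalg K N M pbM (homl A) Hl)) \<and>
     (\<forall>Hr. lifted_hom M N K (pullback_hom M N K pbK (homr A)) Hr \<longrightarrow>
       ((\<exists>T Hl. awfs_two_variable_adjunction K M N pbK pbM poN A T Hl Hr) \<longleftrightarrow>
        hom_criterion_alg M N K pbK (homr A) Hr \<and> hom_criterion_coalg M N K pbK (homr A) Hr))"
proof -
  interpret awfs_adjunction K M N A pbK pbM poN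
    using assms by (intro awfs_adjunction.intro awfs_adjunction_axioms.intro elementary_awfs)
  show ?thesis using tensor_specifies_iff homl_specifies_iff homr_specifies_iff by blast
qed

end
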